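(* Consider the thermodynamic setting in the context. If the regular sequences $\rho_{S^nB^n\underline W^n}=\rho_{S^n}\otimes\tau(\underline\beta)_B^{\otimes n}\otimes|\underline w\rangle\langle\underline w|^n$ and $\sigma_{S^nB^n\underline W^n}=\sigma_{S^nB^n}\otimes|\underline w'\rangle\langle\underline w'|^n$ are equivalent under almost-commuting unitaries, then \[ s(\{\sigma_{S^nB^n}\})=s(\{\rho_{S^n}\})+S(\tau(\underline\beta)_B)\quad\text{and}\quad W_j=-\Delta A_{S_j}-\Delta A_{B_j}\ \text{ for all } j=1,\dots,c. \] Conversely, given regular sequences of product states $\rho_{S^n}$ and $\sigma_{S^nB^n}$ with $s(\{\sigma_{S^nB^n}\})=s(\{\rho_{S^n}\})+S(\tau(\underline\beta)_B)$, there exist regular sequences of pure product states $|w_j\rangle\langle w_j|^n$, $|w_j'\rangle\langle w_j'|^n$ of each $j$-type battery ($j=1,\dots,c$) such that $\rho_{S^n}\otimes\tau(\underline\beta)_B^{\otimes n}\otimes|\underline w\rangle\langle\underline w|^n$ and $\sigma_{S^nB^n}\otimes|\underline w'\rangle\langle\underline w'|^n$ can be transformed into each other by almost-commuting unitaries.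
   Context: The global system is $S\otimes B\otimes W_1\otimes\cdots\otimes W_c$ (finite-dimensional): work system $S$ with Hermitian charges $A_{S_j}$, bath $B$ with charges $A_{B_j}$, and batteries $W_j$ where battery $W_j$ has the single nontrivial charge $A_{W_j}$ (its other charges are $0$); total charges $A_j=A_{S_j}+A_{B_j}+A_{W_j}$. Standing assumption: $\Sigma(A_{S_j})+\Sigma(A_{B_j})\le\Sigma(A_{W_j})$ for all $j$, where $\Sigma(A)=\lambda_{\max}(A)-\lambda_{\min}(A)$. $\tau(\underline\beta)_B=e^{-\sum_j\beta_jA_{B_j}}/\mathrm{Tr}\,e^{-\sum_j\beta_jA_{B_j}}$ for fixed reals $\beta_j$. For $n$ copies, charges are $X^{(n)}=\sum_i\mathbb1^{\otimes(i-1)}\otimes X\otimes\mathbb1^{\otimes(n-i)}$. A sequence of states $\rho^n$ on $Q^{\otimes n}$ is regular if $a_j(\{\rho^n\})=\lim_n\frac1n\mathrm{Tr}\rho^nA_j^{(n)}$ (for the relevant charges) and $s(\{\rho^n\})=\lim_n\frac1nS(\rho^n)$ exist. $|\underline w\rangle\langle\underline w|^n=\bigotimes_{i}\bigotimes_j|w_{j,i}\rangle\langle w_{j,i}|_{W_{j,i}}$ are pure product battery states, similarly $|\underline w'\rangle\langle\underline w'|^n$. $W_j:=\lim_n\frac1n\mathrm{Tr}(|w_j'\rangle\langle w_j'|^n-|w_j\rangle\langle w_j|^n)A_{W_j}^{(n)}$; $\Delta A_{S_j}=\lim\frac1n\mathrm{Tr}(\sigma_{S^n}-\rho_{S^n})A_{S_j}^{(n)}$,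 $\Delta A_{B_j}=\lim\frac1n\mathrm{Tr}(\sigma_{B^n}-\tau(\underline\beta)_B^{\otimes n})A_{B_j}^{(n)}$ with $\sigma_{S^n},\sigma_{B^n}$ the marginals of $\sigma_{S^nB^n}$. Two sequences $X_n,Y_n$ of global states are equivalent under almost-commuting unitaries if there are ancillas $\mathcal K$ of dimension $2^{o(n)}$ with zero charges, states $\omega,\omega'$ on $\mathcal K$ and unitaries $U$ with $\lim_n\frac1n\|[U,A_j^{(n)}]\|_\infty=0$ for all $j$ and $\lim_n\|U(X_n\otimes\omega')U^\dagger-Y_n\otimes\omega\|_1=0$. *)

theory Defs
  imports "Jordan_Normal_Form.Matrix" "Jordan_Normal_Form.Char_Poly"
begin

definition adj :: "complex mat \<Rightarrow> complex mat" where
  "adj A = mat (dim_col A) (dim_row A) (\<lambda>(i,j). cnj (A $$ (j,i)))"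

definition mtrace :: "complex mat \<Rightarrow> complex" where
  "mtrace A = (\<Sum>i<dim_row A. A $$ (i,i))"

definition hermitian :: "nat \<Rightarrow> complex mat \<Rightarrow> bool" where
  "hermitian d A \<longleftrightarrow> A \<in> carrier_mat d d \<and> adj A = A"

definition cinner :: "complex vec \<Rightarrow> complex vec \<Rightarrow> complex" where
  "cinner u v = (\<Sum>i<dim_vec v. cnj (u $ i) * v $ i)"

definition vnorm :: "complex vec \<Rightarrow> real" where
  "vnorm v = sqrt (\<Sum>i<dim_vec v. (cmod (v $ i))\<^sup>2)"

definition psd :: "nat \<Rightarrow> complex mat \<Rightarrow> bool" where
  "psd d A \<longleftrightarrow> hermitian d A \<and> (\<forall>v \<in> carrier_vec d. 0 \<le> Re (cinner v (A *\<^sub>v v)))"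

definition density :: "nat \<Rightarrow> complex mat \<Rightarrow> bool" where
  "density d \<rho> \<longleftrightarrow> psd d \<rho> \<and> mtrace \<rho> = 1"

definition unitary :: "nat \<Rightarrow> complex mat \<Rightarrow> bool" where
  "unitary d U \<longleftrightarrow> U \<in> carrier_mat d d \<and> adj U * U = 1\<^sub>m d"

definition proj :: "complex vec \<Rightarrow> complex mat" where
  "proj v = mat (dim_vec v) (dim_vec v) (\<lambda>(i,j). v $ i * cnj (v $ j))"

definition spread :: "complex mat \<Rightarrow> real" where
  "spread A = Max {Re a | a. eigenvalue A a} - Min {Re a | a. eigenvalue A a}"

text \<open>Von Neumann entropy S(rho) = - Tr rho ln rho, via the eigenvalues
  counted with algebraic multiplicity (convention 0 ln 0 = 0).\<close>
definition vn_entropy :: "complex mat \<Rightarrow> real" where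
  "vn_entropy \<rho> = - (\<Sum>a \<in> {a. poly (char_poly \<rho>) a = 0}.
       real (order a (char_poly \<rho>)) * (Re a * ln (Re a)))"

definition trace_norm :: "complex mat \<Rightarrow> real" where
  "trace_norm X = (\<Sum>a \<in> {a. poly (char_poly (adj X * X)) a = 0}.
       real (order a (char_poly (adj X * X))) * sqrt (Re a))"

definition op_norm :: "complex mat \<Rightarrow> real" where
  "op_norm X = Sup {vnorm (X *\<^sub>v v) | v. v \<in> carrier_vec (dim_col X) \<and> vnorm v = 1}"

definition mexp :: "complex mat \<Rightarrow> complex mat" where
  "mexp A = mat (dim_row A) (dim_col A) (\<lambda>(i,j). \<Sum>k. (A ^\<^sub>m k) $$ (i,j) / of_nat (fact k))"

primrec msum :: "nat \<Rightarrow> (nat \<Rightarrow> complex mat) \<Rightarrow> nat \<Rightarrow> complex mat" where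
  "msum d f 0 = 0\<^sub>m d d"
| "msum d f (Suc k) = msum d f k + f k"

definition kron :: "complex mat \<Rightarrow> complex mat \<Rightarrow> complex mat" where
  "kron A B = mat (dim_row A * dim_row B) (dim_col A * dim_col B)
     (\<lambda>(i,j). A $$ (i div dim_row B, j div dim_col B) * B $$ (i mod dim_row B, j mod dim_col B))"

definition kron_list :: "complex mat list \<Rightarrow> complex mat" where
  "kron_list xs = foldr kron xs (1\<^sub>m 1)"

definition tpow :: "complex mat \<Rightarrow> nat \<Rightarrow> complex mat" where
  "tpow A n = kron_list (replicate n A)"

definition ncopy :: "complex mat \<Rightarrow> nat \<Rightarrow> complex mat" where
  "ncopy X n = msum (dim_row X ^ n)
     (\<lambda>i. kron_list (replicate i (1\<^sub>m (dim_row X)) @ [X] @ replicate (n - 1 - i) (1\<^sub>m (dim_row X)))) n"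

definition ptr_right :: "nat \<Rightarrow> nat \<Rightarrow> complex mat \<Rightarrow> complex mat" where
  "ptr_right d1 d2 X = mat d1 d1 (\<lambda>(i,j). \<Sum>k<d2. X $$ (i * d2 + k, j * d2 + k))"

definition ptr_left :: "nat \<Rightarrow> nat \<Rightarrow> complex mat \<Rightarrow> complex mat" where
  "ptr_left d1 d2 X = mat d2 d2 (\<lambda>(i,j). \<Sum>k<d1. X $$ (k * d2 + i, k * d2 + j))"

text \<open>Reordering (S(x)B)^(x)n (copy-major) into S^n (x) B^n (block order).
  digit d n k x is the k-th most significant base-d digit of an n-digit number x.\<close>
definition digit :: "nat \<Rightarrow> nat \<Rightarrow> nat \<Rightarrow> nat \<Rightarrow> nat" where
  "digit d n k x = x div d ^ (n - 1 - k) mod d"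

definition cm_index :: "nat \<Rightarrow> nat \<Rightarrow> nat \<Rightarrow> nat \<Rightarrow> nat" where
  "cm_index dS dB n i =
     (\<Sum>k<n. (digit dS n k (i div dB ^ n) * dB + digit dB n k (i mod dB ^ n)) * (dS * dB) ^ (n - 1 - k))"

definition to_block :: "nat \<Rightarrow> nat \<Rightarrow> nat \<Rightarrow> complex mat \<Rightarrow> complex mat" where
  "to_block dS dB n X = mat (dS ^ n * dB ^ n) (dS ^ n * dB ^ n)
     (\<lambda>(i,j). X $$ (cm_index dS dB n i, cm_index dS dB n j))"

definition gibbs :: "nat \<Rightarrow> nat \<Rightarrow> (nat \<Rightarrow> real) \<Rightarrow> (nat \<Rightarrow> complex mat) \<Rightarrow> complex mat" where
  "gibbs c dB \<beta> AB =
     (let E = mexp (msum dB (\<lambda>j. complex_of_real (- \<beta> j) \<cdot>\<^sub>m AB j) c)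
      in (1 / mtrace E) \<cdot>\<^sub>m E)"

text \<open>|w_j><w_j|^n = (x)_i |w_{j,i}><w_{j,i}| ; w j n i is the vector of battery j, copy i,
  in the n-th element of the sequence.\<close>
definition batt_j :: "(nat \<Rightarrow> nat \<Rightarrow> nat \<Rightarrow> complex vec) \<Rightarrow> nat \<Rightarrow> nat \<Rightarrow> complex mat" where
  "batt_j w j n = kron_list (map (\<lambda>i. proj (w j n i)) [0..<n])"

definition batt :: "nat \<Rightarrow> (nat \<Rightarrow> nat \<Rightarrow> nat \<Rightarrow> complex vec) \<Rightarrow> nat \<Rightarrow> complex mat" where
  "batt c w n = kron_list (map (\<lambda>j. batt_j w j n) [0..<c])"

definition battW_dim :: "nat \<Rightarrow> (nat \<Rightarrow> nat) \<Rightarrow> nat \<Rightarrow> nat" where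
  "battW_dim c dW n = (\<Prod>j<c. dW j ^ n)"

definition total_charge ::
  "nat \<Rightarrow> nat \<Rightarrow> nat \<Rightarrow> (nat \<Rightarrow> nat) \<Rightarrow> (nat \<Rightarrow> complex mat) \<Rightarrow> (nat \<Rightarrow> complex mat)
   \<Rightarrow> (nat \<Rightarrow> complex mat) \<Rightarrow> nat \<Rightarrow> nat \<Rightarrow> complex mat" where
  "total_charge c dS dB dW AS AB AW j n =
     kron (kron (ncopy (AS j) n) (1\<^sub>m (dB ^ n))) (1\<^sub>m (battW_dim c dW n))
   + kron (kron (1\<^sub>m (dS ^ n)) (ncopy (AB j) n)) (1\<^sub>m (battW_dim c dW n))
   + kron (1\<^sub>m (dS ^ n * dB ^ n))
       (kron_list (map (\<lambda>k. if k = j then ncopy (AW k) n else 1\<^sub>m (dW k ^ n)) [0..<c]))"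

definition SB_charge :: "nat \<Rightarrow> nat \<Rightarrow> (nat \<Rightarrow> complex mat) \<Rightarrow> (nat \<Rightarrow> complex mat) \<Rightarrow> nat \<Rightarrow> nat \<Rightarrow> complex mat" where
  "SB_charge dS dB AS AB j n =
     kron (ncopy (AS j) n) (1\<^sub>m (dB ^ n)) + kron (1\<^sub>m (dS ^ n)) (ncopy (AB j) n)"

definition charge_avg :: "(nat \<Rightarrow> complex mat) \<Rightarrow> (nat \<Rightarrow> complex mat) \<Rightarrow> nat \<Rightarrow> real" where
  "charge_avg X A n = Re (mtrace (X n * A n)) / real n"

definition entropy_rate :: "(nat \<Rightarrow> complex mat) \<Rightarrow> nat \<Rightarrow> real" where
  "entropy_rate X n = vn_entropy (X n) / real n"

definition regular :: "nat \<Rightarrow> (nat \<Rightarrow> nat \<Rightarrow> complex mat) \<Rightarrow> (nat \<Rightarrow> complex mat) \<Rightarrow> bool" where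
  "regular c A X \<longleftrightarrow> (\<forall>j<c. convergent (charge_avg X (A j))) \<and> convergent (entropy_rate X)"

text \<open>Equivalence under almost-commuting unitaries (charges A_j^(n) on the system,
  zero charges on the ancilla K of dimension k n = 2^o(n)).\<close>
definition acu_equiv :: "nat \<Rightarrow> (nat \<Rightarrow> nat \<Rightarrow> complex mat) \<Rightarrow> (nat \<Rightarrow> complex mat) \<Rightarrow> (nat \<Rightarrow> complex mat) \<Rightarrow> bool" where
  "acu_equiv c A X Y \<longleftrightarrow>
     (\<exists>(k :: nat \<Rightarrow> nat) \<omega> \<omega>' U.
        (\<forall>n. 1 \<le> k n) \<and> (\<lambda>n. ln (real (k n)) / real n) \<longlonglongrightarrow> 0 \<and>
        (\<forall>n. density (k n) (\<omega> n) \<and> density (k n) (\<omega>' n)) \<and>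
        (\<forall>n. unitary (dim_row (X n) * k n) (U n)) \<and>
        (\<forall>j<c. (\<lambda>n. op_norm (U n * kron (A j n) (1\<^sub>m (k n)) - kron (A j n) (1\<^sub>m (k n)) * U n) / real n)
                 \<longlonglongrightarrow> 0) \<and>
        (\<lambda>n. trace_norm (U n * kron (X n) (\<omega>' n) * adj (U n) - kron (Y n) (\<omega> n))) \<longlonglongrightarrow> 0)"

end

theory Submission
  imports Defs "Jordan_Normal_Form.Schur_Decomposition" "HOL-Analysis.L2_Norm"
begin

text \<open>
  Forward direction: both sides of the equivalence differ by \<open>o(n)\<close> in entropy (Gibbs' inequality
  against a state mixed with the maximally mixed one, plus additivity, the ancilla contributing at most
  \<open>ln (k n) = o(n)\<close>) and in every charge (the commutator bounds the change under \<open>U\<close>, the trace norm the rest).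

  Converse: the standing assumption leaves room to choose single-copy battery vectors that equalise
  all average charges \<open>v\<^sub>j\<close>; then the global states \<open>X\<close>, \<open>Y\<close> are product states with the same entropy
  rate \<open>s\<close> and the same \<open>v\<^sub>j\<close>. By Chebyshev both are concentrated on the low spectral subspace \<open>P\<close> of
  \<open>\<Sum>\<^sub>j (A\<^sub>j/n - v\<^sub>j)\<^sup>2\<close>, on which every \<open>A\<^sub>j - n v\<^sub>j\<close> has norm \<open>o(n)\<close>; hence any unitary that is the identity off
  \<open>P\<close> almost commutes with all charges. Cut \<open>X\<close> and \<open>Y\<close> down to \<open>P\<close> and to their typical eigenvalues
  \<open>exp (- n (s \<plusminus> \<delta>))\<close>, order the eigenvalues decreasingly and group them into blocks of
  \<open>g \<approx> exp (n (s - 2 \<delta>))\<close>. Inside a block they are nearly constant in total, so \<open>X \<approx> \<omega>\<^sub>X \<otimes> 1/g\<close> and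
  \<open>Y \<approx> \<omega>\<^sub>Y \<otimes> 1/g\<close> with block sums \<open>\<omega>\<^sub>X\<close>, \<open>\<omega>\<^sub>Y\<close> living in dimension about \<open>exp (3 n \<delta>)\<close>. Both \<open>X \<otimes> \<omega>\<^sub>Y\<close> and
  \<open>Y \<otimes> \<omega>\<^sub>X\<close> are then close to \<open>\<omega>\<^sub>X \<otimes> 1/g \<otimes> \<omega>\<^sub>Y\<close>, up to exchanging the block number with the ancilla.
\<close>

section \<open>Hermitian and unitary matrices, the spectral theorem\<close>

text \<open>The charges need not commute, so they have no joint spectral projections, and cutting to
  one charge window after another would disturb the earlier windows. A vector on which a sum of
  squares is small is small for every summand at once; this is why one matrix stands for all
  charges. U must fix the complement of P vector by vector. So P is chosen independently of the
  state, and the eigenbases of the cut-down X and Y are rotations of the first columns of one basis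
  V that share all other columns. Origin of the exponents: typical eigenvalues are at most exp (- n
  (s - \<delta>)), so a block of exp (n (s - 2 \<delta>)) of them weighs at most exp (- n \<delta>),
  which bounds the cost of treating blocks as constant. The rank is at most exp (n (s + \<delta>)),
  hence about exp (3 n \<delta>) blocks. If e bounds the mean square deviations per copy, then
  \<delta> = e^(1/4) makes Chebyshev fail with weight at most e / \<delta>^2 = sqrt e. Keeping e >=
  1/n lets n \<delta> tend to infinity while \<delta> tends to 0, so the ancilla dimension is exp
  (o(n)).\<close>

lemma mult_entry:
  assumes "A \<in> carrier_mat n m" "B \<in> carrier_mat m k" "i < n" "j < k"
  shows "(A * B) $$ (i,j) = (\<Sum>l<m. A $$ (i,l) * B $$ (l,j))"
  using assms by (auto simp: scalar_prod_def atLeast0LessThan)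

text \<open>The side conditions are equations between dimensions, which rewriting can check; the
  carrier form would leave intermediate dimensions to be guessed.\<close>

lemma mat_assoc:
  "dim_col A = dim_row B \<Longrightarrow> dim_col B = dim_row C \<Longrightarrow> (A * B) * C = A * (B * (C :: complex mat))"
  by (rule assoc_mult_mat[of _ "dim_row A" "dim_col A" _ "dim_col B" _ "dim_col C"]) auto

declare assoc_mult_mat [simp del]

lemma adj_carrier [simp, intro]: "A \<in> carrier_mat n m \<Longrightarrow> adj A \<in> carrier_mat m n"
  by (auto simp: adj_def)

lemma adj_dims [simp]: "dim_row (adj A) = dim_col A" "dim_col (adj A) = dim_row A"
  by (auto simp: adj_def)

lemma adj_entry [simp]: "i < dim_col A \<Longrightarrow> j < dim_row A \<Longrightarrow> adj A $$ (i,j) = cnj (A $$ (j,i))"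
  by (auto simp: adj_def)

lemma adj_adj [simp]: "adj (adj A) = A"
  by (rule eq_matI) auto

lemma adj_one [simp]: "adj (1\<^sub>m n) = 1\<^sub>m n"
  by (rule eq_matI) auto

lemma adj_mult:
  assumes "A \<in> carrier_mat n m" "B \<in> carrier_mat m k"
  shows "adj (A * B) = adj B * adj A"
proof (rule eq_matI)
  fix i j assume "i < dim_row (adj B * adj A)" "j < dim_col (adj B * adj A)"
  then have "i < k" "j < n" using assms by auto
  then show "adj (A * B) $$ (i, j) = (adj B * adj A) $$ (i, j)"
    using assms
    by (simp add: mult_entry[OF assms] mult_entry[OF adj_carrier[OF assms(2)] adj_carrier[OF assms(1)]] mult.commute
        del: index_mult_mat(1))
qed (use assms in auto)

lemma adj_mult': "dim_col A = dim_row B \<Longrightarrow> adj (A * B) = adj B * adj A"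
  by (rule adj_mult[of _ "dim_row A" "dim_col A" _ "dim_col B"]) auto

lemma adj_conj_mult:
  assumes "W \<in> carrier_mat n n" "V \<in> carrier_mat n n" "A \<in> carrier_mat n n"
  shows "adj (W * V) * A * (W * V) = adj V * (adj W * A * W) * V"
  using assms[THEN carrier_matD(1)] assms[THEN carrier_matD(2)] by (simp add: adj_mult' mat_assoc)

lemma adj_add:
  assumes "A \<in> carrier_mat n m" "B \<in> carrier_mat n m"
  shows "adj (A + B) = adj A + adj B"
  by (rule eq_matI) (use assms in auto)

lemma adj_minus:
  assumes "A \<in> carrier_mat n m" "B \<in> carrier_mat n m"
  shows "adj (A - B) = adj A - adj B"
  by (rule eq_matI) (use assms in auto)

lemma unitaryD:
  assumes "unitary d U"
  shows "U \<in> carrier_mat d d" "adj U * U = 1\<^sub>m d" "U * adj U = 1\<^sub>m d"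
  using assms mat_mult_left_right_inverse[of "adj U" d U] by (auto simp: unitary_def)

lemma unitary_one [simp]: "unitary d (1\<^sub>m d)"
  by (auto simp: unitary_def)

lemma unitary_adj: "unitary d U \<Longrightarrow> unitary d (adj U)"
  unfolding unitary_def[of d "adj U"] using unitaryD(1,3) by auto

lemma unitary_mult:
  assumes "unitary d U" "unitary d V"
  shows "unitary d (U * V)"
proof -
  note U = unitaryD[OF assms(1)] note V = unitaryD[OF assms(2)]
  have "adj (U * V) * (U * V) = adj V * ((adj U * U) * V)"
    using carrier_matD[OF U(1)] carrier_matD[OF V(1)] by (simp add: adj_mult' mat_assoc)
  then show ?thesis using U V by (auto simp: unitary_def)
qed

lemma hermitianD: "hermitian d A \<Longrightarrow> A \<in> carrier_mat d d" "hermitian d A \<Longrightarrow> adj A = A"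
  by (auto simp: hermitian_def)

lemma hermitian_conj:
  assumes "hermitian d A" "U \<in> carrier_mat d e"
  shows "hermitian e (adj U * A * U)"
proof -
  note A = hermitianD[OF assms(1)]
  have "adj (adj U * A * U) = adj U * (adj A * adj (adj U))"
    using carrier_matD[OF A(1)] carrier_matD[OF assms(2)] by (simp add: adj_mult')
  then have "adj (adj U * A * U) = adj U * A * U"
    using A(2) carrier_matD[OF A(1)] carrier_matD[OF assms(2)] by (simp add: mat_assoc)
  then show ?thesis using A(1) assms(2) by (auto simp: hermitian_def)
qed

text \<open>Gram-Schmidt leaves the first vector of a basis alone, so completing v to a basis,
  orthogonalising and dividing by the norms \<open>nr j\<close> only rescales v. This is the
  deflation step of the spectral theorem.\<close>

lemma unitary_with_first_column:
  assumes v: "v \<in> carrier_vec n" and v0: "v \<noteq> 0\<^sub>v n"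
  shows "\<exists>W a. unitary n W \<and> a \<noteq> 0 \<and> col W 0 = a \<cdot>\<^sub>v v"
proof -
  define ws where "ws = gram_schmidt n (basis_completion v)"
  interpret cof_vec_space n "TYPE(complex)" .
  note bc = basis_completion[OF v v0]
  have n: "n \<noteq> 0" using v v0 by auto
  obtain vs where bv: "basis_completion v = v # vs" using bc(6,7) n by (cases "basis_completion v") auto
  from gram_schmidt_result[OF bc(2) bc(4) bc(5) refl, folded ws_def]
  have ws: "set ws \<subseteq> carrier_vec n" "corthogonal ws" "length ws = n" by (auto simp: bc(6))
  from gram_schmidt_hd[OF v, of vs, folded bv] have hdws: "hd ws = v" unfolding ws_def .
  define nr where "nr j = sqrt (\<Sum>i<n. (cmod (ws ! j $ i))\<^sup>2)" for j
  have ip: "(\<Sum>i<n. ws ! j $ i * cnj (ws ! k $ i)) = 0 \<longleftrightarrow> j \<noteq> k" if "j < n" "k < n" for j k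
  proof -
    have "dim_vec (ws ! k) = n" using that ws(1,3) nth_mem[of k ws] carrier_vecD by blast
    then show ?thesis
      using corthogonalD[OF ws(2), of j k] that ws(3)
      by (simp add: scalar_prod_def atLeast0LessThan)
  qed
  have self: "(\<Sum>i<n. ws ! j $ i * cnj (ws ! j $ i)) = of_real ((nr j)\<^sup>2)" for j
  proof -
    have "(nr j)\<^sup>2 = (\<Sum>i<n. (cmod (ws ! j $ i))\<^sup>2)" unfolding nr_def by (rule real_sqrt_pow2) (simp add: sum_nonneg)
    then show ?thesis by (simp add: complex_norm_square[symmetric])
  qed
  \<comment> \<open>\<open>corthogonal\<close> also excludes zero vectors, through the case j = k of
    \<open>ip\<close>.\<close>
  have nr0: "nr j \<noteq> 0" if "j < n" for j
    using ip[OF that that] self[of j] by auto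
  define W where "W = mat n n (\<lambda>(i,j). ws ! j $ i / of_real (nr j))"
  have W: "W \<in> carrier_mat n n" by (auto simp: W_def)
  have "adj W * W = 1\<^sub>m n"
  proof (rule eq_matI)
    fix j k assume "j < dim_row (1\<^sub>m n)" "k < dim_col (1\<^sub>m n)"
    then have jk: "j < n" "k < n" by auto
    have "(adj W * W) $$ (j,k) = (\<Sum>i<n. (ws ! k $ i * cnj (ws ! j $ i)) / (of_real (nr j) * of_real (nr k)))"
      unfolding mult_entry[OF adj_carrier[OF W] W jk]
      by (rule sum.cong) (use jk in \<open>auto simp: W_def\<close>)
    also have "\<dots> = (\<Sum>i<n. ws ! k $ i * cnj (ws ! j $ i)) / (of_real (nr j) * of_real (nr k))"
      by (simp add: sum_divide_distrib)
    also have "\<dots> = 1\<^sub>m n $$ (j,k)"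
      using jk ip[of k j] self[of j] nr0[of j] by (auto simp: power2_eq_square)
    finally show "(adj W * W) $$ (j,k) = 1\<^sub>m n $$ (j,k)" .
  qed (use W in auto)
  then have "unitary n W" using W by (auto simp: unitary_def)
  moreover have "col W 0 = (1 / of_real (nr 0)) \<cdot>\<^sub>v v"
  proof -
    have "ws ! 0 = v" using hdws n ws(3) by (metis hd_conv_nth length_0_conv)
    then show ?thesis using n v by (intro eq_vecI) (auto simp: W_def)
  qed
  ultimately show ?thesis using nr0[of 0] n by (intro exI[of _ W] exI[of _ "1 / of_real (nr 0)"]) auto
qed

section \<open>Matrices diagonal in a given basis\<close>

definition dg :: "nat \<Rightarrow> (nat \<Rightarrow> real) \<Rightarrow> complex mat" where
  "dg d x = mat d d (\<lambda>(i,j). if i = j then of_real (x i) else 0)"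

text \<open>The combination of the rank-one matrices of the columns of V with coefficients x. V may
  be any square matrix, because truncated bases take its place when states are compressed.\<close>

definition udg :: "nat \<Rightarrow> complex mat \<Rightarrow> (nat \<Rightarrow> real) \<Rightarrow> complex mat" where
  "udg d V x = V * dg d x * adj V"

lemma dg_carrier [simp, intro]: "dg d x \<in> carrier_mat d d"
  and dg_dims [simp]: "dim_row (dg d x) = d" "dim_col (dg d x) = d"
  and dg_entry [simp]: "i < d \<Longrightarrow> j < d \<Longrightarrow> dg d x $$ (i,j) = (if i = j then of_real (x i) else 0)"
  by (auto simp: dg_def)

text \<open>Induction by deflation: an eigenvector for the head of the list becomes the first column
  of a unitary W, and the remaining block has the tail of the list as its roots. The list is given
  in advance so that the caller decides the order of the eigenvalues.\<close>

lemma spectral_list: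
  assumes "hermitian n A" "char_poly A = (\<Prod>e\<leftarrow>es. [:- e, 1:])"
  shows "\<exists>V. unitary n V \<and> adj V * A * V = mat n n (\<lambda>(i,j). if i = j then es ! i else 0)"
  using assms
proof (induct es arbitrary: n A)
  case Nil
  then have "n = 0" using degree_monic_char_poly[of A n] by (auto simp: hermitian_def)
  then show ?case using Nil by (intro exI[of _ "1\<^sub>m 0"]) (auto simp: hermitian_def)
next
  case (Cons e es n A)
  note A = hermitianD[OF Cons(2)]
  have cp: "char_poly A = [: -e, 1 :] * (\<Prod>e \<leftarrow> es. [:- e, 1:])" using Cons(3) by auto
  have mon: "monic (\<Prod>e\<leftarrow> es. [:- e, 1:])" by (rule monic_prod_list, auto)
  have deg: "degree (char_poly A) = Suc (degree (\<Prod>e\<leftarrow> es. [:- e, 1:]))" unfolding cp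
    by (subst degree_mult_eq, insert mon, auto)
  then have n: "n \<noteq> 0" using degree_monic_char_poly[OF A(1)] by auto
  then obtain m where nm: "n = Suc m" by (cases n) auto
  have "eigenvalue A e" unfolding eigenvalue_root_char_poly[OF A(1)] cp by simp
  then obtain v where "eigenvector A v e" unfolding eigenvalue_def by auto
  then have v: "v \<in> carrier_vec n" "v \<noteq> 0\<^sub>v n" "A *\<^sub>v v = e \<cdot>\<^sub>v v"
    using A by (auto simp: eigenvector_def)
  from unitary_with_first_column[OF v(1,2)] obtain W a where
    W: "unitary n W" and a: "a \<noteq> 0" "col W 0 = a \<cdot>\<^sub>v v" by auto
  note Wu = unitaryD[OF W]
  define A' where "A' = adj W * A * W"
  have hA': "hermitian n A'" unfolding A'_def by (rule hermitian_conj[OF Cons(2) Wu(1)])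
  note A' = hermitianD[OF hA']
  have Acol: "A *\<^sub>v col W 0 = e \<cdot>\<^sub>v col W 0"
    using v A(1) by (simp add: a mult_mat_vec smult_smult_assoc mult.commute)
  have c0: "A' $$ (i,0) = (if i = 0 then e else 0)" if "i < n" for i
  proof -
    have n0: "0 < n" using n by simp
    have "col A' 0 = adj W *\<^sub>v (A *\<^sub>v col W 0)"
      unfolding A'_def assoc_mult_mat[OF adj_carrier[OF Wu(1)] A(1) Wu(1)]
        col_mult2[OF adj_carrier[OF Wu(1)] mult_carrier_mat[OF A(1) Wu(1)] n0] col_mult2[OF A(1) Wu(1) n0] ..
    also have "\<dots> = e \<cdot>\<^sub>v (adj W *\<^sub>v col W 0)"
      unfolding Acol using Wu(1) by (subst mult_mat_vec[of _ n n]) auto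
    also have "adj W *\<^sub>v col W 0 = col (adj W * W) 0"
      using Wu(1) n by (subst col_mult2[of _ n n _ n]) auto
    finally have "col A' 0 = e \<cdot>\<^sub>v col (1\<^sub>m n) 0" using Wu(2) by simp
    then have "col A' 0 $ i = (e \<cdot>\<^sub>v col (1\<^sub>m n) 0) $ i" by simp
    then show ?thesis using that n A'(1) by simp
  qed
  \<comment> \<open>Hermitian symmetry clears the first row together with the first column, so that
    \<open>A'\<close> is block diagonal.\<close>
  have r0: "A' $$ (0,i) = (if i = 0 then cnj e else 0)" if "i < n" for i
  proof -
    have "A' $$ (0,i) = cnj (A' $$ (i,0))"
      using arg_cong[OF A'(2), of "\<lambda>M. M $$ (0,i)"] A'(1) that n by simp
    then show ?thesis using c0[OF that] by simp
  qed
  define A3 where "A3 = mat m m (\<lambda>(i,j). A' $$ (Suc i, Suc j))"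
  have A3c: "A3 \<in> carrier_mat m m" by (auto simp: A3_def)
  have hA3: "hermitian m A3"
  proof -
    have "adj A3 $$ (i,j) = A3 $$ (i,j)" if "i < m" "j < m" for i j
      using arg_cong[OF A'(2), of "\<lambda>M. M $$ (Suc i, Suc j)"] A'(1) that nm by (simp add: A3_def)
    then show ?thesis using A3c by (auto simp: hermitian_def intro!: eq_matI)
  qed
  define A1 where "A1 = mat 1 1 (\<lambda>_. e)"
  have A1c: "A1 \<in> carrier_mat 1 1" by (auto simp: A1_def)
  have blk: "A' = four_block_mat A1 (0\<^sub>m 1 m) (0\<^sub>m m 1) A3"
    by (rule eq_matI) (use A' c0 r0 r0[of 0] c0[of 0] nm in \<open>auto simp: A1_def A3_def split: if_splits\<close>)
  have "similar_mat A' A"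
    unfolding similar_mat_def A'_def
    by (intro exI[of _ "adj W"] exI[of _ W] similar_mat_witI[of _ _ n]) (use Wu A in auto)
  then have "char_poly A' = [: -e,1 :] * (\<Prod> e \<leftarrow> es. [:- e, 1:])"
    using char_poly_similar cp by metis
  moreover have "char_poly A' = char_poly A1 * char_poly A3"
    unfolding blk by (rule char_poly_four_block_zeros_col[OF A1c _ A3c]) auto
  moreover have "char_poly A1 = [: -e,1 :]"
    by (simp add: A1_def char_poly_defs det_def sign_def)
  ultimately have "char_poly A3 = (\<Prod> e \<leftarrow> es. [:- e, 1:])"
    by (metis mult_cancel_left pCons_eq_0_iff zero_neq_one)
  from Cons(1)[OF hA3 this] obtain V3 where V3: "unitary m V3"
    and d3: "adj V3 * A3 * V3 = mat m m (\<lambda>(i,j). if i = j then es ! i else 0)" by auto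
  note V3u = unitaryD[OF V3]
  define V where "V = four_block_mat (1\<^sub>m 1) (0\<^sub>m 1 m) (0\<^sub>m m 1) V3"
  have Vc: "V \<in> carrier_mat n n" using V3u nm by (auto simp: V_def)
  have adjV: "adj V = four_block_mat (1\<^sub>m 1) (0\<^sub>m 1 m) (0\<^sub>m m 1) (adj V3)"
    using V3u(1) by (intro eq_matI) (auto simp: V_def)
  have "adj V * V = four_block_mat (1\<^sub>m 1) (0\<^sub>m 1 m) (0\<^sub>m m 1) (1\<^sub>m m)"
    unfolding adjV unfolding V_def using V3u
    by (subst mult_four_block_mat[of _ 1 1 _ m _ m _ _ 1 _ m]) auto
  also have "\<dots> = 1\<^sub>m n" using nm by (intro eq_matI) auto
  finally have uV: "unitary n V" using Vc by (auto simp: unitary_def)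
  have "adj V * A' * V = four_block_mat A1 (0\<^sub>m 1 m) (0\<^sub>m m 1) (adj V3 * A3 * V3)"
  proof -
    have 1: "adj V * A' = four_block_mat A1 (0\<^sub>m 1 m) (0\<^sub>m m 1) (adj V3 * A3)"
      unfolding adjV blk using V3u A3c A1c
      by (subst mult_four_block_mat[of _ 1 1 _ m _ m _ _ 1 _ m]) auto
    have c: "adj V3 * A3 \<in> carrier_mat m m" "adj V3 * A3 * V3 \<in> carrier_mat m m" using V3u A3c by auto
    show ?thesis unfolding 1 unfolding V_def using V3u c A1c
      by (subst mult_four_block_mat[of _ 1 1 _ m _ m _ _ 1 _ m]) auto
  qed
  also have "\<dots> = mat n n (\<lambda>(i,j). if i = j then (e # es) ! i else 0)"
    unfolding d3 using nm by (intro eq_matI) (auto simp: A1_def nth_Cons split: nat.splits)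
  finally have f: "adj V * A' * V = mat n n (\<lambda>(i,j). if i = j then (e # es) ! i else 0)" .
  have "adj (W * V) * A * (W * V) = adj V * A' * V"
    unfolding A'_def by (rule adj_conj_mult[OF Wu(1) Vc A(1)])
  with f have "adj (W * V) * A * (W * V) = mat n n (\<lambda>(i,j). if i = j then (e # es) ! i else 0)" by (rule trans[rotated])
  with unitary_mult[OF W uV] show ?case by (intro exI[of _ "W * V"] conjI)
qed

lemma conj_cancel:
  assumes "unitary d V" "A \<in> carrier_mat d d" "B \<in> carrier_mat d d" "adj V * A * V = B"
  shows "A = V * B * adj V"
proof -
  note V = unitaryD[OF assms(1)]
  have "(V * adj V) * A * (V * adj V) = V * (adj V * A * V) * adj V"
    using carrier_matD[OF V(1)] carrier_matD[OF assms(2)] by (simp add: mat_assoc)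
  then show ?thesis using V assms(2,4) by simp
qed

text \<open>The decreasing order belongs to the result because blocks of consecutive eigenvalues are
  compared later on.\<close>

theorem spectral:
  assumes h: "hermitian d A"
  shows "\<exists>V x. unitary d V \<and> A = udg d V x \<and> (\<forall>i j. i \<le> j \<longrightarrow> j < d \<longrightarrow> x j \<le> x i)"
proof -
  note A = hermitianD[OF h]
  obtain es where es: "char_poly A = (\<Prod>e\<leftarrow>es. [:- e, 1:])" "length es = d"
    using char_poly_factorized[OF A(1)] by auto
  \<comment> \<open>A first diagonalisation, in arbitrary order, shows that the roots are real: they
    are the diagonal entries of a Hermitian matrix.\<close>
  have re: "e = of_real (Re e)" if "e \<in> set es" for e
  proof -
    from spectral_list[OF h es(1)] obtain V where V: "unitary d V" and
      eq: "adj V * A * V = mat d d (\<lambda>(i,j). if i = j then es ! i else 0)" by auto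
    from that obtain i where i: "i < d" "e = es ! i" using es(2) by (auto simp: in_set_conv_nth)
    have "hermitian d (adj V * A * V)" using hermitian_conj[OF h unitaryD(1)[OF V]] .
    then have "adj (mat d d (\<lambda>(i,j). if i = j then es ! i else 0)) $$ (i,i) = mat d d (\<lambda>(i,j). if i = j then es ! i else 0) $$ (i,i)"
      unfolding eq by (simp add: hermitianD(2))
    then show ?thesis using i by (simp add: complex_eq_iff)
  qed
  \<comment> \<open>Sorting keeps the multiset of roots, so \<open>xs\<close> factorises the same
    characteristic polynomial and \<open>spectral_list\<close> can be applied a second time.\<close>
  define xs where "xs = rev (sort (map Re es))"
  have "mset (map of_real xs) = mset es"
  proof -
    have "map (\<lambda>e. of_real (Re e)) es = es" by (rule map_idI) (use re in auto)
    then have "mset es = image_mset (\<lambda>e. of_real (Re e)) (mset es)" by (simp only: mset_map[symmetric])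
    then show ?thesis by (simp add: xs_def image_mset.compositionality comp_def)
  qed
  then have "prod_mset (image_mset (\<lambda>e. [:- e, 1:]) (mset (map complex_of_real xs)))
      = prod_mset (image_mset (\<lambda>e. [:- e, 1:]) (mset es))" by simp
  then have "prod_list (map (\<lambda>e. [:- e, 1:]) (map complex_of_real xs)) = prod_list (map (\<lambda>e. [:- e, 1:]) es)"
    by (simp only: mset_map[symmetric] prod_mset_prod_list)
  then have cp: "char_poly A = (\<Prod>e\<leftarrow>map complex_of_real xs. [:- e, 1:])"
    unfolding es(1) by (rule sym)
  from spectral_list[OF h cp] obtain V where V: "unitary d V"
    "adj V * A * V = mat d d (\<lambda>(i,j). if i = j then map complex_of_real xs ! i else 0)" by auto
  have len: "length xs = d" using es(2) by (simp add: xs_def)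
  have dd: "mat d d (\<lambda>(i,j). if i = j then map complex_of_real xs ! i else 0) = dg d (\<lambda>i. xs ! i)"
    by (rule eq_matI) (auto simp: len)
  have "A = udg d V (\<lambda>i. xs ! i)"
    unfolding udg_def by (rule conj_cancel[OF V(1) A(1)]) (use V(2) dd in auto)
  moreover have "xs ! j \<le> xs ! i" if "i \<le> j" "j < d" for i j
  proof -
    have "sorted_wrt (\<ge>) xs" unfolding xs_def by (simp add: sorted_wrt_rev)
    then show ?thesis using that len by (cases "i = j") (auto simp: sorted_wrt_iff_nth_less)
  qed
  ultimately show ?thesis using V(1) by (intro exI[of _ V] exI[of _ "\<lambda>i. xs ! i"]) auto
qed

section \<open>Kronecker products and spectral sums\<close>

lemma div_lt: "i < a * b \<Longrightarrow> i div b < (a::nat)"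
  by (simp add: less_mult_imp_div_less)

lemma mod_lt: "i < a * b \<Longrightarrow> i mod b < (b::nat)"
  by (cases "b = 0") auto

lemma pair_lt: "i < a \<Longrightarrow> j < b \<Longrightarrow> i * b + j < a * (b::nat)"
proof -
  assume "i < a" "j < b"
  then have "i * b + j < (i + 1) * b" by simp
  also have "\<dots> \<le> a * b" using \<open>i < a\<close> by (intro mult_le_mono1) simp
  finally show ?thesis .
qed

text \<open>Indices of a Kronecker product encode a pair as i * b + j; this change of variables
  underlies every sum over such indices.\<close>

lemma sum_div_mod:
  fixes f :: "nat \<Rightarrow> 'a::comm_monoid_add"
  shows "(\<Sum>l<a*b. f l) = (\<Sum>i<a. \<Sum>j<b. f (i * b + j))"
proof -
  have "(\<Sum>i<a. \<Sum>j<b. f (i * b + j)) = (\<Sum>(i,j)\<in>{..<a}\<times>{..<b}. f (i * b + j))"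
    by (simp add: sum.cartesian_product)
  also have "\<dots> = (\<Sum>l<a*b. f l)"
    by (rule sum.reindex_bij_witness[of _ "\<lambda>l. (l div b, l mod b)" "\<lambda>(i,j). i * b + j"])
      (auto simp: div_lt mod_lt pair_lt)
  finally show ?thesis by simp
qed

lemma sum_div_mod_prod:
  fixes f g :: "nat \<Rightarrow> 'a::semiring_0"
  shows "(\<Sum>l<a*b. f (l div b) * g (l mod b)) = (\<Sum>i<a. f i) * (\<Sum>j<b. g j)"
  by (simp add: sum_div_mod sum_product)

lemma kron_dims [simp]:
  "dim_row (kron A B) = dim_row A * dim_row B" "dim_col (kron A B) = dim_col A * dim_col B"
  by (auto simp: kron_def)

lemma kron_carrier [intro]:
  "A \<in> carrier_mat a b \<Longrightarrow> B \<in> carrier_mat c d \<Longrightarrow> kron A B \<in> carrier_mat (a * c) (b * d)"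
  by (auto simp: kron_def)

lemma kron_entry [simp]:
  "i < dim_row A * dim_row B \<Longrightarrow> j < dim_col A * dim_col B \<Longrightarrow>
   kron A B $$ (i,j) = A $$ (i div dim_row B, j div dim_col B) * B $$ (i mod dim_row B, j mod dim_col B)"
  by (auto simp: kron_def)

lemma kron_mult:
  assumes "dim_col A = dim_row B" "dim_col C = dim_row D"
  shows "kron (A * B) (C * D) = kron A C * kron B D"
proof (rule eq_matI)
  fix i j assume "i < dim_row (kron A C * kron B D)" "j < dim_col (kron A C * kron B D)"
  then have ij: "i < dim_row A * dim_row C" "j < dim_col B * dim_col D" by auto
  note b = div_lt[OF ij(1)] mod_lt[OF ij(1)] div_lt[OF ij(2)] mod_lt[OF ij(2)]
  have AB: "(A * B) $$ (i div dim_row C, j div dim_col D) = (\<Sum>l<dim_row B. A $$ (i div dim_row C, l) * B $$ (l, j div dim_col D))"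
    by (rule mult_entry[of _ "dim_row A" _ _ "dim_col B"]) (use b assms in auto)
  have CD: "(C * D) $$ (i mod dim_row C, j mod dim_col D) = (\<Sum>l<dim_row D. C $$ (i mod dim_row C, l) * D $$ (l, j mod dim_col D))"
    by (rule mult_entry[of _ "dim_row C" _ _ "dim_col D"]) (use b assms in auto)
  have "(kron A C * kron B D) $$ (i,j) = (\<Sum>l<dim_row B * dim_row D. kron A C $$ (i,l) * kron B D $$ (l,j))"
    by (rule mult_entry[of _ "dim_row A * dim_row C" _ _ "dim_col B * dim_col D"]) (use ij assms in auto)
  also have "\<dots> = (\<Sum>l<dim_row B * dim_row D. (A $$ (i div dim_row C, l div dim_row D) * B $$ (l div dim_row D, j div dim_col D)) *
      (C $$ (i mod dim_row C, l mod dim_row D) * D $$ (l mod dim_row D, j mod dim_col D)))"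
    by (rule sum.cong) (use ij assms in \<open>auto simp: mult_ac\<close>)
  also have "\<dots> = kron (A * B) (C * D) $$ (i, j)"
    unfolding sum_div_mod_prod[of "\<lambda>l. A $$ (i div dim_row C, l) * B $$ (l, j div dim_col D)" "dim_row D"
        "\<lambda>l. C $$ (i mod dim_row C, l) * D $$ (l, j mod dim_col D)" "dim_row B"]
      AB[symmetric] CD[symmetric] using ij by (simp del: index_mult_mat(1))
  finally show "kron (A * B) (C * D) $$ (i, j) = (kron A C * kron B D) $$ (i,j)" by simp
qed auto

lemma kron_adj: "adj (kron A B) = kron (adj A) (adj B)"
  by (rule eq_matI) (auto simp: div_lt mod_lt)

lemma kron_one: "kron (1\<^sub>m a) (1\<^sub>m b) = 1\<^sub>m (a * b)"
proof (rule eq_matI)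
  fix i j assume "i < dim_row (1\<^sub>m (a * b))" "j < dim_col (1\<^sub>m (a * b))"
  then show "kron (1\<^sub>m a) (1\<^sub>m b) $$ (i, j) = 1\<^sub>m (a * b) $$ (i,j)"
    by (auto simp: div_lt mod_lt) (metis div_mult_mod_eq)
qed auto

lemma kron_one_right [simp]: "kron A (1\<^sub>m 1) = A"
  by (rule eq_matI) auto

lemma kron_add_left:
  "dim_row A = dim_row B \<Longrightarrow> dim_col A = dim_col B \<Longrightarrow> kron (A + B) C = kron A C + kron B C"
  by (rule eq_matI) (auto simp: div_lt mod_lt ring_distribs)

lemma kron_add_right:
  "dim_row A = dim_row B \<Longrightarrow> dim_col A = dim_col B \<Longrightarrow> kron C (A + B) = kron C A + kron C B"
  by (rule eq_matI) (auto simp: div_lt mod_lt ring_distribs)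

lemma kron_minus_left:
  "dim_row A = dim_row B \<Longrightarrow> dim_col A = dim_col B \<Longrightarrow> kron (A - B) C = kron A C - kron B C"
  by (rule eq_matI) (auto simp: div_lt mod_lt ring_distribs)

section \<open>The trace\<close>

lemma mtrace_mult_comm:
  assumes "A \<in> carrier_mat n m" "B \<in> carrier_mat m n"
  shows "mtrace (A * B) = mtrace (B * A)"
proof -
  have "mtrace (A * B) = (\<Sum>i<n. \<Sum>l<m. A $$ (i,l) * B $$ (l,i))"
    using assms by (simp add: mtrace_def mult_entry[OF assms] del: index_mult_mat(1))
  also have "\<dots> = (\<Sum>l<m. \<Sum>i<n. B $$ (l,i) * A $$ (i,l))"
    by (subst sum.swap) (simp add: mult.commute)
  also have "\<dots> = mtrace (B * A)"
    using assms by (simp add: mtrace_def mult_entry[OF assms(2,1)] del: index_mult_mat(1))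
  finally show ?thesis .
qed

lemma mtrace_add: "A \<in> carrier_mat n n \<Longrightarrow> B \<in> carrier_mat n n \<Longrightarrow> mtrace (A + B) = mtrace A + mtrace B"
  by (auto simp: mtrace_def sum.distrib)

lemma mtrace_minus: "A \<in> carrier_mat n n \<Longrightarrow> B \<in> carrier_mat n n \<Longrightarrow> mtrace (A - B) = mtrace A - mtrace B"
  by (auto simp: mtrace_def sum_subtractf)

lemma mtrace_smult: "mtrace (a \<cdot>\<^sub>m A) = a * mtrace A" if "A \<in> carrier_mat n n"
  using that by (auto simp: mtrace_def sum_distrib_left)

lemma mtrace_kron:
  assumes "A \<in> carrier_mat n n" "B \<in> carrier_mat m m"
  shows "mtrace (kron A B) = mtrace A * mtrace B"
proof -
  have "mtrace (kron A B) = (\<Sum>i<n*m. A $$ (i div m, i div m) * B $$ (i mod m, i mod m))"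
    using assms by (auto simp: mtrace_def)
  also have "\<dots> = mtrace A * mtrace B"
    using assms sum_div_mod_prod[of "\<lambda>i. A $$ (i, i)" m "\<lambda>i. B $$ (i, i)" n] by (auto simp: mtrace_def)
  finally show ?thesis .
qed

lemma unitary_kron:
  assumes "unitary a U" "unitary b V"
  shows "unitary (a * b) (kron U V)"
proof -
  note U = unitaryD[OF assms(1)] note V = unitaryD[OF assms(2)]
  have "adj (kron U V) * kron U V = kron (adj U * U) (adj V * V)"
    using U(1) V(1) by (subst kron_mult) (auto simp: kron_adj)
  then have "adj (kron U V) * kron U V = 1\<^sub>m (a * b)" using U V by (simp add: kron_one)
  then show ?thesis unfolding unitary_def using U V by auto
qed

lemma dg_kron: "kron (dg a x) (dg b y) = dg (a * b) (\<lambda>i. x (i div b) * y (i mod b))"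
proof (rule eq_matI)
  fix i j assume "i < dim_row (dg (a * b) (\<lambda>i. x (i div b) * y (i mod b)))"
    "j < dim_col (dg (a * b) (\<lambda>i. x (i div b) * y (i mod b)))"
  then show "kron (dg a x) (dg b y) $$ (i, j) = dg (a * b) (\<lambda>i. x (i div b) * y (i mod b)) $$ (i, j)"
    by (auto simp: div_lt mod_lt) (metis div_mult_mod_eq)
qed auto

lemma dg_mult: "dg d x * dg d y = dg d (\<lambda>i. x i * y i)"
proof (rule eq_matI)
  fix i j assume "i < dim_row (dg d (\<lambda>i. x i * y i))" "j < dim_col (dg d (\<lambda>i. x i * y i))"
  then have ij: "i < d" "j < d" by auto
  have "(dg d x * dg d y) $$ (i,j) = (\<Sum>l<d. if l = i then dg d x $$ (i,l) * dg d y $$ (l,j) else 0)"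
    unfolding mult_entry[OF dg_carrier dg_carrier ij] by (rule sum.cong) (use ij in auto)
  then show "(dg d x * dg d y) $$ (i,j) = dg d (\<lambda>i. x i * y i) $$ (i,j)"
    using ij by (simp del: index_mult_mat(1))
qed auto

lemma dg_adj: "adj (dg d x) = dg d x"
  by (rule eq_matI) auto

lemma dg_one: "dg d (\<lambda>_. 1) = 1\<^sub>m d"
  by (rule eq_matI) auto

lemma udg_carrier [intro]: "V \<in> carrier_mat d d \<Longrightarrow> udg d V x \<in> carrier_mat d d"
  by (auto simp: udg_def)

lemma udg_dims [simp]: "dim_row (udg d V x) = dim_row V" "dim_col (udg d V x) = dim_row V"
  by (auto simp: udg_def)

lemma udg_entry:
  assumes "V \<in> carrier_mat d d" "i < d" "j < d"
  shows "udg d V x $$ (i,j) = (\<Sum>l<d. of_real (x l) * (V $$ (i,l) * cnj (V $$ (j,l))))"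
proof -
  have 1: "(V * dg d x) $$ (i,l) = V $$ (i,l) * of_real (x l)" if "l < d" for l
  proof -
    have "(V * dg d x) $$ (i,l) = (\<Sum>k<d. if k = l then V $$ (i,k) * of_real (x k) else 0)"
      unfolding mult_entry[OF assms(1) dg_carrier assms(2) that] by (rule sum.cong) (use that in auto)
    then show ?thesis using that by (simp del: index_mult_mat(1))
  qed
  show ?thesis unfolding udg_def
    by (subst mult_entry[of _ d d _ d]) (use assms in \<open>auto simp: 1 mult_ac intro!: sum.cong simp del: index_mult_mat(1)\<close>)
qed

lemma udg_hermitian: "V \<in> carrier_mat d d \<Longrightarrow> hermitian d (udg d V x)"
  by (auto simp: hermitian_def udg_entry mult_ac intro!: eq_matI sum.cong)

lemma udg_cong: "(\<And>i. i < d \<Longrightarrow> x i = y i) \<Longrightarrow> udg d V x = udg d V y"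
proof -
  assume "\<And>i. i < d \<Longrightarrow> x i = y i"
  then have "dg d x = dg d y" by (intro eq_matI) auto
  then show ?thesis by (simp add: udg_def)
qed

lemma udg_kron:
  assumes "V \<in> carrier_mat a a" "W \<in> carrier_mat b b"
  shows "kron (udg a V x) (udg b W y) = udg (a * b) (kron V W) (\<lambda>i. x (i div b) * y (i mod b))"
  using carrier_matD[OF assms(1)] carrier_matD[OF assms(2)]
  by (simp add: udg_def kron_mult dg_kron kron_adj)

lemma udg_conj:
  assumes "U \<in> carrier_mat d d" "V \<in> carrier_mat d d"
  shows "U * udg d V x * adj U = udg d (U * V) x"
  using carrier_matD[OF assms(1)] carrier_matD[OF assms(2)]
  by (simp add: udg_def adj_mult' mat_assoc)

lemma udg_mult:
  assumes "unitary d V"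
  shows "udg d V x * udg d V y = udg d V (\<lambda>i. x i * y i)"
proof -
  note V = unitaryD[OF assms]
  have "udg d V x * udg d V y = V * (dg d x * ((adj V * V) * dg d y)) * adj V"
    using carrier_matD[OF V(1)] by (simp add: udg_def mat_assoc)
  also have "(adj V * V) * dg d y = dg d y" unfolding V(2) by (rule left_mult_one_mat) auto
  finally show ?thesis by (simp add: udg_def dg_mult)
qed

lemma udg_one: "unitary d V \<Longrightarrow> udg d V (\<lambda>_. 1) = 1\<^sub>m d"
proof -
  assume "unitary d V"
  note V = unitaryD[OF this]
  have "V * 1\<^sub>m d = V" using V(1) by simp
  then show ?thesis using V by (simp add: udg_def dg_one)
qed

lemma udg_add: "V \<in> carrier_mat d d \<Longrightarrow> udg d V x + udg d V y = udg d V (\<lambda>i. x i + y i)"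
  by (rule eq_matI) (auto simp: udg_entry ring_distribs sum.distrib)

lemma udg_minus: "V \<in> carrier_mat d d \<Longrightarrow> udg d V x - udg d V y = udg d V (\<lambda>i. x i - y i)"
  by (rule eq_matI) (auto simp: udg_entry ring_distribs sum_subtractf)

text \<open>Cyclicity of the trace turns an expectation value into a classical sum: the coefficients
  x against the diagonal of B in the basis V.\<close>

lemma udg_diag:
  assumes "V \<in> carrier_mat d d" "B \<in> carrier_mat d d"
  shows "mtrace (udg d V x * B) = (\<Sum>l<d. of_real (x l) * (adj V * B * V) $$ (l,l))"
proof -
  have 1: "udg d V x * B = V * (dg d x * (adj V * B))"
    using carrier_matD[OF assms(1)] carrier_matD[OF assms(2)] by (simp add: udg_def mat_assoc)
  have 2: "mtrace (V * (dg d x * (adj V * B))) = mtrace ((dg d x * (adj V * B)) * V)"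
    by (rule mtrace_mult_comm[of _ d d]) (use assms in auto)
  have 3: "(dg d x * (adj V * B)) * V = dg d x * (adj V * B * V)"
    using carrier_matD[OF assms(1)] carrier_matD[OF assms(2)] by (simp add: mat_assoc)
  have c: "adj V * B * V \<in> carrier_mat d d" using assms by auto
  have "mtrace (dg d x * (adj V * B * V)) = (\<Sum>l<d. \<Sum>k<d. if k = l then of_real (x l) * (adj V * B * V) $$ (l,l) else 0)"
  proof -
    have "(\<Sum>k<d. dg d x $$ (l,k) * (adj V * B * V) $$ (k,l)) =
      (\<Sum>k<d. if k = l then of_real (x l) * (adj V * B * V) $$ (l,l) else 0)" if "l < d" for l
      by (rule sum.cong) (use that in auto)
    then show ?thesis by (simp add: mtrace_def mult_entry[OF dg_carrier c] del: index_mult_mat(1))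
  qed
  then show ?thesis unfolding 1 2 3 by simp
qed

lemma mtrace_udg:
  assumes "unitary d V"
  shows "mtrace (udg d V x) = of_real (\<Sum>l<d. x l)"
proof -
  note V = unitaryD[OF assms]
  have "udg d V x * 1\<^sub>m d = udg d V x" using V(1) by (intro right_mult_one_mat) auto
  then have "mtrace (udg d V x) = (\<Sum>l<d. of_real (x l) * (adj V * 1\<^sub>m d * V) $$ (l,l))"
    using udg_diag[OF V(1), of "1\<^sub>m d" x] by simp
  also have "adj V * 1\<^sub>m d * V = 1\<^sub>m d" using V by (subst right_mult_one_mat[of _ d]) auto
  finally show ?thesis by simp
qed

lemma char_poly_udg:
  assumes "unitary d V"
  shows "char_poly (udg d V x) = (\<Prod>i<d. [:- complex_of_real (x i), 1:])"
proof -
  note V = unitaryD[OF assms]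
  have "similar_mat (udg d V x) (dg d x)"
    unfolding similar_mat_def udg_def
    by (intro exI[of _ V] exI[of _ "adj V"] similar_mat_witI[of _ _ d]) (use V in auto)
  then have "char_poly (udg d V x) = char_poly (dg d x)" by (rule char_poly_similar)
  also have "\<dots> = (\<Prod>a\<leftarrow>diag_mat (dg d x). [:- a, 1:])"
    by (rule char_poly_upper_triangular[of _ d]) auto
  also have "diag_mat (dg d x) = map (\<lambda>i. of_real (x i)) [0..<d]"
    by (auto simp: diag_mat_def)
  also have "(\<Prod>a\<leftarrow>map (\<lambda>i. complex_of_real (x i)) [0..<d]. [:- a, 1:]) = (\<Prod>i<d. [:- complex_of_real (x i), 1:])"
    by (simp add: comp_def prod.distinct_set_conv_list[symmetric] atLeast0LessThan)
  finally show ?thesis .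
qed

text \<open>Entropy, trace norm and the second moment of the information are all of this kind, so
  one evaluation on \<open>udg\<close> covers the three.\<close>

definition spec_sum :: "(real \<Rightarrow> real) \<Rightarrow> complex mat \<Rightarrow> real" where
  "spec_sum f A = (\<Sum>a | poly (char_poly A) a = 0. real (Polynomial.order a (char_poly A)) * f (Re a))"

lemma order_prod_linear:
  "finite I \<Longrightarrow> Polynomial.order a (\<Prod>i\<in>I. [:- (c i :: complex), 1:]) = card {i \<in> I. c i = a}"
proof (induct I rule: finite_induct)
  case (insert i I)
  have nz: "[:- c i, 1:] * (\<Prod>i\<in>I. [:- c i, 1:]) \<noteq> 0"
    using insert(1) by (auto simp: prod_zero_iff simp del: mult_pCons_left)
  have "{j \<in> insert i I. c j = a} = (if c i = a then insert i {j \<in> I. c j = a} else {j \<in> I. c j = a})"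
    by auto
  moreover have "Polynomial.order a [:- c i, 1:] = (if c i = a then 1 else 0)"
    using order_linear_power'[of a "c i" 1] by (auto simp: order_0I)
  ultimately show ?case
    using insert order_mult[OF nz] by (simp del: mult_pCons_left)
qed (auto simp: order_0I)

text \<open>Grouping the indices by the value of x recovers the multiplicities, so coinciding
  eigenvalues need no separate treatment later.\<close>

lemma spec_sum_udg:
  assumes "unitary d V"
  shows "spec_sum f (udg d V x) = (\<Sum>i<d. f (x i))"
proof -
  let ?R = "(\<lambda>i. complex_of_real (x i)) ` {..<d}"
  have R: "{a. poly (char_poly (udg d V x)) a = 0} = ?R"
    unfolding char_poly_udg[OF assms] by (auto simp: poly_prod)
  have "spec_sum f (udg d V x) = (\<Sum>a\<in>?R. \<Sum>i | i < d \<and> complex_of_real (x i) = a. f (Re a))"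
    unfolding spec_sum_def R unfolding char_poly_udg[OF assms] by (simp add: order_prod_linear)
  also have "\<dots> = (\<Sum>a\<in>?R. \<Sum>i\<in>{i \<in> {..<d}. complex_of_real (x i) = a}. f (x i))"
    by (intro sum.cong) auto
  also have "\<dots> = (\<Sum>i<d. f (x i))"
    by (rule sum.group) auto
  finally show ?thesis .
qed

lemma vn_entropy_spec: "vn_entropy A = - spec_sum (\<lambda>x. x * ln x) A"
  by (simp add: vn_entropy_def spec_sum_def)

lemma vn_entropy_udg: "unitary d V \<Longrightarrow> vn_entropy (udg d V x) = - (\<Sum>i<d. x i * ln (x i))"
  by (simp add: vn_entropy_spec spec_sum_udg)

lemma trace_norm_udg:
  assumes "unitary d V"
  shows "trace_norm (udg d V x) = (\<Sum>i<d. \<bar>x i\<bar>)"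
proof -
  have "adj (udg d V x) * udg d V x = udg d V (\<lambda>i. x i * x i)"
    using udg_hermitian[OF unitaryD(1)[OF assms]] by (simp add: hermitian_def udg_mult[OF assms])
  then have "trace_norm (udg d V x) = spec_sum sqrt (udg d V (\<lambda>i. x i * x i))"
    by (simp add: trace_norm_def spec_sum_def)
  also have "\<dots> = (\<Sum>i<d. sqrt (x i * x i))" by (rule spec_sum_udg[OF assms])
  finally show ?thesis by simp
qed

section \<open>Operator norm and trace norm\<close>

lemma mult_square [simp, intro]: "A \<in> carrier_mat d d \<Longrightarrow> B \<in> carrier_mat d d \<Longrightarrow> A * B \<in> carrier_mat d d"
  by (rule mult_carrier_mat)

lemma vnorm_L2: "vnorm v = L2_set (\<lambda>i. cmod (v $ i)) {..<dim_vec v}"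
  by (simp add: vnorm_def L2_set_def)

lemma vnorm_nonneg [simp]: "0 \<le> vnorm v"
  by (simp add: vnorm_L2)

lemma vnorm_sq: "(vnorm v)\<^sup>2 = (\<Sum>i<dim_vec v. (cmod (v $ i))\<^sup>2)"
  by (simp add: vnorm_def sum_nonneg)

lemma vnorm_add:
  assumes "u \<in> carrier_vec n" "v \<in> carrier_vec n"
  shows "vnorm (u + v) \<le> vnorm u + vnorm v"
proof -
  have "vnorm (u + v) \<le> L2_set (\<lambda>i. cmod (u $ i) + cmod (v $ i)) {..<n}"
    unfolding vnorm_L2 using assms by (auto intro!: L2_set_mono norm_triangle_ineq)
  also have "\<dots> \<le> vnorm u + vnorm v"
    unfolding vnorm_L2 using assms L2_set_triangle_ineq by auto
  finally show ?thesis .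
qed

lemma vnorm_smult: "vnorm (a \<cdot>\<^sub>v u) = cmod a * vnorm u"
proof -
  have "vnorm (a \<cdot>\<^sub>v u) = sqrt ((cmod a)\<^sup>2 * (\<Sum>i<dim_vec u. (cmod (u $ i))\<^sup>2))"
    by (simp add: vnorm_def norm_mult power_mult_distrib sum_distrib_left)
  then show ?thesis by (simp add: vnorm_def real_sqrt_mult)
qed

lemma cinner_self: "cinner v v = of_real ((vnorm v)\<^sup>2)"
  unfolding vnorm_sq by (simp add: cinner_def complex_norm_square mult.commute del: of_real_power)

lemma cinner_cauchy_schwarz:
  assumes "dim_vec u = dim_vec v"
  shows "cmod (cinner u v) \<le> vnorm u * vnorm v"
proof -
  have "cmod (cinner u v) \<le> (\<Sum>i<dim_vec v. \<bar>cmod (u $ i)\<bar> * \<bar>cmod (v $ i)\<bar>)"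
    unfolding cinner_def by (rule order_trans[OF norm_sum]) (simp add: norm_mult)
  also have "\<dots> \<le> vnorm u * vnorm v"
    unfolding vnorm_L2 assms by (rule L2_set_mult_ineq)
  finally show ?thesis .
qed

lemma mult_vec_entry:
  assumes "M \<in> carrier_mat n m" "v \<in> carrier_vec m" "i < n"
  shows "(M *\<^sub>v v) $ i = (\<Sum>j<m. M $$ (i,j) * v $ j)"
  using assms by (auto simp: scalar_prod_def atLeast0LessThan)

lemma cinner_adj:
  assumes "M \<in> carrier_mat n m" "u \<in> carrier_vec n" "v \<in> carrier_vec m"
  shows "cinner u (M *\<^sub>v v) = cinner (adj M *\<^sub>v u) v"
proof -
  have "cinner u (M *\<^sub>v v) = (\<Sum>i<n. \<Sum>j<m. cnj (u $ i) * (M $$ (i,j) * v $ j))"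
    using assms by (simp add: cinner_def mult_vec_entry[OF assms(1,3)] sum_distrib_left del: index_mult_mat_vec)
  also have "\<dots> = (\<Sum>j<m. \<Sum>i<n. cnj (u $ i) * (M $$ (i,j) * v $ j))" by (rule sum.swap)
  also have "\<dots> = cinner (adj M *\<^sub>v u) v"
    using assms by (auto simp: cinner_def mult_vec_entry[OF adj_carrier[OF assms(1)] assms(2)] sum_distrib_right sum_distrib_left mult_ac
        simp del: index_mult_mat_vec intro!: sum.cong)
  finally show ?thesis .
qed

lemma vnorm_unitary:
  assumes "unitary d U" "v \<in> carrier_vec d"
  shows "vnorm (U *\<^sub>v v) = vnorm v"
proof -
  note U = unitaryD[OF assms(1)]
  have "cinner (U *\<^sub>v v) (U *\<^sub>v v) = cinner (adj U *\<^sub>v (U *\<^sub>v v)) v"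
    by (rule cinner_adj[OF U(1)]) (use U(1) assms(2) in auto)
  also have "adj U *\<^sub>v (U *\<^sub>v v) = (adj U * U) *\<^sub>v v"
    using U(1) assms(2) by (subst assoc_mult_mat_vec[of _ d d _ d]) auto
  also have "\<dots> = v" using U assms(2) by simp
  finally have "(vnorm (U *\<^sub>v v))\<^sup>2 = (vnorm v)\<^sup>2"
    unfolding cinner_self of_real_eq_iff .
  then show ?thesis by (simp add: power2_eq_iff_nonneg)
qed

text \<open>Upper bounds on the operator norm that avoid the supremum.\<close>

definition opb :: "real \<Rightarrow> complex mat \<Rightarrow> bool" where
  "opb c M \<longleftrightarrow> (\<forall>v \<in> carrier_vec (dim_col M). vnorm (M *\<^sub>v v) \<le> c * vnorm v)"

lemma opbD: "opb c M \<Longrightarrow> M \<in> carrier_mat n m \<Longrightarrow> v \<in> carrier_vec m \<Longrightarrow> vnorm (M *\<^sub>v v) \<le> c * vnorm v"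
  by (auto simp: opb_def)

lemma opb_mult:
  assumes "opb a M" "opb b N" "M \<in> carrier_mat n m" "N \<in> carrier_mat m k" "0 \<le> a"
  shows "opb (a * b) (M * N)"
  unfolding opb_def
proof
  fix v :: "complex vec" assume "v \<in> carrier_vec (dim_col (M * N))"
  then have v: "v \<in> carrier_vec k" using assms by auto
  have "vnorm ((M * N) *\<^sub>v v) = vnorm (M *\<^sub>v (N *\<^sub>v v))"
    using assms v by (subst assoc_mult_mat_vec[of _ n m _ k]) auto
  also have "\<dots> \<le> a * vnorm (N *\<^sub>v v)"
    using assms v by (intro opbD[OF assms(1)]) auto
  also have "\<dots> \<le> a * (b * vnorm v)"
    using assms v by (intro mult_left_mono opbD[OF assms(2)]) auto
  finally show "vnorm (M * N *\<^sub>v v) \<le> a * b * vnorm v" by (simp add: mult.assoc)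
qed

lemma opb_add:
  assumes "opb a M" "opb b N" "M \<in> carrier_mat n m" "N \<in> carrier_mat n m"
  shows "opb (a + b) (M + N)"
  unfolding opb_def
proof
  fix v :: "complex vec" assume "v \<in> carrier_vec (dim_col (M + N))"
  then have v: "v \<in> carrier_vec m" using assms by auto
  have "vnorm ((M + N) *\<^sub>v v) = vnorm (M *\<^sub>v v + N *\<^sub>v v)"
    using assms v by (subst add_mult_distrib_mat_vec[of _ n m]) auto
  also have "\<dots> \<le> vnorm (M *\<^sub>v v) + vnorm (N *\<^sub>v v)"
    using assms v by (intro vnorm_add[of _ n]) auto
  also have "\<dots> \<le> a * vnorm v + b * vnorm v"
    using assms v by (intro add_mono opbD[OF assms(1)] opbD[OF assms(2)]) auto
  finally show "vnorm ((M + N) *\<^sub>v v) \<le> (a + b) * vnorm v" by (simp add: ring_distribs)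
qed

lemma opb_smult:
  assumes "opb a M" "M \<in> carrier_mat n m"
  shows "opb (cmod c * a) (c \<cdot>\<^sub>m M)"
  unfolding opb_def
proof
  fix v :: "complex vec" assume "v \<in> carrier_vec (dim_col (c \<cdot>\<^sub>m M))"
  then have v: "v \<in> carrier_vec m" using assms by auto
  have "(c \<cdot>\<^sub>m M) *\<^sub>v v = c \<cdot>\<^sub>v (M *\<^sub>v v)" using assms v by (intro eq_vecI) auto
  then show "vnorm ((c \<cdot>\<^sub>m M) *\<^sub>v v) \<le> cmod c * a * vnorm v"
    using opbD[OF assms v] by (simp add: vnorm_smult mult.assoc mult_left_mono)
qed

lemma opb_minus:
  assumes "opb a M" "opb b N" "M \<in> carrier_mat n m" "N \<in> carrier_mat n m"
  shows "opb (a + b) (M - N)"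
proof -
  have "M - N = M + (-1) \<cdot>\<^sub>m N" using assms by (intro eq_matI) auto
  moreover have "opb b ((-1) \<cdot>\<^sub>m N)" using opb_smult[OF assms(2,4), of "-1"] by simp
  ultimately show ?thesis using opb_add[OF assms(1) _ assms(3)] assms(4) by auto
qed

lemma opb_unitary: "unitary d U \<Longrightarrow> opb 1 U"
  using vnorm_unitary carrier_matD(2)[OF unitaryD(1)] by (simp add: opb_def)

text \<open>The squared norm of w = \<open>adj M\<close> u is the inner product of u with M w.
  Cauchy-Schwarz and the bound on M leave one factor norm w to cancel.\<close>

lemma opb_adj:
  assumes "opb c M" "M \<in> carrier_mat n m" "0 \<le> c"
  shows "opb c (adj M)"
  unfolding opb_def
proof
  fix u :: "complex vec" assume "u \<in> carrier_vec (dim_col (adj M))"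
  then have u: "u \<in> carrier_vec n" using assms by auto
  let ?w = "adj M *\<^sub>v u"
  have w: "?w \<in> carrier_vec m" using mult_mat_vec_carrier[OF adj_carrier[OF assms(2)] u] .
  have "of_real ((vnorm ?w)\<^sup>2) = cinner u (M *\<^sub>v ?w)"
    unfolding cinner_self[symmetric] by (rule cinner_adj[symmetric]) (use assms u w in auto)
  then have "(vnorm ?w)\<^sup>2 = cmod (cinner u (M *\<^sub>v ?w))"
    by (metis abs_of_nonneg norm_of_real zero_le_power2)
  also have "\<dots> \<le> vnorm u * vnorm (M *\<^sub>v ?w)"
    by (rule cinner_cauchy_schwarz) (use assms u in auto)
  also have "\<dots> \<le> vnorm u * (c * vnorm ?w)"
    by (intro mult_left_mono opbD[OF assms(1,2) w]) auto
  finally have "vnorm ?w * vnorm ?w \<le> (c * vnorm u) * vnorm ?w" by (simp add: power2_eq_square mult_ac)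
  then show "vnorm ?w \<le> c * vnorm u"
    using assms(3) vnorm_nonneg[of ?w] by (cases "vnorm ?w = 0") (auto simp: mult_le_cancel_right)
qed

lemma vnorm_unit_vec: "j < m \<Longrightarrow> vnorm (unit_vec m j :: complex vec) = 1"
proof -
  assume j: "j < m"
  have "(\<Sum>k<m. (cmod (unit_vec m j $ k))\<^sup>2) = (\<Sum>k<m. if k = j then 1 else 0)"
    by (rule sum.cong) (use j in auto)
  then show ?thesis using j by (simp add: vnorm_def)
qed

lemma opb_entry:
  assumes "opb c M" "M \<in> carrier_mat n m" "i < n" "j < m"
  shows "cmod (M $$ (i,j)) \<le> c"
proof -
  have u: "vnorm (unit_vec m j :: complex vec) = 1" using assms(4) by (rule vnorm_unit_vec)
  have "cmod (M $$ (i,j)) = cmod ((M *\<^sub>v unit_vec m j) $ i)"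
    using assms by simp
  also have "\<dots> \<le> vnorm (M *\<^sub>v unit_vec m j)"
    unfolding vnorm_L2 using assms by (intro member_le_L2_set) auto
  also have "\<dots> \<le> c" using opbD[OF assms(1,2), of "unit_vec m j"] u by simp
  finally show ?thesis .
qed

text \<open>The Hilbert-Schmidt norm is such a constant. Boundedness is what gives the supremum in
  \<open>op_norm\<close> its meaning.\<close>

lemma opb_exists:
  assumes "M \<in> carrier_mat n m"
  shows "\<exists>c\<ge>0. opb c M"
proof -
  define c where "c = sqrt (\<Sum>i<n. \<Sum>j<m. (cmod (M $$ (i,j)))\<^sup>2)"
  have "vnorm (M *\<^sub>v v) \<le> c * vnorm v" if v: "v \<in> carrier_vec m" for v
  proof -
    have 1: "(cmod ((M *\<^sub>v v) $ i))\<^sup>2 \<le> (\<Sum>j<m. (cmod (M $$ (i,j)))\<^sup>2) * (vnorm v)\<^sup>2" if i: "i < n" for i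
    proof -
      have "cmod ((M *\<^sub>v v) $ i) \<le> (\<Sum>j<m. \<bar>cmod (M $$ (i,j))\<bar> * \<bar>cmod (v $ j)\<bar>)"
        unfolding mult_vec_entry[OF assms v i] by (rule order_trans[OF norm_sum]) (simp add: norm_mult)
      also have "\<dots> \<le> L2_set (\<lambda>j. cmod (M $$ (i,j))) {..<m} * vnorm v"
        unfolding vnorm_L2 carrier_vecD[OF v] by (rule L2_set_mult_ineq)
      finally have "(cmod ((M *\<^sub>v v) $ i))\<^sup>2 \<le> (L2_set (\<lambda>j. cmod (M $$ (i,j))) {..<m} * vnorm v)\<^sup>2"
        by (rule power_mono) simp
      then show ?thesis by (simp add: power_mult_distrib L2_set_def sum_nonneg)
    qed
    have "(vnorm (M *\<^sub>v v))\<^sup>2 \<le> (\<Sum>i<n. (\<Sum>j<m. (cmod (M $$ (i,j)))\<^sup>2) * (vnorm v)\<^sup>2)"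
      unfolding vnorm_sq[of "M *\<^sub>v v"] using assms 1 by (auto intro!: sum_mono simp del: index_mult_mat_vec)
    also have "\<dots> = (c * vnorm v)\<^sup>2"
      by (simp add: c_def power_mult_distrib sum_distrib_right sum_nonneg)
    finally show ?thesis
      by (rule power2_le_imp_le) (simp add: c_def sum_nonneg)
  qed
  then show ?thesis using assms by (intro exI[of _ c]) (auto simp: opb_def c_def sum_nonneg)
qed

text \<open>In dimension 0 there is no unit vector and the supremum is taken over the empty set;
  hence 0 < m.\<close>

lemma op_norm_le:
  assumes "opb c M" "M \<in> carrier_mat n m" "0 < m"
  shows "op_norm M \<le> c"
  unfolding op_norm_def
proof (rule cSup_least)
  have "vnorm (unit_vec m 0 :: complex vec) = 1" using assms by (auto intro: vnorm_unit_vec)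
  then show "{vnorm (M *\<^sub>v v) |v. v \<in> carrier_vec (dim_col M) \<and> vnorm v = 1} \<noteq> {}"
    using assms(2) by (auto intro!: exI[of _ "unit_vec m 0"])
qed (use opbD[OF assms(1,2)] assms(2) in fastforce)

lemma op_norm_nonneg:
  assumes "M \<in> carrier_mat n m" "0 < m"
  shows "0 \<le> op_norm M"
proof -
  obtain c where c: "0 \<le> c" "opb c M" using opb_exists[OF assms(1)] by auto
  have bdd: "bdd_above {vnorm (M *\<^sub>v v) |v. v \<in> carrier_vec (dim_col M) \<and> vnorm v = 1}"
    using c(2) by (intro bdd_aboveI[of _ c]) (auto simp: opb_def)
  have "vnorm (unit_vec m 0 :: complex vec) = 1" using assms by (auto intro: vnorm_unit_vec)
  then have "vnorm (M *\<^sub>v unit_vec m 0) \<le> op_norm M"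
    unfolding op_norm_def using assms by (intro cSup_upper bdd) auto
  then show ?thesis using vnorm_nonneg order_trans by blast
qed

lemma opb_op_norm:
  assumes "M \<in> carrier_mat n m"
  shows "opb (op_norm M) M"
  unfolding opb_def
proof
  fix v :: "complex vec" assume v: "v \<in> carrier_vec (dim_col M)"
  obtain c where c: "0 \<le> c" "opb c M" using opb_exists[OF assms(1)] by auto
  have bdd: "bdd_above {vnorm (M *\<^sub>v v) |v. v \<in> carrier_vec (dim_col M) \<and> vnorm v = 1}"
    using c(2) by (intro bdd_aboveI[of _ c]) (auto simp: opb_def)
  show "vnorm (M *\<^sub>v v) \<le> op_norm M * vnorm v"
  proof (cases "vnorm v = 0")
    case True
    then show ?thesis using c(2) v by (auto simp: opb_def)
  next
    case False
    then have pos: "0 < vnorm v" using vnorm_nonneg[of v] by linarith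
    let ?u = "of_real (1 / vnorm v) \<cdot>\<^sub>v v"
    have "vnorm ?u = 1" using pos unfolding vnorm_smult norm_of_real by simp
    then have "vnorm (M *\<^sub>v ?u) \<le> op_norm M"
      unfolding op_norm_def using v by (intro cSup_upper bdd) auto
    moreover have "M *\<^sub>v ?u = of_real (1 / vnorm v) \<cdot>\<^sub>v (M *\<^sub>v v)"
      using v by (intro mult_mat_vec[of _ "dim_row M" "dim_col M"]) auto
    ultimately have "(1 / vnorm v) * vnorm (M *\<^sub>v v) \<le> op_norm M" using pos by (simp only: vnorm_smult norm_of_real) simp
    then show ?thesis using pos by (simp add: field_simps)
  qed
qed

text \<open>A vector of length m * k consists of k slices \<open>s t\<close> on which M acts
  independently, and squared norms add over the slices.\<close>

lemma opb_kron_one_right: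
  assumes "opb c M" "M \<in> carrier_mat n m" "0 \<le> c"
  shows "opb c (kron M (1\<^sub>m k))"
  unfolding opb_def
proof
  fix v :: "complex vec" assume "v \<in> carrier_vec (dim_col (kron M (1\<^sub>m k)))"
  then have v: "v \<in> carrier_vec (m * k)" using assms by auto
  define s where "s t = vec m (\<lambda>j. v $ (j * k + t))" for t
  have K: "kron M (1\<^sub>m k) \<in> carrier_mat (n * k) (m * k)" using assms by auto
  have 1: "(kron M (1\<^sub>m k) *\<^sub>v v) $ (i * k + t) = (M *\<^sub>v s t) $ i" if it: "i < n" "t < k" for i t
  proof -
    have l: "i * k + t < n * k" by (rule pair_lt[OF it])
    have "(kron M (1\<^sub>m k) *\<^sub>v v) $ (i * k + t) = (\<Sum>j<m*k. kron M (1\<^sub>m k) $$ (i*k+t,j) * v $ j)"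
      by (rule mult_vec_entry[OF K v l])
    also have "\<dots> = (\<Sum>j<m. \<Sum>r<k. if r = t then M $$ (i,j) * v $ (j*k+t) else 0)"
      unfolding sum_div_mod using it l assms(2) by (intro sum.cong) (auto simp: pair_lt)
    also have "\<dots> = (\<Sum>j<m. M $$ (i,j) * v $ (j*k+t))" using it by simp
    also have "\<dots> = (M *\<^sub>v s t) $ i"
      using it assms(2) by (subst mult_vec_entry[of _ n m]) (auto simp: s_def)
    finally show ?thesis .
  qed
  have nv: "(vnorm v)\<^sup>2 = (\<Sum>t<k. (vnorm (s t))\<^sup>2)"
    unfolding vnorm_sq using v by (simp add: sum_div_mod s_def) (rule sum.swap)
  have "(vnorm (kron M (1\<^sub>m k) *\<^sub>v v))\<^sup>2 = (\<Sum>i<n. \<Sum>t<k. (cmod ((M *\<^sub>v s t) $ i))\<^sup>2)"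
    unfolding vnorm_sq using carrier_matD(1)[OF K] by (simp add: sum_div_mod 1 carrier_matD(1)[OF assms(2)] del: index_mult_mat_vec)
  also have "\<dots> = (\<Sum>t<k. (vnorm (M *\<^sub>v s t))\<^sup>2)"
    unfolding vnorm_sq using assms(2) by (subst sum.swap) simp
  also have "\<dots> \<le> (\<Sum>t<k. (c * vnorm (s t))\<^sup>2)"
    by (intro sum_mono power_mono opbD[OF assms(1,2)]) (auto simp: s_def)
  also have "\<dots> = (c * vnorm v)\<^sup>2"
    by (simp add: nv power_mult_distrib sum_distrib_left)
  finally show "vnorm (kron M (1\<^sub>m k) *\<^sub>v v) \<le> c * vnorm v"
    by (rule power2_le_imp_le) (use assms(3) in simp)
qed

lemma opb_kron_one_left:
  assumes "opb c M" "M \<in> carrier_mat n m" "0 \<le> c"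
  shows "opb c (kron (1\<^sub>m k) M)"
  unfolding opb_def
proof
  fix v :: "complex vec" assume "v \<in> carrier_vec (dim_col (kron (1\<^sub>m k) M))"
  then have v: "v \<in> carrier_vec (k * m)" using assms by auto
  define s where "s t = vec m (\<lambda>j. v $ (t * m + j))" for t
  have K: "kron (1\<^sub>m k) M \<in> carrier_mat (k * n) (k * m)" using assms by auto
  have 1: "(kron (1\<^sub>m k) M *\<^sub>v v) $ (t * n + i) = (M *\<^sub>v s t) $ i" if it: "i < n" "t < k" for i t
  proof -
    have l: "t * n + i < k * n" by (rule pair_lt[OF it(2,1)])
    have "(kron (1\<^sub>m k) M *\<^sub>v v) $ (t * n + i) = (\<Sum>j<k*m. kron (1\<^sub>m k) M $$ (t * n + i,j) * v $ j)"
      by (rule mult_vec_entry[OF K v l])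
    also have "\<dots> = (\<Sum>r<k. \<Sum>j<m. if r = t then M $$ (i,j) * v $ (t*m+j) else 0)"
      unfolding sum_div_mod using it l assms(2) by (intro sum.cong) (auto simp: pair_lt)
    also have "\<dots> = (\<Sum>j<m. M $$ (i,j) * v $ (t*m+j))" using it by (subst sum.swap) simp
    also have "\<dots> = (M *\<^sub>v s t) $ i"
      using it assms(2) by (subst mult_vec_entry[of _ n m]) (auto simp: s_def)
    finally show ?thesis .
  qed
  have nv: "(vnorm v)\<^sup>2 = (\<Sum>t<k. (vnorm (s t))\<^sup>2)"
    unfolding vnorm_sq using v by (simp add: sum_div_mod s_def)
  have "(vnorm (kron (1\<^sub>m k) M *\<^sub>v v))\<^sup>2 = (\<Sum>t<k. \<Sum>i<n. (cmod ((M *\<^sub>v s t) $ i))\<^sup>2)"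
    unfolding vnorm_sq using carrier_matD(1)[OF K] by (simp add: sum_div_mod 1 carrier_matD(1)[OF assms(2)] del: index_mult_mat_vec)
  also have "\<dots> = (\<Sum>t<k. (vnorm (M *\<^sub>v s t))\<^sup>2)"
    unfolding vnorm_sq using assms(2) by simp
  also have "\<dots> \<le> (\<Sum>t<k. (c * vnorm (s t))\<^sup>2)"
    by (intro sum_mono power_mono opbD[OF assms(1,2)]) (auto simp: s_def)
  also have "\<dots> = (c * vnorm v)\<^sup>2"
    by (simp add: nv power_mult_distrib sum_distrib_left)
  finally show "vnorm (kron (1\<^sub>m k) M *\<^sub>v v) \<le> c * vnorm v"
    by (rule power2_le_imp_le) (use assms(3) in simp)
qed

section \<open>Doubly stochastic matrices of squared overlaps, and the trace norm\<close>

lemma unitary_rows: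
  assumes "unitary d U" "i < d"
  shows "(\<Sum>l<d. (cmod (U $$ (i,l)))\<^sup>2) = 1"
proof -
  note U = unitaryD[OF assms(1)]
  have "(U * adj U) $$ (i,i) = (\<Sum>l<d. U $$ (i,l) * cnj (U $$ (i,l)))"
    using U(1) assms(2) by (subst mult_entry[of _ d d _ d]) auto
  then have "complex_of_real (\<Sum>l<d. (cmod (U $$ (i,l)))\<^sup>2) = 1"
    unfolding U(3) using assms(2) by (simp add: complex_norm_square del: of_real_power)
  then show ?thesis by (simp only: of_real_eq_1_iff)
qed

lemma unitary_cols:
  assumes "unitary d U" "l < d"
  shows "(\<Sum>i<d. (cmod (U $$ (i,l)))\<^sup>2) = 1"
  using unitary_rows[OF unitary_adj[OF assms(1)] assms(2)] unitaryD(1)[OF assms(1)] assms(2) by simp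

lemma udg_change_basis:
  assumes "W \<in> carrier_mat d d" "V \<in> carrier_mat d d"
  shows "adj W * udg d V x * W = udg d (adj W * V) x"
  using udg_conj[of "adj W" d V x] assms by simp

lemma udg_diag_entry:
  assumes "V \<in> carrier_mat d d" "k < d"
  shows "udg d V x $$ (k,k) = of_real (\<Sum>l<d. x l * (cmod (V $$ (k,l)))\<^sup>2)"
  using assms by (simp add: udg_entry complex_norm_square del: of_real_power)

text \<open>With G = \<open>adj W * V\<close>, the diagonal in the basis W arises from z by the
  matrix of the squared moduli of G, whose columns sum to one; such averaging cannot increase the
  sum of absolute values. For W = V nothing is lost, so the trace norm is a maximum over
  bases.\<close>

lemma pinching:
  assumes "unitary d V" "unitary d W"
  shows "(\<Sum>k<d. cmod ((adj W * udg d V z * W) $$ (k,k))) \<le> (\<Sum>l<d. \<bar>z l\<bar>)"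
proof -
  define G where "G = adj W * V"
  have G: "unitary d G" unfolding G_def by (intro unitary_mult unitary_adj assms)
  note Gc = unitaryD(1)[OF G]
  have "(\<Sum>k<d. cmod ((adj W * udg d V z * W) $$ (k,k))) = (\<Sum>k<d. \<bar>\<Sum>l<d. z l * (cmod (G $$ (k,l)))\<^sup>2\<bar>)"
    using udg_change_basis[OF unitaryD(1)[OF assms(2)] unitaryD(1)[OF assms(1)]]
    by (simp add: udg_diag_entry[OF Gc] G_def[symmetric] del: of_real_sum index_mult_mat(1))
  also have "\<dots> \<le> (\<Sum>k<d. \<Sum>l<d. \<bar>z l\<bar> * (cmod (G $$ (k,l)))\<^sup>2)"
    by (intro sum_mono order_trans[OF sum_abs]) (simp add: abs_mult)
  also have "\<dots> = (\<Sum>l<d. \<bar>z l\<bar> * (\<Sum>k<d. (cmod (G $$ (k,l)))\<^sup>2))"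
    by (subst sum.swap) (simp add: sum_distrib_left)
  also have "\<dots> = (\<Sum>l<d. \<bar>z l\<bar>)" by (simp add: unitary_cols[OF G])
  finally show ?thesis .
qed

lemma hermitian_add: "hermitian d A \<Longrightarrow> hermitian d B \<Longrightarrow> hermitian d (A + B)"
  by (auto simp: hermitian_def adj_add[of _ d d])

lemma hermitian_minus: "hermitian d A \<Longrightarrow> hermitian d B \<Longrightarrow> hermitian d (A - B)"
  by (auto simp: hermitian_def adj_minus[of _ d d])

lemma hermitian_kron: "hermitian a A \<Longrightarrow> hermitian b B \<Longrightarrow> hermitian (a * b) (kron A B)"
  by (auto simp: hermitian_def kron_adj)

lemma trace_norm_pinching:
  assumes "hermitian d A" "unitary d W"
  shows "(\<Sum>k<d. cmod ((adj W * A * W) $$ (k,k))) \<le> trace_norm A"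
proof -
  from spectral[OF assms(1)] obtain V x where V: "unitary d V" "A = udg d V x" by auto
  show ?thesis using pinching[OF V(1) assms(2)] by (simp add: V(2) trace_norm_udg[OF V(1)])
qed

lemma conj_add:
  assumes "A \<in> carrier_mat d d" "B \<in> carrier_mat d d" "W \<in> carrier_mat d d"
  shows "adj W * (A + B) * W = adj W * A * W + adj W * B * W"
proof -
  have "adj W * (A + B) = adj W * A + adj W * B"
    by (rule mult_add_distrib_mat[of _ d d]) (use assms in auto)
  then show ?thesis using add_mult_distrib_mat[of "adj W * A" d d "adj W * B" W d] assms by auto
qed

lemma diag_of_udg:
  assumes "unitary d V"
  shows "adj V * udg d V x * V = dg d x"
proof -
  note V = unitaryD[OF assms]
  have "adj V * udg d V x * V = (adj V * V) * dg d x * (adj V * V)"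
    using carrier_matD[OF V(1)] by (simp add: udg_def mat_assoc)
  also have "(adj V * V) * dg d x * (adj V * V) = dg d x"
    unfolding V(2) using left_mult_one_mat[OF dg_carrier, of d x] right_mult_one_mat[OF dg_carrier, of d x] by simp
  finally show ?thesis .
qed

text \<open>Everything is evaluated in an eigenbasis of A + B, where pinching is exact for the sum
  and can only lose for A and B separately.\<close>

lemma trace_norm_triangle:
  assumes "hermitian d A" "hermitian d B"
  shows "trace_norm (A + B) \<le> trace_norm A + trace_norm B"
proof -
  note A = hermitianD[OF assms(1)] note B = hermitianD[OF assms(2)]
  from spectral[OF hermitian_add[OF assms]] obtain V x where V: "unitary d V" "A + B = udg d V x" by auto
  note Vc = unitaryD(1)[OF V(1)]
  have "trace_norm (A + B) = (\<Sum>k<d. cmod ((adj V * (A + B) * V) $$ (k,k)))"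
    unfolding V(2) by (simp add: trace_norm_udg[OF V(1)] diag_of_udg[OF V(1)])
  also have "\<dots> = (\<Sum>k<d. cmod ((adj V * A * V) $$ (k,k) + (adj V * B * V) $$ (k,k)))"
    using A(1) B(1) Vc by (simp add: conj_add[OF A(1) B(1) Vc] del: index_mult_mat(1))
  also have "\<dots> \<le> (\<Sum>k<d. cmod ((adj V * A * V) $$ (k,k))) + (\<Sum>k<d. cmod ((adj V * B * V) $$ (k,k)))"
    unfolding sum.distrib[symmetric] by (intro sum_mono norm_triangle_ineq)
  also have "\<dots> \<le> trace_norm A + trace_norm B"
    by (intro add_mono trace_norm_pinching assms V(1))
  finally show ?thesis .
qed

lemma trace_norm_conj:
  assumes "hermitian d A" "unitary d U"
  shows "trace_norm (U * A * adj U) = trace_norm A"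
proof -
  from spectral[OF assms(1)] obtain V x where V: "unitary d V" "A = udg d V x" by auto
  have "U * A * adj U = udg d (U * V) x"
    unfolding V(2) by (rule udg_conj[OF unitaryD(1)[OF assms(2)] unitaryD(1)[OF V(1)]])
  then show ?thesis by (simp add: V(2) trace_norm_udg V(1) unitary_mult[OF assms(2) V(1)])
qed

lemma trace_norm_minus_commute:
  assumes "hermitian d A" "hermitian d B"
  shows "trace_norm (A - B) = trace_norm (B - A)"
proof -
  note A = hermitianD(1)[OF assms(1)] note B = hermitianD(1)[OF assms(2)]
  from spectral[OF hermitian_minus[OF assms]] obtain V x where V: "unitary d V" "A - B = udg d V x" by auto
  have "B - A = udg d V (\<lambda>i. - x i)"
  proof (rule eq_matI)
    fix i j assume "i < dim_row (udg d V (\<lambda>i. - x i))" "j < dim_col (udg d V (\<lambda>i. - x i))"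
    then have ij: "i < d" "j < d" using unitaryD(1)[OF V(1)] by auto
    have "(B - A) $$ (i,j) = - ((A - B) $$ (i,j))" using A B ij by simp
    then show "(B - A) $$ (i,j) = udg d V (\<lambda>i. - x i) $$ (i,j)"
      unfolding V(2) using ij by (simp add: udg_entry[OF unitaryD(1)[OF V(1)]] sum_negf)
  qed (use A B unitaryD(1)[OF V(1)] in auto)
  then show ?thesis by (simp add: V(2) trace_norm_udg[OF V(1)])
qed

text \<open>Hoelder's inequality between trace norm and operator norm: in an eigenbasis of Z only
  the diagonal entries of B enter, and each has modulus at most c.\<close>

lemma trace_norm_mtrace:
  assumes "hermitian d Z" "B \<in> carrier_mat d d" "opb c B" "0 \<le> c"
  shows "cmod (mtrace (Z * B)) \<le> c * trace_norm Z"
proof -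
  from spectral[OF assms(1)] obtain V z where V: "unitary d V" "Z = udg d V z" by auto
  note Vc = unitaryD(1)[OF V(1)]
  have opbB: "opb c B'" if "B' = adj V * B * V" for B'
  proof -
    have "opb (1 * c * 1) (adj V * B * V)"
      using Vc assms(2,3,4) opb_unitary[OF V(1)] opb_unitary[OF unitary_adj[OF V(1)]]
      by (intro opb_mult[of _ _ _ _ d d d]) auto
    then show ?thesis using that by simp
  qed
  then have e: "cmod ((adj V * B * V) $$ (l,l)) \<le> c" if "l < d" for l
    by (rule opb_entry[of c _ d d]) (use Vc assms(2) that opbB in \<open>auto simp del: index_mult_mat(1)\<close>)
  have "cmod (mtrace (Z * B)) \<le> (\<Sum>l<d. \<bar>z l\<bar> * cmod ((adj V * B * V) $$ (l,l)))"
    unfolding V(2) udg_diag[OF Vc assms(2)] by (rule order_trans[OF norm_sum]) (simp add: norm_mult del: index_mult_mat(1))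
  also have "\<dots> \<le> (\<Sum>l<d. \<bar>z l\<bar> * c)"
    by (intro sum_mono mult_left_mono e) auto
  finally show ?thesis by (simp add: V(2) trace_norm_udg[OF V(1)] sum_distrib_left mult.commute)
qed

section \<open>Density matrices and von Neumann entropy\<close>

lemma udg_apply_col:
  assumes "unitary d V" "l < d"
  shows "udg d V x *\<^sub>v col V l = of_real (x l) \<cdot>\<^sub>v col V l"
proof -
  note V = unitaryD[OF assms(1)]
  have "udg d V x * V = V * (dg d x * (adj V * V))"
    using carrier_matD[OF V(1)] by (simp add: udg_def mat_assoc)
  also have "\<dots> = V * dg d x"
    unfolding V(2) using right_mult_one_mat[OF dg_carrier, of d x] by simp
  finally have eq: "udg d V x * V = V * dg d x" .
  have "udg d V x *\<^sub>v col V l = col (V * dg d x) l"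
    unfolding eq[symmetric] using V(1) assms(2) by (subst col_mult2[of _ d d _ d]) auto
  also have "\<dots> = of_real (x l) \<cdot>\<^sub>v col V l"
  proof (rule eq_vecI)
    fix i assume "i < dim_vec (of_real (x l) \<cdot>\<^sub>v col V l)"
    then have i: "i < d" using V(1) by auto
    have "(V * dg d x) $$ (i,l) = (\<Sum>k<d. if k = l then V $$ (i,l) * of_real (x l) else 0)"
      unfolding mult_entry[OF V(1) dg_carrier i assms(2)] by (rule sum.cong) (use assms(2) in auto)
    then show "col (V * dg d x) l $ i = (of_real (x l) \<cdot>\<^sub>v col V l) $ i"
      using V(1) i assms(2) by (simp del: index_mult_mat(1))
  qed (use V(1) in auto)
  finally show ?thesis .
qed

lemma vnorm_col:
  assumes "unitary d V" "l < d"
  shows "vnorm (col V l) = 1"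
  using unitary_cols[OF assms] unitaryD(1)[OF assms(1)] assms(2) by (simp add: vnorm_def)

lemma cinner_smult_right: "cinner u (a \<cdot>\<^sub>v v) = a * cinner u v"
  by (simp add: cinner_def sum_distrib_left mult_ac)

lemma cinner_udg:
  assumes "V \<in> carrier_mat d d" "v \<in> carrier_vec d"
  shows "cinner v (udg d V x *\<^sub>v v) = of_real (\<Sum>l<d. x l * (cmod ((adj V *\<^sub>v v) $ l))\<^sup>2)"
proof -
  let ?u = "adj V *\<^sub>v v"
  have u: "?u \<in> carrier_vec d" using mult_mat_vec_carrier[OF adj_carrier[OF assms(1)] assms(2)] .
  have du: "dg d x *\<^sub>v ?u \<in> carrier_vec d" using mult_mat_vec_carrier[OF dg_carrier u] .
  have "udg d V x *\<^sub>v v = V *\<^sub>v (dg d x *\<^sub>v ?u)"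
    using assms u by (simp add: udg_def assoc_mult_mat_vec[of _ d d _ d])
  then have "cinner v (udg d V x *\<^sub>v v) = cinner ?u (dg d x *\<^sub>v ?u)"
    using cinner_adj[OF assms(1) assms(2) du] by simp
  also have "\<dots> = (\<Sum>l<d. cnj (?u $ l) * (\<Sum>k<d. if k = l then of_real (x l) * ?u $ l else 0))"
  proof -
    have "(dg d x *\<^sub>v ?u) $ l = (\<Sum>k<d. if k = l then of_real (x l) * ?u $ l else 0)" if "l < d" for l
      unfolding mult_vec_entry[OF dg_carrier u that] by (rule sum.cong) (use that in auto)
    then show ?thesis using carrier_vecD[OF du] by (simp add: cinner_def del: index_mult_mat_vec)
  qed
  also have "\<dots> = of_real (\<Sum>l<d. x l * (cmod (?u $ l))\<^sup>2)"
    by (simp add: complex_norm_square mult_ac del: index_mult_mat_vec of_real_power)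
  finally show ?thesis .
qed

lemma psd_udg:
  assumes "V \<in> carrier_mat d d" "\<And>i. i < d \<Longrightarrow> 0 \<le> x i"
  shows "psd d (udg d V x)"
  unfolding psd_def using udg_hermitian[OF assms(1)] assms(2)
  by (auto simp: cinner_udg[OF assms(1)] intro!: sum_nonneg simp del: of_real_sum)

lemma psd_spectral:
  assumes "psd d A"
  shows "\<exists>V x. unitary d V \<and> A = udg d V x \<and> (\<forall>i<d. 0 \<le> x i) \<and> (\<forall>i j. i \<le> j \<longrightarrow> j < d \<longrightarrow> x j \<le> x i)"
proof -
  from assms have h: "hermitian d A" by (simp add: psd_def)
  from spectral[OF h] obtain V x where V: "unitary d V" "A = udg d V x" "\<forall>i j. i \<le> j \<longrightarrow> j < d \<longrightarrow> x j \<le> x i" by auto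
  have "0 \<le> x l" if l: "l < d" for l
  proof -
    have "0 \<le> Re (cinner (col V l) (A *\<^sub>v col V l))"
      using assms unitaryD(1)[OF V(1)] l by (auto simp: psd_def)
    also have "\<dots> = x l"
      unfolding V(2) udg_apply_col[OF V(1) l] by (simp add: cinner_smult_right cinner_self vnorm_col[OF V(1) l])
    finally show ?thesis .
  qed
  then show ?thesis using V by auto
qed

lemma density_hermitian: "density d \<rho> \<Longrightarrow> hermitian d \<rho>"
  by (simp add: density_def psd_def)

lemma density_carrier: "density d \<rho> \<Longrightarrow> \<rho> \<in> carrier_mat d d"
  using density_hermitian hermitianD(1) by blast

lemma density_udg:
  assumes "unitary d V" "\<And>i. i < d \<Longrightarrow> 0 \<le> x i" "(\<Sum>i<d. x i) = 1"
  shows "density d (udg d V x)"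
  unfolding density_def using psd_udg[OF unitaryD(1)[OF assms(1)]] assms(2) mtrace_udg[OF assms(1), of x]
  by (auto simp: assms(3))

lemma density_spectral:
  assumes "density d \<rho>"
  obtains V x where "unitary d V" "\<rho> = udg d V x" "\<And>i. i < d \<Longrightarrow> 0 \<le> x i" "(\<Sum>i<d. x i) = 1"
    "\<And>i j. i \<le> j \<Longrightarrow> j < d \<Longrightarrow> x j \<le> x i"
proof -
  from assms have "psd d \<rho>" by (simp add: density_def)
  from psd_spectral[OF this] obtain V x where V: "unitary d V" "\<rho> = udg d V x" "\<forall>i<d. 0 \<le> x i"
    "\<forall>i j. i \<le> j \<longrightarrow> j < d \<longrightarrow> x j \<le> x i" by auto
  have "complex_of_real (\<Sum>i<d. x i) = 1"
    using assms mtrace_udg[OF V(1), of x] V(2) by (simp add: density_def del: of_real_sum)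
  then have "(\<Sum>i<d. x i) = 1" by (simp only: of_real_eq_1_iff)
  then show ?thesis using that V by auto
qed

lemma density_le_one:
  fixes x :: "nat \<Rightarrow> real"
  assumes "\<And>i. i < d \<Longrightarrow> 0 \<le> x i" "(\<Sum>i<d. x i) = 1" "i < d"
  shows "x i \<le> 1"
  using member_le_sum[of i "{..<d}" x] assms by auto

lemma density_conj:
  assumes "density d \<rho>" "unitary d U"
  shows "density d (U * \<rho> * adj U)"
proof -
  obtain V x where V: "unitary d V" "\<rho> = udg d V x" "\<And>i. i < d \<Longrightarrow> 0 \<le> x i" "(\<Sum>i<d. x i) = 1"
    using density_spectral[OF assms(1)] by metis
  have "U * \<rho> * adj U = udg d (U * V) x"
    unfolding V(2) by (rule udg_conj[OF unitaryD(1)[OF assms(2)] unitaryD(1)[OF V(1)]])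
  then show ?thesis using density_udg[OF unitary_mult[OF assms(2) V(1)] V(3,4)] by simp
qed

lemma density_kron:
  assumes "density a \<rho>" "density b \<sigma>"
  shows "density (a * b) (kron \<rho> \<sigma>)"
proof -
  obtain V x where V: "unitary a V" "\<rho> = udg a V x" "\<And>i. i < a \<Longrightarrow> 0 \<le> x i" "(\<Sum>i<a. x i) = 1"
    using density_spectral[OF assms(1)] by metis
  obtain W y where W: "unitary b W" "\<sigma> = udg b W y" "\<And>i. i < b \<Longrightarrow> 0 \<le> y i" "(\<Sum>i<b. y i) = 1"
    using density_spectral[OF assms(2)] by metis
  have "density (a * b) (udg (a * b) (kron V W) (\<lambda>i. x (i div b) * y (i mod b)))"
    by (rule density_udg[OF unitary_kron[OF V(1) W(1)]])
      (auto simp: div_lt mod_lt V(3,4) W(3,4) sum_div_mod_prod[of x b y a])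
  then show ?thesis
    unfolding V(2) W(2) udg_kron[OF unitaryD(1)[OF V(1)] unitaryD(1)[OF W(1)]] .
qed

section \<open>Entropy and the second moment of the information\<close>

lemma spec_sum_kron:
  assumes "hermitian a A" "hermitian b B"
    and V: "unitary a V" "A = udg a V x" and W: "unitary b W" "B = udg b W y"
  shows "spec_sum f (kron A B) = (\<Sum>i<a. \<Sum>j<b. f (x i * y j))"
proof -
  have "kron A B = udg (a * b) (kron V W) (\<lambda>i. x (i div b) * y (i mod b))"
    unfolding V(2) W(2) by (rule udg_kron[OF unitaryD(1)[OF V(1)] unitaryD(1)[OF W(1)]])
  then have "spec_sum f (kron A B) = (\<Sum>l<a*b. f (x (l div b) * y (l mod b)))"
    by (simp add: spec_sum_udg[OF unitary_kron[OF V(1) W(1)]])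
  also have "\<dots> = (\<Sum>i<a. \<Sum>j<b. f (x i * y j))"
    by (simp add: sum_div_mod)
  finally show ?thesis .
qed

lemma spec_sum_conj:
  assumes "hermitian d A" "unitary d U"
  shows "spec_sum f (U * A * adj U) = spec_sum f A"
proof -
  from spectral[OF assms(1)] obtain V x where V: "unitary d V" "A = udg d V x" by auto
  have "U * A * adj U = udg d (U * V) x"
    unfolding V(2) by (rule udg_conj[OF unitaryD(1)[OF assms(2)] unitaryD(1)[OF V(1)]])
  then show ?thesis by (simp add: V(2) spec_sum_udg V(1) unitary_mult[OF assms(2) V(1)])
qed

lemma vn_entropy_conj:
  "hermitian d A \<Longrightarrow> unitary d U \<Longrightarrow> vn_entropy (U * A * adj U) = vn_entropy A"
  by (simp add: vn_entropy_spec spec_sum_conj)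

text \<open>Second moment of the random variable - ln x, where x is an eigenvalue drawn with
  probability x; the mean of this variable is the entropy.\<close>

definition info2 :: "complex mat \<Rightarrow> real" where
  "info2 A = spec_sum (\<lambda>x. x * (ln x)\<^sup>2) A"

text \<open>Eigenvalues of a product state multiply, so the information contents of the factors add
  like independent random variables. Where an eigenvalue vanishes its prefactor makes all terms
  zero, whatever the value of ln 0.\<close>

lemma info_kron:
  assumes "density a \<rho>" "density b \<sigma>"
  shows "vn_entropy (kron \<rho> \<sigma>) = vn_entropy \<rho> + vn_entropy \<sigma>"
    and "info2 (kron \<rho> \<sigma>) = info2 \<rho> + 2 * vn_entropy \<rho> * vn_entropy \<sigma> + info2 \<sigma>"
proof -
  obtain V x where V: "unitary a V" "\<rho> = udg a V x" "\<And>i. i < a \<Longrightarrow> 0 \<le> x i" "(\<Sum>i<a. x i) = 1"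
    using density_spectral[OF assms(1)] by metis
  obtain W y where W: "unitary b W" "\<sigma> = udg b W y" "\<And>i. i < b \<Longrightarrow> 0 \<le> y i" "(\<Sum>i<b. y i) = 1"
    using density_spectral[OF assms(2)] by metis
  note k = spec_sum_kron[OF density_hermitian[OF assms(1)] density_hermitian[OF assms(2)] V(1,2) W(1,2)]
  have e: "x i * y j * ln (x i * y j) = (x i * ln (x i)) * y j + x i * (y j * ln (y j))"
    "x i * y j * (ln (x i * y j))\<^sup>2 = (x i * (ln (x i))\<^sup>2) * y j + 2 * (x i * ln (x i)) * (y j * ln (y j)) + x i * (y j * (ln (y j))\<^sup>2)"
    if ij: "i < a" "j < b" for i j
  proof -
    consider "x i = 0" | "y j = 0" | "0 < x i" "0 < y j" using V(3)[OF ij(1)] W(3)[OF ij(2)] by linarith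
    then show "x i * y j * ln (x i * y j) = (x i * ln (x i)) * y j + x i * (y j * ln (y j))"
      by cases (simp_all add: ln_mult algebra_simps)
    show "x i * y j * (ln (x i * y j))\<^sup>2 = (x i * (ln (x i))\<^sup>2) * y j + 2 * (x i * ln (x i)) * (y j * ln (y j)) + x i * (y j * (ln (y j))\<^sup>2)"
      by (cases "x i = 0"; cases "y j = 0")
        (use V(3)[OF ij(1)] W(3)[OF ij(2)] in \<open>auto simp: ln_mult power2_eq_square algebra_simps\<close>)
  qed
  show "vn_entropy (kron \<rho> \<sigma>) = vn_entropy \<rho> + vn_entropy \<sigma>"
    unfolding vn_entropy_spec k unfolding V(2) W(2) spec_sum_udg[OF V(1)] spec_sum_udg[OF W(1)]
    by (simp add: e(1) sum.distrib sum_product[symmetric] V(4) W(4))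
  show "info2 (kron \<rho> \<sigma>) = info2 \<rho> + 2 * vn_entropy \<rho> * vn_entropy \<sigma> + info2 \<sigma>"
    unfolding vn_entropy_spec info2_def k unfolding V(2) W(2) spec_sum_udg[OF V(1)] spec_sum_udg[OF W(1)]
  proof -
    have "(\<Sum>i<a. \<Sum>j<b. x i * y j * (ln (x i * y j))\<^sup>2) =
      (\<Sum>i<a. \<Sum>j<b. (x i * (ln (x i))\<^sup>2) * y j + 2 * (x i * ln (x i)) * (y j * ln (y j)) + x i * (y j * (ln (y j))\<^sup>2))"
      by (intro sum.cong refl e(2)) auto
    also have "\<dots> = (\<Sum>i<a. x i * (ln (x i))\<^sup>2) * (\<Sum>j<b. y j) + (\<Sum>i<a. 2 * (x i * ln (x i))) * (\<Sum>j<b. y j * ln (y j))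
      + (\<Sum>i<a. x i) * (\<Sum>j<b. y j * (ln (y j))\<^sup>2)"
      unfolding sum.distrib sum_product ..
    finally show "(\<Sum>i<a. \<Sum>j<b. x i * y j * (ln (x i * y j))\<^sup>2) = (\<Sum>i<a. x i * (ln (x i))\<^sup>2) +
      2 * - (\<Sum>i<a. x i * ln (x i)) * - (\<Sum>i<b. y i * ln (y i)) + (\<Sum>i<b. y i * (ln (y i))\<^sup>2)"
      by (simp add: V(4) W(4) sum_distrib_left[symmetric])
  qed
qed

text \<open>With s = sqrt x, the inequality ln (1/s) <= 1/s gives (ln x)^2 = 4 (ln s)^2 <= 4/x. A
  bound per eigenvalue, uniform over all states, is what makes the variance of the information grow
  at most linearly in the number of copies.\<close>

lemma x_ln2_le: "0 \<le> x \<Longrightarrow> x \<le> 1 \<Longrightarrow> x * (ln x)\<^sup>2 \<le> (4::real)"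
proof (cases "x = 0")
  case False
  assume x: "0 \<le> x" "x \<le> 1"
  then have pos: "0 < x" using False by simp
  define s where "s = sqrt x"
  have s: "0 < s" "s \<le> 1" "x = s\<^sup>2" using pos x by (auto simp: s_def)
  have "ln (1 / s) \<le> 1 / s - 1" using s by (intro ln_le_minus_one) auto
  then have a: "- ln s \<le> 1 / s" using s by (simp add: ln_div)
  have b: "0 \<le> - ln s" using s by simp
  have "(ln x)\<^sup>2 = 4 * (- ln s)\<^sup>2" using s by (simp add: ln_realpow power_mult_distrib)
  also have "\<dots> \<le> 4 * (1 / s)\<^sup>2" using power_mono[OF a b, of 2] by simp
  finally have "x * (ln x)\<^sup>2 \<le> x * (4 * (1 / s)\<^sup>2)" using pos by (intro mult_left_mono) auto
  also have "\<dots> = 4" using s by (simp add: power_divide)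
  finally show ?thesis .
qed simp

lemma info2_le:
  assumes "density d \<rho>"
  shows "info2 \<rho> \<le> 4 * real d"
proof -
  obtain V x where V: "unitary d V" "\<rho> = udg d V x" "\<And>i. i < d \<Longrightarrow> 0 \<le> x i" "(\<Sum>i<d. x i) = 1"
    using density_spectral[OF assms(1)] by metis
  have "info2 \<rho> \<le> (\<Sum>i<d. 4)"
    unfolding info2_def V(2) spec_sum_udg[OF V(1)]
    by (intro sum_mono x_ln2_le) (auto simp: V(3) density_le_one[OF V(3,4)])
  then show ?thesis by simp
qed

text \<open>The tangent inequality ln y <= y - 1 at y = q/t, scaled by t. Summed against probability
  weights it becomes Gibbs' inequality; at t = 0 it reads - q <= 0.\<close>

lemma ln_gibbs: "0 \<le> t \<Longrightarrow> 0 < q \<Longrightarrow> t - q \<le> t * ln t - t * ln (q::real)"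
proof (cases "t = 0")
  case False
  assume t: "0 \<le> t" "0 < q"
  then have "ln (q / t) \<le> q / t - 1" using False by (intro ln_le_minus_one) auto
  then have "t * (ln q - ln t) \<le> t * (q / t - 1)" using t False by (intro mult_left_mono) (auto simp: ln_div)
  moreover have "t * (q / t - 1) = q - t" using False by (simp add: field_simps)
  ultimately show ?thesis by (simp add: algebra_simps)
qed simp

lemma vn_entropy_bounds:
  assumes "density d \<rho>" "0 < d"
  shows "0 \<le> vn_entropy \<rho>" "vn_entropy \<rho> \<le> ln (real d)"
proof -
  obtain V x where V: "unitary d V" "\<rho> = udg d V x" "\<And>i. i < d \<Longrightarrow> 0 \<le> x i" "(\<Sum>i<d. x i) = 1"
    using density_spectral[OF assms(1)] by metis
  have "x i * ln (x i) \<le> 0" if "i < d" for i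
    using V(3)[OF that] density_le_one[OF V(3,4) that] by (cases "x i = 0") (auto simp: mult_nonneg_nonpos)
  then show "0 \<le> vn_entropy \<rho>"
    unfolding V(2) vn_entropy_udg[OF V(1)] using sum_nonpos[of "{..<d}" "\<lambda>i. x i * ln (x i)"] by simp
  \<comment> \<open>Gibbs' inequality against the uniform distribution.\<close>
  have "(\<Sum>i<d. x i - 1 / real d) \<le> (\<Sum>i<d. x i * ln (x i) - x i * ln (1 / real d))"
    by (intro sum_mono ln_gibbs) (use assms(2) V(3) in auto)
  moreover have "(\<Sum>i<d. x i - 1 / real d) = 0" using V(4) assms(2) by (simp add: sum_subtractf)
  moreover have "(\<Sum>i<d. x i * ln (x i) - x i * ln (1 / real d)) = (\<Sum>i<d. x i * ln (x i)) + ln (real d)"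
    using V(4) assms(2) by (simp add: sum_subtractf ln_div sum_negf sum_distrib_right[symmetric])
  ultimately show "vn_entropy \<rho> \<le> ln (real d)"
    unfolding V(2) vn_entropy_udg[OF V(1)] by simp
qed

text \<open>Gibbs' inequality against the mixture of \<open>Y\<close> with the maximally mixed state
  replaces Fannes' inequality.\<close>

lemma vn_entropy_continuity:
  assumes "density d X" "density d Y" "0 < d"
  shows "vn_entropy X \<le> vn_entropy Y + ln 2 + trace_norm (X - Y) * ln (2 * real d)"
proof -
  obtain V x where V: "unitary d V" "X = udg d V x" "\<And>i. i < d \<Longrightarrow> 0 \<le> x i" "(\<Sum>i<d. x i) = 1"
    using density_spectral[OF assms(1)] by metis
  obtain W y where W: "unitary d W" "Y = udg d W y" "\<And>i. i < d \<Longrightarrow> 0 \<le> y i" "(\<Sum>i<d. y i) = 1"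
    using density_spectral[OF assms(2)] by metis
  note Vc = unitaryD(1)[OF V(1)] note Wc = unitaryD(1)[OF W(1)]
  define G where "G = adj W * V"
  have G: "unitary d G" unfolding G_def by (intro unitary_mult unitary_adj V W)
  note Gc = unitaryD(1)[OF G]
  define g where "g k l = (cmod (G $$ (k,l)))\<^sup>2" for k l
  have gr: "(\<Sum>l<d. g k l) = 1" if "k < d" for k using unitary_rows[OF G that] by (simp add: g_def)
  have gc: "(\<Sum>k<d. g k l) = 1" if "l < d" for l using unitary_cols[OF G that] by (simp add: g_def)
  \<comment> \<open>The diagonal of X in the eigenbasis of Y.\<close>
  define p where "p k = (\<Sum>l<d. x l * g k l)" for k
  \<comment> \<open>Spectrum of the even mixture of Y with the maximally mixed state. The floor 1/(2
    d) bounds the modulus of ln q by ln (2 d), and q >= y/2 costs only ln 2.\<close>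
  define q where "q k = (y k + 1 / real d) / 2" for k
  have q: "1 / (2 * real d) \<le> q k" "0 < q k" "y k / 2 \<le> q k" "q k \<le> 1" if "k < d" for k
  proof -
    define e where "e = 1 / real d"
    have "e \<le> 1" "0 < e" using assms(3) by (auto simp: e_def)
    moreover have "1 / (2 * real d) = e / 2" "q k = (y k + e) / 2" by (simp_all add: e_def q_def)
    ultimately show "1 / (2 * real d) \<le> q k" "0 < q k" "y k / 2 \<le> q k" "q k \<le> 1"
      using W(3)[OF that] density_le_one[OF W(3,4) that] by (simp_all add: field_simps)
  qed
  have lnq: "\<bar>ln (q k)\<bar> \<le> ln (2 * real d)" if "k < d" for k
  proof -
    have "ln (1 / (2 * real d)) \<le> ln (q k)" using q[OF that] assms(3) by (intro ln_mono) auto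
    moreover have "ln (1 / (2 * real d)) = - ln (2 * real d)" using assms(3) by (simp add: ln_div)
    ultimately show ?thesis using q[OF that] by auto
  qed
  \<comment> \<open>Both sums equal one because g is doubly stochastic. The weighted sum of all x l
    - q k therefore vanishes, and \<open>ln_gibbs\<close> can be applied under the weights
    g.\<close>
  have "0 = (\<Sum>l<d. x l * (\<Sum>k<d. g k l)) - (\<Sum>k<d. q k * (\<Sum>l<d. g k l))"
    using V(4) W(4) assms(3) by (simp add: gr gc q_def sum.distrib sum_divide_distrib[symmetric])
  also have "\<dots> = (\<Sum>l<d. \<Sum>k<d. g k l * (x l - q k))"
  proof -
    have "(\<Sum>k<d. q k * (\<Sum>l<d. g k l)) = (\<Sum>l<d. \<Sum>k<d. q k * g k l)"
      unfolding sum_distrib_left by (rule sum.swap)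
    then show ?thesis by (simp add: sum_distrib_left sum_subtractf[symmetric] algebra_simps)
  qed
  also have "\<dots> \<le> (\<Sum>l<d. \<Sum>k<d. g k l * (x l * ln (x l) - x l * ln (q k)))"
    by (intro sum_mono mult_left_mono ln_gibbs) (auto simp: V(3) q g_def)
  also have "\<dots> = (\<Sum>l<d. x l * ln (x l) * (\<Sum>k<d. g k l)) - (\<Sum>l<d. \<Sum>k<d. g k l * x l * ln (q k))"
    by (simp add: sum_subtractf sum_distrib_left algebra_simps)
  also have "(\<Sum>l<d. \<Sum>k<d. g k l * x l * ln (q k)) = (\<Sum>k<d. p k * ln (q k))"
    by (subst sum.swap) (simp add: p_def sum_distrib_right sum_distrib_left mult_ac)
  finally have 1: "vn_entropy X \<le> (\<Sum>k<d. - (p k * ln (q k)))"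
    unfolding V(2) vn_entropy_udg[OF V(1)] by (simp add: gc sum_negf)
  have 2: "(\<Sum>k<d. \<bar>y k - p k\<bar>) \<le> trace_norm (X - Y)"
  proof -
    have X: "X \<in> carrier_mat d d" "Y \<in> carrier_mat d d" using assms density_carrier by auto
    have m: "adj W * (X - Y) * W = adj W * X * W - adj W * Y * W"
    proof -
      have "adj W * (X - Y) = adj W * X - adj W * Y"
        by (rule mult_minus_distrib_mat[of _ d d]) (use X Wc in auto)
      moreover have "(adj W * X - adj W * Y) * W = adj W * X * W - adj W * Y * W"
        by (rule minus_mult_distrib_mat[of _ d d]) (use X Wc in auto)
      ultimately show ?thesis by simp
    qed
    have "(adj W * (X - Y) * W) $$ (k,k) = of_real (p k - y k)" if "k < d" for k
    proof -
      have "(adj W * X * W) $$ (k,k) = of_real (p k)"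
        unfolding V(2) udg_change_basis[OF Wc Vc] G_def[symmetric] udg_diag_entry[OF Gc that] by (simp add: p_def g_def)
      moreover have "(adj W * Y * W) $$ (k,k) = of_real (y k)"
        unfolding W(2) diag_of_udg[OF W(1)] using that by simp
      moreover have "adj W * X * W \<in> carrier_mat d d" "adj W * Y * W \<in> carrier_mat d d" using X Wc by auto
      ultimately show ?thesis unfolding m using that
        by (subst index_minus_mat(1)) (simp_all only: carrier_matD of_real_diff)
    qed
    then have "(\<Sum>k<d. cmod ((adj W * (X - Y) * W) $$ (k,k))) = (\<Sum>k<d. \<bar>y k - p k\<bar>)"
      by (intro sum.cong) (auto simp del: index_mult_mat(1) of_real_diff simp: abs_minus_commute)
    then show ?thesis
      using trace_norm_pinching[OF hermitian_minus[OF density_hermitian[OF assms(1)] density_hermitian[OF assms(2)]] W(1)] by simp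
  qed
  have 3: "- (y k * ln (q k)) \<le> - (y k * ln (y k)) + y k * ln 2" if k: "k < d" for k
  proof (cases "y k = 0")
    case False
    then have pos: "0 < y k" using W(3)[OF k] by simp
    have "ln (y k / 2) \<le> ln (q k)" using q[OF k] pos by (intro ln_mono) auto
    then have "y k * (ln (y k) - ln 2) \<le> y k * ln (q k)" using pos by (intro mult_left_mono) (auto simp: ln_div)
    then show ?thesis by (simp add: algebra_simps)
  qed simp
  have "(\<Sum>k<d. - (p k * ln (q k))) = (\<Sum>k<d. - (y k * ln (q k)) + (y k - p k) * ln (q k))"
    by (intro sum.cong) (auto simp: algebra_simps)
  also have "\<dots> \<le> (\<Sum>k<d. (- (y k * ln (y k)) + y k * ln 2) + \<bar>y k - p k\<bar> * ln (2 * real d))"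
  proof (intro sum_mono add_mono 3)
    fix k assume "k \<in> {..<d}"
    then have "\<bar>y k - p k\<bar> * \<bar>ln (q k)\<bar> \<le> \<bar>y k - p k\<bar> * ln (2 * real d)"
      by (intro mult_left_mono lnq) auto
    then show "(y k - p k) * ln (q k) \<le> \<bar>y k - p k\<bar> * ln (2 * real d)"
      using abs_ge_self[of "(y k - p k) * ln (q k)"] by (simp add: abs_mult)
  qed auto
  also have "\<dots> = vn_entropy Y + ln 2 + (\<Sum>k<d. \<bar>y k - p k\<bar>) * ln (2 * real d)"
    unfolding W(2) vn_entropy_udg[OF W(1)]
    by (simp add: sum.distrib sum_subtractf sum_negf sum_distrib_right[symmetric] W(4))
  also have "\<dots> \<le> vn_entropy Y + ln 2 + trace_norm (X - Y) * ln (2 * real d)"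
    using 2 assms(3) by (intro add_left_mono mult_right_mono) auto
  finally show ?thesis using 1 by linarith
qed

lemma trace_norm_density: "density d \<rho> \<Longrightarrow> trace_norm \<rho> = 1"
  by (elim density_spectral) (simp add: trace_norm_udg)

lemma trace_norm_uminus:
  assumes "hermitian d A"
  shows "trace_norm (0\<^sub>m d d - A) = trace_norm A"
proof -
  have z: "hermitian d (0\<^sub>m d d)" by (auto simp: hermitian_def intro!: eq_matI)
  have "A - 0\<^sub>m d d = A" using hermitianD(1)[OF assms] by (intro eq_matI) auto
  then show ?thesis using trace_norm_minus_commute[OF z assms] by simp
qed

lemma trace_norm_triangle_minus:
  assumes "hermitian d A" "hermitian d B" "hermitian d C"
  shows "trace_norm (A - C) \<le> trace_norm (A - B) + trace_norm (B - C)"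
proof -
  have "A - C = (A - B) + (B - C)"
    using hermitianD(1)[OF assms(1)] hermitianD(1)[OF assms(2)] hermitianD(1)[OF assms(3)]
    by (intro eq_matI) auto
  then show ?thesis using trace_norm_triangle[OF hermitian_minus[OF assms(1,2)] hermitian_minus[OF assms(2,3)]] by simp
qed

lemma trace_norm_density_diff:
  assumes "density d X" "density d Y"
  shows "trace_norm (X - Y) \<le> 2"
proof -
  note X = density_hermitian[OF assms(1)] note Y = density_hermitian[OF assms(2)]
  have z: "hermitian d (0\<^sub>m d d)" by (auto simp: hermitian_def intro!: eq_matI)
  have "X - 0\<^sub>m d d = X" using hermitianD(1)[OF X] by (intro eq_matI) auto
  then show ?thesis
    using trace_norm_triangle_minus[OF X z Y] trace_norm_uminus[OF Y]
      trace_norm_density[OF assms(1)] trace_norm_density[OF assms(2)] by simp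
qed

lemma trace_norm_kron_density:
  assumes "hermitian a A" "density b \<omega>"
  shows "trace_norm (kron A \<omega>) = trace_norm A"
proof -
  obtain V x where V: "unitary a V" "A = udg a V x" using spectral[OF assms(1)] by metis
  obtain W y where W: "unitary b W" "\<omega> = udg b W y" "\<And>i. i < b \<Longrightarrow> 0 \<le> y i" "(\<Sum>i<b. y i) = 1"
    using density_spectral[OF assms(2)] by metis
  have "trace_norm (kron A \<omega>) = (\<Sum>l<a*b. \<bar>x (l div b)\<bar> * \<bar>y (l mod b)\<bar>)"
    unfolding V(2) W(2) udg_kron[OF unitaryD(1)[OF V(1)] unitaryD(1)[OF W(1)]]
      trace_norm_udg[OF unitary_kron[OF V(1) W(1)]] by (simp add: abs_mult)
  also have "\<dots> = (\<Sum>i<a. \<bar>x i\<bar>) * (\<Sum>j<b. \<bar>y j\<bar>)"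
    by (rule sum_div_mod_prod[of "\<lambda>i. \<bar>x i\<bar>" b "\<lambda>i. \<bar>y i\<bar>" a])
  also have "(\<Sum>j<b. \<bar>y j\<bar>) = 1" using W(3,4) by simp
  finally show ?thesis by (simp add: V(2) trace_norm_udg[OF V(1)])
qed

section \<open>Approximate conversion of spectra by a permutation\<close>

text \<open>Inside a block every value and the average lie between the first and the last entry, at
  distance \<open>a t\<close>. This is at most the drop from the start of the block to the start of
  the next one, and the drops telescope to at most the value at 0.\<close>

lemma block_average_deviation:
  fixes \<xi> :: "nat \<Rightarrow> real"
  assumes anti: "antimono \<xi>" and nn: "\<And>i. 0 \<le> \<xi> i" and b: "\<xi> 0 \<le> b" and g: "1 \<le> g"
  shows "(\<Sum>t<k. \<Sum>r<g. \<bar>\<xi> (t * g + r) - (\<Sum>s<g. \<xi> (t * g + s)) / real g\<bar>) \<le> 2 * real (g - 1) * b"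
proof -
  have le: "\<bar>\<xi> (t * g + r) - (\<Sum>s<g. \<xi> (t * g + s)) / real g\<bar> \<le> \<xi> (t * g) - \<xi> (t * g + (g - 1))"
    if r: "r < g" for t r
  proof -
    have up: "\<xi> (t * g + s) \<le> \<xi> (t * g)" for s by (rule antimonoD[OF anti]) simp
    have lo: "\<xi> (t * g + (g - 1)) \<le> \<xi> (t * g + s)" if "s < g" for s
      by (rule antimonoD[OF anti]) (use that in auto)
    have "(\<Sum>s<g. \<xi> (t * g + s)) \<le> (\<Sum>s<g. \<xi> (t * g))" by (intro sum_mono up)
    then have 1: "(\<Sum>s<g. \<xi> (t * g + s)) / real g \<le> \<xi> (t * g)" using g by (simp add: field_simps)
    have "(\<Sum>s<g. \<xi> (t * g + (g - 1))) \<le> (\<Sum>s<g. \<xi> (t * g + s))" by (intro sum_mono lo) auto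
    then have 2: "\<xi> (t * g + (g - 1)) \<le> (\<Sum>s<g. \<xi> (t * g + s)) / real g" using g by (simp add: field_simps)
    show ?thesis using 1 2 up[of r] lo[OF r] by linarith
  qed
  define a where "a t = \<xi> (t * g) - \<xi> (t * g + (g - 1))" for t
  have a0: "0 \<le> a t" for t unfolding a_def using antimonoD[OF anti, of "t * g" "t * g + (g - 1)"] by simp
  have at: "a t \<le> \<xi> (t * g) - \<xi> (Suc t * g)" for t
    unfolding a_def using antimonoD[OF anti, of "t * g + (g - 1)" "Suc t * g"] by simp
  \<comment> \<open>The factor g - 1 in place of g matters: for g = 1 the blocks are constant and
    the error is zero however large b is. For g >= 2 it costs a factor 2.\<close>
  have ga: "real g * a t \<le> 2 * real (g - 1) * a t" for t
  proof (cases "g = 1")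
    case True
    then show ?thesis by (simp add: a_def)
  next
    case False
    then have "real g \<le> 2 * real (g - 1)" using g by (simp add: of_nat_diff)
    then show ?thesis by (intro mult_right_mono a0)
  qed
  have "(\<Sum>t<k. \<Sum>r<g. \<bar>\<xi> (t * g + r) - (\<Sum>s<g. \<xi> (t * g + s)) / real g\<bar>) \<le> (\<Sum>t<k. \<Sum>r<g. a t)"
    unfolding a_def by (intro sum_mono le) auto
  also have "\<dots> \<le> (\<Sum>t<k. 2 * real (g - 1) * a t)"
    by (intro sum_mono) (use ga in auto)
  also have "\<dots> \<le> 2 * real (g - 1) * (\<Sum>t<k. \<xi> (t * g) - \<xi> (Suc t * g))"
    unfolding sum_distrib_left by (intro sum_mono mult_left_mono at) auto
  also have "(\<Sum>t<k. \<xi> (t * g) - \<xi> (Suc t * g)) = \<xi> 0 - \<xi> (k * g)"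
    by (subst sum_lessThan_telescope') simp
  also have "2 * real (g - 1) * (\<xi> 0 - \<xi> (k * g)) \<le> 2 * real (g - 1) * b"
    using b nn[of "k * g"] by (intro mult_left_mono) auto
  finally show ?thesis .
qed

text \<open>The permutation behind the catalytic transformation: on the first \<open>k * g\<close> levels of the
  system, written as \<open>b * g + r\<close>, the block number \<open>b\<close> is exchanged with the ancilla level \<open>t\<close>.\<close>

definition block_swap :: "nat \<Rightarrow> nat \<Rightarrow> nat \<Rightarrow> nat" where
  "block_swap g k l = (if l div k < k * g then ((l mod k) * g + (l div k) mod g) * k + (l div k) div g else l)"

lemma block_swap_pair:
  assumes "t < k" "t' < k" "r < g"
  shows "block_swap g k ((t' * g + r) * k + t) = (t * g + r) * k + t'"
  using assms pair_lt[OF assms(2,3)] by (simp add: block_swap_def)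

lemma block_swap_split:
  fixes l k g :: nat
  assumes "l div k < k * g"
  obtains t t' r where "t < k" "t' < k" "r < g" "l = (t' * g + r) * k + t"
proof -
  from assms have k: "0 < k" "0 < g" by (auto intro: Nat.gr0I)
  show ?thesis
    by (rule that[of "l mod k" "l div k div g" "l div k mod g"])
      (use k div_lt[OF assms] in auto)
qed

lemma block_swap_lt:
  assumes "l < D * k" "k * g \<le> D"
  shows "block_swap g k l < D * k"
proof (cases "l div k < k * g")
  case True
  then obtain t t' r where t: "t < k" "t' < k" "r < g" "l = (t' * g + r) * k + t"
    by (rule block_swap_split)
  have "t * g + r < D" using pair_lt[OF t(1,3)] assms(2) by linarith
  then show ?thesis unfolding t(4) block_swap_pair[OF t(1-3)] using t(2) by (intro pair_lt)
qed (use assms in \<open>auto simp: block_swap_def\<close>)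

lemma block_swap_invol: "block_swap g k (block_swap g k l) = l"
proof (cases "l div k < k * g")
  case True
  then obtain t t' r where t: "t < k" "t' < k" "r < g" "l = (t' * g + r) * k + t"
    by (rule block_swap_split)
  then show ?thesis by (simp add: block_swap_pair)
qed (auto simp: block_swap_def)

text \<open>On the blocks, X with ancilla wy and Y with ancilla wx both resemble wx t * wy t' / g
  once the block number and the ancilla level are exchanged; each side pays one block deviation 2 (g
  - 1) b. Levels beyond the blocks stay in place and are charged in full.\<close>

lemma block_swap_deviation:
  fixes \<xi> \<eta> :: "nat \<Rightarrow> real"
  assumes \<xi>: "antimono \<xi>" "\<And>i. 0 \<le> \<xi> i" "\<xi> 0 \<le> b"
    and \<eta>: "antimono \<eta>" "\<And>i. 0 \<le> \<eta> i" "\<eta> 0 \<le> b"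
    and g: "1 \<le> g" and kg: "k * g \<le> D"
  defines "sx \<equiv> \<Sum>i<k*g. \<xi> i" and "sy \<equiv> \<Sum>i<k*g. \<eta> i"
  defines "wx \<equiv> \<lambda>t. (\<Sum>r<g. \<xi> (t * g + r)) / sx" and "wy \<equiv> \<lambda>t. (\<Sum>r<g. \<eta> (t * g + r)) / sy"
  assumes pos: "0 < sx" "0 < sy"
  shows "(\<Sum>l<D*k. \<bar>\<xi> (block_swap g k l div k) * wy (block_swap g k l mod k) - \<eta> (l div k) * wx (l mod k)\<bar>)
    \<le> (\<Sum>i=k*g..<D. \<xi> i) + (\<Sum>i=k*g..<D. \<eta> i) + 4 * real (g - 1) * b + \<bar>sx - sy\<bar>"
proof -
  have wx: "0 \<le> wx t" "0 \<le> wy t" for t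
    using pos by (auto simp: wx_def wy_def intro!: sum_nonneg divide_nonneg_pos \<xi> \<eta>)
  have wx1: "(\<Sum>t<k. wx t) = 1" "(\<Sum>t<k. wy t) = 1"
    using pos by (simp_all add: wx_def wy_def sum_divide_distrib[symmetric] sum_div_mod[symmetric] sx_def[symmetric] sy_def[symmetric])
  let ?f = "\<lambda>i t. \<bar>\<xi> (block_swap g k (i * k + t) div k) * wy (block_swap g k (i * k + t) mod k) - \<eta> i * wx t\<bar>"
  have "(\<Sum>l<D*k. \<bar>\<xi> (block_swap g k l div k) * wy (block_swap g k l mod k) - \<eta> (l div k) * wx (l mod k)\<bar>)
    = (\<Sum>i<D. \<Sum>t<k. ?f i t)"
    unfolding sum_div_mod by (intro sum.cong) auto
  also have "\<dots> = (\<Sum>i<k*g. \<Sum>t<k. ?f i t) + (\<Sum>i=k*g..<D. \<Sum>t<k. ?f i t)"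
    using kg sum.atLeastLessThan_concat[of 0 "k*g" D "\<lambda>i. \<Sum>t<k. ?f i t"] by (simp add: atLeast0LessThan)
  also have "(\<Sum>i=k*g..<D. \<Sum>t<k. ?f i t) \<le> (\<Sum>i=k*g..<D. \<xi> i) + (\<Sum>i=k*g..<D. \<eta> i)"
  proof -
    have "?f i t \<le> \<xi> i * wy t + \<eta> i * wx t" if "k * g \<le> i" "t < k" for i t
    proof -
      have "block_swap g k (i * k + t) = i * k + t" using that by (simp add: block_swap_def)
      then have "?f i t = \<bar>\<xi> i * wy t - \<eta> i * wx t\<bar>" using that by simp
      moreover have "0 \<le> \<xi> i * wy t" "0 \<le> \<eta> i * wx t" using wx \<xi>(2) \<eta>(2) by auto
      ultimately show ?thesis by linarith
    qed
    then have "(\<Sum>i=k*g..<D. \<Sum>t<k. ?f i t) \<le> (\<Sum>i=k*g..<D. \<Sum>t<k. \<xi> i * wy t + \<eta> i * wx t)"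
      by (intro sum_mono) auto
    then show ?thesis by (simp add: sum.distrib sum_distrib_left[symmetric] wx1)
  qed
  also have "(\<Sum>i<k*g. \<Sum>t<k. ?f i t) \<le> 4 * real (g - 1) * b + \<bar>sx - sy\<bar>"
  proof -
    have "(\<Sum>i<k*g. \<Sum>t<k. ?f i t) = (\<Sum>t'<k. \<Sum>r<g. \<Sum>t<k. ?f (t' * g + r) t)"
      by (rule sum_div_mod)
    also have "\<dots> = (\<Sum>t'<k. \<Sum>r<g. \<Sum>t<k. \<bar>\<xi> (t * g + r) * wy t' - \<eta> (t' * g + r) * wx t\<bar>)"
      by (intro sum.cong refl) (simp add: block_swap_pair)
    also have "\<dots> \<le> (\<Sum>t'<k. \<Sum>r<g. \<Sum>t<k. \<bar>\<xi> (t * g + r) - sx * wx t / g\<bar> * wy t' + \<bar>sx - sy\<bar> * (wx t * wy t' / g)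
         + \<bar>\<eta> (t' * g + r) - sy * wy t' / g\<bar> * wx t)"
    proof (intro sum_mono)
      fix t t' r
      have abs3: "\<bar>x + y - z\<bar> \<le> \<bar>x\<bar> + \<bar>y\<bar> + \<bar>z\<bar>" for x y z :: real by linarith
      \<comment> \<open>The block averages are sx * wx t / g and sy * wy t' / g, so replacing each
        spectrum by its averages leaves the middle term, the mismatch of the two
        normalisations.\<close>
      have "\<xi> (t * g + r) * wy t' - \<eta> (t' * g + r) * wx t =
        (\<xi> (t * g + r) - sx * wx t / g) * wy t' + (sx - sy) * (wx t * wy t' / g) - (\<eta> (t' * g + r) - sy * wy t' / g) * wx t"
        by (simp add: algebra_simps diff_divide_distrib)
      also have "\<bar>\<dots>\<bar> \<le> \<bar>(\<xi> (t * g + r) - sx * wx t / g) * wy t'\<bar> + \<bar>(sx - sy) * (wx t * wy t' / g)\<bar>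
          + \<bar>(\<eta> (t' * g + r) - sy * wy t' / g) * wx t\<bar>" by (rule abs3)
      finally show "\<bar>\<xi> (t * g + r) * wy t' - \<eta> (t' * g + r) * wx t\<bar> \<le> \<bar>\<xi> (t * g + r) - sx * wx t / g\<bar> * wy t'
          + \<bar>sx - sy\<bar> * (wx t * wy t' / g) + \<bar>\<eta> (t' * g + r) - sy * wy t' / g\<bar> * wx t"
        using wx[of t] wx[of t'] by (simp add: abs_mult)
    qed
    also have "\<dots> = (\<Sum>t'<k. \<Sum>r<g. \<Sum>t<k. \<bar>\<xi> (t * g + r) - sx * wx t / g\<bar> * wy t')
        + (\<Sum>t'<k. \<Sum>r<g. \<Sum>t<k. \<bar>sx - sy\<bar> * (wx t * wy t' / g))
        + (\<Sum>t'<k. \<Sum>r<g. \<Sum>t<k. \<bar>\<eta> (t' * g + r) - sy * wy t' / g\<bar> * wx t)"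
      by (simp add: sum.distrib)
    also have "(\<Sum>t'<k. \<Sum>r<g. \<Sum>t<k. \<bar>\<xi> (t * g + r) - sx * wx t / g\<bar> * wy t') =
        (\<Sum>t'<k. wy t') * (\<Sum>t<k. \<Sum>r<g. \<bar>\<xi> (t * g + r) - sx * wx t / g\<bar>)"
    proof -
      have "(\<Sum>r<g. \<Sum>t<k. \<bar>\<xi> (t * g + r) - sx * wx t / g\<bar> * wy t') =
          wy t' * (\<Sum>t<k. \<Sum>r<g. \<bar>\<xi> (t * g + r) - sx * wx t / g\<bar>)" for t'
        by (subst sum.swap) (simp add: sum_distrib_left mult.commute)
      then show ?thesis by (simp add: sum_distrib_right)
    qed
    also have "(\<Sum>t'<k. \<Sum>r<g. \<Sum>t<k. \<bar>sx - sy\<bar> * (wx t * wy t' / g)) = \<bar>sx - sy\<bar> * ((\<Sum>t'<k. wy t') * (\<Sum>t<k. wx t))"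
    proof -
      have "(\<Sum>t'<k. \<Sum>r<g. \<Sum>t<k. \<bar>sx - sy\<bar> * (wx t * wy t' / g)) = (\<Sum>t'<k. \<Sum>t<k. \<bar>sx - sy\<bar> * (wy t' * wx t))"
        using g by (simp add: sum_distrib_left[of "real g"] mult_ac)
      then show ?thesis unfolding sum_product by (simp only: sum_distrib_left)
    qed
    also have "(\<Sum>t'<k. \<Sum>r<g. \<Sum>t<k. \<bar>\<eta> (t' * g + r) - sy * wy t' / g\<bar> * wx t) =
        (\<Sum>t'<k. \<Sum>r<g. \<bar>\<eta> (t' * g + r) - sy * wy t' / g\<bar>) * (\<Sum>t<k. wx t)"
      by (simp add: sum_distrib_left[symmetric] wx1)
    also have "(\<Sum>t<k. \<Sum>r<g. \<bar>\<xi> (t * g + r) - sx * wx t / g\<bar>) \<le> 2 * real (g - 1) * b"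
      using block_average_deviation[OF \<xi> g, of k] pos by (simp add: wx_def)
    also have "(\<Sum>t'<k. \<Sum>r<g. \<bar>\<eta> (t' * g + r) - sy * wy t' / g\<bar>) \<le> 2 * real (g - 1) * b"
      using block_average_deviation[OF \<eta> g, of k] pos by (simp add: wy_def)
    finally show ?thesis by (simp add: wx1 mult_ac)
  qed
  finally show ?thesis by linarith
qed

section \<open>Permutation matrices of involutions\<close>

definition perm_mat :: "nat \<Rightarrow> (nat \<Rightarrow> nat) \<Rightarrow> complex mat" where
  "perm_mat d \<pi> = mat d d (\<lambda>(i,j). if i = \<pi> j then 1 else 0)"

lemma perm_mat_carrier [simp]: "perm_mat d \<pi> \<in> carrier_mat d d"
  by (simp add: perm_mat_def)

lemma perm_mat_dims [simp]: "dim_row (perm_mat d \<pi>) = d" "dim_col (perm_mat d \<pi>) = d"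
  by (simp_all add: perm_mat_def)

lemma perm_mat_entry [simp]: "i < d \<Longrightarrow> j < d \<Longrightarrow> perm_mat d \<pi> $$ (i,j) = (if i = \<pi> j then 1 else 0)"
  by (simp add: perm_mat_def)

lemma perm_mat_conj_dg:
  assumes lt: "\<And>l. l < d \<Longrightarrow> \<pi> l < d" and inv: "\<And>l. \<pi> (\<pi> l) = l"
  shows "udg d (perm_mat d \<pi>) x = dg d (\<lambda>l. x (\<pi> l))"
proof (rule eq_matI)
  fix i j assume "i < dim_row (dg d (\<lambda>l. x (\<pi> l)))" "j < dim_col (dg d (\<lambda>l. x (\<pi> l)))"
  then have ij: "i < d" "j < d" by auto
  have pi: "i = \<pi> l \<longleftrightarrow> l = \<pi> i" for i l using inv by metis
  have "udg d (perm_mat d \<pi>) x $$ (i,j) = (\<Sum>l<d. if l = \<pi> i then if i = j then of_real (x (\<pi> i)) else 0 else 0)"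
    unfolding udg_entry[OF perm_mat_carrier ij]
    by (intro sum.cong refl) (use ij inv in \<open>auto simp: pi\<close>)
  then show "udg d (perm_mat d \<pi>) x $$ (i,j) = dg d (\<lambda>l. x (\<pi> l)) $$ (i,j)"
    using ij lt[OF ij(1)] by auto
qed (auto)

lemma perm_mat_unitary:
  assumes lt: "\<And>l. l < d \<Longrightarrow> \<pi> l < d" and inv: "\<And>l. \<pi> (\<pi> l) = l"
  shows "unitary d (perm_mat d \<pi>)"
proof -
  have "perm_mat d \<pi> * dg d (\<lambda>_. 1) = perm_mat d \<pi>" by (simp add: dg_one)
  then have "perm_mat d \<pi> * adj (perm_mat d \<pi>) = 1\<^sub>m d"
    using perm_mat_conj_dg[of d \<pi> "\<lambda>_. 1"] lt inv by (simp add: udg_def dg_one)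
  then have "unitary d (adj (perm_mat d \<pi>))" by (auto simp: unitary_def)
  then show ?thesis using unitary_adj by fastforce
qed

text \<open>Columns with q l = 0 are erased and all others belong to fixed points. It is applied
  with q the indicator of the levels outside the low spectral subspace.\<close>

lemma perm_mat_mult_dg:
  assumes fp: "\<And>l. l < d \<Longrightarrow> q l \<noteq> 0 \<Longrightarrow> \<pi> l = l"
  shows "perm_mat d \<pi> * dg d q = dg d q"
proof (rule eq_matI)
  fix i j assume "i < dim_row (dg d q)" "j < dim_col (dg d q)"
  then have ij: "i < d" "j < d" by auto
  have "(perm_mat d \<pi> * dg d q) $$ (i,j) = (\<Sum>l<d. if l = j then perm_mat d \<pi> $$ (i,j) * of_real (q j) else 0)"
    unfolding mult_entry[OF perm_mat_carrier dg_carrier ij] by (intro sum.cong refl) (use ij in auto)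
  then show "(perm_mat d \<pi> * dg d q) $$ (i,j) = dg d q $$ (i,j)"
    using ij fp[OF ij(2)] by (cases "q j = 0") (auto simp del: index_mult_mat(1))
qed auto

section \<open>Compression to a spectral subspace\<close>

text \<open>The rank bound, by double counting the weights \<open>x l * |H i l|^2 / \<xi> i\<close>.\<close>

lemma compression_rank:
  fixes x \<xi> :: "nat \<Rightarrow> real"
  assumes H: "H \<in> carrier_mat D D" and m: "m \<le> D"
    and x: "\<And>l. l < D \<Longrightarrow> 0 \<le> x l" and T: "T \<subseteq> {..<D}" "\<And>l. l < D \<Longrightarrow> l \<notin> T \<Longrightarrow> x l = 0"
    and diag: "\<And>i j. i < m \<Longrightarrow> j < m \<Longrightarrow> udg D H x $$ (i,j) = (if i = j then of_real (\<xi> i) else 0)"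
  shows "card {i. i < m \<and> 0 < \<xi> i} \<le> card T"
proof -
  define I where "I = {i. i < m \<and> 0 < \<xi> i}"
  have I: "finite I" "I \<subseteq> {..<D}" using m by (auto simp: I_def)
  have finT: "finite T" using T(1) finite_subset by auto
  define w where "w i l = (cmod (H $$ (i,l)))\<^sup>2 / \<xi> i" for i l
  have w0: "0 \<le> w i l" if "i \<in> I" for i l using that by (auto simp: w_def I_def)
  \<comment> \<open>The diagonal entry \<xi> i is itself the x-weighted sum of the squared moduli in
    row i, so every index of I carries total weight one.\<close>
  have row: "(\<Sum>l\<in>T. x l * w i l) = 1" if i: "i \<in> I" for i
  proof -
    have "complex_of_real (\<xi> i) = of_real (\<Sum>l<D. x l * (cmod (H $$ (i,l)))\<^sup>2)"
      using diag[of i i] i udg_diag_entry[OF H, of i x] I(2) by (auto simp: I_def simp del: of_real_sum)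
    then have "\<xi> i = (\<Sum>l<D. x l * (cmod (H $$ (i,l)))\<^sup>2)" by (simp only: of_real_eq_iff)
    also have "\<dots> = (\<Sum>l\<in>T. x l * (cmod (H $$ (i,l)))\<^sup>2)"
      using T by (intro sum.mono_neutral_right) auto
    finally show ?thesis using i by (simp add: w_def I_def sum_divide_distrib[symmetric])
  qed
  have col: "x l * (\<Sum>i\<in>I. w i l) \<le> 1" if l: "l \<in> T" for l
  proof -
    define t where "t = (\<Sum>i\<in>I. w i l)"
    \<comment> \<open>Coefficients of a test vector for the quadratic form of the compression. The
      value of the form is t, while its term at l alone is x l * t^2; hence x l * t^2 <= t, that is
      x l * t <= 1.\<close>
    define a where "a i = cnj (H $$ (i,l)) / of_real (\<xi> i)" for i
    have t0: "0 \<le> t" unfolding t_def by (intro sum_nonneg w0)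
    have lD: "l < D" using l T by auto
    have "(\<Sum>l'<D. x l' * (cmod (\<Sum>i\<in>I. a i * H $$ (i,l')))\<^sup>2) = t"
    proof -
      have "complex_of_real (\<Sum>l'<D. x l' * (cmod (\<Sum>i\<in>I. a i * H $$ (i,l')))\<^sup>2)
        = (\<Sum>l'<D. \<Sum>i\<in>I. \<Sum>j\<in>I. a i * cnj (a j) * (of_real (x l') * (H $$ (i,l') * cnj (H $$ (j,l')))))"
        by (simp add: complex_norm_square sum_product sum_distrib_left mult_ac del: of_real_power)
          (intro sum.cong refl sum.swap)
      also have "\<dots> = (\<Sum>i\<in>I. \<Sum>j\<in>I. \<Sum>l'<D. a i * cnj (a j) * (of_real (x l') * (H $$ (i,l') * cnj (H $$ (j,l')))))"
        by (subst sum.swap) (intro sum.cong refl sum.swap)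
      also have "\<dots> = (\<Sum>i\<in>I. \<Sum>j\<in>I. a i * cnj (a j) * udg D H x $$ (i,j))"
        using I(2) by (intro sum.cong refl) (auto simp: udg_entry[OF H] sum_distrib_left subset_iff)
      also have "\<dots> = (\<Sum>i\<in>I. \<Sum>j\<in>I. if j = i then a i * cnj (a i) * of_real (\<xi> i) else 0)"
        by (intro sum.cong refl) (auto simp: diag I_def)
      also have "\<dots> = (\<Sum>i\<in>I. a i * cnj (a i) * of_real (\<xi> i))"
        using I(1) by simp
      also have "\<dots> = (\<Sum>i\<in>I. of_real (w i l))"
      proof (intro sum.cong refl)
        fix i assume "i \<in> I"
        then have "complex_of_real (\<xi> i) \<noteq> 0" by (auto simp: I_def)
        then show "a i * cnj (a i) * of_real (\<xi> i) = of_real (w i l)"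
          by (simp add: a_def w_def complex_norm_square mult.commute del: of_real_power)
      qed
      finally show ?thesis unfolding t_def of_real_sum[symmetric] of_real_eq_iff .
    qed
    moreover have "x l * (cmod (\<Sum>i\<in>I. a i * H $$ (i,l)))\<^sup>2 \<le> (\<Sum>l'<D. x l' * (cmod (\<Sum>i\<in>I. a i * H $$ (i,l')))\<^sup>2)"
      by (rule member_le_sum[of l "{..<D}" "\<lambda>l'. x l' * (cmod (\<Sum>i\<in>I. a i * H $$ (i,l')))\<^sup>2"]) (use lD x in auto)
    moreover have "(\<Sum>i\<in>I. a i * H $$ (i,l)) = of_real t"
      unfolding t_def of_real_sum
      by (intro sum.cong refl) (simp add: a_def w_def complex_norm_square mult.commute del: of_real_power)
    ultimately have "x l * t * t \<le> t" using t0 by (simp add: power2_eq_square mult.assoc)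
    then show ?thesis unfolding t_def[symmetric] using t0 by (cases "t = 0") (auto simp: mult_le_cancel_right)
  qed
  have "real (card I) = (\<Sum>i\<in>I. \<Sum>l\<in>T. x l * w i l)" by (simp add: row)
  also have "\<dots> = (\<Sum>l\<in>T. x l * (\<Sum>i\<in>I. w i l))" by (subst sum.swap) (simp add: sum_distrib_left)
  also have "\<dots> \<le> (\<Sum>l\<in>T. 1)" by (intro sum_mono col)
  finally show ?thesis unfolding I_def by simp
qed

lemma unitary_mult_col_norm:
  assumes "unitary D W" "M \<in> carrier_mat D D" "l < D"
  shows "(\<Sum>k<D. (cmod ((W * M) $$ (k,l)))\<^sup>2) = (\<Sum>i<D. (cmod (M $$ (i,l)))\<^sup>2)"
proof -
  note W = unitaryD(1)[OF assms(1)]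
  have c: "W *\<^sub>v col M l = col (W * M) l"
    using W assms by (subst col_mult2[of _ D D _ D]) auto
  have "(vnorm (W *\<^sub>v col M l))\<^sup>2 = (vnorm (col M l))\<^sup>2"
    using assms by (subst vnorm_unitary) auto
  moreover have "(vnorm (col M l))\<^sup>2 = (\<Sum>i<D. (cmod (M $$ (i,l)))\<^sup>2)"
    unfolding vnorm_sq using assms by auto
  moreover have "(vnorm (col (W * M) l))\<^sup>2 = (\<Sum>k<D. (cmod ((W * M) $$ (k,l)))\<^sup>2)"
    unfolding vnorm_sq using carrier_matD[OF W] carrier_matD[OF assms(2)] assms(3) by simp
  ultimately show ?thesis unfolding c by simp
qed

text \<open>Gentle measurement: H1 keeps the first m coordinates of each column of H. The difference
  is evaluated in its own eigenbasis W, where it compares squared moduli a^2 and b^2 with |a - b| <=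
  c, the contribution of the deleted coordinates. Cauchy-Schwarz over k turns this into the square
  root of the deleted weight of each column.\<close>

lemma gentle_truncation:
  fixes x :: "nat \<Rightarrow> real" and m :: nat
  assumes H: "unitary D H" and x: "\<And>l. l < D \<Longrightarrow> 0 \<le> x l" "(\<Sum>l<D. x l) \<le> 1"
  defines "H1 \<equiv> mat D D (\<lambda>(i,l). if i < m then H $$ (i,l) else 0)"
  shows "trace_norm (udg D H x - udg D H1 x) \<le> 2 * sqrt (\<Sum>l<D. x l * (\<Sum>i=m..<D. (cmod (H $$ (i,l)))\<^sup>2))"
proof -
  note Hc = unitaryD(1)[OF H]
  define H2 where "H2 = mat D D (\<lambda>(i,l). if i < m then 0 else H $$ (i,l))"
  have H1c: "H1 \<in> carrier_mat D D" and H2c: "H2 \<in> carrier_mat D D" by (auto simp: H1_def H2_def)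
  have Hs: "H = H1 + H2" using Hc by (intro eq_matI) (auto simp: H1_def H2_def)
  define Z where "Z = udg D H x - udg D H1 x"
  have hZ: "hermitian D Z" unfolding Z_def by (intro hermitian_minus udg_hermitian Hc H1c)
  from spectral[OF hZ] obtain W z where W: "unitary D W" "Z = udg D W z" by auto
  note Wc = unitaryD(1)[OF W(1)]
  define a where "a k l = cmod ((adj W * H) $$ (k,l))" for k l
  define b where "b k l = cmod ((adj W * H1) $$ (k,l))" for k l
  define c where "c k l = cmod ((adj W * H2) $$ (k,l))" for k l
  define e where "e l = (\<Sum>i=m..<D. (cmod (H $$ (i,l)))\<^sup>2)" for l
  note uW = unitary_adj[OF W(1)]
  have sa: "(\<Sum>k<D. (a k l)\<^sup>2) = 1" if "l < D" for l
    unfolding a_def using unitary_mult_col_norm[OF uW Hc that] unitary_cols[OF H that] by simp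
  have sb: "(\<Sum>k<D. (b k l)\<^sup>2) \<le> 1" if "l < D" for l
  proof -
    have "(\<Sum>k<D. (b k l)\<^sup>2) = (\<Sum>i<D. (cmod (H1 $$ (i,l)))\<^sup>2)"
      unfolding b_def by (rule unitary_mult_col_norm[OF uW H1c that])
    also have "\<dots> \<le> (\<Sum>i<D. (cmod (H $$ (i,l)))\<^sup>2)"
      using that by (intro sum_mono) (auto simp: H1_def)
    finally show ?thesis using unitary_cols[OF H that] by simp
  qed
  have sc: "(\<Sum>k<D. (c k l)\<^sup>2) = e l" if "l < D" for l
  proof -
    have "(\<Sum>k<D. (c k l)\<^sup>2) = (\<Sum>i<D. (cmod (H2 $$ (i,l)))\<^sup>2)"
      unfolding c_def by (rule unitary_mult_col_norm[OF uW H2c that])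
    also have "\<dots> = (\<Sum>i\<in>{m..<D}. (cmod (H2 $$ (i,l)))\<^sup>2)"
      using that by (intro sum.mono_neutral_right) (auto simp: H2_def)
    also have "\<dots> = e l" unfolding e_def using that by (intro sum.cong) (auto simp: H2_def)
    finally show ?thesis .
  qed
  have e0: "0 \<le> e l" for l unfolding e_def by (intro sum_nonneg) auto
  have tri: "\<bar>(a k l)\<^sup>2 - (b k l)\<^sup>2\<bar> \<le> \<bar>c k l\<bar> * \<bar>a k l\<bar> + \<bar>c k l\<bar> * \<bar>b k l\<bar>" if "k < D" "l < D" for k l
  proof -
    have "adj W * H = adj W * H1 + adj W * H2"
      unfolding Hs by (rule mult_add_distrib_mat[of _ D D]) (use Wc H1c H2c in auto)
    then have "(adj W * H) $$ (k,l) = (adj W * H1) $$ (k,l) + (adj W * H2) $$ (k,l)"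
      using carrier_matD[OF Wc] carrier_matD[OF H2c] that by (simp del: index_mult_mat(1))
    then have "\<bar>a k l - b k l\<bar> \<le> c k l"
      unfolding a_def b_def c_def by (metis add_diff_cancel_left' norm_triangle_ineq3)
    moreover have n: "0 \<le> a k l" "0 \<le> b k l" "0 \<le> c k l" by (simp_all add: a_def b_def c_def)
    moreover have "(a k l)\<^sup>2 - (b k l)\<^sup>2 = (a k l - b k l) * (a k l + b k l)"
      by (simp add: power2_eq_square algebra_simps)
    then have "\<bar>(a k l)\<^sup>2 - (b k l)\<^sup>2\<bar> = \<bar>a k l - b k l\<bar> * (a k l + b k l)"
      using n by (simp add: abs_mult)
    ultimately show ?thesis
      using mult_right_mono[of "\<bar>a k l - b k l\<bar>" "c k l" "a k l + b k l"] by (simp add: distrib_left)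
  qed
  have l2: "(\<Sum>k<D. \<bar>(a k l)\<^sup>2 - (b k l)\<^sup>2\<bar>) \<le> 2 * sqrt (e l)" if l: "l < D" for l
  proof -
    have "(\<Sum>k<D. \<bar>(a k l)\<^sup>2 - (b k l)\<^sup>2\<bar>) \<le> (\<Sum>k<D. \<bar>c k l\<bar> * \<bar>a k l\<bar>) + (\<Sum>k<D. \<bar>c k l\<bar> * \<bar>b k l\<bar>)"
      unfolding sum.distrib[symmetric] by (intro sum_mono tri l) auto
    also have "\<dots> \<le> L2_set (\<lambda>k. c k l) {..<D} * L2_set (\<lambda>k. a k l) {..<D} + L2_set (\<lambda>k. c k l) {..<D} * L2_set (\<lambda>k. b k l) {..<D}"
      by (intro add_mono L2_set_mult_ineq)
    also have "\<dots> \<le> sqrt (e l) * 1 + sqrt (e l) * 1"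
      using sa[OF l] sb[OF l] sc[OF l] e0[of l] by (intro add_mono mult_mono) (auto simp: L2_set_def intro!: sum_nonneg)
    finally show ?thesis by simp
  qed
  have zk: "z k = (\<Sum>l<D. x l * ((a k l)\<^sup>2 - (b k l)\<^sup>2))" if k: "k < D" for k
  proof -
    have "adj W * Z * W = adj W * udg D H x * W - adj W * udg D H1 x * W"
    proof -
      have u: "udg D H x \<in> carrier_mat D D" "udg D H1 x \<in> carrier_mat D D" using Hc H1c by auto
      have "adj W * Z = adj W * udg D H x - adj W * udg D H1 x"
        unfolding Z_def by (rule mult_minus_distrib_mat[of _ D D]) (use u Wc in auto)
      moreover have "(adj W * udg D H x - adj W * udg D H1 x) * W = adj W * udg D H x * W - adj W * udg D H1 x * W"
        by (rule minus_mult_distrib_mat[of _ D D]) (use u Wc in auto)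
      ultimately show ?thesis by simp
    qed
    also have "\<dots> = udg D (adj W * H) x - udg D (adj W * H1) x"
      using udg_change_basis[OF Wc Hc] udg_change_basis[OF Wc H1c] by simp
    finally have "dg D z = udg D (adj W * H) x - udg D (adj W * H1) x"
      unfolding W(2) diag_of_udg[OF W(1)] .
    then have "dg D z $$ (k,k) = udg D (adj W * H) x $$ (k,k) - udg D (adj W * H1) x $$ (k,k)"
      using k carrier_matD[OF Wc] by simp
    also have "\<dots> = of_real ((\<Sum>l<D. x l * (a k l)\<^sup>2) - (\<Sum>l<D. x l * (b k l)\<^sup>2))"
      using udg_diag_entry[of "adj W * H" D k x] udg_diag_entry[of "adj W * H1" D k x] k Wc Hc H1c
      by (simp add: a_def b_def mult_square del: index_mult_mat(1) of_real_sum)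
    finally have "complex_of_real (z k) = of_real ((\<Sum>l<D. x l * (a k l)\<^sup>2) - (\<Sum>l<D. x l * (b k l)\<^sup>2))"
      using k by (simp del: of_real_sum of_real_diff)
    then show ?thesis unfolding of_real_eq_iff by (simp add: sum_subtractf algebra_simps)
  qed
  have "trace_norm Z = (\<Sum>k<D. \<bar>\<Sum>l<D. x l * ((a k l)\<^sup>2 - (b k l)\<^sup>2)\<bar>)"
    unfolding W(2) trace_norm_udg[OF W(1)] by (simp add: zk)
  also have "\<dots> \<le> (\<Sum>k<D. \<Sum>l<D. x l * \<bar>(a k l)\<^sup>2 - (b k l)\<^sup>2\<bar>)"
    by (intro sum_mono order_trans[OF sum_abs]) (auto simp: abs_mult x)
  also have "\<dots> = (\<Sum>l<D. x l * (\<Sum>k<D. \<bar>(a k l)\<^sup>2 - (b k l)\<^sup>2\<bar>))"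
    by (subst sum.swap) (simp add: sum_distrib_left)
  also have "\<dots> \<le> (\<Sum>l<D. x l * (2 * sqrt (e l)))"
    by (intro sum_mono mult_left_mono l2 x) auto
  \<comment> \<open>Second use of Cauchy-Schwarz, now over l. Splitting x l into two square roots
    lets the total weight, at most one, absorb the first factor.\<close>
  also have "\<dots> = 2 * (\<Sum>l<D. \<bar>sqrt (x l)\<bar> * \<bar>sqrt (x l * e l)\<bar>)"
    unfolding sum_distrib_left
    by (intro sum.cong refl) (simp add: x real_sqrt_mult real_sqrt_mult_self e0)
  also have "\<dots> \<le> 2 * (L2_set (\<lambda>l. sqrt (x l)) {..<D} * L2_set (\<lambda>l. sqrt (x l * e l)) {..<D})"
    by (intro mult_left_mono L2_set_mult_ineq) auto
  also have "\<dots> = 2 * (sqrt (\<Sum>l<D. x l) * sqrt (\<Sum>l<D. x l * e l))"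
    by (simp add: L2_set_def x e0)
  also have "\<dots> \<le> 2 * (1 * sqrt (\<Sum>l<D. x l * e l))"
    using x e0 by (intro mult_left_mono mult_right_mono) (auto intro!: sum_nonneg)
  finally show ?thesis unfolding Z_def e_def by simp
qed

lemma unitary_block_extend:
  assumes E0: "unitary m E0" and m: "m \<le> D"
  defines "R \<equiv> mat D D (\<lambda>(i,j). if i < m \<and> j < m then E0 $$ (i,j) else if i = j then 1 else 0)"
  shows "unitary D R"
proof -
  note E = unitaryD[OF E0]
  have R: "R = four_block_mat E0 (0\<^sub>m m (D - m)) (0\<^sub>m (D - m) m) (1\<^sub>m (D - m))"
    using E(1) m by (intro eq_matI) (auto simp: R_def)
  have aR: "adj R = four_block_mat (adj E0) (0\<^sub>m m (D - m)) (0\<^sub>m (D - m) m) (1\<^sub>m (D - m))"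
    unfolding R using E(1) m by (intro eq_matI) auto
  have "adj R * R = four_block_mat (adj E0 * E0) (0\<^sub>m m (D - m)) (0\<^sub>m (D - m) m) (1\<^sub>m (D - m))"
    unfolding aR unfolding R using E(1) m
    by (subst mult_four_block_mat[of _ m m _ "D - m" _ "D - m" _ _ m _ "D - m"]) auto
  also have "\<dots> = 1\<^sub>m D" unfolding E(2) using m by (intro eq_matI) auto
  finally show ?thesis unfolding unitary_def by (simp add: R_def)
qed

lemma sum_if_lt:
  fixes f :: "nat \<Rightarrow> 'a::comm_monoid_add"
  shows "m \<le> D \<Longrightarrow> (\<Sum>l<D. if l < m then f l else 0) = (\<Sum>l<m. f l)"
proof -
  assume m: "m \<le> D"
  have "{..<D} \<inter> {l. l < m} = {..<m}" using m by auto
  then show ?thesis by (simp add: sum.If_cases)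
qed

text \<open>Diagonalising the compression of the typical part of a state to the span of the first
  \<open>m\<close> columns of \<open>V\<close>, without touching the remaining columns.\<close>

lemma compress:
  assumes X: "density D X" and V: "unitary D V" and m: "m \<le> D" and \<Delta>: "0 < \<Delta>"
    and tail: "Re (mtrace (udg D V (\<lambda>i. if i < m then 0 else 1) * X)) \<le> \<epsilon>"
    and info: "spec_sum (\<lambda>x. x * (ln x + h)\<^sup>2) X \<le> \<epsilon> * \<Delta>\<^sup>2"
  obtains E \<xi> where "unitary D E"
    "\<And>r i. r < D \<Longrightarrow> m \<le> i \<Longrightarrow> i < D \<Longrightarrow> E $$ (r,i) = V $$ (r,i)"
    "antimono \<xi>" "\<And>i. 0 \<le> \<xi> i" "\<And>i. \<xi> i \<le> exp (- (h - \<Delta>))" "\<And>i. m \<le> i \<Longrightarrow> \<xi> i = 0"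
    "real (card {i. i < m \<and> 0 < \<xi> i}) \<le> exp (h + \<Delta>)"
    "1 - 2 * \<epsilon> \<le> (\<Sum>i<m. \<xi> i)" "(\<Sum>i<m. \<xi> i) \<le> 1"
    "trace_norm (X - udg D E \<xi>) \<le> \<epsilon> + 2 * sqrt \<epsilon>"
proof -
  obtain W x where W: "unitary D W" "X = udg D W x" "\<And>i. i < D \<Longrightarrow> 0 \<le> x i" "(\<Sum>i<D. x i) = 1"
    using density_spectral[OF X] by metis
  note Vc = unitaryD(1)[OF V] note Wc = unitaryD(1)[OF W(1)] note Xc = density_carrier[OF X]
  \<comment> \<open>Indices of the typical eigenvalues, those between exp (- (h + \<Delta>)) and exp
    (- (h - \<Delta>)).\<close>
  define T where "T = {l. l < D \<and> 0 < x l \<and> \<bar>ln (x l) + h\<bar> \<le> \<Delta>}"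
  define xt where "xt l = (if l \<in> T then x l else 0)" for l
  have T: "T \<subseteq> {..<D}" "finite T" by (auto simp: T_def)
  have xt0: "0 \<le> xt l" "xt l \<le> x l" if "l < D" for l using W(3)[OF that] by (auto simp: xt_def)
  \<comment> \<open>Chebyshev's inequality for - ln x: a positive eigenvalue outside T deviates from
    h by more than \<Delta>.\<close>
  have cheb: "(\<Sum>l<D. x l - xt l) \<le> \<epsilon>"
  proof -
    have "(\<Sum>l<D. (x l - xt l) * \<Delta>\<^sup>2) \<le> (\<Sum>l<D. x l * (ln (x l) + h)\<^sup>2)"
    proof (intro sum_mono)
      fix l assume "l \<in> {..<D}"
      then have l: "l < D" by simp
      show "(x l - xt l) * \<Delta>\<^sup>2 \<le> x l * (ln (x l) + h)\<^sup>2"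
      proof (cases "l \<in> T \<or> x l = 0")
        case True
        then show ?thesis using W(3)[OF l] by (auto simp: xt_def)
      next
        case False
        then have "\<Delta> \<le> \<bar>ln (x l) + h\<bar>" using l W(3)[OF l] by (auto simp: T_def)
        then have "\<Delta>\<^sup>2 \<le> (ln (x l) + h)\<^sup>2" using \<Delta> by (simp add: abs_le_square_iff[symmetric])
        then show ?thesis using False W(3)[OF l] by (auto simp: xt_def intro: mult_left_mono)
      qed
    qed
    also have "\<dots> \<le> \<epsilon> * \<Delta>\<^sup>2" using info unfolding W(2) spec_sum_udg[OF W(1)] .
    finally have "(\<Sum>l<D. x l - xt l) * \<Delta>\<^sup>2 \<le> \<epsilon> * \<Delta>\<^sup>2" by (simp add: sum_distrib_right)
    then show ?thesis using \<Delta> by (simp add: mult_le_cancel_right)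
  qed
  have xts: "(\<Sum>l<D. xt l) \<le> 1" "1 - \<epsilon> \<le> (\<Sum>l<D. xt l)"
    using cheb sum_mono[of "{..<D}" xt x] xt0 W(4) by (auto simp: sum_subtractf)
  have xtb: "xt l \<le> exp (- (h - \<Delta>))" for l
  proof (cases "l \<in> T")
    case True
    then have "ln (x l) \<le> - (h - \<Delta>)" "0 < x l" by (auto simp: T_def)
    then have "x l \<le> exp (- (h - \<Delta>))" by (metis exp_le_cancel_iff exp_ln)
    then show ?thesis using True by (simp add: xt_def)
  qed (simp add: xt_def)
  have cardT: "real (card T) \<le> exp (h + \<Delta>)"
  proof -
    have "exp (- (h + \<Delta>)) \<le> xt l" if "l \<in> T" for l
    proof -
      from that have "- (h + \<Delta>) \<le> ln (x l)" "0 < x l" by (auto simp: T_def)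
      then have "exp (- (h + \<Delta>)) \<le> x l" by (metis exp_le_cancel_iff exp_ln)
      then show ?thesis using that by (simp add: xt_def)
    qed
    then have "(\<Sum>l\<in>T. exp (- (h + \<Delta>))) \<le> (\<Sum>l\<in>T. xt l)" by (intro sum_mono) auto
    also have "\<dots> \<le> (\<Sum>l<D. xt l)" using T xt0 by (intro sum_mono2) auto
    finally have "real (card T) * exp (- (h + \<Delta>)) \<le> 1" using xts by simp
    then have "real (card T) * exp (- (h + \<Delta>)) * exp (h + \<Delta>) \<le> 1 * exp (h + \<Delta>)"
      by (intro mult_right_mono) auto
    then show ?thesis by (simp add: mult.assoc exp_add[symmetric] mult_exp_exp)
  qed
  define G where "G = adj V * W"
  have G: "unitary D G" unfolding G_def by (intro unitary_mult unitary_adj V W)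
  note Gc = unitaryD(1)[OF G]
  \<comment> \<open>With G = \<open>adj V * W\<close> this is the upper left corner of the typical
    part written in the basis V.\<close>
  define N where "N = mat m m (\<lambda>(i,j). udg D G xt $$ (i,j))"
  have hN: "hermitian m N"
  proof -
    have "adj (udg D G xt) $$ (i,j) = udg D G xt $$ (i,j)" for i j
      using hermitianD(2)[OF udg_hermitian[OF Gc]] by simp
    then have "cnj (udg D G xt $$ (j,i)) = udg D G xt $$ (i,j)" if "i < m" "j < m" for i j
      using that m carrier_matD[OF Gc] by (metis adj_entry order_less_le_trans udg_dims)
    then show ?thesis unfolding hermitian_def by (auto simp: N_def intro!: eq_matI)
  qed
  from spectral[OF hN] obtain E0 \<xi>0 where E0: "unitary m E0" "N = udg m E0 \<xi>0"
    and dec: "\<And>i j. i \<le> j \<Longrightarrow> j < m \<Longrightarrow> \<xi>0 j \<le> \<xi>0 i" by metis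
  note E0c = unitaryD(1)[OF E0(1)]
  \<comment> \<open>E = V * R rotates only the first m columns of V, so the complement of the
    subspace keeps its basis.\<close>
  define R where "R = mat D D (\<lambda>(i,j). if i < m \<and> j < m then E0 $$ (i,j) else if i = j then 1 else 0)"
  have R: "unitary D R" unfolding R_def by (rule unitary_block_extend[OF E0(1) m])
  note Rc = unitaryD(1)[OF R]
  define E where "E = V * R"
  have E: "unitary D E" unfolding E_def by (rule unitary_mult[OF V R])
  note Ec = unitaryD(1)[OF E]
  define \<xi> where "\<xi> i = (if i < m then \<xi>0 i else 0)" for i
  have EV: "E $$ (r,i) = V $$ (r,i)" if "r < D" "m \<le> i" "i < D" for r i
  proof -
    have "E $$ (r,i) = (\<Sum>l<D. if l = i then V $$ (r,i) else 0)"
      unfolding E_def mult_entry[OF Vc Rc that(1,3)]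
      by (intro sum.cong refl) (use that in \<open>auto simp: R_def\<close>)
    then show ?thesis using that by simp
  qed
  define H where "H = adj E * W"
  have H: "unitary D H" unfolding H_def by (intro unitary_mult unitary_adj E W)
  note Hc = unitaryD(1)[OF H]
  have HG: "H = adj R * G"
    unfolding H_def E_def G_def using carrier_matD[OF Rc] carrier_matD[OF Vc] carrier_matD[OF Wc]
    by (simp add: adj_mult' mat_assoc)
  have Hij: "H $$ (i,l) = (\<Sum>r<m. cnj (E0 $$ (r,i)) * G $$ (r,l))" if "i < m" "l < D" for i l
  proof -
    have iD: "i < D" using that m by simp
    have "H $$ (i,l) = (\<Sum>r<D. if r < m then cnj (E0 $$ (r,i)) * G $$ (r,l) else 0)"
      unfolding HG mult_entry[OF adj_carrier[OF Rc] Gc iD that(2)]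
      by (intro sum.cong refl) (use that iD in \<open>auto simp: R_def\<close>)
    then show ?thesis by (simp add: sum_if_lt[OF m])
  qed
  have diag: "udg D H xt $$ (i,j) = (if i = j then of_real (\<xi> i) else 0)" if ij: "i < m" "j < m" for i j
  proof -
    have "udg D H xt $$ (i,j) = (\<Sum>l<D. of_real (xt l) * (H $$ (i,l) * cnj (H $$ (j,l))))"
      using udg_entry[OF Hc] ij m by simp
    also have "\<dots> = (\<Sum>l<D. \<Sum>r<m. \<Sum>s<m. cnj (E0 $$ (r,i)) * E0 $$ (s,j) * (of_real (xt l) * (G $$ (r,l) * cnj (G $$ (s,l)))))"
      by (intro sum.cong refl) (simp add: Hij ij sum_product sum_distrib_left mult_ac)
    also have "\<dots> = (\<Sum>r<m. \<Sum>s<m. \<Sum>l<D. cnj (E0 $$ (r,i)) * E0 $$ (s,j) * (of_real (xt l) * (G $$ (r,l) * cnj (G $$ (s,l)))))"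
      by (subst sum.swap) (intro sum.cong refl sum.swap)
    also have "\<dots> = (\<Sum>r<m. \<Sum>s<m. cnj (E0 $$ (r,i)) * E0 $$ (s,j) * udg D G xt $$ (r,s))"
      using m by (intro sum.cong refl) (simp add: udg_entry[OF Gc] sum_distrib_left)
    also have "\<dots> = (\<Sum>s<m. (\<Sum>r<m. cnj (E0 $$ (r,i)) * N $$ (r,s)) * E0 $$ (s,j))"
      by (subst sum.swap) (simp add: N_def sum_distrib_right sum_distrib_left mult_ac)
    also have "\<dots> = (adj E0 * N * E0) $$ (i,j)"
    proof -
      have Nc: "N \<in> carrier_mat m m" using hN hermitianD by auto
      have "(adj E0 * N) $$ (i,s) = (\<Sum>r<m. cnj (E0 $$ (r,i)) * N $$ (r,s))" if "s < m" for s
        using mult_entry[OF adj_carrier[OF E0c] Nc ij(1) that] E0c ij by simp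
      then show ?thesis using mult_entry[of "adj E0 * N" m m E0 m i j] E0c Nc ij by simp
    qed
    also have "\<dots> = dg m \<xi>0 $$ (i,j)" unfolding E0(2) diag_of_udg[OF E0(1)] ..
    finally show ?thesis using ij by (simp add: \<xi>_def)
  qed
  have \<xi>i: "\<xi> i = (\<Sum>l<D. xt l * (cmod (H $$ (i,l)))\<^sup>2)" if "i < m" for i
  proof -
    have "complex_of_real (\<xi> i) = of_real (\<Sum>l<D. xt l * (cmod (H $$ (i,l)))\<^sup>2)"
      using diag[OF that that] udg_diag_entry[OF Hc, of i xt] that m by (simp del: of_real_sum)
    then show ?thesis unfolding of_real_eq_iff .
  qed
  have nn: "0 \<le> \<xi> i" for i
    by (cases "i < m") (auto simp: \<xi>i xt0 intro!: sum_nonneg, simp add: \<xi>_def)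
  have anti: "antimono \<xi>"
  proof (rule antimonoI)
    fix i j :: nat assume "i \<le> j"
    then show "\<xi> j \<le> \<xi> i" using nn[of i] dec[of i j] by (cases "j < m") (auto simp: \<xi>_def)
  qed
  \<comment> \<open>The typical cut precedes the compression because its bounds survive: here since
    the rows of H are unit vectors, and below for the rank since a compression cannot raise
    it.\<close>
  have ub: "\<xi> i \<le> exp (- (h - \<Delta>))" for i
  proof (cases "i < m")
    case True
    have "\<xi> i \<le> (\<Sum>l<D. exp (- (h - \<Delta>)) * (cmod (H $$ (i,l)))\<^sup>2)"
      unfolding \<xi>i[OF True] by (intro sum_mono mult_right_mono xtb) auto
    also have "\<dots> = exp (- (h - \<Delta>))"
      using unitary_rows[OF H, of i] True m by (simp add: sum_distrib_left[symmetric])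
    finally show ?thesis .
  qed (simp add: \<xi>_def)
  \<comment> \<open>The weight of the typical part outside the subspace. It is at most the tail of
    X, since V and E have the same projector onto the complement.\<close>
  define e where "e = (\<Sum>l<D. xt l * (\<Sum>i=m..<D. (cmod (H $$ (i,l)))\<^sup>2))"
  have ee: "e \<le> \<epsilon>"
  proof -
    have "udg D V (\<lambda>i. if i < m then 0 else 1) = udg D E (\<lambda>i. if i < m then 0 else 1)"
      by (rule eq_matI) (use Vc Ec EV in \<open>auto simp: udg_entry intro!: sum.cong\<close>)
    then have "mtrace (udg D V (\<lambda>i. if i < m then 0 else 1) * X) =
      (\<Sum>i<D. of_real (if i < m then 0 else 1) * (adj E * X * E) $$ (i,i))"
      using udg_diag[OF Ec Xc] by simp
    also have "\<dots> = (\<Sum>i=m..<D. (adj E * X * E) $$ (i,i))"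
      by (rule sum.mono_neutral_cong_right) auto
    also have "\<dots> = (\<Sum>i=m..<D. of_real (\<Sum>l<D. x l * (cmod (H $$ (i,l)))\<^sup>2))"
      unfolding W(2) udg_change_basis[OF Ec Wc] H_def[symmetric] by (intro sum.cong refl udg_diag_entry[OF Hc]) auto
    finally have "Re (mtrace (udg D V (\<lambda>i. if i < m then 0 else 1) * X)) = (\<Sum>i=m..<D. \<Sum>l<D. x l * (cmod (H $$ (i,l)))\<^sup>2)"
      by (simp del: of_real_sum add: of_real_sum[symmetric])
    moreover have "e \<le> (\<Sum>l<D. x l * (\<Sum>i=m..<D. (cmod (H $$ (i,l)))\<^sup>2))"
      unfolding e_def by (intro sum_mono mult_right_mono sum_nonneg) (auto simp: xt0)
    moreover have "(\<Sum>l<D. x l * (\<Sum>i=m..<D. (cmod (H $$ (i,l)))\<^sup>2)) = (\<Sum>i=m..<D. \<Sum>l<D. x l * (cmod (H $$ (i,l)))\<^sup>2)"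
      by (subst sum.swap) (simp add: sum_distrib_left)
    ultimately show ?thesis using tail by linarith
  qed
  have e0: "0 \<le> e" unfolding e_def by (intro sum_nonneg mult_nonneg_nonneg) (auto simp: xt0)
  \<comment> \<open>The typical cut loses at most \<epsilon> and the compression loses e <=
    \<epsilon>; together they give the lower bound 1 - 2 * \<epsilon>.\<close>
  have tot: "(\<Sum>i<m. \<xi> i) = (\<Sum>l<D. xt l) - e"
  proof -
    have "(\<Sum>l<D. xt l) = (\<Sum>l<D. xt l * ((\<Sum>i<m. (cmod (H $$ (i,l)))\<^sup>2) + (\<Sum>i=m..<D. (cmod (H $$ (i,l)))\<^sup>2)))"
    proof (intro sum.cong refl)
      fix l assume "l \<in> {..<D}"
      then show "xt l = xt l * ((\<Sum>i<m. (cmod (H $$ (i,l)))\<^sup>2) + (\<Sum>i=m..<D. (cmod (H $$ (i,l)))\<^sup>2))"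
        using unitary_cols[OF H, of l] sum.atLeastLessThan_concat[of 0 m D "\<lambda>i. (cmod (H $$ (i,l)))\<^sup>2"] m
        by (simp add: atLeast0LessThan)
    qed
    also have "\<dots> = (\<Sum>l<D. \<Sum>i<m. xt l * (cmod (H $$ (i,l)))\<^sup>2) + e"
      by (simp add: e_def distrib_left sum.distrib sum_distrib_left)
    also have "(\<Sum>l<D. \<Sum>i<m. xt l * (cmod (H $$ (i,l)))\<^sup>2) = (\<Sum>i<m. \<xi> i)"
      by (subst sum.swap) (simp add: \<xi>i)
    finally show ?thesis by simp
  qed
  have rank: "card {i. i < m \<and> 0 < \<xi> i} \<le> card T"
    by (rule compression_rank[OF Hc m, of xt]) (use xt0 T diag in \<open>auto simp: xt_def\<close>)
  have tn: "trace_norm (X - udg D E \<xi>) \<le> \<epsilon> + 2 * sqrt \<epsilon>"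
  proof -
    define H1 where "H1 = mat D D (\<lambda>(i,l). if i < m then H $$ (i,l) else 0)"
    have H1c: "H1 \<in> carrier_mat D D" by (simp add: H1_def)
    have H1x: "udg D H1 xt = dg D \<xi>"
    proof (rule eq_matI)
      fix i j assume "i < dim_row (dg D \<xi>)" "j < dim_col (dg D \<xi>)"
      then have ij: "i < D" "j < D" by auto
      show "udg D H1 xt $$ (i,j) = dg D \<xi> $$ (i,j)"
      proof (cases "i < m \<and> j < m")
        case True
        then have "udg D H1 xt $$ (i,j) = udg D H xt $$ (i,j)"
          unfolding udg_entry[OF H1c ij] udg_entry[OF Hc ij] by (intro sum.cong refl) (use ij in \<open>auto simp: H1_def\<close>)
        then show ?thesis using diag True ij by simp
      next
        case False
        then have "udg D H1 xt $$ (i,j) = 0"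
          unfolding udg_entry[OF H1c ij] by (intro sum.neutral) (use ij in \<open>auto simp: H1_def\<close>)
        then show ?thesis using False ij by (auto simp: \<xi>_def)
      qed
    qed (use H1c in auto)
    have hx: "hermitian D (udg D W xt)" "hermitian D (udg D E \<xi>)" by (intro udg_hermitian Wc Ec)+
    have 1: "trace_norm (X - udg D W xt) \<le> \<epsilon>"
      unfolding W(2) udg_minus[OF Wc] trace_norm_udg[OF W(1)] using cheb xt0 by simp
    \<comment> \<open>Conjugation by E turns the truncation of coordinates in H into the compression
      of the typical part of X.\<close>
    have "E * (udg D H xt - udg D H1 xt) * adj E = udg D W xt - udg D E \<xi>"
    proof -
      have a: "E * (udg D H xt - udg D H1 xt) = E * udg D H xt - E * udg D H1 xt"
        by (rule mult_minus_distrib_mat[of _ D D]) (use Ec Hc H1c in auto)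
      have b: "(E * udg D H xt - E * udg D H1 xt) * adj E = E * udg D H xt * adj E - E * udg D H1 xt * adj E"
        by (rule minus_mult_distrib_mat[of _ D D]) (use Ec Hc H1c in auto)
      have "E * H = (E * adj E) * W"
        unfolding H_def using carrier_matD[OF Ec] carrier_matD[OF Wc] by (simp add: mat_assoc)
      then have "E * H = W" using unitaryD(3)[OF E] Wc by simp
      then have "E * udg D H xt * adj E = udg D W xt" using udg_conj[OF Ec Hc] by simp
      moreover have "E * udg D H1 xt * adj E = udg D E \<xi>" unfolding H1x by (simp add: udg_def)
      ultimately show ?thesis unfolding a b by simp
    qed
    moreover have "hermitian D (udg D H xt - udg D H1 xt)" by (intro hermitian_minus udg_hermitian Hc H1c)
    ultimately have "trace_norm (udg D W xt - udg D E \<xi>) = trace_norm (udg D H xt - udg D H1 xt)"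
      using trace_norm_conj[OF _ E] by metis
    also have "\<dots> \<le> 2 * sqrt e"
      unfolding e_def H1_def by (rule gentle_truncation[OF H]) (use xt0 xts in auto)
    also have "\<dots> \<le> 2 * sqrt \<epsilon>" using ee by simp
    finally show ?thesis
      using 1 trace_norm_triangle_minus[OF density_hermitian[OF X] hx] by linarith
  qed
  show ?thesis
    by (rule that[OF E EV anti nn ub _ _ _ _ tn])
      (use rank cardT tot xts ee e0 in \<open>auto simp: \<xi>_def\<close>)
qed

section \<open>Almost-commuting unitaries\<close>

lemma msum_carrier [simp]: "(\<And>j. j < c \<Longrightarrow> f j \<in> carrier_mat d d) \<Longrightarrow> msum d f c \<in> carrier_mat d d"
  by (induct c) auto

lemma msum_hermitian: "(\<And>j. j < c \<Longrightarrow> hermitian d (f j)) \<Longrightarrow> hermitian d (msum d f c)"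
proof (induct c)
  case 0
  then show ?case by (auto simp: hermitian_def intro!: eq_matI)
next
  case (Suc c)
  then show ?case by (simp add: hermitian_add)
qed

lemma cinner_add_right: "dim_vec u = dim_vec v \<Longrightarrow> cinner w (u + v) = cinner w u + cinner w v"
  by (simp add: cinner_def sum.distrib ring_distribs)

lemma cinner_msum:
  assumes "\<And>j. j < c \<Longrightarrow> f j \<in> carrier_mat d d" "u \<in> carrier_vec d"
  shows "cinner u (msum d f c *\<^sub>v u) = (\<Sum>j<c. cinner u (f j *\<^sub>v u))"
  using assms(1)
proof (induct c)
  case 0
  have "0\<^sub>m d d *\<^sub>v u = 0\<^sub>v d" using assms(2) by (intro eq_vecI) auto
  then show ?case by (simp add: cinner_def)
next
  case (Suc c)
  have "(msum d f c + f c) *\<^sub>v u = msum d f c *\<^sub>v u + f c *\<^sub>v u"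
    using Suc(2) assms(2) by (intro add_mult_distrib_mat_vec[of _ d d]) auto
  then show ?case using Suc carrier_matD(1)[OF msum_carrier, of c f d] carrier_matD(1)[OF Suc(2)[of c]]
    by (simp add: cinner_add_right)
qed

lemma mtrace_mult_msum:
  assumes "\<And>j. j < c \<Longrightarrow> f j \<in> carrier_mat d d" "X \<in> carrier_mat d d"
  shows "mtrace (X * msum d f c) = (\<Sum>j<c. mtrace (X * f j))"
  using assms(1)
proof (induct c)
  case 0
  have "X * 0\<^sub>m d d = 0\<^sub>m d d" using assms(2) by (rule right_mult_zero_mat)
  then show ?case by (simp add: mtrace_def)
next
  case (Suc c)
  have "X * (msum d f c + f c) = X * msum d f c + X * f c"
    using Suc(2) assms(2) by (intro mult_add_distrib_mat[of _ d d _ d]) auto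
  moreover have "mtrace (X * msum d f c + X * f c) = mtrace (X * msum d f c) + mtrace (X * f c)"
    using Suc(2) assms(2) by (intro mtrace_add[of _ d] mult_square) auto
  ultimately show ?case using Suc by simp
qed

lemma dg_mult_vec: "w \<in> carrier_vec d \<Longrightarrow> l < d \<Longrightarrow> (dg d q *\<^sub>v w) $ l = of_real (q l) * w $ l"
proof -
  assume w: "w \<in> carrier_vec d" "l < d"
  have "(dg d q *\<^sub>v w) $ l = (\<Sum>k<d. if k = l then of_real (q l) * w $ l else 0)"
    unfolding mult_vec_entry[OF dg_carrier w] by (intro sum.cong refl) (use w in auto)
  then show ?thesis using w by (simp del: index_mult_mat_vec)
qed

lemma cinner_sum_squares:
  assumes B: "\<And>j. j < c \<Longrightarrow> hermitian D (B j)" and u: "u \<in> carrier_vec D"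
  shows "cinner u (msum D (\<lambda>j. B j * B j) c *\<^sub>v u) = of_real (\<Sum>j<c. (vnorm (B j *\<^sub>v u))\<^sup>2)"
proof -
  have Bc: "B j \<in> carrier_mat D D" if "j < c" for j using hermitianD(1)[OF B[OF that]] .
  have sq: "cinner u ((B j * B j) *\<^sub>v u) = of_real ((vnorm (B j *\<^sub>v u))\<^sup>2)" if "j < c" for j
  proof -
    have Bu: "B j *\<^sub>v u \<in> carrier_vec D" using mult_mat_vec_carrier[OF Bc[OF that] u] .
    have "cinner u ((B j * B j) *\<^sub>v u) = cinner u (B j *\<^sub>v (B j *\<^sub>v u))"
      using Bc[OF that] u by (simp add: assoc_mult_mat_vec[of _ D D _ D])
    also have "\<dots> = cinner (adj (B j) *\<^sub>v u) (B j *\<^sub>v u)" by (rule cinner_adj[OF Bc[OF that] u Bu])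
    finally show ?thesis using hermitianD(2)[OF B[OF that]] by (simp add: cinner_self)
  qed
  show ?thesis
    using cinner_msum[of c "\<lambda>j. B j * B j" D u] Bc u by (simp add: sq mult_square)
qed

text \<open>For u in the span of the low eigenvectors the squared norms of all B j u add up to the
  quadratic form of the sum of squares, which is at most the square of \<delta> times that of the
  norm of u. Each summand obeys the same bound, although the B j have no common
  eigenvectors.\<close>

lemma spectral_subspace_bound:
  assumes B: "\<And>j. j < c \<Longrightarrow> hermitian D (B j)"
    and V: "unitary D V" and C: "msum D (\<lambda>j. B j * B j) c = udg D V q"
    and q: "\<And>i. i < m \<Longrightarrow> i < D \<Longrightarrow> q i \<le> \<delta>\<^sup>2" and \<delta>: "0 \<le> \<delta>" and j: "j < c"
  shows "opb \<delta> (B j * udg D V (\<lambda>i. if i < m then 1 else 0))"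
  unfolding opb_def
proof
  note Vc = unitaryD(1)[OF V]
  let ?p = "\<lambda>i. if i < m then 1 else 0 :: real"
  fix v :: "complex vec" assume "v \<in> carrier_vec (dim_col (B j * udg D V ?p))"
  then have v: "v \<in> carrier_vec D" using Vc by simp
  define w where "w = adj V *\<^sub>v v"
  have w: "w \<in> carrier_vec D" unfolding w_def using mult_mat_vec_carrier[OF adj_carrier[OF Vc] v] .
  define u where "u = udg D V ?p *\<^sub>v v"
  have u: "u \<in> carrier_vec D" unfolding u_def using mult_mat_vec_carrier[OF udg_carrier[OF Vc] v] .
  have dw: "dg D ?p *\<^sub>v w \<in> carrier_vec D" using mult_mat_vec_carrier[OF dg_carrier w] .
  have uV: "u = V *\<^sub>v (dg D ?p *\<^sub>v w)"
    unfolding u_def w_def udg_def using Vc v w by (simp add: assoc_mult_mat_vec[of _ D D _ D] w_def)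
  have Vu: "adj V *\<^sub>v u = dg D ?p *\<^sub>v w"
  proof -
    have "adj V *\<^sub>v u = (adj V * V) *\<^sub>v (dg D ?p *\<^sub>v w)"
      unfolding uV using Vc dw by (subst assoc_mult_mat_vec[of _ D D _ D]) auto
    then show ?thesis using unitaryD(2)[OF V] dw by simp
  qed
  have Bc: "B j \<in> carrier_mat D D" if "j < c" for j using hermitianD(1)[OF B[OF that]] .
  have "complex_of_real (\<Sum>j<c. (vnorm (B j *\<^sub>v u))\<^sup>2) = cinner u (msum D (\<lambda>j. B j * B j) c *\<^sub>v u)"
    by (rule cinner_sum_squares[OF B u, symmetric])
  also have "\<dots> = of_real (\<Sum>l<D. q l * (cmod ((adj V *\<^sub>v u) $ l))\<^sup>2)"
    unfolding C by (rule cinner_udg[OF Vc u])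
  finally have "(\<Sum>j<c. (vnorm (B j *\<^sub>v u))\<^sup>2) = (\<Sum>l<D. q l * (cmod ((adj V *\<^sub>v u) $ l))\<^sup>2)"
    unfolding of_real_eq_iff .
  also have "\<dots> \<le> (\<Sum>l<D. \<delta>\<^sup>2 * (cmod (w $ l))\<^sup>2)"
  proof (intro sum_mono)
    fix l assume "l \<in> {..<D}"
    then have l: "l < D" by simp
    show "q l * (cmod ((adj V *\<^sub>v u) $ l))\<^sup>2 \<le> \<delta>\<^sup>2 * (cmod (w $ l))\<^sup>2"
      unfolding Vu dg_mult_vec[OF w l] using q[OF _ l] by (auto intro: mult_right_mono)
  qed
  also have "\<dots> = (\<delta> * vnorm w)\<^sup>2"
    using w by (simp add: vnorm_sq power_mult_distrib sum_distrib_left)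
  also have "vnorm w = vnorm v" unfolding w_def by (rule vnorm_unitary[OF unitary_adj[OF V] v])
  finally have "(\<Sum>j<c. (vnorm (B j *\<^sub>v u))\<^sup>2) \<le> (\<delta> * vnorm v)\<^sup>2" .
  moreover have "(vnorm (B j *\<^sub>v u))\<^sup>2 \<le> (\<Sum>j<c. (vnorm (B j *\<^sub>v u))\<^sup>2)"
    by (rule member_le_sum[of j "{..<c}" "\<lambda>j. (vnorm (B j *\<^sub>v u))\<^sup>2"]) (use j in auto)
  ultimately have "(vnorm (B j *\<^sub>v u))\<^sup>2 \<le> (\<delta> * vnorm v)\<^sup>2" by (rule order_trans[rotated])
  then have "vnorm (B j *\<^sub>v u) \<le> \<delta> * vnorm v"
    by (rule power2_le_imp_le) (rule mult_nonneg_nonneg[OF \<delta> vnorm_nonneg])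
  moreover have "B j * udg D V ?p *\<^sub>v v = B j *\<^sub>v u"
    unfolding u_def using Bc[OF j] udg_carrier[OF Vc] v by (intro assoc_mult_mat_vec[of _ D D _ D])
  ultimately show "vnorm (B j * udg D V ?p *\<^sub>v v) \<le> \<delta> * vnorm v" by simp
qed

text \<open>Reads off the levels in the basis E, exchanges block number and ancilla level, and
  writes the result in the basis F. It thereby carries the eigenbasis of one state to that of the
  other.\<close>

definition swap_unitary :: "nat \<Rightarrow> nat \<Rightarrow> nat \<Rightarrow> complex mat \<Rightarrow> complex mat \<Rightarrow> complex mat" where
  "swap_unitary D g k E F = kron F (1\<^sub>m k) * perm_mat (D * k) (block_swap g k) * adj (kron E (1\<^sub>m k))"

context
  fixes D g k m :: nat and E F :: "complex mat"
  assumes E: "unitary D E" and F: "unitary D F" and kg: "k * g \<le> m" and m: "m \<le> D"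
    and EF: "\<And>r i. r < D \<Longrightarrow> m \<le> i \<Longrightarrow> i < D \<Longrightarrow> E $$ (r,i) = F $$ (r,i)"
begin

lemma swap_unitary_ingredients:
  "unitary (D * k) (kron E (1\<^sub>m k))" "unitary (D * k) (kron F (1\<^sub>m k))" "unitary (D * k) (perm_mat (D * k) (block_swap g k))"
  using kg m unitary_kron[OF E unitary_one] unitary_kron[OF F unitary_one]
  by (auto intro!: perm_mat_unitary block_swap_lt block_swap_invol)

lemma swap_unitary_unitary: "unitary (D * k) (swap_unitary D g k E F)"
  unfolding swap_unitary_def
  by (intro unitary_mult unitary_adj swap_unitary_ingredients)

lemma kron_udg_one: "V \<in> carrier_mat D D \<Longrightarrow> kron (udg D V x) (dg k w) = udg (D * k) (kron V (1\<^sub>m k)) (\<lambda>l. x (l div k) * w (l mod k))"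
  using udg_kron[of V D "1\<^sub>m k" k x w] by (simp add: udg_def left_mult_one_mat[OF dg_carrier] right_mult_one_mat[OF dg_carrier])

lemma swap_unitary_action:
  "(swap_unitary D g k E F) * kron (udg D E x) (dg k w) * adj (swap_unitary D g k E F) =
    udg (D * k) (kron F (1\<^sub>m k)) (\<lambda>l. x (block_swap g k l div k) * w (block_swap g k l mod k))"
proof -
  let ?E = "kron E (1\<^sub>m k)" and ?F = "kron F (1\<^sub>m k)" and ?P = "perm_mat (D * k) (block_swap g k)" and ?U = "swap_unitary D g k E F"
  note u = swap_unitary_ingredients[THEN unitaryD(1)]
  define z where "z l = x (l div k) * w (l mod k)" for l
  have "?U * ?E = ?F * ?P * (adj ?E * ?E)"
    unfolding swap_unitary_def using carrier_matD[OF unitaryD(1)[OF E]] carrier_matD[OF unitaryD(1)[OF F]] by (simp add: mat_assoc)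
  also have "\<dots> = ?F * ?P"
    unfolding unitaryD(2)[OF swap_unitary_ingredients(1)] using u by (intro right_mult_one_mat[of _ "D * k"]) auto
  finally have UE: "?U * ?E = ?F * ?P" .
  have "?U * kron (udg D E x) (dg k w) * adj ?U = udg (D * k) (?U * ?E) z"
    unfolding kron_udg_one[OF unitaryD(1)[OF E]] z_def
    by (rule udg_conj[OF unitaryD(1)[OF swap_unitary_unitary] u(1)])
  also have "\<dots> = ?F * udg (D * k) ?P z * adj ?F"
    unfolding UE by (rule udg_conj[OF u(2,3), symmetric])
  also have "udg (D * k) ?P z = dg (D * k) (\<lambda>l. z (block_swap g k l))"
    by (rule perm_mat_conj_dg) (use kg m in \<open>auto intro: block_swap_lt block_swap_invol\<close>)
  finally show ?thesis by (simp add: udg_def z_def)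
qed

text \<open>Let Q project onto the levels from m on and P' = 1 - Q. The unitary U satisfies U Q = Q
  U = Q, hence Y = U - 1 satisfies Y P' = P' Y = Y. With K the charge extended to the ancilla, the
  commutator of U and K equals that of Y and K, and P' can be inserted next to K in both of its
  terms. As Y has norm at most 2 and K P' and P' K have norm at most \<delta>, the constant is
  4.\<close>

lemma swap_unitary_commutator:
  assumes B: "hermitian D B" and bp: "opb \<delta> (B * udg D E (\<lambda>i. if i < m then 1 else 0))" and \<delta>: "0 \<le> \<delta>"
  shows "opb (4 * \<delta>) ((swap_unitary D g k E F) * kron B (1\<^sub>m k) - kron B (1\<^sub>m k) * (swap_unitary D g k E F))"
proof -
  let ?E = "kron E (1\<^sub>m k)" and ?F = "kron F (1\<^sub>m k)" and ?P = "perm_mat (D * k) (block_swap g k)" and ?U = "swap_unitary D g k E F"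
  let ?N = "D * k"
  note u = swap_unitary_ingredients[THEN unitaryD(1)]
  note Uc = unitaryD(1)[OF swap_unitary_unitary]
  note dims = carrier_matD[OF unitaryD(1)[OF E]] carrier_matD[OF unitaryD(1)[OF F]] carrier_matD[OF Uc]
  \<comment> \<open>Indicator of the levels from m on, on which the permutation acts trivially and E
    agrees with F.\<close>
  define q where "q l = (if l div k < m then 0 else 1 :: real)" for l
  define Q where "Q = udg ?N ?E q"
  have Qc: "Q \<in> carrier_mat ?N ?N" unfolding Q_def by (rule udg_carrier[OF u(1)])
  have Pq: "?P * dg ?N q = dg ?N q"
  proof (rule perm_mat_mult_dg)
    fix l assume "l < ?N" "q l \<noteq> 0"
    then show "block_swap g k l = l" using kg by (auto simp: block_swap_def q_def split: if_splits)
  qed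
  have aP: "adj ?P = ?P"
  proof (rule eq_matI)
    fix i j assume "i < dim_row ?P" "j < dim_col ?P"
    moreover have "j = block_swap g k i \<longleftrightarrow> i = block_swap g k j" using block_swap_invol by metis
    ultimately show "adj ?P $$ (i,j) = ?P $$ (i,j)" by simp
  qed auto
  have qP: "dg ?N q * ?P = dg ?N q"
    using arg_cong[OF Pq, of adj] by (simp add: adj_mult' dg_adj aP)
  have FE: "?F * dg ?N q = ?E * dg ?N q"
  proof (rule eq_matI)
    fix i l assume "i < dim_row (?E * dg ?N q)" "l < dim_col (?E * dg ?N q)"
    then have il: "i < ?N" "l < ?N" using dims by auto
    have "(M * dg ?N q) $$ (i,l) = M $$ (i,l) * of_real (q l)" if M: "M \<in> carrier_mat ?N ?N" for M
    proof -
      have "(M * dg ?N q) $$ (i,l) = (\<Sum>r<?N. if r = l then M $$ (i,l) * of_real (q l) else 0)"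
        unfolding mult_entry[OF M dg_carrier il] by (intro sum.cong refl) (use il in auto)
      then show ?thesis using il by (simp del: index_mult_mat(1))
    qed
    note e = this[OF u(1)] this[OF u(2)]
    have "?F $$ (i,l) * of_real (q l) = ?E $$ (i,l) * of_real (q l)"
      using il EF[of "i div k" "l div k"] unitaryD(1)[OF E] unitaryD(1)[OF F]
      by (auto simp: q_def div_lt mod_lt)
    then show "(?F * dg ?N q) $$ (i,l) = (?E * dg ?N q) $$ (i,l)" unfolding e .
  qed (use dims in auto)
  have FqE: "?F * dg ?N q * adj ?E = Q" unfolding Q_def udg_def FE ..
  have FqF: "?F * dg ?N q * adj ?F = Q"
  proof -
    have "dg ?N q * adj ?F = dg ?N q * adj ?E"
      using arg_cong[OF FE, of adj] dims by (simp add: adj_mult' dg_adj)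
    then have "?F * (dg ?N q * adj ?F) = ?F * (dg ?N q * adj ?E)" by simp
    then show ?thesis using FqE dims by (simp add: mat_assoc)
  qed
  have UQ: "?U * Q = Q"
  proof -
    have "?U * Q = ?F * ?P * ((adj ?E * ?E) * (dg ?N q * adj ?E))"
      unfolding swap_unitary_def Q_def udg_def using dims by (simp add: mat_assoc)
    also have "(adj ?E * ?E) * (dg ?N q * adj ?E) = dg ?N q * adj ?E"
      unfolding unitaryD(2)[OF swap_unitary_ingredients(1)] using u by (intro left_mult_one_mat[of _ _ ?N]) auto
    also have "?F * ?P * (dg ?N q * adj ?E) = ?F * (?P * dg ?N q) * adj ?E" using dims by (simp add: mat_assoc)
    finally show ?thesis unfolding Pq FqE .
  qed
  have QU: "Q * ?U = Q"
  proof -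
    have "Q * ?U = ?F * dg ?N q * ((adj ?F * ?F) * (?P * adj ?E))"
      unfolding swap_unitary_def FqF[symmetric] using dims by (simp add: mat_assoc)
    also have "(adj ?F * ?F) * (?P * adj ?E) = ?P * adj ?E"
      unfolding unitaryD(2)[OF swap_unitary_ingredients(2)] using u by (intro left_mult_one_mat[of _ _ ?N]) auto
    also have "?F * dg ?N q * (?P * adj ?E) = ?F * (dg ?N q * ?P) * adj ?E" using dims by (simp add: mat_assoc)
    finally show ?thesis unfolding qP FqE .
  qed
  define P where "P = udg D E (\<lambda>i. if i < m then 1 else 0)"
  have Pc: "P \<in> carrier_mat D D" unfolding P_def by (rule udg_carrier[OF unitaryD(1)[OF E]])
  note Bc = hermitianD(1)[OF B]
  define P' where "P' = kron P (1\<^sub>m k)"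
  define K where "K = kron B (1\<^sub>m k)"
  define Y where "Y = ?U - 1\<^sub>m ?N"
  have c: "P' \<in> carrier_mat ?N ?N" "K \<in> carrier_mat ?N ?N" "Y \<in> carrier_mat ?N ?N"
    unfolding P'_def K_def Y_def using Pc Bc Uc by auto
  have P'Q: "P' = 1\<^sub>m ?N - Q"
  proof -
    have "P' = udg ?N ?E (\<lambda>l. if l div k < m then 1 else 0)"
      using kron_udg_one[OF unitaryD(1)[OF E], of "\<lambda>i. if i < m then 1 else 0" "\<lambda>_. 1"]
      by (simp add: P'_def P_def dg_one)
    also have "\<dots> = udg ?N ?E (\<lambda>l. 1 - q l)" by (intro udg_cong) (simp add: q_def)
    also have "\<dots> = udg ?N ?E (\<lambda>_. 1) - Q" unfolding Q_def by (rule udg_minus[OF u(1), symmetric])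
    finally show ?thesis by (simp add: udg_one[OF swap_unitary_ingredients(1)])
  qed
  have minus_zero: "M - 0\<^sub>m ?N ?N = M" if "M \<in> carrier_mat ?N ?N" for M :: "complex mat"
    using that by (intro eq_matI) auto
  have one: "1\<^sub>m ?N \<in> carrier_mat ?N ?N" by simp
  have self_minus: "Q - Q = 0\<^sub>m ?N ?N" using Qc by (intro eq_matI) auto
  have YQ: "Y * Q = 0\<^sub>m ?N ?N"
    unfolding Y_def minus_mult_distrib_mat[OF Uc one Qc] left_mult_one_mat[OF Qc] UQ self_minus ..
  have QY: "Q * Y = 0\<^sub>m ?N ?N"
    unfolding Y_def mult_minus_distrib_mat[OF Qc Uc one] right_mult_one_mat[OF Qc] QU self_minus ..
  have YP: "Y * P' = Y" "P' * Y = Y"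
    unfolding P'Q mult_minus_distrib_mat[OF c(3) one Qc] minus_mult_distrib_mat[OF one Qc c(3)]
      right_mult_one_mat[OF c(3)] left_mult_one_mat[OF c(3)] YQ QY by (rule minus_zero[OF c(3)])+
  \<comment> \<open>The identity part of U commutes with K; the two copies of P' are absorbed by
    Y.\<close>
  have comm: "?U * K - K * ?U = Y * (P' * K) - (K * P') * Y"
  proof -
    have "Y * (P' * K) = Y * K"
      using YP(1) assoc_mult_mat[OF c(3,1,2)] by simp
    moreover have "(K * P') * Y = K * Y"
      using YP(2) assoc_mult_mat[OF c(2,1,3)] by simp
    moreover have "Y * K = ?U * K - K" "K * Y = K * ?U - K"
      unfolding Y_def minus_mult_distrib_mat[OF Uc one c(2)] mult_minus_distrib_mat[OF c(2) Uc one]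
        right_mult_one_mat[OF c(2)] left_mult_one_mat[OF c(2)] by (rule refl)+
    moreover have "?U * K - K - (K * ?U - K) = ?U * K - K * ?U"
    proof (rule eq_matI)
      fix i j assume "i < dim_row (?U * K - K * ?U)" "j < dim_col (?U * K - K * ?U)"
      then have ij: "i < ?N" "j < ?N" using dims carrier_matD[OF c(2)] by auto
      then show "(?U * K - K - (K * ?U - K)) $$ (i,j) = (?U * K - K * ?U) $$ (i,j)"
        using dims carrier_matD[OF c(2)] by (simp del: index_mult_mat(1))
    qed (use dims c in auto)
    ultimately show ?thesis by simp
  qed
  have KP: "K * P' = kron (B * P) (1\<^sub>m k)"
    unfolding K_def P'_def using carrier_matD[OF Bc] carrier_matD[OF Pc] kron_mult[of B P "1\<^sub>m k" "1\<^sub>m k"] by simp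
  have o1: "opb \<delta> (K * P')"
    unfolding KP by (rule opb_kron_one_right[of _ _ D D]) (use bp \<delta> Bc Pc in \<open>auto simp: P_def\<close>)
  have "adj (K * P') = P' * K"
  proof -
    have "adj K = K" unfolding K_def by (simp add: kron_adj hermitianD(2)[OF B])
    moreover have "adj P' = P'"
      using hermitianD(2)[OF udg_hermitian[OF unitaryD(1)[OF E]]] by (simp add: P'_def P_def kron_adj)
    ultimately show ?thesis using carrier_matD[OF c(1)] carrier_matD[OF c(2)] by (simp add: adj_mult')
  qed
  then have o2: "opb \<delta> (P' * K)" using opb_adj[OF o1 _ \<delta>, of ?N ?N] c by auto
  have oY: "opb (1 + 1) Y"
    unfolding Y_def using opb_unitary[OF swap_unitary_unitary] opb_unitary[OF unitary_one, of ?N] Uc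
    by (intro opb_minus[of _ _ _ _ ?N ?N]) auto
  have "opb ((1 + 1) * \<delta>) (Y * (P' * K))" by (rule opb_mult[OF oY o2, of ?N ?N ?N]) (use c in auto)
  moreover have "opb (\<delta> * (1 + 1)) (K * P' * Y)" by (rule opb_mult[OF o1 oY, of ?N ?N ?N]) (use c \<delta> in auto)
  ultimately have "opb ((1 + 1) * \<delta> + \<delta> * (1 + 1)) (Y * (P' * K) - K * P' * Y)"
    by (rule opb_minus[of _ _ _ _ ?N ?N]) (use c in auto)
  moreover have "(1 + 1) * \<delta> + \<delta> * (1 + 1) = 4 * \<delta>" by simp
  ultimately show ?thesis by (simp only: comm[unfolded K_def] K_def)
qed

end

lemma udg_neg_entry:
  assumes "V \<in> carrier_mat d d" "A \<in> carrier_mat d d" "0\<^sub>m d d - A = udg d V q"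
  shows "A = udg d V (\<lambda>i. - q i)"
proof (rule eq_matI)
  fix i j assume "i < dim_row (udg d V (\<lambda>i. - q i))" "j < dim_col (udg d V (\<lambda>i. - q i))"
  then have ij: "i < d" "j < d" using assms(1) by auto
  have "A $$ (i,j) = - (0\<^sub>m d d - A) $$ (i,j)" using assms(2) ij by simp
  then show "A $$ (i,j) = udg d V (\<lambda>i. - q i) $$ (i,j)"
    unfolding assms(3) udg_entry[OF assms(1) ij] by (simp add: sum_negf)
qed (use assms in auto)

text \<open>The subspace depends only on the charges, and its tail estimate holds for every state,
  so that one subspace can serve both X and Y.\<close>

lemma low_spectral_subspace:
  fixes \<delta> :: real and c :: nat
  assumes B: "\<And>j. j < c \<Longrightarrow> hermitian D (B j)" and \<delta>: "0 < \<delta>"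
  obtains V m where "unitary D V" "m \<le> D"
    "\<And>j. j < c \<Longrightarrow> opb \<delta> (B j * udg D V (\<lambda>i. if i < m then 1 else 0))"
    "\<And>X. density D X \<Longrightarrow> Re (mtrace (udg D V (\<lambda>i. if i < m then 0 else 1) * X)) * \<delta>\<^sup>2
        \<le> (\<Sum>j<c. Re (mtrace (X * (B j * B j))))"
proof -
  define C where "C = msum D (\<lambda>j. B j * B j) c"
  have Bc: "B j \<in> carrier_mat D D" if "j < c" for j using hermitianD(1)[OF B[OF that]] .
  have hBB: "hermitian D (B j * B j)" if "j < c" for j
    using B[OF that] Bc[OF that] by (auto simp: hermitian_def adj_mult')
  have hC: "hermitian D C" unfolding C_def by (rule msum_hermitian[OF hBB])
  note Cc = hermitianD(1)[OF hC]
  have z: "hermitian D (0\<^sub>m D D)" by (auto simp: hermitian_def intro!: eq_matI)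
  \<comment> \<open>\<open>spectral\<close> sorts decreasingly; applied to the negative of C it puts
    the low eigenvalues of C into the first columns.\<close>
  obtain V q' where V: "unitary D V" "0\<^sub>m D D - C = udg D V q'" and dec: "\<And>i j. i \<le> j \<Longrightarrow> j < D \<Longrightarrow> q' j \<le> q' i"
    using spectral[OF hermitian_minus[OF z hC]] by metis
  note Vc = unitaryD(1)[OF V(1)]
  define q where "q i = - q' i" for i
  have Cq: "C = udg D V q" unfolding q_def by (rule udg_neg_entry[OF Vc Cc V(2)])
  have asc: "q i \<le> q j" if "i \<le> j" "j < D" for i j using dec[OF that] by (simp add: q_def)
  have q0: "0 \<le> q i" if i: "i < D" for i
  proof -
    have cV: "col V i \<in> carrier_vec D" using Vc i by auto
    have "complex_of_real (q i) = cinner (col V i) (C *\<^sub>v col V i)"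
      unfolding Cq udg_apply_col[OF V(1) i] by (simp add: cinner_smult_right cinner_self vnorm_col[OF V(1) i])
    also have "\<dots> = of_real (\<Sum>j<c. (vnorm (B j *\<^sub>v col V i))\<^sup>2)"
      unfolding C_def by (rule cinner_sum_squares[OF B cV])
    finally show ?thesis unfolding of_real_eq_iff by (simp add: sum_nonneg)
  qed
  \<comment> \<open>The alternative D <= i guarantees existence and gives m = D when no eigenvalue
    exceeds the threshold.\<close>
  define m where "m = (LEAST i. D \<le> i \<or> \<delta>\<^sup>2 < q i)"
  have mD: "m \<le> D" unfolding m_def by (rule Least_le) simp
  have lo: "q i \<le> \<delta>\<^sup>2" if "i < m" for i
    using not_less_Least[of i "\<lambda>i. D \<le> i \<or> \<delta>\<^sup>2 < q i"] that unfolding m_def by auto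
  have "D \<le> m \<or> \<delta>\<^sup>2 < q m" unfolding m_def by (rule LeastI[of "\<lambda>i. D \<le> i \<or> \<delta>\<^sup>2 < q i" D]) simp
  then have hi: "\<delta>\<^sup>2 < q i" if "m \<le> i" "i < D" for i using asc[OF that] that by auto
  \<comment> \<open>Markov's inequality for C: all eigenvalues from level m on exceed the
    threshold.\<close>
  have tail: "Re (mtrace (udg D V (\<lambda>i. if i < m then 0 else 1) * X)) * \<delta>\<^sup>2 \<le> (\<Sum>j<c. Re (mtrace (X * (B j * B j))))"
    if X: "density D X" for X
  proof -
    note Xc = density_carrier[OF X]
    obtain W x where W: "unitary D W" "X = udg D W x" "\<And>i. i < D \<Longrightarrow> 0 \<le> x i" "(\<Sum>i<D. x i) = 1"
      using density_spectral[OF X] by metis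
    define a where "a i = (\<Sum>l<D. x l * (cmod ((adj V * W) $$ (i,l)))\<^sup>2)" for i
    have a0: "0 \<le> a i" for i unfolding a_def using W(3) by (intro sum_nonneg) auto
    have aX: "(adj V * X * V) $$ (i,i) = of_real (a i)" if "i < D" for i
      unfolding W(2) udg_change_basis[OF Vc unitaryD(1)[OF W(1)]] a_def
      by (rule udg_diag_entry) (use Vc unitaryD(1)[OF W(1)] that in auto)
    have tr: "Re (mtrace (udg D V p * X)) = (\<Sum>i<D. p i * a i)" for p
      unfolding udg_diag[OF Vc Xc] by (simp add: aX del: index_mult_mat(1))
    have "Re (mtrace (udg D V (\<lambda>i. if i < m then 0 else 1) * X)) * \<delta>\<^sup>2 = (\<Sum>i<D. (if i < m then 0 else 1) * a i * \<delta>\<^sup>2)"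
      unfolding tr by (simp add: sum_distrib_right)
    also have "\<dots> \<le> (\<Sum>i<D. q i * a i)"
    proof (intro sum_mono)
      fix i assume "i \<in> {..<D}"
      then show "(if i < m then 0 else 1) * a i * \<delta>\<^sup>2 \<le> q i * a i"
        using q0[of i] a0[of i] hi[of i] by (cases "i < m") (auto simp: mult.commute[of _ "\<delta>\<^sup>2"] intro: mult_right_mono)
    qed
    also have "\<dots> = Re (mtrace (C * X))" unfolding Cq tr ..
    also have "mtrace (C * X) = mtrace (X * C)" by (rule mtrace_mult_comm[OF Cc Xc])
    also have "Re (mtrace (X * C)) = (\<Sum>j<c. Re (mtrace (X * (B j * B j))))"
      unfolding C_def using mtrace_mult_msum[of c "\<lambda>j. B j * B j" D X] Xc Bc by simp
    finally show ?thesis .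
  qed
  show ?thesis
    by (rule that[OF V(1) mD spectral_subspace_bound[OF B V(1) Cq[unfolded C_def]] tail])
      (use lo \<delta> in auto)
qed

lemma trace_norm_minus_self_le: "density d X \<Longrightarrow> density d Y \<Longrightarrow> unitary d U \<Longrightarrow> trace_norm (U * X * adj U - Y) \<le> 2"
  by (intro trace_norm_density_diff density_conj)

text \<open>The positive values of a decreasing nonnegative sequence form an initial segment whose
  length is their number.\<close>

lemma antimono_support:
  fixes \<xi> :: "nat \<Rightarrow> real"
  assumes "antimono \<xi>" "\<And>i. m \<le> i \<Longrightarrow> \<xi> i = 0" "card {i. i < m \<and> 0 < \<xi> i} \<le> i" "0 \<le> \<xi> i"
  shows "\<xi> i = 0"
proof (rule ccontr)
  assume "\<xi> i \<noteq> 0"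
  then have p: "0 < \<xi> i" "i < m" using assms(2,4) by (force simp: not_le[symmetric])+
  then have "{..i} \<subseteq> {i. i < m \<and> 0 < \<xi> i}" using antimonoD[OF assms(1)] by (force intro: less_le_trans)
  then have "card {..i} \<le> card {i. i < m \<and> 0 < \<xi> i}" by (intro card_mono) auto
  then show False using assms(3) by simp
qed

text \<open>There are two reasons to stop after k blocks. Either no further block fits into the m
  levels, and the remainder has at most g - 1 levels of height at most b; or k * g exceeds R, so the
  support is exhausted and the tail is zero.\<close>

lemma block_tail_bound:
  fixes \<xi> :: "nat \<Rightarrow> real"
  assumes \<xi>: "antimono \<xi>" "\<And>i. 0 \<le> \<xi> i" "\<And>i. \<xi> i \<le> b" "\<And>i. m \<le> i \<Longrightarrow> \<xi> i = 0"
    and R: "card {i. i < m \<and> 0 < \<xi> i} \<le> R" and g: "1 \<le> g"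
    and k: "k = min (m div g) (R div g + 1)" and m: "m \<le> D"
  shows "(\<Sum>i=k*g..<D. \<xi> i) \<le> real (g - 1) * b"
proof (cases "m div g \<le> R div g + 1")
  case True
  then have kg: "k * g = m - m mod g" using k by (simp add: minus_mod_eq_div_mult)
  have b0: "0 \<le> b" using \<xi>(2,3)[of 0] by linarith
  have "(\<Sum>i=k*g..<D. \<xi> i) = (\<Sum>i=k*g..<m. \<xi> i)"
    by (rule sum.mono_neutral_right) (use m \<xi>(4) in auto)
  also have "\<dots> \<le> (\<Sum>i=k*g..<m. b)" by (intro sum_mono \<xi>(3))
  also have "\<dots> = real (m mod g) * b" using kg mod_less_eq_dividend[of m g] by (simp add: of_nat_diff)
  also have "\<dots> \<le> real (g - 1) * b"
  proof (rule mult_right_mono[OF _ b0])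
    have "m mod g \<le> g - 1" using mod_less_divisor[of g m] g by linarith
    then show "real (m mod g) \<le> real (g - 1)" by (rule of_nat_mono)
  qed
  finally show ?thesis .
next
  case False
  then have "k = R div g + 1" using k by simp
  then have "R < k * g" using g dividend_less_div_times[of g R] by (simp add: add.commute)
  then have "\<xi> i = 0" if "k * g \<le> i" for i
    using that R by (intro antimono_support[OF \<xi>(1,4) _ \<xi>(2)]) auto
  moreover have "0 \<le> b" using \<xi>(2,3)[of 0] by linarith
  ultimately show ?thesis by simp
qed

text \<open>The conversion in one fixed dimension with explicit errors. In the application B j is
  the centred charge per copy, h is n times the entropy rate, \<delta> is the charge resolution and
  \<Delta> the half-width of the typical window.\<close>

theorem finite_transformation:
  fixes c D :: nat
  assumes D: "0 < D" and X: "density D X" and Y: "density D Y"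
    and B: "\<And>j. j < c \<Longrightarrow> hermitian D (B j)" and pos: "0 < \<delta>" "0 < \<Delta>"
    and eX: "(\<Sum>j<c. Re (mtrace (X * (B j * B j)))) \<le> \<epsilon> * \<delta>\<^sup>2"
    and eY: "(\<Sum>j<c. Re (mtrace (Y * (B j * B j)))) \<le> \<epsilon> * \<delta>\<^sup>2"
    and iX: "spec_sum (\<lambda>x. x * (ln x + h)\<^sup>2) X \<le> \<epsilon> * \<Delta>\<^sup>2"
    and iY: "spec_sum (\<lambda>x. x * (ln x + h)\<^sup>2) Y \<le> \<epsilon> * \<Delta>\<^sup>2"
    and e0: "0 \<le> \<epsilon>"
  shows "\<exists>k \<omega> \<omega>' U. 1 \<le> k \<and> real k \<le> exp (3 * \<Delta>) + 1 \<and> density k \<omega> \<and> density k \<omega>' \<and> unitary (D * k) U \<and>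
    (\<forall>j<c. opb (4 * \<delta>) (U * kron (B j) (1\<^sub>m k) - kron (B j) (1\<^sub>m k) * U)) \<and>
    trace_norm (U * kron X \<omega>' * adj U - kron Y \<omega>) \<le> 4 * \<epsilon> + 4 * sqrt \<epsilon> + 7 * exp (- \<Delta>)"
proof (cases "2 * \<epsilon> + exp (- \<Delta>) < 1")
  \<comment> \<open>The asserted bound is then at least 2, the largest possible trace distance of
    two states, so the identity with a trivial ancilla suffices.\<close>
  case False
  have d1: "density 1 (1\<^sub>m 1)"
    using density_udg[OF unitary_one[of 1], of "\<lambda>_. 1"] udg_one[OF unitary_one[of 1]] by simp
  have "trace_norm (1\<^sub>m (D * 1) * kron X (1\<^sub>m 1) * adj (1\<^sub>m (D * 1)) - kron Y (1\<^sub>m 1)) \<le> 2"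
    using trace_norm_minus_self_le[OF density_kron[OF X d1] density_kron[OF Y d1] unitary_one] .
  also have "2 \<le> 4 * \<epsilon> + 4 * sqrt \<epsilon> + 7 * exp (- \<Delta>)"
  proof -
    have "0 \<le> sqrt \<epsilon>" "0 \<le> exp (- \<Delta>)" using e0 by auto
    then show ?thesis using False by linarith
  qed
  finally have t: "trace_norm (1\<^sub>m (D * 1) * kron X (1\<^sub>m 1) * adj (1\<^sub>m (D * 1)) - kron Y (1\<^sub>m 1))
    \<le> 4 * \<epsilon> + 4 * sqrt \<epsilon> + 7 * exp (- \<Delta>)" .
  have o: "opb (4 * \<delta>) (1\<^sub>m (D * 1) * kron (B j) (1\<^sub>m 1) - kron (B j) (1\<^sub>m 1) * 1\<^sub>m (D * 1))" if "j < c" for j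
  proof -
    note Bc = hermitianD(1)[OF B[OF that]]
    have "1\<^sub>m (D * 1) * kron (B j) (1\<^sub>m 1) - kron (B j) (1\<^sub>m 1) * 1\<^sub>m (D * 1) = B j - B j"
      unfolding kron_one_right mult_1_right left_mult_one_mat[OF Bc] right_mult_one_mat[OF Bc] ..
    also have "\<dots> = 0\<^sub>m D D" using Bc by (intro eq_matI) auto
    finally have eq: "1\<^sub>m (D * 1) * kron (B j) (1\<^sub>m 1) - kron (B j) (1\<^sub>m 1) * 1\<^sub>m (D * 1) = 0\<^sub>m D D" .
    have "vnorm (0\<^sub>m D D *\<^sub>v v) = 0" if "v \<in> carrier_vec D" for v
    proof -
      have "0\<^sub>m D D *\<^sub>v v = 0\<^sub>v D" using that by (intro eq_vecI) auto
      then show ?thesis by (simp add: vnorm_def)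
    qed
    then show ?thesis unfolding eq opb_def using pos by auto
  qed
  show ?thesis
    by (intro exI[of _ 1] exI[of _ "1\<^sub>m 1"] exI[of _ "1\<^sub>m (D * 1)"] conjI allI impI)
      (use d1 t o unitary_one in \<open>auto simp del: mult_1_right\<close>)
next
  case True
  obtain V m where V: "unitary D V" and m: "m \<le> D"
    and bP: "\<And>j. j < c \<Longrightarrow> opb \<delta> (B j * udg D V (\<lambda>i. if i < m then 1 else 0))"
    and tail: "\<And>X. density D X \<Longrightarrow> Re (mtrace (udg D V (\<lambda>i. if i < m then 0 else 1) * X)) * \<delta>\<^sup>2
        \<le> (\<Sum>j<c. Re (mtrace (X * (B j * B j))))"
    using low_spectral_subspace[of c D B \<delta>, OF B pos(1)] by blast
  have tX: "Re (mtrace (udg D V (\<lambda>i. if i < m then 0 else 1) * X)) \<le> \<epsilon>"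
    using order_trans[OF tail[OF X] eX] pos by (simp add: mult_le_cancel_right)
  have tY: "Re (mtrace (udg D V (\<lambda>i. if i < m then 0 else 1) * Y)) \<le> \<epsilon>"
    using order_trans[OF tail[OF Y] eY] pos by (simp add: mult_le_cancel_right)
  obtain E \<xi> where E: "unitary D E" and EV: "\<And>r i. r < D \<Longrightarrow> m \<le> i \<Longrightarrow> i < D \<Longrightarrow> E $$ (r,i) = V $$ (r,i)"
    and \<xi>: "antimono \<xi>" "\<And>i. 0 \<le> \<xi> i" "\<And>i. \<xi> i \<le> exp (- (h - \<Delta>))" "\<And>i. m \<le> i \<Longrightarrow> \<xi> i = 0"
    and \<xi>c: "real (card {i. i < m \<and> 0 < \<xi> i}) \<le> exp (h + \<Delta>)"
    and \<xi>s: "1 - 2 * \<epsilon> \<le> (\<Sum>i<m. \<xi> i)" "(\<Sum>i<m. \<xi> i) \<le> 1"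
    and \<xi>t: "trace_norm (X - udg D E \<xi>) \<le> \<epsilon> + 2 * sqrt \<epsilon>"
    using compress[OF X V m pos(2) tX iX] by blast
  obtain F \<eta> where F: "unitary D F" and FV: "\<And>r i. r < D \<Longrightarrow> m \<le> i \<Longrightarrow> i < D \<Longrightarrow> F $$ (r,i) = V $$ (r,i)"
    and \<eta>: "antimono \<eta>" "\<And>i. 0 \<le> \<eta> i" "\<And>i. \<eta> i \<le> exp (- (h - \<Delta>))" "\<And>i. m \<le> i \<Longrightarrow> \<eta> i = 0"
    and \<eta>c: "real (card {i. i < m \<and> 0 < \<eta> i}) \<le> exp (h + \<Delta>)"
    and \<eta>s: "1 - 2 * \<epsilon> \<le> (\<Sum>i<m. \<eta> i)" "(\<Sum>i<m. \<eta> i) \<le> 1"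
    and \<eta>t: "trace_norm (Y - udg D F \<eta>) \<le> \<epsilon> + 2 * sqrt \<epsilon>"
    using compress[OF Y V m pos(2) tY iY] by blast
  define b where "b = exp (- (h - \<Delta>))"
  \<comment> \<open>Floor plus one gives g >= 1 and g - 1 <= exp (h - 2 * \<Delta>) even when this
    exponential is below one.\<close>
  define g where "g = nat \<lfloor>exp (h - 2 * \<Delta>)\<rfloor> + 1"
  define R where "R = nat \<lfloor>exp (h + \<Delta>)\<rfloor>"
  \<comment> \<open>As many blocks as fit into the m levels, but no more than are needed to cover R
    levels.\<close>
  define k where "k = min (m div g) (R div g + 1)"
  have g: "1 \<le> g" "real (g - 1) \<le> exp (h - 2 * \<Delta>)" "exp (h - 2 * \<Delta>) \<le> real g"
  proof -
    show "1 \<le> g" by (simp add: g_def)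
    show "real (g - 1) \<le> exp (h - 2 * \<Delta>)" by (simp add: g_def)
    show "exp (h - 2 * \<Delta>) \<le> real g" unfolding g_def by (simp add: of_nat_nat) linarith
  qed
  have Rle: "real R \<le> exp (h + \<Delta>)" by (simp add: R_def)
  have cR: "card {i. i < m \<and> 0 < \<xi> i} \<le> R" "card {i. i < m \<and> 0 < \<eta> i} \<le> R"
    using \<xi>c \<eta>c unfolding R_def by (simp_all add: le_nat_floor)
  define \<beta> where "\<beta> = real (g - 1) * b"
  \<comment> \<open>Up to g - 1 levels of height at most b weigh no more than this; the exponents h
    - 2 * \<Delta> and - (h - \<Delta>) add up to - \<Delta>.\<close>
  have \<beta>: "\<beta> \<le> exp (- \<Delta>)"
  proof -
    have "\<beta> \<le> exp (h - 2 * \<Delta>) * b" unfolding \<beta>_def by (rule mult_right_mono[OF g(2)]) (simp add: b_def)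
    also have "\<dots> = exp (- \<Delta>)" by (simp add: b_def exp_add[symmetric] mult_exp_exp)
    finally show ?thesis .
  qed
  \<comment> \<open>If m were at most g - 1, the m levels would weigh at most \<beta>, which is less
    than 1 - 2 * \<epsilon>. Hence at least one block fits.\<close>
  have mg: "g \<le> m"
  proof -
    have "1 - 2 * \<epsilon> \<le> (\<Sum>i<m. b)" using \<xi>s(1) sum_mono[of "{..<m}" \<xi> "\<lambda>_. b"] \<xi>(3) by (simp add: b_def)
    then have "real (g - 1) * b < real m * b" using True \<beta> unfolding \<beta>_def by simp
    then have "g - 1 < m" by (simp add: b_def)
    then show ?thesis by simp
  qed
  have k1: "1 \<le> k" using mg g(1) by (simp add: k_def div_greater_zero_iff Suc_le_eq)
  have kg: "k * g \<le> m"
  proof -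
    have "k * g \<le> m div g * g" unfolding k_def by (intro mult_right_mono) auto
    then show ?thesis using div_times_less_eq_dividend[of m g] by linarith
  qed
  \<comment> \<open>A support of size exp (h + \<Delta>) is divided into blocks of size at least exp
    (h - 2 * \<Delta>).\<close>
  have kexp: "real k \<le> exp (3 * \<Delta>) + 1"
  proof -
    have "real (R div g) \<le> real R / real g" by (rule of_nat_div_le_of_nat)
    also have "\<dots> \<le> exp (h + \<Delta>) / exp (h - 2 * \<Delta>)" using Rle g by (intro frac_le) auto
    also have "\<dots> = exp (3 * \<Delta>)" by (simp add: exp_diff[symmetric])
    finally show ?thesis unfolding k_def by linarith
  qed
  define sx where "sx = (\<Sum>i<k*g. \<xi> i)"
  define sy where "sy = (\<Sum>i<k*g. \<eta> i)"
  define wx where "wx t = (\<Sum>r<g. \<xi> (t * g + r)) / sx" for t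
  define wy where "wy t = (\<Sum>r<g. \<eta> (t * g + r)) / sy" for t
  have split: "(\<Sum>i<m. f i) = (\<Sum>i<k*g. f i) + (\<Sum>i=k*g..<m. f i)" for f :: "nat \<Rightarrow> real"
    using kg sum.atLeastLessThan_concat[of 0 "k*g" m f] by (simp add: atLeast0LessThan)
  have tails: "(\<Sum>i=k*g..<D. \<xi> i) \<le> \<beta>" "(\<Sum>i=k*g..<D. \<eta> i) \<le> \<beta>" "(\<Sum>i=k*g..<m. \<xi> i) \<le> \<beta>" "(\<Sum>i=k*g..<m. \<eta> i) \<le> \<beta>"
    unfolding \<beta>_def b_def
    using block_tail_bound[OF \<xi> cR(1) g(1) k_def m] block_tail_bound[OF \<eta> cR(2) g(1) k_def m]
      block_tail_bound[OF \<xi> cR(1) g(1) k_def order_refl] block_tail_bound[OF \<eta> cR(2) g(1) k_def order_refl]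
    by blast+
  have tails0: "0 \<le> (\<Sum>i=k*g..<m. \<xi> i)" "0 \<le> (\<Sum>i=k*g..<m. \<eta> i)" by (intro sum_nonneg \<xi>(2) \<eta>(2))+
  have s: "1 - 2 * \<epsilon> - \<beta> \<le> sx" "sx \<le> 1" "1 - 2 * \<epsilon> - \<beta> \<le> sy" "sy \<le> 1" "0 < sx" "0 < sy"
    using split[of \<xi>] split[of \<eta>] \<xi>s \<eta>s tails tails0 True \<beta> unfolding sx_def sy_def by linarith+
  have wx0: "0 \<le> wx t" "0 \<le> wy t" for t
    using s unfolding wx_def wy_def by (auto intro!: sum_nonneg divide_nonneg_pos \<xi> \<eta>)
  have wx1: "(\<Sum>t<k. wx t) = 1" "(\<Sum>t<k. wy t) = 1"
    using s by (simp_all add: wx_def wy_def sum_divide_distrib[symmetric] sum_div_mod[symmetric] sx_def[symmetric] sy_def[symmetric])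
  have dk: "dg k w = udg k (1\<^sub>m k) w" for w
    by (simp add: udg_def left_mult_one_mat[OF dg_carrier] right_mult_one_mat[OF dg_carrier])
  have dens: "density k (dg k wx)" "density k (dg k wy)"
    unfolding dk by (rule density_udg[OF unitary_one]; simp add: wx0 wx1)+
  define U where "U = swap_unitary D g k E F"
  have EF: "E $$ (r,i) = F $$ (r,i)" if "r < D" "m \<le> i" "i < D" for r i using EV[OF that] FV[OF that] by simp
  have U: "unitary (D * k) U" unfolding U_def by (rule swap_unitary_unitary[OF E F kg m EF])
  note Ec = unitaryD(1)[OF E] note Fc = unitaryD(1)[OF F]
  \<comment> \<open>The projector onto the first m columns is one minus the projector onto the
    others, and those others are common to V and E.\<close>
  have PE: "udg D V (\<lambda>i. if i < m then 1 else 0) = udg D E (\<lambda>i. if i < m then 1 else 0)"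
  proof -
    have "udg D V (\<lambda>i. if i < m then 0 else 1) = udg D E (\<lambda>i. if i < m then 0 else 1)"
      by (rule eq_matI) (use unitaryD(1)[OF V] Ec EV in \<open>auto simp: udg_entry intro!: sum.cong\<close>)
    then have "udg D V (\<lambda>_. 1) - udg D V (\<lambda>i. if i < m then 0 else 1) = udg D E (\<lambda>_. 1) - udg D E (\<lambda>i. if i < m then 0 else 1)"
      by (simp add: udg_one V E)
    then have "udg D V (\<lambda>i. 1 - (if i < m then 0 else 1)) = udg D E (\<lambda>i. 1 - (if i < m then 0 else 1))"
      by (simp only: udg_minus[OF unitaryD(1)[OF V]] udg_minus[OF Ec])
    moreover have "(\<lambda>i. 1 - (if i < m then 0 else 1)) = (\<lambda>i. if i < m then 1 else 0 :: real)" by auto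
    ultimately show ?thesis by simp
  qed
  have comm: "opb (4 * \<delta>) (U * kron (B j) (1\<^sub>m k) - kron (B j) (1\<^sub>m k) * U)" if "j < c" for j
    unfolding U_def by (rule swap_unitary_commutator[OF E F kg m EF B[OF that] bP[OF that, unfolded PE]]) (use pos in auto)
  have Uc: "U \<in> carrier_mat (D * k) (D * k)" using unitaryD(1)[OF U] .
  have hX: "hermitian D X" and hY: "hermitian D Y" using X Y density_hermitian by auto
  have hE: "hermitian D (udg D E \<xi>)" and hF: "hermitian D (udg D F \<eta>)" by (intro udg_hermitian Ec Fc)+
  have hw: "hermitian k (dg k wx)" "hermitian k (dg k wy)" using dens density_hermitian by auto
  have hconj: "hermitian (D * k) (U * Z * adj U)" if "hermitian (D * k) Z" for Z
    using hermitian_conj[OF that adj_carrier[OF Uc]] by simp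
  let ?Xh = "udg D E \<xi>" and ?Yh = "udg D F \<eta>"
  have a: "trace_norm (U * kron X (dg k wy) * adj U - U * kron ?Xh (dg k wy) * adj U) \<le> \<epsilon> + 2 * sqrt \<epsilon>"
  proof -
    have kc: "kron X (dg k wy) \<in> carrier_mat (D * k) (D * k)" "kron ?Xh (dg k wy) \<in> carrier_mat (D * k) (D * k)"
      using hermitianD(1)[OF hX] hermitianD(1)[OF hE] by auto
    have "U * (kron X (dg k wy) - kron ?Xh (dg k wy)) = U * kron X (dg k wy) - U * kron ?Xh (dg k wy)"
      by (rule mult_minus_distrib_mat[OF Uc kc])
    moreover have "(U * kron X (dg k wy) - U * kron ?Xh (dg k wy)) * adj U = U * kron X (dg k wy) * adj U - U * kron ?Xh (dg k wy) * adj U"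
      by (rule minus_mult_distrib_mat[of _ "D*k" "D*k"]) (use Uc kc in auto)
    moreover have "kron X (dg k wy) - kron ?Xh (dg k wy) = kron (X - ?Xh) (dg k wy)"
      by (rule kron_minus_left[symmetric]) (use hermitianD(1)[OF hX] hermitianD(1)[OF hE] in auto)
    ultimately have "U * kron X (dg k wy) * adj U - U * kron ?Xh (dg k wy) * adj U = U * kron (X - ?Xh) (dg k wy) * adj U"
      by simp
    then show ?thesis
      using trace_norm_conj[OF hermitian_kron[OF hermitian_minus[OF hX hE] hw(2)] U]
        trace_norm_kron_density[OF hermitian_minus[OF hX hE] dens(2)] \<xi>t by simp
  qed
  have b': "trace_norm (U * kron ?Xh (dg k wy) * adj U - kron ?Yh (dg k wx)) \<le> 2 * \<epsilon> + 7 * \<beta>"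
  proof -
    have uF: "unitary (D * k) (kron F (1\<^sub>m k))" by (rule unitary_kron[OF F unitary_one])
    have 1: "U * kron ?Xh (dg k wy) * adj U = udg (D * k) (kron F (1\<^sub>m k)) (\<lambda>l. \<xi> (block_swap g k l div k) * wy (block_swap g k l mod k))"
      unfolding U_def by (rule swap_unitary_action[OF E F kg m EF])
    have 2: "kron ?Yh (dg k wx) = udg (D * k) (kron F (1\<^sub>m k)) (\<lambda>l. \<eta> (l div k) * wx (l mod k))"
      by (rule kron_udg_one[OF E F kg m EF Fc])
    have "trace_norm (U * kron ?Xh (dg k wy) * adj U - kron ?Yh (dg k wx)) =
       (\<Sum>l<D*k. \<bar>\<xi> (block_swap g k l div k) * wy (block_swap g k l mod k) - \<eta> (l div k) * wx (l mod k)\<bar>)"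
      unfolding 1 2 udg_minus[OF unitaryD(1)[OF uF]] trace_norm_udg[OF uF] ..
    also have "\<dots> \<le> (\<Sum>i=k*g..<D. \<xi> i) + (\<Sum>i=k*g..<D. \<eta> i) + 4 * real (g - 1) * b + \<bar>sx - sy\<bar>"
      unfolding wx_def wy_def sx_def sy_def
      by (rule block_swap_deviation[OF \<xi>(1,2) \<xi>(3)[of 0, folded b_def] \<eta>(1,2) \<eta>(3)[of 0, folded b_def] g(1)])
        (use kg m s in \<open>auto simp: sx_def sy_def\<close>)
    also have "4 * real (g - 1) * b = 4 * \<beta>" by (simp add: \<beta>_def)
    \<comment> \<open>The seven \<beta>: two from the tails beyond the blocks, four from the block
      deviations, and one from the difference of sx and sy, which is at most 2 * \<epsilon> +
      \<beta>.\<close>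
    finally show ?thesis using tails s by linarith
  qed
  have c': "trace_norm (kron ?Yh (dg k wx) - kron Y (dg k wx)) \<le> \<epsilon> + 2 * sqrt \<epsilon>"
  proof -
    have "kron ?Yh (dg k wx) - kron Y (dg k wx) = kron (?Yh - Y) (dg k wx)"
      by (rule kron_minus_left[symmetric]) (use hermitianD(1)[OF hY] hermitianD(1)[OF hF] in auto)
    then show ?thesis
      using trace_norm_kron_density[OF hermitian_minus[OF hF hY] dens(1)] trace_norm_minus_commute[OF hF hY] \<eta>t by simp
  qed
  have h1: "hermitian (D * k) (U * kron X (dg k wy) * adj U)" by (intro hconj hermitian_kron hX hw)
  have h2: "hermitian (D * k) (U * kron ?Xh (dg k wy) * adj U)" by (intro hconj hermitian_kron hE hw)
  have h3: "hermitian (D * k) (kron ?Yh (dg k wx))" by (intro hermitian_kron hF hw)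
  have h4: "hermitian (D * k) (kron Y (dg k wx))" by (intro hermitian_kron hY hw)
  have "trace_norm (U * kron X (dg k wy) * adj U - kron Y (dg k wx)) \<le> 4 * \<epsilon> + 4 * sqrt \<epsilon> + 7 * exp (- \<Delta>)"
    using trace_norm_triangle_minus[OF h1 h2 h4] trace_norm_triangle_minus[OF h2 h3 h4] a b' c' \<beta> by linarith
  then show ?thesis
    using k1 kexp dens U comm by (intro exI[of _ k] exI[of _ "dg k wx"] exI[of _ "dg k wy"] exI[of _ U]) auto
qed

section \<open>Concentration of charges and of the spectrum\<close>

definition mean :: "complex mat \<Rightarrow> complex mat \<Rightarrow> real" where
  "mean A X = Re (mtrace (X * A))"

definition var :: "complex mat \<Rightarrow> complex mat \<Rightarrow> real" where
  "var A X = Re (mtrace (X * (A * A))) - (mean A X)\<^sup>2"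

definition info_var :: "complex mat \<Rightarrow> real" where
  "info_var X = info2 X - (vn_entropy X)\<^sup>2"

lemma mtrace_adj: "A \<in> carrier_mat d d \<Longrightarrow> mtrace (adj A) = cnj (mtrace A)"
  by (auto simp: mtrace_def)

lemma mtrace_hermitian_mult:
  assumes "hermitian d X" "hermitian d A"
  shows "mtrace (X * A) = of_real (mean A X)"
proof -
  note X = hermitianD[OF assms(1)] note A = hermitianD[OF assms(2)]
  have "cnj (mtrace (X * A)) = mtrace (adj (X * A))"
    using X A by (intro mtrace_adj[symmetric, of _ d]) auto
  also have "adj (X * A) = A * X" using X A adj_mult[OF X(1) A(1)] by simp
  also have "mtrace (A * X) = mtrace (X * A)" by (rule mtrace_mult_comm[OF A(1) X(1)])
  finally show ?thesis unfolding mean_def by (simp add: complex_eq_iff)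
qed

lemma hermitian_one: "hermitian d (1\<^sub>m d)"
  by (simp add: hermitian_def)

lemma mtrace_mult_minus:
  "X \<in> carrier_mat d d \<Longrightarrow> M \<in> carrier_mat d d \<Longrightarrow> N \<in> carrier_mat d d \<Longrightarrow> mtrace (X * (M - N)) = mtrace (X * M) - mtrace (X * N)"
  by (simp add: mult_minus_distrib_mat[of X d d M d N] mtrace_minus[of _ d] mult_square)

lemma mtrace_mult_add:
  "X \<in> carrier_mat d d \<Longrightarrow> M \<in> carrier_mat d d \<Longrightarrow> N \<in> carrier_mat d d \<Longrightarrow> mtrace (X * (M + N)) = mtrace (X * M) + mtrace (X * N)"
  by (simp add: mult_add_distrib_mat[of X d d M d N] mtrace_add[of _ d] mult_square)

lemma mtrace_mult_smult:
  "X \<in> carrier_mat d d \<Longrightarrow> M \<in> carrier_mat d d \<Longrightarrow> mtrace (X * (a \<cdot>\<^sub>m M)) = a * mtrace (X * M)"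
  by (simp add: mult_smult_distrib[of X d d M d] mtrace_smult[of _ d] mult_square)

text \<open>Bias-variance decomposition. With a = 1/n and b the target value it splits the mean
  square deviation per copy into a fluctuation and a shift of the mean.\<close>

lemma second_moment_shift:
  fixes a b :: real
  assumes X: "density d X" and A: "hermitian d A"
  defines "B \<equiv> complex_of_real a \<cdot>\<^sub>m A - complex_of_real b \<cdot>\<^sub>m 1\<^sub>m d"
  shows "Re (mtrace (X * (B * B))) = a\<^sup>2 * var A X + (a * mean A X - b)\<^sup>2"
proof -
  note Xc = density_carrier[OF X] note Ac = hermitianD(1)[OF A]
  have Bc: "B \<in> carrier_mat d d" unfolding B_def using Ac by auto
  have 1: "B * B = complex_of_real a \<cdot>\<^sub>m (A * B) - complex_of_real b \<cdot>\<^sub>m B"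
  proof -
    have "B * B = (complex_of_real a \<cdot>\<^sub>m A) * B - (complex_of_real b \<cdot>\<^sub>m 1\<^sub>m d) * B"
      using minus_mult_distrib_mat[of "complex_of_real a \<cdot>\<^sub>m A" d d "complex_of_real b \<cdot>\<^sub>m 1\<^sub>m d" B d] Ac Bc
      unfolding B_def[symmetric] by simp
    also have "(complex_of_real a \<cdot>\<^sub>m A) * B = complex_of_real a \<cdot>\<^sub>m (A * B)"
      by (rule mult_smult_assoc_mat[OF Ac Bc])
    also have "(complex_of_real b \<cdot>\<^sub>m 1\<^sub>m d) * B = complex_of_real b \<cdot>\<^sub>m (1\<^sub>m d * B)"
      by (rule mult_smult_assoc_mat[OF _ Bc, of _ d]) simp
    finally show ?thesis using left_mult_one_mat[OF Bc] by simp
  qed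
  have 2: "A * B = complex_of_real a \<cdot>\<^sub>m (A * A) - complex_of_real b \<cdot>\<^sub>m A"
  proof -
    have "A * B = A * (complex_of_real a \<cdot>\<^sub>m A) - A * (complex_of_real b \<cdot>\<^sub>m 1\<^sub>m d)"
      unfolding B_def by (rule mult_minus_distrib_mat[OF Ac]) (use Ac in auto)
    also have "A * (complex_of_real a \<cdot>\<^sub>m A) = complex_of_real a \<cdot>\<^sub>m (A * A)" by (rule mult_smult_distrib[OF Ac Ac])
    also have "A * (complex_of_real b \<cdot>\<^sub>m 1\<^sub>m d) = complex_of_real b \<cdot>\<^sub>m (A * 1\<^sub>m d)" by (rule mult_smult_distrib[OF Ac, of _ d]) simp
    finally show ?thesis using right_mult_one_mat[OF Ac] by simp
  qed
  have tA: "mtrace (X * A) = of_real (mean A X)" by (rule mtrace_hermitian_mult[OF density_hermitian[OF X] A])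
  have "mtrace (X * (B * B)) = of_real a * mtrace (X * (A * B)) - of_real b * mtrace (X * B)"
    unfolding 1 using Xc Ac Bc by (simp add: mtrace_mult_minus[of _ d] mtrace_mult_smult[of _ d] mult_square)
  also have "mtrace (X * (A * B)) = of_real a * mtrace (X * (A * A)) - of_real b * of_real (mean A X)"
    unfolding 2 using Xc Ac by (simp add: mtrace_mult_minus[of _ d] mtrace_mult_smult[of _ d] mult_square tA)
  also have "mtrace (X * B) = of_real a * of_real (mean A X) - of_real b"
    unfolding B_def using Xc Ac X by (simp add: mtrace_mult_minus[of _ d] mtrace_mult_smult[of _ d] tA density_def)
  finally show ?thesis unfolding var_def by (simp only:) (simp add: power2_eq_square algebra_simps)
qed

text \<open>The same decomposition for the random variable - ln x around h.\<close>

lemma info_shift: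
  assumes X: "density d X"
  shows "spec_sum (\<lambda>x. x * (ln x + h)\<^sup>2) X = info_var X + (vn_entropy X - h)\<^sup>2"
proof -
  obtain V x where V: "unitary d V" "X = udg d V x" "\<And>i. i < d \<Longrightarrow> 0 \<le> x i" "(\<Sum>i<d. x i) = 1"
    using density_spectral[OF X] by metis
  have "(\<Sum>i<d. x i * (ln (x i) + h)\<^sup>2) = (\<Sum>i<d. x i * (ln (x i))\<^sup>2 + 2 * h * (x i * ln (x i)) + h\<^sup>2 * x i)"
    by (intro sum.cong refl) (simp add: power2_eq_square algebra_simps)
  also have "\<dots> = (\<Sum>i<d. x i * (ln (x i))\<^sup>2) + 2 * h * (\<Sum>i<d. x i * ln (x i)) + h\<^sup>2 * 1"
    unfolding sum.distrib sum_distrib_left[symmetric] V(4) ..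
  finally show ?thesis
    unfolding info_var_def info2_def V(2) vn_entropy_udg[OF V(1)] spec_sum_udg[OF V(1)]
    by (simp add: power2_eq_square algebra_simps)
qed

text \<open>Scalars commute with U, so a commutator estimate for a centred and rescaled charge
  carries over to the charge itself.\<close>

lemma comm_shift:
  fixes U K :: "complex mat"
  assumes U: "U \<in> carrier_mat N N" and K: "K \<in> carrier_mat N N"
  shows "U * (a \<cdot>\<^sub>m K + b \<cdot>\<^sub>m 1\<^sub>m N) - (a \<cdot>\<^sub>m K + b \<cdot>\<^sub>m 1\<^sub>m N) * U = a \<cdot>\<^sub>m (U * K - K * U)"
proof -
  have o: "b \<cdot>\<^sub>m 1\<^sub>m N \<in> carrier_mat N N" "a \<cdot>\<^sub>m K \<in> carrier_mat N N" "1\<^sub>m N \<in> carrier_mat N N" using K by auto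
  have 1: "U * (a \<cdot>\<^sub>m K + b \<cdot>\<^sub>m 1\<^sub>m N) = a \<cdot>\<^sub>m (U * K) + b \<cdot>\<^sub>m U"
    unfolding mult_add_distrib_mat[OF U o(2,1)] mult_smult_distrib[OF U K] mult_smult_distrib[OF U o(3)] right_mult_one_mat[OF U] ..
  have 2: "(a \<cdot>\<^sub>m K + b \<cdot>\<^sub>m 1\<^sub>m N) * U = a \<cdot>\<^sub>m (K * U) + b \<cdot>\<^sub>m U"
    unfolding add_mult_distrib_mat[OF o(2,1) U] mult_smult_assoc_mat[OF K U] mult_smult_assoc_mat[OF o(3) U] left_mult_one_mat[OF U] ..
  have c: "U * K \<in> carrier_mat N N" "K * U \<in> carrier_mat N N" using U K by auto
  show ?thesis unfolding 1 2
  proof (rule eq_matI)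
    fix i j assume "i < dim_row (a \<cdot>\<^sub>m (U * K - K * U))" "j < dim_col (a \<cdot>\<^sub>m (U * K - K * U))"
    then have ij: "i < N" "j < N" using c by auto
    then show "(a \<cdot>\<^sub>m (U * K) + b \<cdot>\<^sub>m U - (a \<cdot>\<^sub>m (K * U) + b \<cdot>\<^sub>m U)) $$ (i,j) = (a \<cdot>\<^sub>m (U * K - K * U)) $$ (i,j)"
      using carrier_matD[OF U] carrier_matD[OF K] by (simp add: algebra_simps del: index_mult_mat(1))
  qed (use carrier_matD[OF U] carrier_matD[OF K] in auto)
qed

lemma shifted_charge_hermitian:
  "hermitian d A \<Longrightarrow> hermitian d (complex_of_real a \<cdot>\<^sub>m A - complex_of_real b \<cdot>\<^sub>m 1\<^sub>m d)"
proof (rule hermitian_minus)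
  have h: "hermitian d (complex_of_real a \<cdot>\<^sub>m M)" if M: "hermitian d M" for a M
  proof -
    note Mc = hermitianD[OF M]
    have "adj (complex_of_real a \<cdot>\<^sub>m M) = complex_of_real a \<cdot>\<^sub>m adj M"
      by (rule eq_matI) auto
    then show ?thesis using Mc by (simp add: hermitian_def)
  qed
  show "hermitian d A \<Longrightarrow> hermitian d (complex_of_real a \<cdot>\<^sub>m A)" by (rule h)
  show "hermitian d (complex_of_real b \<cdot>\<^sub>m 1\<^sub>m d)" by (rule h[OF hermitian_one])
qed

lemma var_nonneg:
  assumes X: "density d X" and A: "hermitian d A"
  shows "0 \<le> var A X"
proof -
  define B where "B = complex_of_real 1 \<cdot>\<^sub>m A - complex_of_real (mean A X) \<cdot>\<^sub>m 1\<^sub>m d"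
  have B: "hermitian d B" unfolding B_def by (rule shifted_charge_hermitian[OF A])
  note Bc = hermitianD[OF B]
  obtain V x where V: "unitary d V" "X = udg d V x" "\<And>i. i < d \<Longrightarrow> 0 \<le> x i" "(\<Sum>i<d. x i) = 1"
    using density_spectral[OF X] by metis
  note Vc = unitaryD(1)[OF V(1)]
  have "adj V * (B * B) * V = adj (B * V) * (B * V)"
    using carrier_matD[OF Vc] carrier_matD[OF Bc(1)] Bc(2) by (simp add: adj_mult' mat_assoc)
  moreover have "0 \<le> Re ((adj (B * V) * (B * V)) $$ (l,l))" if l: "l < d" for l
  proof -
    have c: "B * V \<in> carrier_mat d d" using Bc Vc by auto
    have "(adj (B * V) * (B * V)) $$ (l,l) = (\<Sum>i<d. cnj ((B * V) $$ (i,l)) * (B * V) $$ (i,l))"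
      unfolding mult_entry[OF adj_carrier[OF c] c l l]
      by (intro sum.cong refl) (use carrier_matD[OF c] l in \<open>simp del: index_mult_mat\<close>)
    then show ?thesis by (simp add: sum_nonneg del: index_mult_mat(1))
  qed
  ultimately have "0 \<le> Re (mtrace (X * (B * B)))"
    unfolding V(2) udg_diag[OF Vc mult_square[OF Bc(1) Bc(1)]]
    using V(3) by (auto intro!: sum_nonneg mult_nonneg_nonneg simp del: index_mult_mat(1))
  then show ?thesis using second_moment_shift[OF X A, of 1 "mean A X"] by (simp add: B_def)
qed

text \<open>A single number e for all mean square deviations per copy is turned into the parameters
  of the conversion; every error then vanishes with e once n * e^(1/4) is large.\<close>

lemma finite_transformation':
  fixes c D n :: nat and v :: "nat \<Rightarrow> real" and s e :: real
  assumes D: "0 < D" and X: "density D X" and Y: "density D Y" and n: "0 < n" and e: "0 < e"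
    and A: "\<And>j. j < c \<Longrightarrow> hermitian D (A j)"
    and eX: "(\<Sum>j<c. var (A j) X / (real n)\<^sup>2 + (mean (A j) X / real n - v j)\<^sup>2) \<le> e"
    and eY: "(\<Sum>j<c. var (A j) Y / (real n)\<^sup>2 + (mean (A j) Y / real n - v j)\<^sup>2) \<le> e"
    and iX: "info_var X / (real n)\<^sup>2 + (vn_entropy X / real n - s)\<^sup>2 \<le> e"
    and iY: "info_var Y / (real n)\<^sup>2 + (vn_entropy Y / real n - s)\<^sup>2 \<le> e"
  shows "\<exists>k \<omega> \<omega>' U. 1 \<le> k \<and> density k \<omega> \<and> density k \<omega>' \<and> unitary (D * k) U \<and>
    ln (real k) / real n \<le> 3 * sqrt (sqrt e) + ln 2 / real n \<and>
    (\<forall>j<c. op_norm (U * kron (A j) (1\<^sub>m k) - kron (A j) (1\<^sub>m k) * U) / real n \<le> 4 * sqrt (sqrt e)) \<and>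
    trace_norm (U * kron X \<omega>' * adj U - kron Y \<omega>) \<le> 4 * sqrt e + 4 * sqrt (sqrt e) + 7 * exp (- (real n * sqrt (sqrt e)))"
proof -
  define B where "B j = complex_of_real (1 / real n) \<cdot>\<^sub>m A j - complex_of_real (v j) \<cdot>\<^sub>m 1\<^sub>m D" for j
  have hB: "hermitian D (B j)" if "j < c" for j
    unfolding B_def by (rule shifted_charge_hermitian[OF A[OF that]])
  have mB: "Re (mtrace (Z * (B j * B j))) = var (A j) Z / (real n)\<^sup>2 + (mean (A j) Z / real n - v j)\<^sup>2"
    if "j < c" "density D Z" for j Z
    unfolding B_def second_moment_shift[OF that(2) A[OF that(1)]] by (simp add: power_divide)
  \<comment> \<open>The budget e is split as \<epsilon> times the square of \<delta> with \<epsilon>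
    = sqrt e; the window of the information is \<Delta> = n * \<delta>.\<close>
  define \<delta> where "\<delta> = sqrt (sqrt e)"
  have \<delta>: "0 < \<delta>" "\<delta>\<^sup>2 = sqrt e" "sqrt e * \<delta>\<^sup>2 = e" using e by (simp_all add: \<delta>_def)
  have iB: "spec_sum (\<lambda>x. x * (ln x + real n * s)\<^sup>2) Z \<le> sqrt e * (real n * \<delta>)\<^sup>2"
    if "info_var Z / (real n)\<^sup>2 + (vn_entropy Z / real n - s)\<^sup>2 \<le> e" "density D Z" for Z
  proof -
    have "info_var Z + (vn_entropy Z - real n * s)\<^sup>2 = (real n)\<^sup>2 * (info_var Z / (real n)\<^sup>2 + (vn_entropy Z / real n - s)\<^sup>2)"
      using n by (simp add: power2_eq_square field_simps)
    also have "\<dots> \<le> (real n)\<^sup>2 * e" by (intro mult_left_mono that) auto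
    also have "\<dots> = sqrt e * (real n * \<delta>)\<^sup>2" using \<delta>(3) by (simp add: power_mult_distrib)
    finally show ?thesis by (simp add: info_shift[OF that(2)])
  qed
  have pos: "0 < real n * \<delta>" using n \<delta> by simp
  have sX: "(\<Sum>j<c. Re (mtrace (X * (B j * B j)))) \<le> sqrt e * \<delta>\<^sup>2" using eX \<delta>(3) by (simp add: mB X)
  have sY: "(\<Sum>j<c. Re (mtrace (Y * (B j * B j)))) \<le> sqrt e * \<delta>\<^sup>2" using eY \<delta>(3) by (simp add: mB Y)
  obtain k \<omega> \<omega>' U where k: "1 \<le> k" "real k \<le> exp (3 * (real n * \<delta>)) + 1" "density k \<omega>" "density k \<omega>'" "unitary (D * k) U"
    and comm: "\<And>j. j < c \<Longrightarrow> opb (4 * \<delta>) (U * kron (B j) (1\<^sub>m k) - kron (B j) (1\<^sub>m k) * U)"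
    and tn: "trace_norm (U * kron X \<omega>' * adj U - kron Y \<omega>) \<le> 4 * sqrt e + 4 * sqrt (sqrt e) + 7 * exp (- (real n * \<delta>))"
    using finite_transformation[OF D X Y hB \<delta>(1) pos sX sY iB[OF iX X] iB[OF iY Y]] e by auto
  note Uc = unitaryD(1)[OF k(5)]
  have lnk: "ln (real k) / real n \<le> 3 * \<delta> + ln 2 / real n"
  proof -
    \<comment> \<open>This absorbs the additive 1 in the bound for k, at the price ln 2 / n in the
      rate.\<close>
    have "1 \<le> exp (3 * (real n * \<delta>))" using pos by simp
    then have "real k \<le> 2 * exp (3 * (real n * \<delta>))" using k(2) by linarith
    then have "ln (real k) \<le> ln (2 * exp (3 * (real n * \<delta>)))" using k(1) by (intro ln_mono) auto
    then have "ln (real k) / real n \<le> (ln 2 + 3 * (real n * \<delta>)) / real n"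
      by (intro divide_right_mono) (simp_all add: ln_mult)
    then show ?thesis using n by (simp add: field_simps)
  qed
  have op: "op_norm (U * kron (A j) (1\<^sub>m k) - kron (A j) (1\<^sub>m k) * U) / real n \<le> 4 * \<delta>" if j: "j < c" for j
  proof -
    note Ac = hermitianD(1)[OF A[OF j]] note Bc = hermitianD(1)[OF hB[OF j]]
    have Kc: "kron (B j) (1\<^sub>m k) \<in> carrier_mat (D * k) (D * k)" using Bc by auto
    have AB: "A j = complex_of_real (real n) \<cdot>\<^sub>m B j + complex_of_real (real n * v j) \<cdot>\<^sub>m 1\<^sub>m D"
      unfolding B_def by (rule eq_matI) (use Ac n in \<open>auto simp: algebra_simps\<close>)
    have KA: "kron (A j) (1\<^sub>m k) = complex_of_real (real n) \<cdot>\<^sub>m kron (B j) (1\<^sub>m k) + complex_of_real (real n * v j) \<cdot>\<^sub>m 1\<^sub>m (D * k)"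
    proof -
      have "kron (A j) (1\<^sub>m k) = kron (complex_of_real (real n) \<cdot>\<^sub>m B j) (1\<^sub>m k) + kron (complex_of_real (real n * v j) \<cdot>\<^sub>m 1\<^sub>m D) (1\<^sub>m k)"
        unfolding arg_cong[OF AB, of "\<lambda>M. kron M (1\<^sub>m k)"] by (rule kron_add_left) (use Bc in auto)
      moreover have "kron (a \<cdot>\<^sub>m M) N = a \<cdot>\<^sub>m kron M N" for a and M N :: "complex mat"
        by (rule eq_matI) (auto simp: div_lt mod_lt)
      ultimately show ?thesis by (simp add: kron_one)
    qed
    have "opb (cmod (complex_of_real (real n)) * (4 * \<delta>)) (U * kron (A j) (1\<^sub>m k) - kron (A j) (1\<^sub>m k) * U)"
      unfolding KA comm_shift[OF Uc Kc] by (rule opb_smult[OF comm[OF j] minus_carrier_mat[OF mult_square[OF Kc Uc]]])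
    moreover have "kron (A j) (1\<^sub>m k) \<in> carrier_mat (D * k) (D * k)" using Ac by auto
    ultimately have "op_norm (U * kron (A j) (1\<^sub>m k) - kron (A j) (1\<^sub>m k) * U) \<le> cmod (complex_of_real (real n)) * (4 * \<delta>)"
      by (intro op_norm_le[of _ _ "D * k" "D * k"] minus_carrier_mat mult_square[OF _ Uc]) (use k(1) D in auto)
    then show ?thesis using n by (simp add: field_simps)
  qed
  show ?thesis
    using k lnk op tn unfolding \<delta>_def by blast
qed

theorem acu_equiv_of_concentration:
  fixes c :: nat and D :: "nat \<Rightarrow> nat" and v :: "nat \<Rightarrow> real" and s :: real
  assumes D: "\<And>n. 0 < D n" and X: "\<And>n. density (D n) (X n)" and Y: "\<And>n. density (D n) (Y n)"
    and A: "\<And>j n. j < c \<Longrightarrow> hermitian (D n) (A j n)"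
    and mX: "\<And>j. j < c \<Longrightarrow> (\<lambda>n. mean (A j n) (X n) / real n) \<longlonglongrightarrow> v j"
      "\<And>j. j < c \<Longrightarrow> (\<lambda>n. var (A j n) (X n) / (real n)\<^sup>2) \<longlonglongrightarrow> 0"
    and mY: "\<And>j. j < c \<Longrightarrow> (\<lambda>n. mean (A j n) (Y n) / real n) \<longlonglongrightarrow> v j"
      "\<And>j. j < c \<Longrightarrow> (\<lambda>n. var (A j n) (Y n) / (real n)\<^sup>2) \<longlonglongrightarrow> 0"
    and iX: "(\<lambda>n. vn_entropy (X n) / real n) \<longlonglongrightarrow> s" "(\<lambda>n. info_var (X n) / (real n)\<^sup>2) \<longlonglongrightarrow> 0"
    and iY: "(\<lambda>n. vn_entropy (Y n) / real n) \<longlonglongrightarrow> s" "(\<lambda>n. info_var (Y n) / (real n)\<^sup>2) \<longlonglongrightarrow> 0"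
  shows "acu_equiv c A X Y"
proof -
  define a where "a Z n = (\<Sum>j<c. var (A j n) (Z n) / (real n)\<^sup>2 + (mean (A j n) (Z n) / real n - v j)\<^sup>2)" for Z n
  define b where "b Z n = info_var (Z n) / (real n)\<^sup>2 + (vn_entropy (Z n) / real n - s)\<^sup>2" for Z :: "nat \<Rightarrow> complex mat" and n
  \<comment> \<open>The summand 1 / n keeps e positive and forces n * e^(1/4) to tend to
    infinity.\<close>
  define e where "e n = \<bar>a X n\<bar> + \<bar>a Y n\<bar> + \<bar>b X n\<bar> + \<bar>b Y n\<bar> + 1 / real n" for n
  have sq0: "(\<lambda>n. (f n - l)\<^sup>2) \<longlonglongrightarrow> 0" if "f \<longlonglongrightarrow> l" for f and l :: real
  proof -
    have "(\<lambda>n. f n - l) \<longlonglongrightarrow> 0" using that by (simp add: LIM_zero_iff)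
    then have "(\<lambda>n. (f n - l)\<^sup>2) \<longlonglongrightarrow> 0\<^sup>2" by (rule tendsto_power)
    then show ?thesis by simp
  qed
  have "a X \<longlonglongrightarrow> (\<Sum>j<c. 0 + 0)" "a Y \<longlonglongrightarrow> (\<Sum>j<c. 0 + 0)"
    unfolding a_def by (intro tendsto_sum tendsto_add sq0 mX mY; simp)+
  moreover have "b X \<longlonglongrightarrow> 0 + 0" "b Y \<longlonglongrightarrow> 0 + 0"
    unfolding b_def by (intro tendsto_add sq0 iX iY)+
  ultimately have e0: "e \<longlonglongrightarrow> \<bar>\<Sum>j<c. 0 + 0\<bar> + \<bar>\<Sum>j<c. 0 + 0\<bar> + \<bar>0 + 0\<bar> + \<bar>0 + 0\<bar> + 0"
    unfolding e_def by (intro tendsto_add tendsto_rabs lim_1_over_n)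
  then have e0: "e \<longlonglongrightarrow> 0" by simp
  have r0: "(\<lambda>n. sqrt (e n)) \<longlonglongrightarrow> 0" "(\<lambda>n. sqrt (sqrt (e n))) \<longlonglongrightarrow> 0"
    using tendsto_real_sqrt[OF e0] tendsto_real_sqrt[OF tendsto_real_sqrt[OF e0]] by simp_all
  have epos: "0 < e n" "1 / real n \<le> e n" if "0 < n" for n
  proof -
    have "0 < 1 / real n" using that by simp
    then show "0 < e n" "1 / real n \<le> e n" unfolding e_def by linarith+
  qed
  \<comment> \<open>Ancilla and unitary are also required at n = 0, where no rate makes sense; a
    trivial choice fills this index and the estimates are stated for positive n.\<close>
  have "\<exists>k \<omega> \<omega>' U. 1 \<le> k \<and> density k \<omega> \<and> density k \<omega>' \<and> unitary (D n * k) U \<and>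
     (0 < n \<longrightarrow> ln (real k) / real n \<le> 3 * sqrt (sqrt (e n)) + ln 2 / real n \<and>
    (\<forall>j<c. op_norm (U * kron (A j n) (1\<^sub>m k) - kron (A j n) (1\<^sub>m k) * U) / real n \<le> 4 * sqrt (sqrt (e n))) \<and>
    trace_norm (U * kron (X n) \<omega>' * adj U - kron (Y n) \<omega>) \<le> 4 * sqrt (e n) + 4 * sqrt (sqrt (e n)) + 7 * exp (- (real n * sqrt (sqrt (e n)))))" for n
  proof (cases "0 < n")
    case True
    have "\<bar>a X n\<bar> \<le> e n" "\<bar>a Y n\<bar> \<le> e n" "\<bar>b X n\<bar> \<le> e n" "\<bar>b Y n\<bar> \<le> e n"
      unfolding e_def by (simp_all add: add_nonneg_nonneg)
    then have le: "a X n \<le> e n" "a Y n \<le> e n" "b X n \<le> e n" "b Y n \<le> e n" by linarith+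
    show ?thesis
      using finite_transformation'[OF D X Y True epos(1)[OF True] A le[unfolded a_def b_def]] by blast
  next
    case False
    have "density 1 (1\<^sub>m 1)"
      using density_udg[OF unitary_one[of 1], of "\<lambda>_. 1"] udg_one[OF unitary_one[of 1]] by simp
    then show ?thesis using False unitary_one[of "D n * 1"] by blast
  qed
  then obtain k \<omega> \<omega>' U where k: "\<And>n. 1 \<le> k n" "\<And>n. density (k n) (\<omega> n)" "\<And>n. density (k n) (\<omega>' n)"
      "\<And>n. unitary (D n * k n) (U n)"
    and lnk: "\<And>n. 0 < n \<Longrightarrow> ln (real (k n)) / real n \<le> 3 * sqrt (sqrt (e n)) + ln 2 / real n"
    and op: "\<And>n j. 0 < n \<Longrightarrow> j < c \<Longrightarrow> op_norm (U n * kron (A j n) (1\<^sub>m (k n)) - kron (A j n) (1\<^sub>m (k n)) * U n) / real n \<le> 4 * sqrt (sqrt (e n))"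
    and tn: "\<And>n. 0 < n \<Longrightarrow> trace_norm (U n * kron (X n) (\<omega>' n) * adj (U n) - kron (Y n) (\<omega> n))
       \<le> 4 * sqrt (e n) + 4 * sqrt (sqrt (e n)) + 7 * exp (- (real n * sqrt (sqrt (e n))))"
    by metis
  have l2: "(\<lambda>n. ln 2 / real n) \<longlonglongrightarrow> 0" by (rule lim_const_over_n)
  have L1: "(\<lambda>n. ln (real (k n)) / real n) \<longlonglongrightarrow> 0"
  proof (rule tendsto_sandwich[of "\<lambda>_. 0"])
    show "\<forall>\<^sub>F n in sequentially. 0 \<le> ln (real (k n)) / real n" using k(1) by simp
    show "\<forall>\<^sub>F n in sequentially. ln (real (k n)) / real n \<le> 3 * sqrt (sqrt (e n)) + ln 2 / real n"
      using eventually_gt_at_top[of 0] by eventually_elim (rule lnk)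
    show "(\<lambda>n. 3 * sqrt (sqrt (e n)) + ln 2 / real n) \<longlonglongrightarrow> 0"
      using tendsto_add[OF tendsto_mult[OF tendsto_const r0(2)] l2, of 3] by simp
  qed simp
  have L2: "(\<lambda>n. op_norm (U n * kron (A j n) (1\<^sub>m (k n)) - kron (A j n) (1\<^sub>m (k n)) * U n) / real n) \<longlonglongrightarrow> 0" if j: "j < c" for j
  proof (rule tendsto_sandwich[of "\<lambda>_. 0"])
    have "0 \<le> op_norm (U n * kron (A j n) (1\<^sub>m (k n)) - kron (A j n) (1\<^sub>m (k n)) * U n)" for n
    proof (rule op_norm_nonneg[of _ "D n * k n" "D n * k n"])
      have "kron (A j n) (1\<^sub>m (k n)) \<in> carrier_mat (D n * k n) (D n * k n)" using hermitianD(1)[OF A[OF j]] by auto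
      then show "U n * kron (A j n) (1\<^sub>m (k n)) - kron (A j n) (1\<^sub>m (k n)) * U n \<in> carrier_mat (D n * k n) (D n * k n)"
        using unitaryD(1)[OF k(4)[of n]] by (intro minus_carrier_mat mult_square)
      show "0 < D n * k n" using D[of n] k(1)[of n] by simp
    qed
    then show "\<forall>\<^sub>F n in sequentially. 0 \<le> op_norm (U n * kron (A j n) (1\<^sub>m (k n)) - kron (A j n) (1\<^sub>m (k n)) * U n) / real n"
      by simp
    show "\<forall>\<^sub>F n in sequentially. op_norm (U n * kron (A j n) (1\<^sub>m (k n)) - kron (A j n) (1\<^sub>m (k n)) * U n) / real n \<le> 4 * sqrt (sqrt (e n))"
      using eventually_gt_at_top[of 0] by eventually_elim (rule op[OF _ j])
    show "(\<lambda>n. 4 * sqrt (sqrt (e n))) \<longlonglongrightarrow> 0" using tendsto_mult[OF tendsto_const r0(2), of 4] by simp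
  qed simp
  \<comment> \<open>The real \<open>sqrt\<close> is negative on negative arguments, so nonnegativity
    rests on the roots: each eigenvalue of \<open>adj M * M\<close> is the squared norm of a column
    of M * V.\<close>
  have tn0: "0 \<le> trace_norm M" for M
  proof -
    have "0 \<le> sqrt (Re a)" if "poly (char_poly (adj M * M)) a = 0" for a
    proof -
      have "hermitian (dim_col M) (adj M * M)" by (auto simp: hermitian_def adj_mult')
      then obtain V x where V: "unitary (dim_col M) V" "adj M * M = udg (dim_col M) V x" using spectral by metis
      note Vc = unitaryD(1)[OF V(1)]
      have "poly (\<Prod>i<dim_col M. [:- complex_of_real (x i), 1:]) a = 0"
        using that unfolding V(2) char_poly_udg[OF V(1)] .
      then have "\<exists>i\<in>{..<dim_col M}. a - complex_of_real (x i) = 0"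
        unfolding poly_prod prod_zero_iff[OF finite_lessThan] by simp
      then obtain i where i: "i < dim_col M" "a = of_real (x i)" by auto
      have "adj (M * V) * (M * V) = adj V * (adj M * M) * V"
        using carrier_matD[OF Vc] by (simp add: adj_mult' mat_assoc)
      also have "\<dots> = dg (dim_col M) x" unfolding V(2) by (rule diag_of_udg[OF V(1)])
      finally have "(adj (M * V) * (M * V)) $$ (i,i) = of_real (x i)" using i by simp
      moreover have "(adj (M * V) * (M * V)) $$ (i,i) = (\<Sum>r<dim_row M. cnj ((M * V) $$ (r,i)) * (M * V) $$ (r,i))"
        using i Vc by (subst mult_entry[of _ "dim_col M" "dim_row M" _ "dim_col M"]) (auto simp del: index_mult_mat(1))
      ultimately have "complex_of_real (x i) = (\<Sum>r<dim_row M. cnj ((M * V) $$ (r,i)) * (M * V) $$ (r,i))" by simp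
      then have "x i = Re (\<Sum>r<dim_row M. cnj ((M * V) $$ (r,i)) * (M * V) $$ (r,i))" by (metis Re_complex_of_real)
      then have "0 \<le> x i" by (simp add: sum_nonneg del: index_mult_mat(1))
      then show ?thesis using i by simp
    qed
    then show ?thesis unfolding trace_norm_def by (intro sum_nonneg mult_nonneg_nonneg) auto
  qed
  have ex: "(\<lambda>n. exp (- (real n * sqrt (sqrt (e n))))) \<longlonglongrightarrow> 0"
  proof (rule tendsto_sandwich[of "\<lambda>_. 0"])
    \<comment> \<open>From e >= 1/n even n * e^(1/4) >= n^(3/4) follows; the weaker bound sqrt n is
      enough and avoids fractional powers.\<close>
    have le: "exp (- (real n * sqrt (sqrt (e n)))) \<le> exp (- sqrt (real n))" if n: "0 < n" for n
    proof -
      have "1 / real n \<le> sqrt (1 / real n)"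
      proof (rule real_le_rsqrt)
        show "(1 / real n)\<^sup>2 \<le> 1 / real n" using n by (simp add: power2_eq_square field_simps)
      qed
      also have "\<dots> \<le> sqrt (e n)" using epos(2)[OF n] by simp
      finally have "sqrt (1 / real n) \<le> sqrt (sqrt (e n))" by simp
      then have "real n * sqrt (1 / real n) \<le> real n * sqrt (sqrt (e n))" by (intro mult_left_mono) auto
      moreover have "real n * sqrt (1 / real n) = sqrt (real n)"
        using n by (simp add: real_sqrt_divide real_div_sqrt)
      ultimately show ?thesis by simp
    qed
    show "\<forall>\<^sub>F n in sequentially. exp (- (real n * sqrt (sqrt (e n)))) \<le> exp (- sqrt (real n))"
      using eventually_gt_at_top[of 0] by eventually_elim (rule le)
    have "filterlim (\<lambda>n. sqrt (real n)) at_top sequentially"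
      by (intro filterlim_compose[OF sqrt_at_top] filterlim_real_sequentially)
    then show "(\<lambda>n. exp (- sqrt (real n))) \<longlonglongrightarrow> 0"
      by (intro filterlim_compose[OF exp_at_bot] filterlim_compose[OF filterlim_uminus_at_bot_at_top])
  qed auto
  have L3: "(\<lambda>n. trace_norm (U n * kron (X n) (\<omega>' n) * adj (U n) - kron (Y n) (\<omega> n))) \<longlonglongrightarrow> 0"
  proof (rule tendsto_sandwich[of "\<lambda>_. 0"])
    show "\<forall>\<^sub>F n in sequentially. trace_norm (U n * kron (X n) (\<omega>' n) * adj (U n) - kron (Y n) (\<omega> n))
       \<le> 4 * sqrt (e n) + 4 * sqrt (sqrt (e n)) + 7 * exp (- (real n * sqrt (sqrt (e n))))"
      using eventually_gt_at_top[of 0] by eventually_elim (rule tn)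
    show "(\<lambda>n. 4 * sqrt (e n) + 4 * sqrt (sqrt (e n)) + 7 * exp (- (real n * sqrt (sqrt (e n))))) \<longlonglongrightarrow> 0"
      using tendsto_add[OF tendsto_add[OF tendsto_mult[OF tendsto_const r0(1), of 4] tendsto_mult[OF tendsto_const r0(2), of 4]]
        tendsto_mult[OF tendsto_const ex, of 7]] by simp
  qed (use tn0 in simp_all)
  have dr: "dim_row (X n) = D n" for n using density_carrier[OF X[of n]] by simp
  show ?thesis
    unfolding acu_equiv_def dr using k L1 L2 L3 by blast
qed

section \<open>Product states\<close>

lemma kron_list_simps [simp]: "kron_list [] = 1\<^sub>m 1" "kron_list (x # xs) = kron x (kron_list xs)"
  by (simp_all add: kron_list_def)

lemma density_one: "density 1 (1\<^sub>m 1)"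
  using density_udg[OF unitary_one[of 1], of "\<lambda>_. 1"] udg_one[OF unitary_one[of 1]] by simp

lemma info_one: "vn_entropy (1\<^sub>m 1) = 0" "info2 (1\<^sub>m 1) = 0"
  using vn_entropy_udg[OF unitary_one[of 1], of "\<lambda>_. 1"] spec_sum_udg[OF unitary_one[of 1], of _ "\<lambda>_. 1"]
    udg_one[OF unitary_one[of 1]] by (simp_all add: info2_def)

lemma info_var_kron:
  assumes "density a \<rho>" "density b \<sigma>"
  shows "info_var (kron \<rho> \<sigma>) = info_var \<rho> + info_var \<sigma>"
  unfolding info_var_def info_kron[OF assms] by (simp add: power2_eq_square algebra_simps)

lemma kron_list_density:
  assumes "\<And>k. k \<in> set ks \<Longrightarrow> density (d k) (f k)"
  shows "density (\<Prod>k\<leftarrow>ks. d k) (kron_list (map f ks))"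
    and "vn_entropy (kron_list (map f ks)) = (\<Sum>k\<leftarrow>ks. vn_entropy (f k))"
    and "info_var (kron_list (map f ks)) = (\<Sum>k\<leftarrow>ks. info_var (f k))"
  using assms
proof (induct ks)
  case Nil
  {
    case 1 then show ?case by (simp add: density_one[unfolded One_nat_def])
  next
    case 2 then show ?case by (simp add: info_one[unfolded One_nat_def])
  next
    case 3 then show ?case by (simp add: info_var_def info_one[unfolded One_nat_def])
  }
next
  case (Cons k ks)
  {
    case 1 then show ?case using Cons by (auto intro: density_kron)
  next
    case 2 then show ?case using Cons by (simp add: info_kron(1)[of "d k" _ "\<Prod>k\<leftarrow>ks. d k"])
  next
    case 3 then show ?case using Cons by (simp add: info_var_kron[of "d k" _ "\<Prod>k\<leftarrow>ks. d k"])
  }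
qed

lemma kron_list_carrier:
  assumes "\<And>k. k \<in> set ks \<Longrightarrow> f k \<in> carrier_mat (d k) (d k)"
  shows "kron_list (map f ks) \<in> carrier_mat (\<Prod>k\<leftarrow>ks. d k) (\<Prod>k\<leftarrow>ks. d k)"
  using assms by (induct ks) auto

lemma kron_list_mult:
  assumes "\<And>k. k \<in> set ks \<Longrightarrow> f k \<in> carrier_mat (d k) (d k)" "\<And>k. k \<in> set ks \<Longrightarrow> h k \<in> carrier_mat (d k) (d k)"
  shows "kron_list (map f ks) * kron_list (map h ks) = kron_list (map (\<lambda>k. f k * h k) ks)"
  using assms
proof (induct ks)
  case (Cons k ks)
  have "kron_list (map f ks) \<in> carrier_mat (\<Prod>k\<leftarrow>ks. d k) (\<Prod>k\<leftarrow>ks. d k)"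
    "kron_list (map h ks) \<in> carrier_mat (\<Prod>k\<leftarrow>ks. d k) (\<Prod>k\<leftarrow>ks. d k)"
    using Cons(2,3) by (auto intro!: kron_list_carrier)
  moreover have "f k \<in> carrier_mat (d k) (d k)" "h k \<in> carrier_mat (d k) (d k)" using Cons(2,3) by auto
  ultimately have "kron (f k) (kron_list (map f ks)) * kron (h k) (kron_list (map h ks))
     = kron (f k * h k) (kron_list (map f ks) * kron_list (map h ks))"
    by (intro kron_mult[symmetric]) auto
  then show ?case using Cons by simp
qed auto

lemma mtrace_kron_list:
  assumes "\<And>k. k \<in> set ks \<Longrightarrow> f k \<in> carrier_mat (d k) (d k)"
  shows "mtrace (kron_list (map f ks)) = (\<Prod>k\<leftarrow>ks. mtrace (f k))"
  using assms
proof (induct ks)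
  case Nil
  then show ?case by (simp add: mtrace_def)
next
  case (Cons k ks)
  then show ?case
    using mtrace_kron[of "f k" "d k" "kron_list (map f ks)" "\<Prod>k\<leftarrow>ks. d k"] kron_list_carrier[of ks f d] by auto
qed

text \<open>Independence: the square of the joint charge has the cross term 2 A \<otimes> B, whose
  expectation in a product state is twice the product of the means and cancels in the
  variance.\<close>

lemma mean_var_kron:
  assumes X: "density a X" and Y: "density b Y" and A: "hermitian a A" and B: "hermitian b B"
  defines "C \<equiv> kron A (1\<^sub>m b) + kron (1\<^sub>m a) B"
  shows "mean C (kron X Y) = mean A X + mean B Y" "var C (kron X Y) = var A X + var B Y"
proof -
  note Xc = density_carrier[OF X] note Yc = density_carrier[OF Y]
  note Ac = hermitianD(1)[OF A] note Bc = hermitianD(1)[OF B]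
  let ?A = "kron A (1\<^sub>m b)" and ?B = "kron (1\<^sub>m a) B"
  have c: "?A \<in> carrier_mat (a * b) (a * b)" "?B \<in> carrier_mat (a * b) (a * b)" "kron X Y \<in> carrier_mat (a * b) (a * b)"
    using Ac Bc Xc Yc by auto
  have tX: "mtrace X = 1" and tY: "mtrace Y = 1" using X Y by (auto simp: density_def)
  have T: "mtrace (kron X Y * kron M N) = mtrace (X * M) * mtrace (Y * N)"
    if "M \<in> carrier_mat a a" "N \<in> carrier_mat b b" for M N
  proof -
    have "kron X Y * kron M N = kron (X * M) (Y * N)"
      using that Xc Yc by (intro kron_mult[symmetric]) auto
    then show ?thesis using that Xc Yc by (simp add: mtrace_kron[of _ a _ b] mult_square)
  qed
  have tA: "mtrace (X * A) = of_real (mean A X)" "mtrace (Y * B) = of_real (mean B Y)"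
    by (rule mtrace_hermitian_mult[OF density_hermitian[OF X] A] mtrace_hermitian_mult[OF density_hermitian[OF Y] B])+
  have 1: "mtrace (kron X Y * C) = of_real (mean A X + mean B Y)"
    unfolding C_def mtrace_mult_add[OF c(3,1,2)]
    using Xc Yc Ac Bc by (simp add: T tA tX tY right_mult_one_mat[OF Xc] right_mult_one_mat[OF Yc])
  then show m: "mean C (kron X Y) = mean A X + mean B Y" unfolding mean_def by simp
  have "C * C = (?A * ?A + ?A * ?B) + (?B * ?A + ?B * ?B)"
  proof -
    have "C * C = C * ?A + C * ?B"
      unfolding C_def by (rule mult_add_distrib_mat[of _ "a*b" "a*b"]) (use c in auto)
    also have "C * ?A = ?A * ?A + ?B * ?A" unfolding C_def by (rule add_mult_distrib_mat[OF c(1,2,1)])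
    also have "C * ?B = ?A * ?B + ?B * ?B" unfolding C_def by (rule add_mult_distrib_mat[OF c(1,2,2)])
    finally show ?thesis
      using assoc_add_mat comm_add_mat mult_square[OF c(1,1)] mult_square[OF c(1,2)] mult_square[OF c(2,1)] mult_square[OF c(2,2)]
      by (intro eq_matI) (auto simp del: index_mult_mat(1))
  qed
  moreover have "?A * ?A = kron (A * A) (1\<^sub>m b)" "?B * ?B = kron (1\<^sub>m a) (B * B)" "?A * ?B = kron A B" "?B * ?A = kron A B"
    using Ac Bc by (simp_all add: kron_mult[symmetric] left_mult_one_mat[OF Ac] right_mult_one_mat[OF Ac]
        left_mult_one_mat[OF Bc] right_mult_one_mat[OF Bc])
  ultimately have "C * C = (kron (A * A) (1\<^sub>m b) + kron A B) + (kron A B + kron (1\<^sub>m a) (B * B))" by simp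
  moreover have k: "kron (A * A) (1\<^sub>m b) \<in> carrier_mat (a * b) (a * b)" "kron A B \<in> carrier_mat (a * b) (a * b)"
    "kron (1\<^sub>m a) (B * B) \<in> carrier_mat (a * b) (a * b)" using Ac Bc by auto
  ultimately have "mtrace (kron X Y * (C * C)) = mtrace (X * (A * A)) + 2 * of_real (mean A X) * of_real (mean B Y) + mtrace (Y * (B * B))"
    using Ac Bc Xc Yc
    by (simp add: mtrace_mult_add[OF c(3)] T tA tX tY right_mult_one_mat[OF Xc] right_mult_one_mat[OF Yc] mult_square)
  then show "var C (kron X Y) = var A X + var B Y"
    unfolding var_def m by (simp add: power2_eq_square algebra_simps)
qed

lemma var_le:
  assumes X: "density d X" and A: "hermitian d A" and c: "opb c A" "0 \<le> c"
  shows "var A X \<le> c\<^sup>2"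
proof -
  note Ac = hermitianD(1)[OF A]
  have "opb (c * c) (A * A)" by (rule opb_mult[OF c(1,1) Ac Ac c(2)])
  then have "cmod (mtrace (X * (A * A))) \<le> c * c * trace_norm X"
    by (intro trace_norm_mtrace[OF density_hermitian[OF X] mult_square[OF Ac Ac]]) (use c in auto)
  then have "Re (mtrace (X * (A * A))) \<le> c\<^sup>2"
    using complex_Re_le_cmod[of "mtrace (X * (A * A))"] by (simp add: trace_norm_density[OF X] power2_eq_square)
  moreover have "0 \<le> (mean A X)\<^sup>2" by simp
  ultimately show ?thesis unfolding var_def by linarith
qed

section \<open>Charges on n copies\<close>

lemma msum_shift:
  assumes "\<And>i. f i \<in> carrier_mat d d"
  shows "msum d f (Suc n) = f 0 + msum d (\<lambda>i. f (Suc i)) n"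
proof (induct n)
  case 0
  show ?case using assms[of 0] by (simp add: left_add_zero_mat right_add_zero_mat)
next
  case (Suc n)
  then show ?case using assms msum_carrier[of n "\<lambda>i. f (Suc i)" d] by (simp add: assoc_add_mat[of _ d d])
qed

lemma msum_cong: "(\<And>i. i < n \<Longrightarrow> f i = h i) \<Longrightarrow> msum d f n = msum d h n"
  by (induct n) auto

lemma msum_kron_left:
  assumes "\<And>i. i < n \<Longrightarrow> f i \<in> carrier_mat e e" "A \<in> carrier_mat d d"
  shows "msum (d * e) (\<lambda>i. kron A (f i)) n = kron A (msum e f n)"
  using assms(1)
proof (induct n)
  case 0
  show ?case using assms(2) by (intro eq_matI) (auto simp: div_lt mod_lt)
next
  case (Suc n)
  have "msum e f n \<in> carrier_mat e e" "f n \<in> carrier_mat e e" using Suc(2) by (auto intro!: msum_carrier)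
  then have "kron A (msum e f n + f n) = kron A (msum e f n) + kron A (f n)" by (intro kron_add_right) auto
  then show ?case using Suc by simp
qed

lemma kron_list_ones: "kron_list (replicate n (1\<^sub>m d)) = 1\<^sub>m (d ^ n)"
  by (induct n) (simp_all add: kron_one)

lemma ncopy_0: "ncopy X 0 = 0\<^sub>m 1 1"
  by (simp add: ncopy_def)

text \<open>Splitting off the first copy gives the two-factor form of \<open>mean_var_kron\<close>,
  so all statements about n copies become inductions.\<close>

lemma ncopy_Suc:
  assumes X: "X \<in> carrier_mat d d"
  shows "ncopy X (Suc n) = kron X (1\<^sub>m (d ^ n)) + kron (1\<^sub>m d) (ncopy X n)"
proof -
  have dX: "dim_row X = d" using X by simp
  define f where "f n i = kron_list (replicate i (1\<^sub>m d) @ [X] @ replicate (n - 1 - i) (1\<^sub>m d))" for n i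
  have len: "kron_list (replicate i (1\<^sub>m d) @ [X] @ replicate r (1\<^sub>m d)) \<in> carrier_mat (d ^ (i + Suc r)) (d ^ (i + Suc r))" for i r
    by (induct i) (use X in \<open>auto simp: kron_list_ones intro!: kron_carrier\<close>)
  have fc: "f n i \<in> carrier_mat (d ^ n) (d ^ n)" if "i < n" for i n
    unfolding f_def using len[of i "n - 1 - i"] that by simp
  have n1: "ncopy X m = msum (d ^ m) (f m) m" for m by (simp add: ncopy_def dX f_def[abs_def])
  \<comment> \<open>Padded by zero beyond n, since \<open>msum_shift\<close> asks for the right
    dimension at every index.\<close>
  define h where "h i = (if i \<le> n then f (Suc n) i else 0\<^sub>m (d ^ Suc n) (d ^ Suc n))" for i
  have hc: "h i \<in> carrier_mat (d ^ Suc n) (d ^ Suc n)" for i using fc[of i "Suc n"] by (simp add: h_def)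
  have "ncopy X (Suc n) = msum (d ^ Suc n) h (Suc n)"
    unfolding n1 by (rule msum_cong) (simp add: h_def)
  also have "\<dots> = h 0 + msum (d ^ Suc n) (\<lambda>i. h (Suc i)) n" by (rule msum_shift[OF hc])
  also have "h 0 = kron X (1\<^sub>m (d ^ n))" by (simp add: h_def f_def kron_list_ones)
  also have "msum (d ^ Suc n) (\<lambda>i. h (Suc i)) n = msum (d * d ^ n) (\<lambda>i. kron (1\<^sub>m d) (f n i)) n"
    unfolding power_Suc by (rule msum_cong) (simp add: h_def f_def)
  also have "\<dots> = kron (1\<^sub>m d) (ncopy X n)" unfolding n1 by (rule msum_kron_left) (use fc in auto)
  finally show ?thesis .
qed

lemma ncopy_carrier: "X \<in> carrier_mat d d \<Longrightarrow> ncopy X n \<in> carrier_mat (d ^ n) (d ^ n)"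
  by (induct n) (auto simp: ncopy_0 ncopy_Suc intro!: add_carrier_mat kron_carrier)

lemma ncopy_hermitian:
  assumes "hermitian d X"
  shows "hermitian (d ^ n) (ncopy X n)"
proof (induct n)
  case 0
  show ?case by (auto simp: ncopy_0 hermitian_def intro!: eq_matI)
next
  case (Suc n)
  have "hermitian (d * d ^ n) (kron X (1\<^sub>m (d ^ n)) + kron (1\<^sub>m d) (ncopy X n))"
    by (intro hermitian_add hermitian_kron assms hermitian_one Suc)
  then show ?case by (simp add: ncopy_Suc[OF hermitianD(1)[OF assms]])
qed

lemma opb_ncopy:
  assumes X: "X \<in> carrier_mat d d" and c: "opb c X" "0 \<le> c"
  shows "opb (real n * c) (ncopy X n)"
proof (induct n)
  case 0
  have "vnorm (0\<^sub>m 1 1 *\<^sub>v v) = 0" if "v \<in> carrier_vec 1" for v :: "complex vec"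
  proof -
    have "0\<^sub>m 1 1 *\<^sub>v v = 0\<^sub>v 1" using that by (intro eq_vecI) auto
    then show ?thesis by (simp add: vnorm_def)
  qed
  then show ?case by (simp add: ncopy_0 opb_def)
next
  case (Suc n)
  note nc = ncopy_carrier[OF X, of n]
  have "opb (c + real n * c) (kron X (1\<^sub>m (d ^ n)) + kron (1\<^sub>m d) (ncopy X n))"
    by (rule opb_add[OF opb_kron_one_right[OF c(1) X c(2)] opb_kron_one_left[OF Suc nc]])
      (use c X nc in auto)
  then show ?case by (simp add: ncopy_Suc[OF X] algebra_simps)
qed

lemma mean_var_product:
  assumes A: "hermitian d A" and xs: "\<And>x. x \<in> set xs \<Longrightarrow> density d x"
  shows "density (d ^ length xs) (kron_list xs)"
    and "mean (ncopy A (length xs)) (kron_list xs) = (\<Sum>x\<leftarrow>xs. mean A x)"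
    and "var (ncopy A (length xs)) (kron_list xs) = (\<Sum>x\<leftarrow>xs. var A x)"
  using xs
proof (induct xs)
  case Nil
  {
    case 1 then show ?case by (simp add: density_one[unfolded One_nat_def])
  next
    case 2 then show ?case by (simp add: mean_def ncopy_0 mtrace_def)
  next
    case 3 then show ?case by (simp add: var_def mean_def ncopy_0 mtrace_def)
  }
next
  case (Cons x xs)
  {
    case 1 then show ?case using Cons by (auto intro: density_kron)
  next
    case 2
    have "density (d ^ length xs) (kron_list xs)" using Cons(1) 2 by simp
    then show ?case
      using mean_var_kron(1)[where X = x and Y = "kron_list xs", OF _ _ A ncopy_hermitian[OF A]] Cons 2
      by (simp add: ncopy_Suc[OF hermitianD(1)[OF A]])
  next
    case 3
    have "density (d ^ length xs) (kron_list xs)" using Cons(1) 3 by simp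
    then show ?case
      using mean_var_kron(2)[where X = x and Y = "kron_list xs", OF _ _ A ncopy_hermitian[OF A]] Cons 3
      by (simp add: ncopy_Suc[OF hermitianD(1)[OF A]])
  }
qed

section \<open>Batteries and total charges\<close>

lemma mtrace_mult:
  assumes "A \<in> carrier_mat n m" "B \<in> carrier_mat m n"
  shows "mtrace (A * B) = (\<Sum>i<n. \<Sum>l<m. A $$ (i,l) * B $$ (l,i))"
  using assms by (simp add: mtrace_def mult_entry[OF assms] del: index_mult_mat(1))

lemma proj_dims [simp]: "dim_row (proj v) = dim_vec v" "dim_col (proj v) = dim_vec v"
  by (simp_all add: proj_def)

text \<open>After completing v to a basis, the first column is v up to a scalar of modulus one,
  which cancels in the rank-one projector.\<close>

lemma proj_udg:
  assumes v: "v \<in> carrier_vec d" "vnorm v = 1" and d: "0 < d"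
  shows "\<exists>W. unitary d W \<and> proj v = udg d W (\<lambda>i. if i = 0 then 1 else 0)"
proof -
  have v0: "v \<noteq> 0\<^sub>v d" using v by (auto simp: vnorm_def)
  obtain W a where W: "unitary d W" and a: "col W 0 = a \<cdot>\<^sub>v v"
    using unitary_with_first_column[OF v(1) v0] by auto
  note Wc = unitaryD(1)[OF W]
  have "cmod a = 1" using vnorm_col[OF W d] v(2) unfolding a vnorm_smult by simp
  then have aa: "a * cnj a = 1" by (simp add: complex_norm_square[symmetric])
  have Wi: "W $$ (i,0) = a * v $ i" if "i < d" for i
    using arg_cong[OF a, of "\<lambda>u. u $ i"] that v Wc d by simp
  have "proj v = udg d W (\<lambda>i. if i = 0 then 1 else 0)"
  proof (rule eq_matI)
    fix i j assume "i < dim_row (udg d W (\<lambda>i. if i = 0 then 1 else 0))" "j < dim_col (udg d W (\<lambda>i. if i = 0 then 1 else 0))"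
    then have ij: "i < d" "j < d" using Wc by auto
    have "udg d W (\<lambda>i. if i = 0 then 1 else 0) $$ (i,j) = (\<Sum>l<d. if l = 0 then W $$ (i,0) * cnj (W $$ (j,0)) else 0)"
      unfolding udg_entry[OF Wc ij] by (intro sum.cong refl) auto
    also have "\<dots> = (a * cnj a) * (v $ i * cnj (v $ j))" using d Wi ij by simp
    finally show "proj v $$ (i,j) = udg d W (\<lambda>i. if i = 0 then 1 else 0) $$ (i,j)"
      using ij v by (simp add: aa proj_def)
  qed (use v Wc in auto)
  then show ?thesis using W by blast
qed

lemma proj_pure:
  assumes v: "v \<in> carrier_vec d" "vnorm v = 1" and d: "0 < d"
  shows "density d (proj v)" "vn_entropy (proj v) = 0" "info_var (proj v) = 0"
proof -
  obtain W where W: "unitary d W" "proj v = udg d W (\<lambda>i. if i = 0 then 1 else 0)"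
    using proj_udg[OF assms] by blast
  show "density d (proj v)" unfolding W(2) by (rule density_udg[OF W(1)]) (use d in auto)
  show e: "vn_entropy (proj v) = 0" unfolding W(2) vn_entropy_udg[OF W(1)] by (simp add: sum.neutral)
  show "info_var (proj v) = 0"
    unfolding info_var_def e info2_def unfolding W(2) spec_sum_udg[OF W(1)] by (simp add: sum.neutral)
qed

lemma mtrace_proj:
  assumes v: "v \<in> carrier_vec d" and A: "A \<in> carrier_mat d d"
  shows "mtrace (proj v * A) = cinner v (A *\<^sub>v v)"
proof -
  have p: "proj v \<in> carrier_mat d d" using v by (auto simp: proj_def)
  have "mtrace (proj v * A) = (\<Sum>i<d. \<Sum>l<d. v $ i * cnj (v $ l) * A $$ (l,i))"
    unfolding mtrace_mult[OF p A] using v by (intro sum.cong refl) (simp add: proj_def)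
  also have "\<dots> = (\<Sum>l<d. cnj (v $ l) * (\<Sum>i<d. A $$ (l,i) * v $ i))"
    by (subst sum.swap) (simp add: sum_distrib_left mult_ac)
  also have "\<dots> = cinner v (A *\<^sub>v v)"
    using A by (auto simp: cinner_def mult_vec_entry[OF A v] intro!: sum.cong simp del: index_mult_mat_vec)
  finally show ?thesis .
qed

lemma prod_list_const_upt: "(\<Prod>k\<leftarrow>[0..<n]. d) = (d::nat) ^ n"
  by (induct n) simp_all

lemma prod_list_upt: "(\<Prod>k\<leftarrow>[0..<n]. f k) = (\<Prod>k<n. f k :: 'a::comm_monoid_mult)"
  by (induct n) simp_all

lemma sum_list_upt: "(\<Sum>k\<leftarrow>[0..<n]. f k) = (\<Sum>k<n. f k :: 'a::comm_monoid_add)"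
  by (induct n) simp_all

lemma product_state:
  assumes "\<And>i. density d (f i)" and "hermitian d A"
  shows "density (d ^ n) (kron_list (map f [0..<n]))"
    "vn_entropy (kron_list (map f [0..<n])) = (\<Sum>i<n. vn_entropy (f i))"
    "info_var (kron_list (map f [0..<n])) = (\<Sum>i<n. info_var (f i))"
    "mean (ncopy A n) (kron_list (map f [0..<n])) = (\<Sum>i<n. mean A (f i))"
    "var (ncopy A n) (kron_list (map f [0..<n])) = (\<Sum>i<n. var A (f i))"
  using kron_list_density[of "[0..<n]" "\<lambda>_. d" f] mean_var_product[OF assms(2), of "map f [0..<n]"] assms
  by (auto simp: prod_list_const_upt sum_list_upt comp_def)

lemma tpow_product: "tpow X n = kron_list (map (\<lambda>_. X) [0..<n])"
  by (simp add: tpow_def map_replicate_const)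

definition batt_charge :: "nat \<Rightarrow> (nat \<Rightarrow> nat) \<Rightarrow> (nat \<Rightarrow> complex mat) \<Rightarrow> nat \<Rightarrow> nat \<Rightarrow> complex mat" where
  "batt_charge c dW AW j n = kron_list (map (\<lambda>k. if k = j then ncopy (AW k) n else 1\<^sub>m (dW k ^ n)) [0..<c])"

lemma battW_dim_list: "battW_dim c dW n = (\<Prod>k\<leftarrow>[0..<c]. dW k ^ n)"
  by (simp add: battW_dim_def prod_list_upt)

lemma kron_list_adj: "adj (kron_list (map f ks)) = kron_list (map (\<lambda>k. adj (f k)) ks)"
  by (induct ks) (simp_all add: kron_adj)

lemma batt_charge_hermitian:
  assumes "\<And>j. j < c \<Longrightarrow> hermitian (dW j) (AW j)"
  shows "hermitian (battW_dim c dW n) (batt_charge c dW AW j n)"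
proof -
  have h: "hermitian (dW k ^ n) (if k = j then ncopy (AW k) n else 1\<^sub>m (dW k ^ n))" if "k < c" for k
    using ncopy_hermitian[OF assms[OF that]] hermitian_one by (cases "k = j") auto
  show ?thesis unfolding hermitian_def battW_dim_list batt_charge_def kron_list_adj
    using h by (auto intro!: kron_list_carrier arg_cong[of _ _ kron_list] simp: hermitian_def)
qed

lemma batt_state:
  assumes dW: "\<And>j. j < c \<Longrightarrow> 0 < dW j"
    and w: "\<And>j i. j < c \<Longrightarrow> w j n i \<in> carrier_vec (dW j) \<and> vnorm (w j n i) = 1"
  shows "\<And>j. j < c \<Longrightarrow> density (dW j ^ n) (batt_j w j n)"
    and "density (battW_dim c dW n) (batt c w n)"
    and "vn_entropy (batt c w n) = 0" "info_var (batt c w n) = 0"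
proof -
  have p: "density (dW j ^ n) (batt_j w j n) \<and> vn_entropy (batt_j w j n) = 0 \<and> info_var (batt_j w j n) = 0" if j: "j < c" for j
  proof -
    note q = proj_pure[of "w j n i" "dW j" for i]
    have "density (dW j) (proj (w j n i))" "vn_entropy (proj (w j n i)) = 0" "info_var (proj (w j n i)) = 0" for i
      using proj_pure[of "w j n i" "dW j"] w[OF j, of i] dW[OF j] by auto
    then show ?thesis unfolding batt_j_def
      using kron_list_density[of "[0..<n]" "\<lambda>_. dW j" "\<lambda>i. proj (w j n i)"] by (simp add: prod_list_const_upt)
  qed
  then show "\<And>j. j < c \<Longrightarrow> density (dW j ^ n) (batt_j w j n)" by blast
  show "density (battW_dim c dW n) (batt c w n)" "vn_entropy (batt c w n) = 0" "info_var (batt c w n) = 0"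
    unfolding batt_def battW_dim_list
    using kron_list_density[of "[0..<c]" "\<lambda>k. dW k ^ n" "\<lambda>j. batt_j w j n"] p by (simp_all add: sum_list_upt)
qed

lemma batt_mean_var:
  assumes AW: "\<And>j. j < c \<Longrightarrow> hermitian (dW j) (AW j)" and dW: "\<And>j. j < c \<Longrightarrow> 0 < dW j"
    and w: "\<And>j i. j < c \<Longrightarrow> w j n i \<in> carrier_vec (dW j) \<and> vnorm (w j n i) = 1" and j: "j < c"
  shows "mean (batt_charge c dW AW j n) (batt c w n) = mean (ncopy (AW j) n) (batt_j w j n)"
    and "var (batt_charge c dW AW j n) (batt c w n) = var (ncopy (AW j) n) (batt_j w j n)"
proof -
  define N where "N k = (if k = j then ncopy (AW k) n else 1\<^sub>m (dW k ^ n))" for k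
  define d where "d k = dW k ^ n" for k
  have b: "density (d k) (batt_j w k n)" if "k < c" for k
    using batt_state(1)[of c dW w n, OF dW w that] by (simp add: d_def)
  have bc: "batt_j w k n \<in> carrier_mat (d k) (d k)" if "k < c" for k using density_carrier[OF b[OF that]] .
  have Nc: "N k \<in> carrier_mat (d k) (d k)" if "k < c" for k
    using ncopy_carrier[OF hermitianD(1)[OF AW[OF that]]] by (cases "k = j") (auto simp: N_def d_def)
  \<comment> \<open>Every battery other than j contributes the trace of a state, which is
    one.\<close>
  have tr: "mtrace (batt c w n * kron_list (map M [0..<c])) = mtrace (batt_j w j n * M j)"
    if M: "\<And>k. k < c \<Longrightarrow> M k \<in> carrier_mat (d k) (d k)" "\<And>k. k < c \<Longrightarrow> k \<noteq> j \<Longrightarrow> M k = 1\<^sub>m (d k)" for M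
  proof -
    have "mtrace (batt c w n * kron_list (map M [0..<c])) = mtrace (kron_list (map (\<lambda>k. batt_j w k n * M k) [0..<c]))"
      unfolding batt_def using kron_list_mult[of "[0..<c]" "\<lambda>j. batt_j w j n" d M] bc M by simp
    also have "\<dots> = (\<Prod>k<c. mtrace (batt_j w k n * M k))"
      using mtrace_kron_list[of "[0..<c]" "\<lambda>k. batt_j w k n * M k" d] bc M by (auto simp: prod_list_upt)
    also have "\<dots> = (\<Prod>k<c. if k = j then mtrace (batt_j w j n * M j) else 1)"
    proof (intro prod.cong refl)
      fix k assume "k \<in> {..<c}"
      then show "mtrace (batt_j w k n * M k) = (if k = j then mtrace (batt_j w j n * M j) else 1)"
        using M(2)[of k] right_mult_one_mat[OF bc, of k] b[of k] by (auto simp: density_def)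
    qed
    finally show ?thesis using j by simp
  qed
  have W: "batt_charge c dW AW j n = kron_list (map N [0..<c])"
    unfolding batt_charge_def N_def[abs_def] ..
  have W2: "batt_charge c dW AW j n * batt_charge c dW AW j n = kron_list (map (\<lambda>k. N k * N k) [0..<c])"
    unfolding W using kron_list_mult[of "[0..<c]" N d N] Nc by simp
  have "mtrace (batt c w n * batt_charge c dW AW j n) = mtrace (batt_j w j n * N j)"
    unfolding W by (rule tr) (use Nc in \<open>auto simp: N_def d_def\<close>)
  then show m: "mean (batt_charge c dW AW j n) (batt c w n) = mean (ncopy (AW j) n) (batt_j w j n)"
    by (simp add: mean_def N_def)
  have "mtrace (batt c w n * (batt_charge c dW AW j n * batt_charge c dW AW j n)) = mtrace (batt_j w j n * (N j * N j))"
    unfolding W2 by (rule tr) (use Nc in \<open>auto simp: N_def d_def left_mult_one_mat[OF one_carrier_mat]\<close>)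
  then show "var (batt_charge c dW AW j n) (batt c w n) = var (ncopy (AW j) n) (batt_j w j n)"
    by (simp add: var_def m N_def)
qed

section \<open>Total charges of system, bath and batteries\<close>

lemma SB_charge_hermitian:
  assumes "hermitian dS (AS j)" "hermitian dB (AB j)"
  shows "hermitian (dS ^ n * dB ^ n) (SB_charge dS dB AS AB j n)"
  unfolding SB_charge_def by (intro hermitian_add hermitian_kron ncopy_hermitian assms hermitian_one)

lemma total_charge_split:
  assumes "AS j \<in> carrier_mat dS dS" "AB j \<in> carrier_mat dB dB"
  shows "total_charge c dS dB dW AS AB AW j n =
    kron (SB_charge dS dB AS AB j n) (1\<^sub>m (battW_dim c dW n)) + kron (1\<^sub>m (dS ^ n * dB ^ n)) (batt_charge c dW AW j n)"
proof -
  have "kron (SB_charge dS dB AS AB j n) (1\<^sub>m (battW_dim c dW n)) =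
    kron (kron (ncopy (AS j) n) (1\<^sub>m (dB ^ n))) (1\<^sub>m (battW_dim c dW n))
   + kron (kron (1\<^sub>m (dS ^ n)) (ncopy (AB j) n)) (1\<^sub>m (battW_dim c dW n))"
    unfolding SB_charge_def
    by (rule kron_add_left) (use ncopy_carrier[OF assms(1), of n] ncopy_carrier[OF assms(2), of n] in auto)
  then show ?thesis by (simp add: total_charge_def batt_charge_def)
qed

lemma total_charge_state:
  assumes AS: "hermitian dS (AS j)" and AB: "hermitian dB (AB j)"
    and AW: "\<And>j. j < c \<Longrightarrow> hermitian (dW j) (AW j)" and dW: "\<And>j. j < c \<Longrightarrow> 0 < dW j"
    and w: "\<And>j i. j < c \<Longrightarrow> w j n i \<in> carrier_vec (dW j) \<and> vnorm (w j n i) = 1" and j: "j < c"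
    and Z: "density (dS ^ n * dB ^ n) Z"
  shows "mean (total_charge c dS dB dW AS AB AW j n) (kron Z (batt c w n)) =
      mean (SB_charge dS dB AS AB j n) Z + mean (ncopy (AW j) n) (batt_j w j n)"
    and "var (total_charge c dS dB dW AS AB AW j n) (kron Z (batt c w n)) =
      var (SB_charge dS dB AS AB j n) Z + var (ncopy (AW j) n) (batt_j w j n)"
  unfolding total_charge_split[of AS j dS AB dB, OF hermitianD(1)[OF AS] hermitianD(1)[OF AB]]
  using mean_var_kron[OF Z batt_state(2)[of c dW w n, OF dW w] SB_charge_hermitian[where AS = AS and AB = AB and j = j, OF AS AB, of n] batt_charge_hermitian[of c dW AW n j, OF AW]]
    batt_mean_var[of c dW AW w n j, OF AW dW w j] by auto

lemma total_charge_hermitian: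
  assumes AS: "hermitian dS (AS j)" and AB: "hermitian dB (AB j)"
    and AW: "\<And>j. j < c \<Longrightarrow> hermitian (dW j) (AW j)"
  shows "hermitian (dS ^ n * dB ^ n * battW_dim c dW n) (total_charge c dS dB dW AS AB AW j n)"
  unfolding total_charge_split[of AS j dS AB dB, OF hermitianD(1)[OF AS] hermitianD(1)[OF AB]]
  by (intro hermitian_add hermitian_kron SB_charge_hermitian[where AS = AS and AB = AB and j = j, OF AS AB] hermitian_one batt_charge_hermitian AW)

text \<open>Each part is a sum of n one-copy terms, so a single C serves all n. With it a vanishing
  trace-norm error becomes a charge error of order o(n).\<close>

lemma opb_total_charge:
  assumes AS: "hermitian dS (AS j)" and AB: "hermitian dB (AB j)"
    and AW: "\<And>j. j < c \<Longrightarrow> hermitian (dW j) (AW j)" and j: "j < c"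
  shows "\<exists>C\<ge>0. \<forall>n. opb (real n * C) (total_charge c dS dB dW AS AB AW j n)"
proof -
  note Sc = hermitianD(1)[OF AS] note Bc = hermitianD(1)[OF AB] note Wc = hermitianD(1)[OF AW]
  obtain a where a: "0 \<le> a" "opb a (AS j)" using opb_exists[OF Sc] by auto
  obtain b where b: "0 \<le> b" "opb b (AB j)" using opb_exists[OF Bc] by auto
  obtain e where e: "0 \<le> e" "opb e (AW j)" using opb_exists[OF Wc[OF j]] by auto
  have "opb (real n * (a + b + e)) (total_charge c dS dB dW AS AB AW j n)" for n
  proof -
    have SB: "opb (real n * a + real n * b) (SB_charge dS dB AS AB j n)"
      unfolding SB_charge_def
      by (rule opb_add[OF opb_kron_one_right[OF opb_ncopy[OF Sc a(2,1)] ncopy_carrier[OF Sc]]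
           opb_kron_one_left[OF opb_ncopy[OF Bc b(2,1)] ncopy_carrier[OF Bc]]])
        (use a b ncopy_carrier[OF Sc, of n] ncopy_carrier[OF Bc, of n] in auto)
    have SBc: "SB_charge dS dB AS AB j n \<in> carrier_mat (dS ^ n * dB ^ n) (dS ^ n * dB ^ n)"
      by (rule hermitianD(1)[OF SB_charge_hermitian[where AS = AS and AB = AB and j = j, OF AS AB]])
    \<comment> \<open>Induction over lists that contain j exactly once: ahead of j an identity is
      prepended, and behind j only identities follow.\<close>
    have W: "opb (real n * e) (kron_list (map (\<lambda>k. if k = j then ncopy (AW k) n else 1\<^sub>m (dW k ^ n)) ks)) \<and>
       kron_list (map (\<lambda>k. if k = j then ncopy (AW k) n else 1\<^sub>m (dW k ^ n)) ks) \<in> carrier_mat (\<Prod>k\<leftarrow>ks. dW k ^ n) (\<Prod>k\<leftarrow>ks. dW k ^ n)"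
      if "distinct ks" "j \<in> set ks" "set ks \<subseteq> {..<c}" for ks
      using that
    proof (induct ks)
      case (Cons k ks)
      let ?f = "\<lambda>k. if k = j then ncopy (AW k) n else 1\<^sub>m (dW k ^ n)"
      have car: "kron_list (map ?f (k # ks)) \<in> carrier_mat (\<Prod>k\<leftarrow>k#ks. dW k ^ n) (\<Prod>k\<leftarrow>k#ks. dW k ^ n)"
        by (rule kron_list_carrier) (use Cons(4) ncopy_carrier[OF Wc] in auto)
      have ones: "kron_list (map (\<lambda>k. 1\<^sub>m (dW k ^ n)) ls) = 1\<^sub>m (\<Prod>k\<leftarrow>ls. dW k ^ n)" for ls
        by (induct ls) (simp_all add: kron_one)
      have "opb (real n * e) (kron_list (map ?f (k # ks)))"
      proof (cases "k = j")
        case True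
        then have m: "map ?f ks = map (\<lambda>k. 1\<^sub>m (dW k ^ n)) ks" using Cons(2) by auto
        have "kron_list (map ?f (k # ks)) = kron (ncopy (AW j) n) (1\<^sub>m (\<Prod>k\<leftarrow>ks. dW k ^ n))"
          unfolding list.map kron_list_simps m ones using True by simp
        then show ?thesis using opb_kron_one_right[OF opb_ncopy[OF Wc[OF j] e(2,1)] ncopy_carrier[OF Wc[OF j]]] e by simp
      next
        case False
        then have "kron_list (map ?f (k # ks)) = kron (1\<^sub>m (dW k ^ n)) (kron_list (map ?f ks))" by simp
        moreover have "opb (real n * e) (kron_list (map ?f ks))"
          "kron_list (map ?f ks) \<in> carrier_mat (\<Prod>k\<leftarrow>ks. dW k ^ n) (\<Prod>k\<leftarrow>ks. dW k ^ n)"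
          using Cons False by auto
        ultimately show ?thesis using opb_kron_one_left e by simp
      qed
      then show ?case using car by blast
    qed simp
    have Wb: "opb (real n * e) (batt_charge c dW AW j n)"
      "batt_charge c dW AW j n \<in> carrier_mat (battW_dim c dW n) (battW_dim c dW n)"
      using W[of "[0..<c]"] j by (auto simp: batt_charge_def battW_dim_list atLeast0LessThan)
    have "opb ((real n * a + real n * b) + real n * e) (total_charge c dS dB dW AS AB AW j n)"
      unfolding total_charge_split[of AS j dS AB dB, OF Sc Bc]
      by (rule opb_add[OF opb_kron_one_right[OF SB SBc] opb_kron_one_left[OF Wb]]) (use a b e SBc Wb(2) in auto)
    then show ?thesis by (simp add: algebra_simps)
  qed
  then show ?thesis using a b e by (intro exI[of _ "a + b + e"]) auto
qed

section \<open>Marginals\<close>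

lemma mtrace_ptr_right:
  assumes X: "X \<in> carrier_mat (d1 * d2) (d1 * d2)" and A: "A \<in> carrier_mat d1 d1"
  shows "mtrace (ptr_right d1 d2 X * A) = mtrace (X * kron A (1\<^sub>m d2))"
proof -
  have p: "ptr_right d1 d2 X \<in> carrier_mat d1 d1" by (simp add: ptr_right_def)
  have K: "kron A (1\<^sub>m d2) \<in> carrier_mat (d1 * d2) (d1 * d2)" using A by auto
  have "mtrace (X * kron A (1\<^sub>m d2)) = (\<Sum>i<d1. \<Sum>k<d2. \<Sum>j<d1. \<Sum>r<d2. X $$ (i*d2+k, j*d2+r) * kron A (1\<^sub>m d2) $$ (j*d2+r, i*d2+k))"
    using carrier_matD[OF X] by (simp add: mtrace_def mult_entry[OF X K] sum_div_mod pair_lt del: index_mult_mat(1) kron_entry)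
  also have "\<dots> = (\<Sum>i<d1. \<Sum>k<d2. \<Sum>j<d1. \<Sum>r<d2. if r = k then X $$ (i*d2+k, j*d2+k) * A $$ (j,i) else 0)"
    using A by (intro sum.cong refl) (auto simp: pair_lt)
  also have "\<dots> = (\<Sum>i<d1. \<Sum>k<d2. \<Sum>j<d1. X $$ (i*d2+k, j*d2+k) * A $$ (j,i))" by simp
  also have "\<dots> = (\<Sum>i<d1. \<Sum>j<d1. \<Sum>k<d2. X $$ (i*d2+k, j*d2+k) * A $$ (j,i))"
    by (intro sum.cong refl sum.swap)
  also have "\<dots> = mtrace (ptr_right d1 d2 X * A)"
    unfolding mtrace_mult[OF p A] by (intro sum.cong refl) (simp add: ptr_right_def sum_distrib_right)
  finally show ?thesis by simp
qed

lemma mtrace_ptr_left: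
  assumes X: "X \<in> carrier_mat (d1 * d2) (d1 * d2)" and A: "A \<in> carrier_mat d2 d2"
  shows "mtrace (ptr_left d1 d2 X * A) = mtrace (X * kron (1\<^sub>m d1) A)"
proof -
  have p: "ptr_left d1 d2 X \<in> carrier_mat d2 d2" by (simp add: ptr_left_def)
  have K: "kron (1\<^sub>m d1) A \<in> carrier_mat (d1 * d2) (d1 * d2)" using A by auto
  have "mtrace (X * kron (1\<^sub>m d1) A) = (\<Sum>k<d1. \<Sum>i<d2. \<Sum>r<d1. \<Sum>j<d2. X $$ (k*d2+i, r*d2+j) * kron (1\<^sub>m d1) A $$ (r*d2+j, k*d2+i))"
    using carrier_matD[OF X] by (simp add: mtrace_def mult_entry[OF X K] sum_div_mod pair_lt del: index_mult_mat(1) kron_entry)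
  also have "\<dots> = (\<Sum>k<d1. \<Sum>i<d2. \<Sum>r<d1. if r = k then \<Sum>j<d2. X $$ (k*d2+i, k*d2+j) * A $$ (j,i) else 0)"
    using A by (intro sum.cong refl) (auto simp: pair_lt)
  also have "\<dots> = (\<Sum>k<d1. \<Sum>i<d2. \<Sum>j<d2. X $$ (k*d2+i, k*d2+j) * A $$ (j,i))" by simp
  also have "\<dots> = (\<Sum>i<d2. \<Sum>j<d2. \<Sum>k<d1. X $$ (k*d2+i, k*d2+j) * A $$ (j,i))"
    by (subst sum.swap) (intro sum.cong refl sum.swap)
  also have "\<dots> = mtrace (ptr_left d1 d2 X * A)"
    unfolding mtrace_mult[OF p A] by (intro sum.cong refl) (simp add: ptr_left_def sum_distrib_right)
  finally show ?thesis by simp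
qed

lemma SB_charge_mean_marginals:
  assumes AS: "hermitian dS (AS j)" and AB: "hermitian dB (AB j)" and Z: "density (dS ^ n * dB ^ n) Z"
  shows "mean (SB_charge dS dB AS AB j n) Z =
    mean (ncopy (AS j) n) (ptr_right (dS ^ n) (dB ^ n) Z) + mean (ncopy (AB j) n) (ptr_left (dS ^ n) (dB ^ n) Z)"
proof -
  note Zc = density_carrier[OF Z]
  note S = ncopy_carrier[OF hermitianD(1)[OF AS], of n] and B = ncopy_carrier[OF hermitianD(1)[OF AB], of n]
  have k: "kron (ncopy (AS j) n) (1\<^sub>m (dB ^ n)) \<in> carrier_mat (dS ^ n * dB ^ n) (dS ^ n * dB ^ n)"
    "kron (1\<^sub>m (dS ^ n)) (ncopy (AB j) n) \<in> carrier_mat (dS ^ n * dB ^ n) (dS ^ n * dB ^ n)" using S B by auto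
  show ?thesis unfolding mean_def SB_charge_def mtrace_mult_add[OF Zc k] mtrace_ptr_right[OF Zc S] mtrace_ptr_left[OF Zc B] by simp
qed

section \<open>Reordering of tensor factors\<close>

lemma digit_0:
  assumes "a < d" "i < d ^ n"
  shows "digit d (Suc n) 0 (a * d ^ n + i) = a"
  using assms by (simp add: digit_def)

lemma digit_Suc:
  assumes "k < n" "i < d ^ n"
  shows "digit d (Suc n) (Suc k) (a * d ^ n + i) = digit d n k i"
proof -
  define q where "q = d ^ (n - 1 - k)"
  have e: "d ^ n = q * (d * d ^ k)"
  proof -
    have "n = (n - 1 - k) + Suc k" using assms(1) by simp
    then have "d ^ n = d ^ ((n - 1 - k) + Suc k)" by (rule arg_cong)
    then show ?thesis unfolding q_def by (simp only: power_add power_Suc)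
  qed
  have "0 < d ^ n" using assms(2) by linarith
  then have p: "0 < q" unfolding e by simp
  have "a * d ^ n + i = i + (a * d ^ k * d) * q" unfolding e by (simp only: mult_ac add_ac)
  then have "(a * d ^ n + i) div q = a * d ^ k * d + i div q"
    using p by (simp only: div_mult_self1)
  then have "(a * d ^ n + i) div q mod d = i div q mod d" by simp
  then have "digit d (Suc n) (Suc k) (a * d ^ n + i) = digit d n k i"
    unfolding digit_def q_def by simp
  then show ?thesis .
qed

lemma div_mod_pair:
  fixes m :: nat
  assumes "z < m"
  shows "(y * m + z) div m = y" "(y * m + z) mod m = z"
proof -
  have "m \<noteq> 0" using assms by linarith
  then show "(y * m + z) div m = y" "(y * m + z) mod m = z" using assms by simp_all
qed

text \<open>The leading digits a and b of the system and bath indices form the leading digit a * dB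
  + b in base dS * dB, and the rest is the same encoding for n copies. Range, injectivity and the
  action on charges are inductions along this recursion rather than arguments about digit
  sums.\<close>

lemma cm_index_Suc:
  assumes a: "a < dS" "b < dB" and i: "i < dS ^ n" "j < dB ^ n"
  shows "cm_index dS dB (Suc n) ((a * dS ^ n + i) * dB ^ Suc n + (b * dB ^ n + j)) =
    (a * dB + b) * (dS * dB) ^ n + cm_index dS dB n (i * dB ^ n + j)"
proof -
  let ?x = "(a * dS ^ n + i) * dB ^ Suc n + (b * dB ^ n + j)"
  have lt: "b * dB ^ n + j < dB ^ Suc n" using pair_lt[OF a(2) i(2)] by simp
  have d: "?x div dB ^ Suc n = a * dS ^ n + i" "?x mod dB ^ Suc n = b * dB ^ n + j"
    using lt by (rule div_mod_pair)+
  have d': "(i * dB ^ n + j) div dB ^ n = i" "(i * dB ^ n + j) mod dB ^ n = j" using i(2) by (rule div_mod_pair)+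
  have "cm_index dS dB (Suc n) ?x = (\<Sum>k<Suc n. (digit dS (Suc n) k (a * dS ^ n + i) * dB + digit dB (Suc n) k (b * dB ^ n + j)) * (dS * dB) ^ (Suc n - 1 - k))"
    unfolding cm_index_def d ..
  also have "\<dots> = (a * dB + b) * (dS * dB) ^ n +
      (\<Sum>k<n. (digit dS n k i * dB + digit dB n k j) * (dS * dB) ^ (n - 1 - k))"
    unfolding sum.lessThan_Suc_shift using a i by (simp add: digit_0 digit_Suc)
  also have "(\<Sum>k<n. (digit dS n k i * dB + digit dB n k j) * (dS * dB) ^ (n - 1 - k)) = cm_index dS dB n (i * dB ^ n + j)"
    unfolding cm_index_def d' ..
  finally show ?thesis .
qed

lemma block_index_cases:
  fixes x dS dB n :: nat
  assumes "x < dS ^ Suc n * dB ^ Suc n"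
  obtains a b i j where "a < dS" "b < dB" "i < dS ^ n" "j < dB ^ n" "x = (a * dS ^ n + i) * dB ^ Suc n + (b * dB ^ n + j)"
proof -
  define y z where "y = x div dB ^ Suc n" and "z = x mod dB ^ Suc n"
  have y: "y < dS * dS ^ n" and z: "z < dB * dB ^ n"
    using div_lt[OF assms] mod_lt[OF assms] by (simp_all add: y_def z_def)
  have "x = y * dB ^ Suc n + z" unfolding y_def z_def by (rule div_mult_mod_eq[symmetric])
  then have "x = (y div dS ^ n * dS ^ n + y mod dS ^ n) * dB ^ Suc n + (z div dB ^ n * dB ^ n + z mod dB ^ n)"
    unfolding div_mult_mod_eq .
  then show ?thesis
    by (rule that[OF div_lt[OF y] div_lt[OF z] mod_lt[OF y] mod_lt[OF z]])
qed

lemma cm_index_lt: "x < dS ^ n * dB ^ n \<Longrightarrow> cm_index dS dB n x < (dS * dB) ^ n"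
proof (induct n arbitrary: x)
  case 0
  then show ?case by (simp add: cm_index_def)
next
  case (Suc n)
  from Suc(2) obtain a b i j where hs: "a < dS" "b < dB" "i < dS ^ n" "j < dB ^ n"
    and x: "x = (a * dS ^ n + i) * dB ^ Suc n + (b * dB ^ n + j)" by (rule block_index_cases)
  have "cm_index dS dB n (i * dB ^ n + j) < (dS * dB) ^ n" by (rule Suc(1)[OF pair_lt[OF hs(3,4)]])
  then show ?case unfolding x cm_index_Suc[OF hs] using pair_lt[OF pair_lt[OF hs(1,2)]] by simp
qed

lemma pair_eq_iff:
  fixes b :: nat
  assumes "j < b" "j' < b"
  shows "i * b + j = i' * b + j' \<longleftrightarrow> i = i' \<and> j = j'"
  using div_mod_pair[OF assms(1), of i] div_mod_pair[OF assms(2), of i'] by metis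

lemma cm_index_inj:
  "x < dS ^ n * dB ^ n \<Longrightarrow> y < dS ^ n * dB ^ n \<Longrightarrow> cm_index dS dB n x = cm_index dS dB n y \<Longrightarrow> x = y"
proof (induct n arbitrary: x y)
  case (Suc n)
  from Suc(2) obtain a b i j where hs: "a < dS" "b < dB" "i < dS ^ n" "j < dB ^ n"
    and x: "x = (a * dS ^ n + i) * dB ^ Suc n + (b * dB ^ n + j)" by (rule block_index_cases)
  from Suc(3) obtain a' b' i' j' where hs': "a' < dS" "b' < dB" "i' < dS ^ n" "j' < dB ^ n"
    and y: "y = (a' * dS ^ n + i') * dB ^ Suc n + (b' * dB ^ n + j')" by (rule block_index_cases)
  have lt: "cm_index dS dB n (i * dB ^ n + j) < (dS * dB) ^ n" "cm_index dS dB n (i' * dB ^ n + j') < (dS * dB) ^ n"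
    by (rule cm_index_lt[OF pair_lt[OF hs(3,4)]] cm_index_lt[OF pair_lt[OF hs'(3,4)]])+
  have "a * dB + b = a' * dB + b'" "cm_index dS dB n (i * dB ^ n + j) = cm_index dS dB n (i' * dB ^ n + j')"
    using Suc(4) unfolding x y cm_index_Suc[OF hs] cm_index_Suc[OF hs'] pair_eq_iff[OF lt] by auto
  then have "a = a'" "b = b'" "i * dB ^ n + j = i' * dB ^ n + j'"
    using pair_eq_iff[OF hs(2) hs'(2)] Suc(1)[OF pair_lt[OF hs(3,4)] pair_lt[OF hs'(3,4)]] by auto
  then show ?case unfolding x y using pair_eq_iff[OF hs(4) hs'(4)] by auto
qed simp

text \<open>The permutation matrix whose conjugation is \<open>to_block\<close>; unitary invariance
  then transports spectrum, means and variances.\<close>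

definition cm_mat :: "nat \<Rightarrow> nat \<Rightarrow> nat \<Rightarrow> complex mat" where
  "cm_mat dS dB n = mat (dS ^ n * dB ^ n) (dS ^ n * dB ^ n) (\<lambda>(i,j). if j = cm_index dS dB n i then 1 else 0)"

lemma cm_mat_conj:
  assumes X: "X \<in> carrier_mat ((dS * dB) ^ n) ((dS * dB) ^ n)"
  shows "cm_mat dS dB n * X * adj (cm_mat dS dB n) = to_block dS dB n X"
proof -
  define N where "N = dS ^ n * dB ^ n"
  let ?W = "cm_mat dS dB n" and ?c = "cm_index dS dB n"
  have Xc: "X \<in> carrier_mat N N" using X by (simp add: N_def power_mult_distrib)
  have W: "?W \<in> carrier_mat N N" by (simp add: cm_mat_def N_def)
  have lt: "?c i < N" if "i < N" for i using cm_index_lt[of i dS n dB] that by (simp add: N_def power_mult_distrib)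
  show ?thesis
  proof (rule eq_matI)
    fix i j assume "i < dim_row (to_block dS dB n X)" "j < dim_col (to_block dS dB n X)"
    then have ij: "i < N" "j < N" by (simp_all add: to_block_def N_def)
    have 1: "(?W * X) $$ (i,l) = X $$ (?c i, l)" if "l < N" for l
    proof -
      have "(?W * X) $$ (i,l) = (\<Sum>r<N. if r = ?c i then X $$ (?c i, l) else 0)"
        unfolding mult_entry[OF W Xc ij(1) that]
        by (intro sum.cong refl) (use ij in \<open>simp add: cm_mat_def N_def[symmetric]\<close>)
      then show ?thesis using lt[OF ij(1)] by simp
    qed
    have 2: "adj ?W $$ (l,j) = (if l = ?c j then 1 else 0)" if "l < N" for l
      using that ij by (simp add: cm_mat_def N_def[symmetric])
    have "(?W * X * adj ?W) $$ (i,j) = (\<Sum>l<N. if l = ?c j then X $$ (?c i, ?c j) else 0)"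
      unfolding mult_entry[OF mult_square[OF W Xc] adj_carrier[OF W] ij]
      by (intro sum.cong refl) (use ij in \<open>simp add: 1 2 del: index_mult_mat(1) adj_entry\<close>)
    then show "(?W * X * adj ?W) $$ (i,j) = to_block dS dB n X $$ (i,j)"
      using lt[OF ij(2)] ij by (simp add: to_block_def N_def)
  qed (simp_all add: to_block_def cm_mat_def)
qed

text \<open>Off the diagonal this is the injectivity of \<open>cm_index\<close>, and it is exactly
  what makes \<open>cm_mat\<close> unitary.\<close>

lemma to_block_one: "to_block dS dB n (1\<^sub>m ((dS * dB) ^ n)) = 1\<^sub>m (dS ^ n * dB ^ n)"
proof (rule eq_matI)
  fix i j assume "i < dim_row (1\<^sub>m (dS ^ n * dB ^ n))" "j < dim_col (1\<^sub>m (dS ^ n * dB ^ n))"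
  then show "to_block dS dB n (1\<^sub>m ((dS * dB) ^ n)) $$ (i,j) = 1\<^sub>m (dS ^ n * dB ^ n) $$ (i,j)"
    using cm_index_inj[of i dS n dB j] by (auto simp: to_block_def cm_index_lt)
qed (simp_all add: to_block_def)

lemma cm_mat_unitary: "unitary (dS ^ n * dB ^ n) (cm_mat dS dB n)"
proof -
  define N where "N = dS ^ n * dB ^ n"
  have W: "cm_mat dS dB n \<in> carrier_mat N N" by (simp add: cm_mat_def N_def)
  have "cm_mat dS dB n * 1\<^sub>m N * adj (cm_mat dS dB n) = 1\<^sub>m N"
    using cm_mat_conj[of "1\<^sub>m N" dS dB n] to_block_one[of dS dB n] by (simp add: N_def power_mult_distrib)
  then have "cm_mat dS dB n * adj (cm_mat dS dB n) = 1\<^sub>m N" using right_mult_one_mat[OF W] by simp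
  then have "unitary N (adj (cm_mat dS dB n))" using W by (auto simp: unitary_def)
  then show ?thesis using unitary_adj unfolding N_def by fastforce
qed

section \<open>Invariance under unitary conjugation\<close>

lemma unitary_conj_mult:
  assumes W: "unitary d W" and A: "A \<in> carrier_mat d d" "B \<in> carrier_mat d d"
  shows "(W * A * adj W) * (W * B * adj W) = W * (A * B) * adj W"
proof -
  note u = unitaryD[OF W]
  have "(W * A * adj W) * (W * B * adj W) = W * (A * ((adj W * W) * B)) * adj W"
    using carrier_matD[OF u(1)] carrier_matD[OF A(1)] carrier_matD[OF A(2)] by (simp add: mat_assoc)
  then show ?thesis using u(2) A by simp
qed

lemma mtrace_unitary_conj:
  assumes W: "unitary d W" and A: "A \<in> carrier_mat d d"
  shows "mtrace (W * A * adj W) = mtrace A"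
proof -
  note u = unitaryD[OF W]
  have "mtrace (W * A * adj W) = mtrace (adj W * (W * A))"
    by (rule mtrace_mult_comm[of _ d d]) (use u A in auto)
  also have "adj W * (W * A) = (adj W * W) * A"
    using carrier_matD[OF u(1)] carrier_matD[OF A] by (simp add: mat_assoc)
  finally show ?thesis using u(2) A by simp
qed

lemma mean_var_unitary_conj:
  assumes W: "unitary d W" and X: "X \<in> carrier_mat d d" and A: "A \<in> carrier_mat d d"
  shows "mean (W * A * adj W) (W * X * adj W) = mean A X"
    "var (W * A * adj W) (W * X * adj W) = var A X"
  using mult_square[OF X A] mult_square[OF A A] mult_square[OF X mult_square[OF A A]]
  by (simp_all add: mean_def var_def unitary_conj_mult[OF W] mtrace_unitary_conj[OF W] X A)

lemma to_block_state:
  assumes X: "density ((dS * dB) ^ n) X" and A: "hermitian ((dS * dB) ^ n) A"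
  shows "density (dS ^ n * dB ^ n) (to_block dS dB n X)"
    "vn_entropy (to_block dS dB n X) = vn_entropy X" "info_var (to_block dS dB n X) = info_var X"
    "mean (to_block dS dB n A) (to_block dS dB n X) = mean A X"
    "var (to_block dS dB n A) (to_block dS dB n X) = var A X"
proof -
  note Xc = density_carrier[OF X] note Ac = hermitianD(1)[OF A]
  have N: "(dS * dB) ^ n = dS ^ n * dB ^ n" by (rule power_mult_distrib)
  note W = cm_mat_unitary[of dS n dB]
  have X': "density (dS ^ n * dB ^ n) X" using X unfolding N .
  have tX: "to_block dS dB n X = cm_mat dS dB n * X * adj (cm_mat dS dB n)" by (rule cm_mat_conj[OF Xc, symmetric])
  have tA: "to_block dS dB n A = cm_mat dS dB n * A * adj (cm_mat dS dB n)" by (rule cm_mat_conj[OF Ac, symmetric])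
  show "density (dS ^ n * dB ^ n) (to_block dS dB n X)" unfolding tX by (rule density_conj[OF X' W])
  show e: "vn_entropy (to_block dS dB n X) = vn_entropy X" unfolding tX by (rule vn_entropy_conj[OF density_hermitian[OF X'] W])
  show "info_var (to_block dS dB n X) = info_var X"
    unfolding info_var_def e unfolding info2_def tX spec_sum_conj[OF density_hermitian[OF X'] W] ..
  show "mean (to_block dS dB n A) (to_block dS dB n X) = mean A X"
    "var (to_block dS dB n A) (to_block dS dB n X) = var A X"
    unfolding tX tA by (rule mean_var_unitary_conj[OF W], use Xc Ac in \<open>simp_all add: N\<close>)+
qed

lemma kron_entry_pair:
  assumes "A \<in> carrier_mat a a" "B \<in> carrier_mat b b" "i < a" "j < a" "r < b" "s < b"
  shows "kron A B $$ (i * b + r, j * b + s) = A $$ (i,j) * B $$ (r,s)"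
  using assms pair_lt[of i a r b] pair_lt[of j a s b] by auto

text \<open>Both sides obey the recursion that splits off the first copy. The identity lets a
  product over system-bath pairs have additive means and variances for the charges in block
  order.\<close>

lemma to_block_ncopy:
  assumes AS: "AS j \<in> carrier_mat dS dS" and AB: "AB j \<in> carrier_mat dB dB"
  shows "to_block dS dB n (ncopy (kron (AS j) (1\<^sub>m dB) + kron (1\<^sub>m dS) (AB j)) n) = SB_charge dS dB AS AB j n"
proof (induct n)
  case 0
  show ?case by (rule eq_matI) (simp_all add: to_block_def SB_charge_def ncopy_0 cm_index_def)
next
  case (Suc n)
  define C where "C = kron (AS j) (1\<^sub>m dB) + kron (1\<^sub>m dS) (AB j)"
  have Cc: "C \<in> carrier_mat (dS * dB) (dS * dB)" unfolding C_def using AS AB by auto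
  note Cn = ncopy_carrier[OF Cc, of n] note Sn = ncopy_carrier[OF AS, of n] note Bn = ncopy_carrier[OF AB, of n]
  note Sn' = ncopy_carrier[OF AS, of "Suc n"] note Bn' = ncopy_carrier[OF AB, of "Suc n"]
  have k: "kron C (1\<^sub>m ((dS * dB) ^ n)) \<in> carrier_mat ((dS*dB) * (dS*dB)^n) ((dS*dB) * (dS*dB)^n)"
    "kron (1\<^sub>m (dS * dB)) (ncopy C n) \<in> carrier_mat ((dS*dB) * (dS*dB)^n) ((dS*dB) * (dS*dB)^n)"
    using Cc Cn by auto
  have SBc: "SB_charge dS dB AS AB j m \<in> carrier_mat (dS ^ m * dB ^ m) (dS ^ m * dB ^ m)" for m
    unfolding SB_charge_def using ncopy_carrier[OF AS, of m] ncopy_carrier[OF AB, of m] by auto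
  show ?case unfolding C_def[symmetric]
  proof (rule eq_matI)
    fix x y assume "x < dim_row (SB_charge dS dB AS AB j (Suc n))" "y < dim_col (SB_charge dS dB AS AB j (Suc n))"
    then have xy: "x < dS ^ Suc n * dB ^ Suc n" "y < dS ^ Suc n * dB ^ Suc n" using SBc[of "Suc n"] by auto
    from xy(1) obtain a b i l where hs: "a < dS" "b < dB" "i < dS ^ n" "l < dB ^ n"
      and x: "x = (a * dS ^ n + i) * dB ^ Suc n + (b * dB ^ n + l)" by (rule block_index_cases)
    from xy(2) obtain a' b' i' l' where hs': "a' < dS" "b' < dB" "i' < dS ^ n" "l' < dB ^ n"
      and y: "y = (a' * dS ^ n + i') * dB ^ Suc n + (b' * dB ^ n + l')" by (rule block_index_cases)
    define u v where "u = i * dB ^ n + l" and "v = i' * dB ^ n + l'"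
    have uv: "u < dS ^ n * dB ^ n" "v < dS ^ n * dB ^ n" unfolding u_def v_def using hs hs' by (auto intro: pair_lt)
    have cu: "cm_index dS dB n u < (dS * dB) ^ n" "cm_index dS dB n v < (dS * dB) ^ n" using uv by (auto intro: cm_index_lt)
    have ab: "a * dB + b < dS * dB" "a' * dB + b' < dS * dB" using hs hs' by (auto intro: pair_lt)
    have one: "1\<^sub>m ((dS * dB) ^ n) $$ (cm_index dS dB n u, cm_index dS dB n v) = (1\<^sub>m (dS ^ n * dB ^ n) $$ (u, v) :: complex)"
      using arg_cong[OF to_block_one[of dS dB n], of "\<lambda>M. M $$ (u,v)"] uv by (simp add: to_block_def)
    have IH: "ncopy C n $$ (cm_index dS dB n u, cm_index dS dB n v) = SB_charge dS dB AS AB j n $$ (u,v)"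
      using arg_cong[OF Suc, of "\<lambda>M. M $$ (u,v)"] uv by (simp add: to_block_def C_def)
    have p: "(a * dB + b) * (dS * dB) ^ n + cm_index dS dB n u < (dS*dB) * (dS*dB)^n"
      "(a' * dB + b') * (dS * dB) ^ n + cm_index dS dB n v < (dS*dB) * (dS*dB)^n"
      using ab cu by (auto intro: pair_lt)
    have "to_block dS dB (Suc n) (ncopy C (Suc n)) $$ (x,y) =
      ncopy C (Suc n) $$ ((a * dB + b) * (dS * dB) ^ n + cm_index dS dB n u, (a' * dB + b') * (dS * dB) ^ n + cm_index dS dB n v)"
      using xy unfolding x y u_def v_def cm_index_Suc[OF hs, symmetric] cm_index_Suc[OF hs', symmetric] by (simp add: to_block_def)
    also have "\<dots> = C $$ (a * dB + b, a' * dB + b') * 1\<^sub>m (dS ^ n * dB ^ n) $$ (u, v)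
        + 1\<^sub>m (dS * dB) $$ (a * dB + b, a' * dB + b') * SB_charge dS dB AS AB j n $$ (u,v)"
    proof -
      have "(kron C (1\<^sub>m ((dS * dB) ^ n)) + kron (1\<^sub>m (dS * dB)) (ncopy C n)) $$
        ((a * dB + b) * (dS * dB) ^ n + cm_index dS dB n u, (a' * dB + b') * (dS * dB) ^ n + cm_index dS dB n v) =
        kron C (1\<^sub>m ((dS * dB) ^ n)) $$ ((a * dB + b) * (dS * dB) ^ n + cm_index dS dB n u, (a' * dB + b') * (dS * dB) ^ n + cm_index dS dB n v)
       + kron (1\<^sub>m (dS * dB)) (ncopy C n) $$ ((a * dB + b) * (dS * dB) ^ n + cm_index dS dB n u, (a' * dB + b') * (dS * dB) ^ n + cm_index dS dB n v)"
        by (rule index_add_mat(1)) (use p carrier_matD[OF k(2)] in auto)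
      also have "\<dots> = C $$ (a * dB + b, a' * dB + b') * 1\<^sub>m ((dS * dB) ^ n) $$ (cm_index dS dB n u, cm_index dS dB n v)
        + 1\<^sub>m (dS * dB) $$ (a * dB + b, a' * dB + b') * ncopy C n $$ (cm_index dS dB n u, cm_index dS dB n v)"
        unfolding kron_entry_pair[OF Cc one_carrier_mat ab cu] kron_entry_pair[OF one_carrier_mat Cn ab cu] ..
      finally show ?thesis unfolding ncopy_Suc[OF Cc] one IH .
    qed
    also have "C $$ (a * dB + b, a' * dB + b') = AS j $$ (a,a') * 1\<^sub>m dB $$ (b,b') + 1\<^sub>m dS $$ (a,a') * AB j $$ (b,b')"
    proof -
      have "C $$ (a * dB + b, a' * dB + b') = kron (AS j) (1\<^sub>m dB) $$ (a * dB + b, a' * dB + b') + kron (1\<^sub>m dS) (AB j) $$ (a * dB + b, a' * dB + b')"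
        unfolding C_def by (rule index_add_mat(1)) (use ab AB in auto)
      then show ?thesis
        unfolding kron_entry_pair[OF AS one_carrier_mat hs(1) hs'(1) hs(2) hs'(2)] kron_entry_pair[OF one_carrier_mat AB hs(1) hs'(1) hs(2) hs'(2)] .
    qed
    also have "1\<^sub>m (dS ^ n * dB ^ n) $$ (u, v) = (1\<^sub>m (dS ^ n) $$ (i,i') * 1\<^sub>m (dB ^ n) $$ (l,l') :: complex)"
      unfolding u_def v_def kron_one[symmetric] by (rule kron_entry_pair) (use hs hs' in auto)
    also have "1\<^sub>m (dS * dB) $$ (a * dB + b, a' * dB + b') = (1\<^sub>m dS $$ (a,a') * 1\<^sub>m dB $$ (b,b') :: complex)"
      unfolding kron_one[symmetric] by (rule kron_entry_pair) (use hs hs' in auto)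
    also have "SB_charge dS dB AS AB j n $$ (u,v) = ncopy (AS j) n $$ (i,i') * 1\<^sub>m (dB ^ n) $$ (l,l') + 1\<^sub>m (dS ^ n) $$ (i,i') * ncopy (AB j) n $$ (l,l')"
    proof -
      have "SB_charge dS dB AS AB j n $$ (u,v) = kron (ncopy (AS j) n) (1\<^sub>m (dB ^ n)) $$ (u,v) + kron (1\<^sub>m (dS ^ n)) (ncopy (AB j) n) $$ (u,v)"
        unfolding SB_charge_def by (rule index_add_mat(1)) (use uv Bn in auto)
      then show ?thesis unfolding u_def v_def
          kron_entry_pair[OF Sn one_carrier_mat hs(3) hs'(3) hs(4) hs'(4)] kron_entry_pair[OF one_carrier_mat Bn hs(3) hs'(3) hs(4) hs'(4)] .
    qed
    finally have L: "to_block dS dB (Suc n) (ncopy C (Suc n)) $$ (x,y) =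
       (AS j $$ (a,a') * 1\<^sub>m dB $$ (b,b') + 1\<^sub>m dS $$ (a,a') * AB j $$ (b,b')) * (1\<^sub>m (dS ^ n) $$ (i,i') * 1\<^sub>m (dB ^ n) $$ (l,l'))
       + 1\<^sub>m dS $$ (a,a') * 1\<^sub>m dB $$ (b,b') * (ncopy (AS j) n $$ (i,i') * 1\<^sub>m (dB ^ n) $$ (l,l') + 1\<^sub>m (dS ^ n) $$ (i,i') * ncopy (AB j) n $$ (l,l'))" .
    have ai: "a * dS ^ n + i < dS ^ Suc n" "a' * dS ^ n + i' < dS ^ Suc n" "b * dB ^ n + l < dB ^ Suc n" "b' * dB ^ n + l' < dB ^ Suc n"
      using pair_lt[OF hs(1,3)] pair_lt[OF hs'(1,3)] pair_lt[OF hs(2,4)] pair_lt[OF hs'(2,4)] by simp_all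
    have S: "SB_charge dS dB AS AB j (Suc n) $$ (x,y) =
       ncopy (AS j) (Suc n) $$ (a * dS ^ n + i, a' * dS ^ n + i') * 1\<^sub>m (dB ^ Suc n) $$ (b * dB ^ n + l, b' * dB ^ n + l')
      + 1\<^sub>m (dS ^ Suc n) $$ (a * dS ^ n + i, a' * dS ^ n + i') * ncopy (AB j) (Suc n) $$ (b * dB ^ n + l, b' * dB ^ n + l')"
    proof -
      have "SB_charge dS dB AS AB j (Suc n) $$ (x,y) = kron (ncopy (AS j) (Suc n)) (1\<^sub>m (dB ^ Suc n)) $$ (x,y) + kron (1\<^sub>m (dS ^ Suc n)) (ncopy (AB j) (Suc n)) $$ (x,y)"
        unfolding SB_charge_def by (rule index_add_mat(1)) (use xy carrier_matD[OF Bn'] in \<open>simp_all del: power_Suc\<close>)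
      then show ?thesis unfolding x y
          kron_entry_pair[OF Sn' one_carrier_mat ai] kron_entry_pair[OF one_carrier_mat Bn' ai] .
    qed
    have N: "ncopy M (Suc n) $$ (r * d ^ n + s, r' * d ^ n + s') = M $$ (r,r') * 1\<^sub>m (d ^ n) $$ (s,s') + 1\<^sub>m d $$ (r,r') * ncopy M n $$ (s,s')"
      if M: "M \<in> carrier_mat d d" and r: "r < d" "r' < d" "s < d ^ n" "s' < d ^ n" for M :: "complex mat" and d r r' s s'
    proof -
      have "ncopy M (Suc n) $$ (r * d ^ n + s, r' * d ^ n + s') =
         kron M (1\<^sub>m (d ^ n)) $$ (r * d ^ n + s, r' * d ^ n + s') + kron (1\<^sub>m d) (ncopy M n) $$ (r * d ^ n + s, r' * d ^ n + s')"
        unfolding ncopy_Suc[OF M] by (rule index_add_mat(1))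
          (use pair_lt[OF r(1,3)] pair_lt[OF r(2,4)] carrier_matD[OF ncopy_carrier[OF M, of n]] in simp_all)
      then show ?thesis unfolding kron_entry_pair[OF M one_carrier_mat r] kron_entry_pair[OF one_carrier_mat ncopy_carrier[OF M] r] .
    qed
    have O: "1\<^sub>m (d ^ Suc n) $$ (r * d ^ n + s, r' * d ^ n + s') = (1\<^sub>m d $$ (r,r') * 1\<^sub>m (d ^ n) $$ (s,s') :: complex)"
      if "r < d" "r' < d" "s < d ^ n" "s' < d ^ n" for d r r' s s'
      unfolding power_Suc kron_one[symmetric] by (rule kron_entry_pair) (use that in auto)
    \<comment> \<open>All entries are now expressed through one copy and n copies, and the two sides
      agree by distributivity.\<close>
    show "to_block dS dB (Suc n) (ncopy C (Suc n)) $$ (x,y) = SB_charge dS dB AS AB j (Suc n) $$ (x,y)"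
      unfolding L S N[OF AS hs(1) hs'(1) hs(3) hs'(3)] N[OF AB hs(2) hs'(2) hs(4) hs'(4)]
        O[OF hs(1) hs'(1) hs(3) hs'(3)] O[OF hs(2) hs'(2) hs(4) hs'(4)] by (simp add: algebra_simps)
  qed (use SBc[of "Suc n"] in \<open>simp_all add: to_block_def\<close>)
qed

section \<open>Gibbs states, battery vectors and continuity of rates\<close>

lemma hermitian_smult: "hermitian d M \<Longrightarrow> hermitian d (complex_of_real a \<cdot>\<^sub>m M)"
proof -
  assume M: "hermitian d M"
  have "adj (complex_of_real a \<cdot>\<^sub>m M) = complex_of_real a \<cdot>\<^sub>m adj M" by (rule eq_matI) auto
  then show ?thesis using hermitianD[OF M] by (simp add: hermitian_def)
qed

lemma udg_pow:
  assumes V: "unitary d V"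
  shows "udg d V x ^\<^sub>m k = udg d V (\<lambda>i. x i ^ k)"
proof (induct k)
  case 0
  then show ?case using udg_one[OF V] unitaryD(1)[OF V] by simp
next
  case (Suc k)
  then show ?case by (simp add: udg_mult[OF V] mult.commute)
qed

text \<open>Powers act on the eigenvalues, so each entry of the series is a finite combination of
  scalar exponential series.\<close>

lemma mexp_udg:
  assumes V: "unitary d V"
  shows "mexp (udg d V x) = udg d V (\<lambda>i. exp (x i))"
proof (rule eq_matI)
  note Vc = unitaryD(1)[OF V]
  fix i j assume "i < dim_row (udg d V (\<lambda>i. exp (x i)))" "j < dim_col (udg d V (\<lambda>i. exp (x i)))"
  then have ij: "i < d" "j < d" using Vc by auto
  have "(\<lambda>k. complex_of_real (x l ^ k) * z / of_nat (fact k)) sums (of_real (exp (x l)) * z)" for l z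
  proof -
    have "(\<lambda>k. complex_of_real (x l ^ k /\<^sub>R fact k)) sums of_real (exp (x l))"
      unfolding sums_of_real_iff by (rule exp_converges)
    from sums_mult2[OF this, of z] show ?thesis by (simp add: field_simps scaleR_conv_of_real)
  qed
  then have "(\<lambda>k. \<Sum>l<d. complex_of_real (x l ^ k) * (V $$ (i,l) * cnj (V $$ (j,l))) / of_nat (fact k))
     sums (\<Sum>l<d. of_real (exp (x l)) * (V $$ (i,l) * cnj (V $$ (j,l))))"
    by (intro sums_sum)
  then have "(\<lambda>k. (udg d V x ^\<^sub>m k) $$ (i,j) / of_nat (fact k)) sums udg d V (\<lambda>i. exp (x i)) $$ (i,j)"
    unfolding udg_pow[OF V] udg_entry[OF Vc ij] sum_divide_distrib .
  then show "mexp (udg d V x) $$ (i,j) = udg d V (\<lambda>i. exp (x i)) $$ (i,j)"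
    using ij Vc by (simp add: mexp_def sums_iff)
qed (use unitaryD(1)[OF V] in \<open>simp_all add: mexp_def\<close>)

lemma gibbs_density:
  assumes AB: "\<And>j. j < c \<Longrightarrow> hermitian d (AB j)" and d: "0 < d"
  shows "density d (gibbs c d \<beta> AB)"
proof -
  have "hermitian d (msum d (\<lambda>j. complex_of_real (- \<beta> j) \<cdot>\<^sub>m AB j) c)"
    by (rule msum_hermitian) (rule hermitian_smult[OF AB])
  then obtain V x where V: "unitary d V" "msum d (\<lambda>j. complex_of_real (- \<beta> j) \<cdot>\<^sub>m AB j) c = udg d V x"
    using spectral by metis
  note Vc = unitaryD(1)[OF V(1)]
  define Z where "Z = (\<Sum>i<d. exp (x i))"
  have Z: "0 < Z" unfolding Z_def using d by (intro sum_pos) auto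
  have "gibbs c d \<beta> AB = (1 / mtrace (udg d V (\<lambda>i. exp (x i)))) \<cdot>\<^sub>m udg d V (\<lambda>i. exp (x i))"
    unfolding gibbs_def V(2) mexp_udg[OF V(1)] Let_def ..
  also have "\<dots> = udg d V (\<lambda>i. exp (x i) / Z)"
    unfolding mtrace_udg[OF V(1)] Z_def[symmetric]
    by (rule eq_matI) (use Vc Z in \<open>auto simp: udg_entry sum_distrib_left field_simps intro!: sum.cong\<close>)
  finally show ?thesis
    using density_udg[OF V(1), of "\<lambda>i. exp (x i) / Z"] Z by (simp add: Z_def sum_divide_distrib[symmetric])
qed

lemma spread_udg:
  assumes V: "unitary d V" and A: "A = udg d V x" and d: "0 < d"
    and dec: "\<And>i j. i \<le> j \<Longrightarrow> j < d \<Longrightarrow> x j \<le> x i"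
  shows "spread A = x 0 - x (d - 1)"
proof -
  have Ac: "A \<in> carrier_mat d d" unfolding A using unitaryD(1)[OF V] by auto
  have "{Re a | a. eigenvalue A a} = x ` {..<d}"
    unfolding eigenvalue_root_char_poly[OF Ac] unfolding A char_poly_udg[OF V]
    by (auto simp: poly_prod) (metis Re_complex_of_real lessThan_iff)
  moreover have "Max (x ` {..<d}) = x 0" using d dec by (intro Max_eqI) auto
  moreover have "Min (x ` {..<d}) = x (d - 1)" using d dec by (intro Min_eqI) auto
  ultimately show ?thesis by (simp add: spread_def)
qed

text \<open>The expectation is a convex combination of the x l; the weights p are the diagonal of X
  in the basis V.\<close>

lemma mean_bounds:
  assumes X: "density d X" and V: "unitary d V" and x: "\<And>l. l < d \<Longrightarrow> m \<le> x l" "\<And>l. l < d \<Longrightarrow> x l \<le> M"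
  shows "m \<le> mean (udg d V x) X" "mean (udg d V x) X \<le> M"
proof -
  note Vc = unitaryD(1)[OF V] note Xc = density_carrier[OF X]
  obtain W y where W: "unitary d W" "X = udg d W y" "\<And>i. i < d \<Longrightarrow> 0 \<le> y i" "(\<Sum>i<d. y i) = 1"
    using density_spectral[OF X] by metis
  define G where "G = adj V * W"
  have G: "unitary d G" unfolding G_def by (intro unitary_mult unitary_adj V W)
  define p where "p i = (\<Sum>l<d. y l * (cmod (G $$ (i,l)))\<^sup>2)" for i
  have p0: "0 \<le> p i" for i unfolding p_def using W(3) by (intro sum_nonneg) auto
  have p1: "(\<Sum>i<d. p i) = 1"
    unfolding p_def by (subst sum.swap) (simp add: sum_distrib_left[symmetric] unitary_cols[OF G] W(4))
  have "mtrace (X * udg d V x) = mtrace (udg d V x * X)" by (rule mtrace_mult_comm[of _ d d]) (use Xc Vc in auto)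
  also have "\<dots> = (\<Sum>i<d. of_real (x i) * of_real (p i))"
    unfolding udg_diag[OF Vc Xc]
    by (intro sum.cong refl) (simp add: W(2) udg_change_basis[OF Vc unitaryD(1)[OF W(1)]] G_def[symmetric]
        udg_diag_entry[OF unitaryD(1)[OF G]] p_def del: index_mult_mat(1))
  finally have m: "mean (udg d V x) X = (\<Sum>i<d. x i * p i)" by (simp add: mean_def)
  have "m = (\<Sum>i<d. m * p i)" "M = (\<Sum>i<d. M * p i)" by (simp_all add: sum_distrib_left[symmetric] p1)
  then show "m \<le> mean (udg d V x) X" "mean (udg d V x) X \<le> M"
    unfolding m using sum_mono[of "{..<d}" "\<lambda>i. m * p i" "\<lambda>i. x i * p i"] sum_mono[of "{..<d}" "\<lambda>i. x i * p i" "\<lambda>i. M * p i"]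
      x p0 mult_right_mono by (metis (no_types, lifting) lessThan_iff)+
qed

text \<open>A superposition of the two extreme eigenvectors reaches every expectation value between
  the extreme eigenvalues.\<close>

lemma battery_vector:
  assumes V: "unitary d V" and d: "0 < d" and t: "x (d - 1) \<le> t" "t \<le> x 0"
  shows "\<exists>w \<in> carrier_vec d. vnorm w = 1 \<and> mean (udg d V x) (proj w) = t"
proof -
  note Vc = unitaryD(1)[OF V]
  have m: "mean (udg d V x) (proj w) = (\<Sum>l<d. x l * (cmod ((adj V *\<^sub>v w) $ l))\<^sup>2)" if "w \<in> carrier_vec d" for w
    unfolding mean_def mtrace_proj[OF that udg_carrier[OF Vc]] cinner_udg[OF Vc that] by simp
  have "\<exists>z \<in> carrier_vec d. vnorm z = 1 \<and> (\<Sum>l<d. x l * (cmod (z $ l))\<^sup>2) = t"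
  proof (cases "x (d - 1) = x 0")
    case True
    have "(\<Sum>l<d. x l * (cmod (unit_vec d 0 $ l))\<^sup>2) = (\<Sum>l<d. if l = 0 then x 0 else 0)"
      by (intro sum.cong refl) (use d in auto)
    then show ?thesis using True t d vnorm_unit_vec[OF d] by (intro bexI[of _ "unit_vec d 0"]) auto
  next
    case False
    \<comment> \<open>Probability of the top level; it needs distinct extremes, and equal extremes
      were settled by a basis vector.\<close>
    define p where "p = (t - x (d - 1)) / (x 0 - x (d - 1))"
    have p: "0 \<le> p" "p \<le> 1" "x 0 * p + x (d - 1) * (1 - p) = t"
    proof -
      show "0 \<le> p" "p \<le> 1" using False t by (simp_all add: p_def divide_simps)
      have "p * (x 0 - x (d - 1)) = t - x (d - 1)" using False by (simp add: p_def)
      then show "x 0 * p + x (d - 1) * (1 - p) = t" by (simp add: algebra_simps)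
    qed
    define z where "z = vec d (\<lambda>i. complex_of_real (if i = 0 then sqrt p else if i = d - 1 then sqrt (1 - p) else 0))"
    have d1: "d - 1 \<noteq> 0" using False by metis
    have s: "(\<Sum>l<d. f l * (cmod (z $ l))\<^sup>2) = f 0 * p + f (d - 1) * (1 - p)" for f :: "nat \<Rightarrow> real"
    proof -
      have "(\<Sum>l<d. f l * (cmod (z $ l))\<^sup>2) = (\<Sum>l\<in>{0, d - 1}. f l * (cmod (z $ l))\<^sup>2)"
        by (rule sum.mono_neutral_right) (use d in \<open>auto simp: z_def\<close>)
      then show ?thesis using d d1 p by (simp add: z_def)
    qed
    have "vnorm z = 1" unfolding vnorm_def using s[of "\<lambda>_. 1"] by (simp add: z_def)
    then show ?thesis using s[of x] p(3) by (intro bexI[of _ z]) (auto simp: z_def)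
  qed
  then obtain z where z: "z \<in> carrier_vec d" "vnorm z = 1" "(\<Sum>l<d. x l * (cmod (z $ l))\<^sup>2) = t" by auto
  have w: "V *\<^sub>v z \<in> carrier_vec d" using mult_mat_vec_carrier[OF Vc z(1)] .
  have "adj V *\<^sub>v (V *\<^sub>v z) = (adj V * V) *\<^sub>v z" using Vc z(1) by (subst assoc_mult_mat_vec[of _ d d _ d]) auto
  then have "adj V *\<^sub>v (V *\<^sub>v z) = z" using unitaryD(2)[OF V] z(1) by simp
  then have "mean (udg d V x) (proj (V *\<^sub>v z)) = t" using m[OF w] z(3) by simp
  then show ?thesis using w vnorm_unitary[OF V z(1)] z(2) by auto
qed

lemma info_var_bounds:
  assumes "density d X"
  shows "0 \<le> info_var X" "info_var X \<le> 4 * real d"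
proof -
  obtain V x where V: "unitary d V" "X = udg d V x" "\<And>i. i < d \<Longrightarrow> 0 \<le> x i" "(\<Sum>i<d. x i) = 1"
    using density_spectral[OF assms] by metis
  have "0 \<le> spec_sum (\<lambda>x. x * (ln x + vn_entropy X)\<^sup>2) X"
    unfolding V(2) spec_sum_udg[OF V(1)] using V(3) by (intro sum_nonneg) auto
  then show "0 \<le> info_var X" by (simp add: info_shift[OF assms])
  have "0 \<le> (vn_entropy X)\<^sup>2" by simp
  then show "info_var X \<le> 4 * real d" using info2_le[OF assms] unfolding info_var_def by linarith
qed

section \<open>Rates under almost-commuting unitaries\<close>

lemma null_comparison:
  fixes f g :: "nat \<Rightarrow> real"
  assumes le: "\<forall>\<^sub>F n in sequentially. norm (f n) \<le> g n" and g: "g \<longlonglongrightarrow> 0"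
  shows "f \<longlonglongrightarrow> 0"
proof (rule tendsto_0_le[OF g, of _ 1])
  show "\<forall>\<^sub>F n in sequentially. norm (f n) \<le> norm (g n) * 1"
    using le by eventually_elim simp
qed

text \<open>The ancilla entropies lie between 0 and ln (k n), which is o(n). Continuity costs T n
  times the logarithm of the full dimension; this logarithm is linear in n because D n = d ^ n, and
  T n tends to 0.\<close>

lemma acu_equiv_entropy:
  fixes d :: nat
  assumes X: "\<And>n. density (D n) (X n)" and Y: "\<And>n. density (D n) (Y n)"
    and D: "\<And>n. D n = d ^ n" and d: "0 < d" and acu: "acu_equiv c A X Y"
  shows "(\<lambda>n. (vn_entropy (X n) - vn_entropy (Y n)) / real n) \<longlonglongrightarrow> 0"
proof -
  obtain k \<omega> \<omega>' U where k: "\<And>n. 1 \<le> k n" "(\<lambda>n. ln (real (k n)) / real n) \<longlonglongrightarrow> 0"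
    "\<And>n. density (k n) (\<omega> n)" "\<And>n. density (k n) (\<omega>' n)" and U': "\<And>n. unitary (dim_row (X n) * k n) (U n)"
    and T: "(\<lambda>n. trace_norm (U n * kron (X n) (\<omega>' n) * adj (U n) - kron (Y n) (\<omega> n))) \<longlonglongrightarrow> 0"
    using acu unfolding acu_equiv_def by blast
  define T where "T n = trace_norm (U n * kron (X n) (\<omega>' n) * adj (U n) - kron (Y n) (\<omega> n))" for n
  have U: "unitary (D n * k n) (U n)" for n using U'[of n] density_carrier[OF X[of n]] by simp
  have Dp: "0 < D n" for n using d by (simp add: D)
  define b where "b n = ln (real (k n)) + ln 2 + T n * ln (2 * real (D n * k n))" for n
  have bound: "\<bar>vn_entropy (X n) - vn_entropy (Y n)\<bar> \<le> b n" for n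
  proof -
    note dX = density_conj[OF density_kron[OF X k(4)] U, of n] and dY = density_kron[OF Y k(3), of n]
    have pos: "0 < D n * k n" "0 < k n" using Dp[of n] k(1)[of n] by auto
    have eX: "vn_entropy (U n * kron (X n) (\<omega>' n) * adj (U n)) = vn_entropy (X n) + vn_entropy (\<omega>' n)"
      using vn_entropy_conj[OF density_hermitian[OF density_kron[OF X k(4)]] U, of n] info_kron(1)[OF X k(4), of n] by simp
    have eY: "vn_entropy (kron (Y n) (\<omega> n)) = vn_entropy (Y n) + vn_entropy (\<omega> n)" by (rule info_kron(1)[OF Y k(3)])
    have 1: "vn_entropy (X n) + vn_entropy (\<omega>' n) \<le> vn_entropy (Y n) + vn_entropy (\<omega> n) + ln 2 + T n * ln (2 * real (D n * k n))"
      using vn_entropy_continuity[OF dX dY pos(1)] unfolding eX eY T_def .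
    have 2: "vn_entropy (Y n) + vn_entropy (\<omega> n) \<le> vn_entropy (X n) + vn_entropy (\<omega>' n) + ln 2 + T n * ln (2 * real (D n * k n))"
      using vn_entropy_continuity[OF dY dX pos(1)]
      unfolding eX eY T_def trace_norm_minus_commute[OF density_hermitian[OF dY] density_hermitian[OF dX]] .
    show ?thesis using 1 2 vn_entropy_bounds[OF k(3) pos(2)] vn_entropy_bounds[OF k(4) pos(2)] unfolding b_def by linarith
  qed
  have "(\<lambda>n. ln (real (k n)) / real n + ln 2 / real n + T n * (ln 2 / real n + ln (real d) + ln (real (k n)) / real n))
     \<longlonglongrightarrow> 0 + 0 + 0 * (0 + ln (real d) + 0)"
    unfolding T_def by (intro tendsto_intros k(2) T lim_const_over_n)
  moreover have e: "b n / real n = ln (real (k n)) / real n + ln 2 / real n + T n * (ln 2 / real n + ln (real d) + ln (real (k n)) / real n)"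
    if "0 < n" for n
  proof -
    have "ln (2 * real (D n * k n)) = ln 2 + real n * ln (real d) + ln (real (k n))"
      using d k(1)[of n] by (simp add: D ln_mult ln_realpow)
    then show ?thesis using that by (simp add: b_def add_divide_distrib distrib_left)
  qed
  have "\<forall>\<^sub>F n in sequentially. ln (real (k n)) / real n + ln 2 / real n + T n * (ln 2 / real n + ln (real d) + ln (real (k n)) / real n) = b n / real n"
    using eventually_gt_at_top[of 0] by eventually_elim (rule e[symmetric])
  ultimately have b0: "(\<lambda>n. b n / real n) \<longlonglongrightarrow> 0" using Lim_transform_eventually by fastforce
  have "\<forall>\<^sub>F n in sequentially. norm ((vn_entropy (X n) - vn_entropy (Y n)) / real n) \<le> b n / real n"
  proof (rule always_eventually, rule allI)
    fix n
    show "norm ((vn_entropy (X n) - vn_entropy (Y n)) / real n) \<le> b n / real n"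
      using divide_right_mono[OF bound[of n], of "real n"] by (simp add: abs_divide)
  qed
  then show ?thesis by (rule null_comparison[OF _ b0])
qed

text \<open>Conjugating by U changes the expectation of a charge by at most the norm of their
  commutator; replacing the result by Y changes it by at most n * C times the trace
  distance.\<close>

lemma acu_equiv_charge:
  assumes X: "\<And>n. density (D n) (X n)" and Y: "\<And>n. density (D n) (Y n)" and D: "\<And>n. 0 < D n"
    and A: "\<And>n. hermitian (D n) (A j n)" and C: "0 \<le> C" "\<And>n. opb (real n * C) (A j n)"
    and acu: "acu_equiv c A X Y" and j: "j < c"
  shows "(\<lambda>n. (mean (A j n) (X n) - mean (A j n) (Y n)) / real n) \<longlonglongrightarrow> 0"
proof -
  obtain k \<omega> \<omega>' U where k: "\<And>n. 1 \<le> k n"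
    "\<And>n. density (k n) (\<omega> n)" "\<And>n. density (k n) (\<omega>' n)" and U': "\<And>n. unitary (dim_row (X n) * k n) (U n)"
    and O: "(\<lambda>n. op_norm (U n * kron (A j n) (1\<^sub>m (k n)) - kron (A j n) (1\<^sub>m (k n)) * U n) / real n) \<longlonglongrightarrow> 0"
    and T: "(\<lambda>n. trace_norm (U n * kron (X n) (\<omega>' n) * adj (U n) - kron (Y n) (\<omega> n))) \<longlonglongrightarrow> 0"
    using acu j unfolding acu_equiv_def by blast
  define T where "T n = trace_norm (U n * kron (X n) (\<omega>' n) * adj (U n) - kron (Y n) (\<omega> n))" for n
  define Q where "Q n = op_norm (U n * kron (A j n) (1\<^sub>m (k n)) - kron (A j n) (1\<^sub>m (k n)) * U n)" for n
  have U: "unitary (D n * k n) (U n)" for n using U'[of n] density_carrier[OF X[of n]] by simp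
  have bound: "\<bar>mean (A j n) (X n) - mean (A j n) (Y n)\<bar> \<le> Q n + real n * C * T n" for n
  proof -
    let ?N = "D n * k n"
    define A' where "A' = kron (A j n) (1\<^sub>m (k n))"
    define X' where "X' = kron (X n) (\<omega>' n)"
    define Y' where "Y' = kron (Y n) (\<omega> n)"
    note Uc = unitaryD[OF U[of n]]
    have hA: "hermitian ?N A'" unfolding A'_def by (intro hermitian_kron A hermitian_one)
    note Ac = hermitianD(1)[OF hA]
    have dX: "density ?N X'" unfolding X'_def by (rule density_kron[OF X k(3)])
    have dY: "density ?N Y'" unfolding Y'_def by (rule density_kron[OF Y k(2)])
    have dZ: "density ?N (U n * X' * adj (U n))" by (rule density_conj[OF dX U])
    note Xc = density_carrier[OF dX] note Yc = density_carrier[OF dY] note Zc = density_carrier[OF dZ]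
    have red: "mtrace (kron M \<omega> * A') = mtrace (M * A j n)" if "density (D n) M" "density (k n) \<omega>" for M \<omega>
    proof -
      note Mc = density_carrier[OF that(1)] note wc = density_carrier[OF that(2)] note An = hermitianD(1)[OF A[of n]]
      have "kron M \<omega> * A' = kron (M * A j n) (\<omega> * 1\<^sub>m (k n))"
        unfolding A'_def using Mc wc An by (intro kron_mult[symmetric]) auto
      also have "\<omega> * 1\<^sub>m (k n) = \<omega>" by (rule right_mult_one_mat[OF wc])
      finally show ?thesis
        using mtrace_kron[OF mult_square[OF Mc An] wc] that(2) by (simp add: density_def)
    qed
    have mX: "mean (A j n) (X n) = Re (mtrace (X' * A'))" unfolding mean_def X'_def red[OF X k(3)] ..
    have mY: "mean (A j n) (Y n) = Re (mtrace (Y' * A'))" unfolding mean_def Y'_def red[OF Y k(2)] ..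
    define E where "E = U n * A' - A' * U n"
    have Ec: "E \<in> carrier_mat ?N ?N" unfolding E_def by (intro minus_carrier_mat mult_square Ac Uc)
    have Np: "0 < ?N" using D[of n] k(1)[of n] by simp
    have Q0: "0 \<le> Q n" unfolding Q_def A'_def[symmetric] E_def[symmetric] by (rule op_norm_nonneg[OF Ec Np])
    \<comment> \<open>Cyclicity moves U around the trace, and inserting
      \<open>adj (U n) * U n\<close> = 1 before A' exhibits the commutator E.\<close>
    have a: "mtrace (X' * A') - mtrace (U n * X' * adj (U n) * A') = mtrace (X' * (adj (U n) * E))"
    proof -
      have "mtrace (U n * X' * adj (U n) * A') = mtrace (U n * (X' * (adj (U n) * A')))"
        using carrier_matD[OF Uc(1)] carrier_matD[OF Xc] carrier_matD[OF Ac] by (simp add: mat_assoc)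
      also have "\<dots> = mtrace ((X' * (adj (U n) * A')) * U n)"
        by (rule mtrace_mult_comm[of _ ?N ?N]) (use Uc Xc Ac in auto)
      also have "(X' * (adj (U n) * A')) * U n = X' * (adj (U n) * (A' * U n))"
        using carrier_matD[OF Uc(1)] carrier_matD[OF Xc] carrier_matD[OF Ac] by (simp add: mat_assoc)
      finally have 1: "mtrace (U n * X' * adj (U n) * A') = mtrace (X' * (adj (U n) * (A' * U n)))" .
      have 2: "adj (U n) * (U n * A') = A'"
      proof -
        have "adj (U n) * (U n * A') = (adj (U n) * U n) * A'"
          using carrier_matD[OF Uc(1)] carrier_matD[OF Ac] by (simp add: mat_assoc)
        then show ?thesis using Uc(2) left_mult_one_mat[OF Ac] by simp
      qed
      have "adj (U n) * E = adj (U n) * (U n * A') - adj (U n) * (A' * U n)"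
        unfolding E_def by (rule mult_minus_distrib_mat[of _ ?N ?N]) (use Uc Ac in auto)
      then have "adj (U n) * E = A' - adj (U n) * (A' * U n)" unfolding 2 .
      then show ?thesis unfolding 1
        using mtrace_mult_minus[OF Xc Ac, of "adj (U n) * (A' * U n)"] Uc Ac by (simp add: mult_square adj_carrier)
    qed
    have "opb (1 * Q n) (adj (U n) * E)"
      by (rule opb_mult[OF opb_unitary[OF unitary_adj[OF U]] _ adj_carrier[OF Uc(1)] Ec])
        (use opb_op_norm[OF Ec] in \<open>simp_all add: Q_def E_def A'_def\<close>)
    then have b: "cmod (mtrace (X' * (adj (U n) * E))) \<le> Q n"
      using trace_norm_mtrace[OF density_hermitian[OF dX] _ _ Q0, of "adj (U n) * E"] Uc Ec
      by (simp add: trace_norm_density[OF dX] mult_square adj_carrier)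
    have oA: "opb (real n * C) A'"
      unfolding A'_def by (rule opb_kron_one_right[OF C(2) hermitianD(1)[OF A]]) (use C in simp)
    have c: "cmod (mtrace ((U n * X' * adj (U n) - Y') * A')) \<le> real n * C * T n"
      unfolding T_def X'_def[symmetric] Y'_def[symmetric]
      by (rule trace_norm_mtrace[OF hermitian_minus[OF density_hermitian[OF dZ] density_hermitian[OF dY]] Ac oA]) (use C in simp)
    have d: "mtrace ((U n * X' * adj (U n) - Y') * A') = mtrace (U n * X' * adj (U n) * A') - mtrace (Y' * A')"
      unfolding minus_mult_distrib_mat[OF Zc Yc Ac] by (rule mtrace_minus[of _ ?N]) (use Zc Yc Ac in auto)
    have "mean (A j n) (X n) - mean (A j n) (Y n) = Re (mtrace (X' * (adj (U n) * E))) + Re (mtrace ((U n * X' * adj (U n) - Y') * A'))"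
      unfolding mX mY d a[symmetric] by simp
    then show ?thesis
      using b c abs_Re_le_cmod[of "mtrace (X' * (adj (U n) * E))"] abs_Re_le_cmod[of "mtrace ((U n * X' * adj (U n) - Y') * A')"]
      by linarith
  qed
  have l: "(\<lambda>n. Q n / real n + C * T n) \<longlonglongrightarrow> 0"
    using tendsto_add[OF O tendsto_mult[OF tendsto_const T, of C]] by (simp add: Q_def T_def)
  have "\<forall>\<^sub>F n in sequentially. norm ((mean (A j n) (X n) - mean (A j n) (Y n)) / real n) \<le> Q n / real n + C * T n"
    using eventually_gt_at_top[of 0]
  proof eventually_elim
    case (elim n)
    have "\<bar>mean (A j n) (X n) - mean (A j n) (Y n)\<bar> / real n \<le> (Q n + real n * C * T n) / real n"
      by (intro divide_right_mono bound) simp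
    then show ?case using elim by (simp add: abs_divide add_divide_distrib)
  qed
  then show ?thesis by (rule null_comparison[OF _ l])
qed

section \<open>The two directions\<close>

lemma charge_avg_mean: "charge_avg X A = (\<lambda>n. mean (A n) (X n) / real n)"
  by (rule ext) (simp add: charge_avg_def mean_def)

lemma vn_entropy_tpow:
  assumes "density d X" "hermitian d A"
  shows "density (d ^ n) (tpow X n)" "vn_entropy (tpow X n) = real n * vn_entropy X"
    "info_var (tpow X n) = real n * info_var X"
    "mean (ncopy A n) (tpow X n) = real n * mean A X" "var (ncopy A n) (tpow X n) = real n * var A X"
  unfolding tpow_product using product_state[of d "\<lambda>_. X" A n] assms by simp_all

text \<open>At n = 0 the quotient is 0 by the convention on division, so the sequence is constant
  only from 1 on.\<close>

lemma tendsto_cmult_over_n: "(\<lambda>n. real n * a / real n) \<longlonglongrightarrow> a"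
  by (rule Lim_transform_eventually[OF tendsto_const])
    (use eventually_gt_at_top[of 0] in eventually_elim, simp)

lemma mtrace_diff_mult:
  assumes "P \<in> carrier_mat d d" "Q \<in> carrier_mat d d" "A \<in> carrier_mat d d"
  shows "Re (mtrace ((P - Q) * A)) = mean A P - mean A Q"
proof -
  have "mtrace (P * A - Q * A) = mtrace (P * A) - mtrace (Q * A)"
    by (rule mtrace_minus[of _ d]) (use assms in auto)
  then show ?thesis unfolding mean_def minus_mult_distrib_mat[OF assms] by simp
qed

text \<open>The weak law of large numbers: a variance growing at most linearly is negligible against
  the square of the number of copies.\<close>

lemma bounded_per_copy:
  fixes f :: "nat \<Rightarrow> real"
  assumes "\<And>n. 0 \<le> f n" "\<And>n. f n \<le> real n * C"
  shows "(\<lambda>n. f n / (real n)\<^sup>2) \<longlonglongrightarrow> 0"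
proof (rule null_comparison[OF _ lim_const_over_n[of C]])
  show "\<forall>\<^sub>F n in sequentially. norm (f n / (real n)\<^sup>2) \<le> C / real n"
    using eventually_gt_at_top[of 0]
  proof eventually_elim
    case (elim n)
    have "f n / (real n)\<^sup>2 \<le> real n * C / (real n)\<^sup>2" by (intro divide_right_mono assms) simp
    then show ?case using elim assms(1)[of n] by (simp add: power2_eq_square)
  qed
qed

lemma forward_direction:
  fixes c dS dB :: nat and dW :: "nat \<Rightarrow> nat" and AS AB AW :: "nat \<Rightarrow> complex mat" and \<tau> :: "complex mat"
  defines "A \<equiv> total_charge c dS dB dW AS AB AW"
  assumes dims: "0 < dS" "0 < dB" "\<And>j. j < c \<Longrightarrow> 0 < dW j"
    and AS: "\<And>j. j < c \<Longrightarrow> hermitian dS (AS j)" and AB: "\<And>j. j < c \<Longrightarrow> hermitian dB (AB j)"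
    and AW: "\<And>j. j < c \<Longrightarrow> hermitian (dW j) (AW j)" and \<tau>: "density dB \<tau>"
    and \<rho>: "\<And>n. density (dS ^ n) (\<rho>S n)" and \<sigma>: "\<And>n. density (dS ^ n * dB ^ n) (\<sigma>SB n)"
    and w: "\<And>j n i. j < c \<Longrightarrow> w j n i \<in> carrier_vec (dW j) \<and> vnorm (w j n i) = 1"
    and w': "\<And>j n i. j < c \<Longrightarrow> w' j n i \<in> carrier_vec (dW j) \<and> vnorm (w' j n i) = 1"
    and reg: "regular c A (\<lambda>n. kron (kron (\<rho>S n) (tpow \<tau> n)) (batt c w n))"
    and e\<rho>: "convergent (entropy_rate \<rho>S)" and e\<sigma>: "convergent (entropy_rate \<sigma>SB)"
    and cS: "\<And>j. j < c \<Longrightarrow> convergent (charge_avg (\<lambda>n. ptr_right (dS ^ n) (dB ^ n) (\<sigma>SB n)) (\<lambda>n. ncopy (AS j) n))"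
    and cB: "\<And>j. j < c \<Longrightarrow> convergent (charge_avg (\<lambda>n. ptr_left (dS ^ n) (dB ^ n) (\<sigma>SB n)) (\<lambda>n. ncopy (AB j) n))"
    and cW: "\<And>j. j < c \<Longrightarrow> convergent (charge_avg (batt_j w j) (\<lambda>n. ncopy (AW j) n))"
    and cW': "\<And>j. j < c \<Longrightarrow> convergent (charge_avg (batt_j w' j) (\<lambda>n. ncopy (AW j) n))"
    and acu: "acu_equiv c A (\<lambda>n. kron (kron (\<rho>S n) (tpow \<tau> n)) (batt c w n)) (\<lambda>n. kron (\<sigma>SB n) (batt c w' n))"
  shows "lim (entropy_rate \<sigma>SB) = lim (entropy_rate \<rho>S) + vn_entropy \<tau>"
    and "j < c \<Longrightarrow> lim (\<lambda>n. Re (mtrace ((batt_j w' j n - batt_j w j n) * ncopy (AW j) n)) / real n)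
          = - lim (\<lambda>n. Re (mtrace ((ptr_right (dS ^ n) (dB ^ n) (\<sigma>SB n) - \<rho>S n) * ncopy (AS j) n)) / real n)
            - lim (\<lambda>n. Re (mtrace ((ptr_left (dS ^ n) (dB ^ n) (\<sigma>SB n) - tpow \<tau> n) * ncopy (AB j) n)) / real n)"
proof -
  define X where "X n = kron (kron (\<rho>S n) (tpow \<tau> n)) (batt c w n)" for n
  define Y where "Y n = kron (\<sigma>SB n) (batt c w' n)" for n
  define D where "D n = dS ^ n * dB ^ n * battW_dim c dW n" for n
  have d\<tau>: "density (dB ^ n) (tpow \<tau> n)" "vn_entropy (tpow \<tau> n) = real n * vn_entropy \<tau>" for n
    using vn_entropy_tpow(1,2)[OF \<tau> hermitian_one] by auto
  have b: "j < c \<Longrightarrow> density (dW j ^ n) (batt_j w j n)" "density (battW_dim c dW n) (batt c w n)" "vn_entropy (batt c w n) = 0" for j n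
    using batt_state[of c dW w n] dims(3) w by blast+
  have b': "j < c \<Longrightarrow> density (dW j ^ n) (batt_j w' j n)" "density (battW_dim c dW n) (batt c w' n)" "vn_entropy (batt c w' n) = 0" for j n
    using batt_state[of c dW w' n] dims(3) w' by blast+
  have d\<rho>\<tau>: "density (dS ^ n * dB ^ n) (kron (\<rho>S n) (tpow \<tau> n))" for n by (rule density_kron[OF \<rho> d\<tau>(1)])
  have dX: "density (D n) (X n)" for n unfolding X_def D_def by (rule density_kron[OF d\<rho>\<tau>]) (rule b(2))
  have dY: "density (D n) (Y n)" for n unfolding Y_def D_def by (rule density_kron[OF \<sigma>]) (rule b'(2))
  \<comment> \<open>Dimension of one copy of the global system, so that D n is a power of
    it.\<close>
  define d where "d = dS * dB * (\<Prod>j<c. dW j)"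
  have Dd: "D n = d ^ n" for n
    by (simp add: D_def d_def battW_dim_def power_mult_distrib prod_power_distrib)
  have d0: "0 < d" unfolding d_def using dims by (auto intro!: prod_pos)
  have Dp: "0 < D n" for n using d0 by (simp add: Dd)
  have acu': "acu_equiv c A X Y" using acu unfolding X_def Y_def .
  have SX: "vn_entropy (X n) = vn_entropy (\<rho>S n) + real n * vn_entropy \<tau>" for n
    unfolding X_def using info_kron(1)[OF d\<rho>\<tau> b(2)] info_kron(1)[OF \<rho> d\<tau>(1)] b(3) d\<tau>(2) by simp
  have SY: "vn_entropy (Y n) = vn_entropy (\<sigma>SB n)" for n
    unfolding Y_def using info_kron(1)[OF \<sigma> b'(2)] b'(3) by simp
  have l\<rho>: "entropy_rate \<rho>S \<longlonglongrightarrow> lim (entropy_rate \<rho>S)" and l\<sigma>: "entropy_rate \<sigma>SB \<longlonglongrightarrow> lim (entropy_rate \<sigma>SB)"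
    using e\<rho> e\<sigma> by (simp_all add: convergent_LIMSEQ_iff)
  have "(\<lambda>n. (vn_entropy (X n) - vn_entropy (Y n)) / real n) \<longlonglongrightarrow> 0"
    by (rule acu_equiv_entropy[OF dX dY Dd d0 acu'])
  moreover have "(\<lambda>n. entropy_rate \<rho>S n + real n * vn_entropy \<tau> / real n - entropy_rate \<sigma>SB n)
      \<longlonglongrightarrow> lim (entropy_rate \<rho>S) + vn_entropy \<tau> - lim (entropy_rate \<sigma>SB)"
    by (intro tendsto_intros l\<rho> l\<sigma> tendsto_cmult_over_n)
  moreover have "(\<lambda>n. (vn_entropy (X n) - vn_entropy (Y n)) / real n) =
     (\<lambda>n. entropy_rate \<rho>S n + real n * vn_entropy \<tau> / real n - entropy_rate \<sigma>SB n)"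
    by (rule ext) (simp add: SX SY entropy_rate_def add_divide_distrib diff_divide_distrib)
  ultimately have "0 = lim (entropy_rate \<rho>S) + vn_entropy \<tau> - lim (entropy_rate \<sigma>SB)"
    using LIMSEQ_unique by metis
  then show "lim (entropy_rate \<sigma>SB) = lim (entropy_rate \<rho>S) + vn_entropy \<tau>" by simp
  assume j: "j < c"
  note ASj = AS[OF j] and ABj = AB[OF j] and AWj = AW[OF j]
  have hA: "hermitian (D n) (A j n)" for n
    unfolding A_def D_def by (rule total_charge_hermitian[of dS AS j dB AB, OF ASj ABj AW])
  obtain C where C: "0 \<le> C" "\<And>n. opb (real n * C) (A j n)"
    using opb_total_charge[of dS AS j dB AB c dW AW, OF ASj ABj AW j] unfolding A_def by blast
  define rS where "rS n = mean (ncopy (AS j) n) (\<rho>S n) / real n" for n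
  define sS where "sS n = mean (ncopy (AS j) n) (ptr_right (dS ^ n) (dB ^ n) (\<sigma>SB n)) / real n" for n
  define sB where "sB n = mean (ncopy (AB j) n) (ptr_left (dS ^ n) (dB ^ n) (\<sigma>SB n)) / real n" for n
  define tB where "tB n = mean (ncopy (AB j) n) (tpow \<tau> n) / real n" for n
  define bw where "bw n = mean (ncopy (AW j) n) (batt_j w j n) / real n" for n
  define bw' where "bw' n = mean (ncopy (AW j) n) (batt_j w' j n) / real n" for n
  have mX: "mean (A j n) (X n) / real n = rS n + tB n + bw n" for n
  proof -
    have "mean (SB_charge dS dB AS AB j n) (kron (\<rho>S n) (tpow \<tau> n)) = mean (ncopy (AS j) n) (\<rho>S n) + mean (ncopy (AB j) n) (tpow \<tau> n)"
      unfolding SB_charge_def by (rule mean_var_kron(1)[OF \<rho> d\<tau>(1) ncopy_hermitian[OF ASj] ncopy_hermitian[OF ABj]])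
    then show ?thesis
      using total_charge_state(1)[of dS AS j dB AB c dW AW w n, OF ASj ABj AW dims(3) w j d\<rho>\<tau>]
      unfolding A_def X_def rS_def tB_def bw_def by (simp add: add_divide_distrib)
  qed
  have mY: "mean (A j n) (Y n) / real n = sS n + sB n + bw' n" for n
    using total_charge_state(1)[of dS AS j dB AB c dW AW w' n, OF ASj ABj AW dims(3) w' j \<sigma>]
      SB_charge_mean_marginals[of dS AS j dB AB, OF ASj ABj \<sigma>, of n]
    unfolding A_def Y_def sS_def sB_def bw'_def by (simp add: add_divide_distrib)
  have tBl: "tB \<longlonglongrightarrow> mean (AB j) \<tau>"
    using tendsto_cmult_over_n[of "mean (AB j) \<tau>"] vn_entropy_tpow(4)[OF \<tau> ABj] by (simp add: tB_def[abs_def])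
  have sSl: "sS \<longlonglongrightarrow> lim sS" and sBl: "sB \<longlonglongrightarrow> lim sB" and bwl: "bw \<longlonglongrightarrow> lim bw" and bw'l: "bw' \<longlonglongrightarrow> lim bw'"
    using cS[OF j] cB[OF j] cW[OF j] cW'[OF j]
    by (simp_all add: charge_avg_mean convergent_LIMSEQ_iff sS_def[abs_def] sB_def[abs_def] bw_def[abs_def] bw'_def[abs_def])
  have "convergent (\<lambda>n. mean (A j n) (X n) / real n)"
    using reg j unfolding regular_def charge_avg_mean X_def by blast
  then obtain L where L: "(\<lambda>n. mean (A j n) (X n) / real n) \<longlonglongrightarrow> L" unfolding convergent_def by blast
  \<comment> \<open>The charge rate of the work system is what remains of the total after bath and
    batteries.\<close>
  have "(\<lambda>n. mean (A j n) (X n) / real n - tB n - bw n) \<longlonglongrightarrow> L - mean (AB j) \<tau> - lim bw"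
    by (intro tendsto_intros L tBl bwl)
  then have rSl: "rS \<longlonglongrightarrow> L - mean (AB j) \<tau> - lim bw" by (simp add: mX)
  have "(\<lambda>n. (mean (A j n) (X n) - mean (A j n) (Y n)) / real n) \<longlonglongrightarrow> 0"
    by (rule acu_equiv_charge[OF dX dY Dp hA C acu' j])
  moreover have "(\<lambda>n. (mean (A j n) (X n) - mean (A j n) (Y n)) / real n) = (\<lambda>n. (rS n + tB n + bw n) - (sS n + sB n + bw' n))"
    by (rule ext) (simp only: diff_divide_distrib mX mY)
  moreover have "(\<lambda>n. (rS n + tB n + bw n) - (sS n + sB n + bw' n)) \<longlonglongrightarrow>
      (L - mean (AB j) \<tau> - lim bw + mean (AB j) \<tau> + lim bw) - (lim sS + lim sB + lim bw')"
    by (intro tendsto_intros rSl tBl bwl sSl sBl bw'l)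
  \<comment> \<open>Conservation of charge j: both global sequences have the same total per copy in
    the limit.\<close>
  ultimately have bal: "0 = L - (lim sS + lim sB + lim bw')" using LIMSEQ_unique by fastforce
  have W: "(\<lambda>n. Re (mtrace ((batt_j w' j n - batt_j w j n) * ncopy (AW j) n)) / real n) \<longlonglongrightarrow> lim bw' - lim bw"
  proof -
    have "(\<lambda>n. Re (mtrace ((batt_j w' j n - batt_j w j n) * ncopy (AW j) n)) / real n) = (\<lambda>n. bw' n - bw n)"
      by (rule ext) (simp add: mtrace_diff_mult[OF density_carrier[OF b'(1)[OF j]] density_carrier[OF b(1)[OF j]] ncopy_carrier[OF hermitianD(1)[OF AWj]]]
          bw_def bw'_def diff_divide_distrib)
    then show ?thesis using tendsto_diff[OF bw'l bwl] by simp
  qed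
  have S: "(\<lambda>n. Re (mtrace ((ptr_right (dS ^ n) (dB ^ n) (\<sigma>SB n) - \<rho>S n) * ncopy (AS j) n)) / real n)
     \<longlonglongrightarrow> lim sS - (L - mean (AB j) \<tau> - lim bw)"
  proof -
    have p: "ptr_right (dS ^ n) (dB ^ n) (\<sigma>SB n) \<in> carrier_mat (dS ^ n) (dS ^ n)" for n by (simp add: ptr_right_def)
    have "(\<lambda>n. Re (mtrace ((ptr_right (dS ^ n) (dB ^ n) (\<sigma>SB n) - \<rho>S n) * ncopy (AS j) n)) / real n) = (\<lambda>n. sS n - rS n)"
      by (rule ext) (simp add: mtrace_diff_mult[OF p density_carrier[OF \<rho>] ncopy_carrier[OF hermitianD(1)[OF ASj]]]
          sS_def rS_def diff_divide_distrib)
    then show ?thesis using tendsto_diff[OF sSl rSl] by simp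
  qed
  have B: "(\<lambda>n. Re (mtrace ((ptr_left (dS ^ n) (dB ^ n) (\<sigma>SB n) - tpow \<tau> n) * ncopy (AB j) n)) / real n)
     \<longlonglongrightarrow> lim sB - mean (AB j) \<tau>"
  proof -
    have p: "ptr_left (dS ^ n) (dB ^ n) (\<sigma>SB n) \<in> carrier_mat (dB ^ n) (dB ^ n)" for n by (simp add: ptr_left_def)
    have "(\<lambda>n. Re (mtrace ((ptr_left (dS ^ n) (dB ^ n) (\<sigma>SB n) - tpow \<tau> n) * ncopy (AB j) n)) / real n) = (\<lambda>n. sB n - tB n)"
      by (rule ext) (simp add: mtrace_diff_mult[OF p density_carrier[OF d\<tau>(1)] ncopy_carrier[OF hermitianD(1)[OF ABj]]]
          sB_def tB_def diff_divide_distrib)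
    then show ?thesis using tendsto_diff[OF sBl tBl] by simp
  qed
  show "lim (\<lambda>n. Re (mtrace ((batt_j w' j n - batt_j w j n) * ncopy (AW j) n)) / real n)
          = - lim (\<lambda>n. Re (mtrace ((ptr_right (dS ^ n) (dB ^ n) (\<sigma>SB n) - \<rho>S n) * ncopy (AS j) n)) / real n)
            - lim (\<lambda>n. Re (mtrace ((ptr_left (dS ^ n) (dB ^ n) (\<sigma>SB n) - tpow \<tau> n) * ncopy (AB j) n)) / real n)"
    unfolding limI[OF W] limI[OF S] limI[OF B] using bal by simp
qed

text \<open>Limits of averages stay between the extreme eigenvalues, so the charge per copy of
  system and bath changes by at most the sum of their spreads. By the standing assumption this
  change fits into the range of the battery.\<close>

lemma battery_choice:
  assumes AS: "hermitian dS AS" and AB: "hermitian dB AB" and AW: "hermitian dW AW"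
    and dims: "0 < dS" "0 < dB" "0 < dW"
    and standing: "spread AS + spread AB \<le> spread AW"
    and \<tau>: "density dB \<tau>" and \<rho>: "\<And>n i. density dS (\<rho> n i)" and \<sigma>: "\<And>n i. density (dS * dB) (\<sigma> n i)"
    and a: "(\<lambda>n. (\<Sum>i<n. mean AS (\<rho> n i)) / real n) \<longlonglongrightarrow> a"
    and f: "(\<lambda>n. (\<Sum>i<n. mean (kron AS (1\<^sub>m dB) + kron (1\<^sub>m dS) AB) (\<sigma> n i)) / real n) \<longlonglongrightarrow> f"
  shows "\<exists>u u'. u \<in> carrier_vec dW \<and> vnorm u = 1 \<and> u' \<in> carrier_vec dW \<and> vnorm u' = 1 \<and>
    a + mean AB \<tau> + mean AW (proj u) = f + mean AW (proj u')"
proof -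
  obtain V x where V: "unitary dS V" "AS = udg dS V x" and x: "\<And>i j. i \<le> j \<Longrightarrow> j < dS \<Longrightarrow> x j \<le> x i"
    using spectral[OF AS] by metis
  obtain W y where W: "unitary dB W" "AB = udg dB W y" and y: "\<And>i j. i \<le> j \<Longrightarrow> j < dB \<Longrightarrow> y j \<le> y i"
    using spectral[OF AB] by metis
  obtain R z where R: "unitary dW R" "AW = udg dW R z" and z: "\<And>i j. i \<le> j \<Longrightarrow> j < dW \<Longrightarrow> z j \<le> z i"
    using spectral[OF AW] by metis
  have xb: "x (dS - 1) \<le> x l" "x l \<le> x 0" if "l < dS" for l using x[of l "dS - 1"] x[of 0 l] that by auto
  have yb: "y (dB - 1) \<le> y l" "y l \<le> y 0" if "l < dB" for l using y[of l "dB - 1"] y[of 0 l] that by auto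
  \<comment> \<open>Stated from n = 1 on, since the average over zero copies is 0 and may leave the
    interval.\<close>
  have avg: "m \<le> g" "g \<le> M" if g: "(\<lambda>n. (\<Sum>i<n. h n i) / real n) \<longlonglongrightarrow> g" and h: "\<And>n i. m \<le> h n i" "\<And>n i. h n i \<le> M"
    for h :: "nat \<Rightarrow> nat \<Rightarrow> real" and g m M
  proof -
    have "m \<le> (\<Sum>i<n. h n i) / real n \<and> (\<Sum>i<n. h n i) / real n \<le> M" if "0 < n" for n
      using sum_mono[of "{..<n}" "\<lambda>_. m" "h n"] sum_mono[of "{..<n}" "h n" "\<lambda>_. M"] h that
      by (simp add: divide_simps mult.commute)
    then have "\<forall>n\<ge>1. m \<le> (\<Sum>i<n. h n i) / real n" "\<forall>n\<ge>1. (\<Sum>i<n. h n i) / real n \<le> M" by auto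
    then show "m \<le> g" "g \<le> M" using LIMSEQ_le_const[OF g] LIMSEQ_le_const2[OF g] by blast+
  qed
  have am: "x (dS - 1) \<le> mean AS Z" "mean AS Z \<le> x 0" if "density dS Z" for Z
    using mean_bounds[OF that V(1), of "x (dS - 1)" x "x 0", folded V(2)] xb by blast+
  have aa: "x (dS - 1) \<le> a" "a \<le> x 0"
    by (fact avg(1)[OF a am(1)[OF \<rho>] am(2)[OF \<rho>]] avg(2)[OF a am(1)[OF \<rho>] am(2)[OF \<rho>]])+
  have bb: "y (dB - 1) \<le> mean AB \<tau>" "mean AB \<tau> \<le> y 0"
    using mean_bounds[OF \<tau> W(1), of "y (dB - 1)" y "y 0", folded W(2)] yb by blast+
  \<comment> \<open>The two local charges are diagonal in one product basis, with sums x + y as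
    joint eigenvalues.\<close>
  have C: "kron AS (1\<^sub>m dB) + kron (1\<^sub>m dS) AB = udg (dS * dB) (kron V W) (\<lambda>l. x (l div dB) + y (l mod dB))"
  proof -
    note Vc = unitaryD(1)[OF V(1)] note Wc = unitaryD(1)[OF W(1)]
    have "kron AS (1\<^sub>m dB) = udg (dS * dB) (kron V W) (\<lambda>l. x (l div dB))"
      using udg_kron[OF Vc Wc, of x "\<lambda>_. 1"] unfolding V(2) udg_one[OF W(1)] by simp
    moreover have "kron (1\<^sub>m dS) AB = udg (dS * dB) (kron V W) (\<lambda>l. y (l mod dB))"
      using udg_kron[OF Vc Wc, of "\<lambda>_. 1" y] unfolding W(2) udg_one[OF V(1)] by simp
    ultimately show ?thesis using udg_add[of "kron V W" "dS * dB"] Vc Wc by auto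
  qed
  have fm: "x (dS - 1) + y (dB - 1) \<le> mean (kron AS (1\<^sub>m dB) + kron (1\<^sub>m dS) AB) Z"
    "mean (kron AS (1\<^sub>m dB) + kron (1\<^sub>m dS) AB) Z \<le> x 0 + y 0" if Z: "density (dS * dB) Z" for Z
  proof -
    have lb: "x (dS - 1) + y (dB - 1) \<le> x (l div dB) + y (l mod dB)" "x (l div dB) + y (l mod dB) \<le> x 0 + y 0"
      if "l < dS * dB" for l
      using xb[OF div_lt[OF that]] yb[OF mod_lt[OF that]] by auto
    note mb = mean_bounds[where x = "\<lambda>l. x (l div dB) + y (l mod dB)", OF Z unitary_kron[OF V(1) W(1)]]
    show "x (dS - 1) + y (dB - 1) \<le> mean (kron AS (1\<^sub>m dB) + kron (1\<^sub>m dS) AB) Z"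
      unfolding C by (rule mb(1)[where M = "x 0 + y 0"]) (fact lb)+
    show "mean (kron AS (1\<^sub>m dB) + kron (1\<^sub>m dS) AB) Z \<le> x 0 + y 0"
      unfolding C by (rule mb(2)[where m = "x (dS - 1) + y (dB - 1)"]) (fact lb)+
  qed
  have ff: "x (dS - 1) + y (dB - 1) \<le> f" "f \<le> x 0 + y 0"
    by (fact avg(1)[OF f fm(1)[OF \<sigma>] fm(2)[OF \<sigma>]] avg(2)[OF f fm(1)[OF \<sigma>] fm(2)[OF \<sigma>]])+
  have sp: "spread AS = x 0 - x (dS - 1)" "spread AB = y 0 - y (dB - 1)" "spread AW = z 0 - z (dW - 1)"
    using spread_udg[OF V dims(1) x] spread_udg[OF W dims(2) y] spread_udg[OF R dims(3) z] by blast+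
  define \<delta> where "\<delta> = a + mean AB \<tau> - f"
  have \<delta>: "\<bar>\<delta>\<bar> \<le> z 0 - z (dW - 1)" using standing aa bb ff unfolding sp \<delta>_def by linarith
  \<comment> \<open>A battery that has to absorb charge starts at its lowest level, one that has to
    supply charge at its highest; t + \<delta> then stays in the spectral range.\<close>
  define t where "t = (if 0 \<le> \<delta> then z (dW - 1) else z 0)"
  have t: "z (dW - 1) \<le> t" "t \<le> z 0" "z (dW - 1) \<le> t + \<delta>" "t + \<delta> \<le> z 0"
    using \<delta> z[of 0 "dW - 1"] dims(3) unfolding t_def by (auto split: if_splits)
  obtain u where u: "u \<in> carrier_vec dW" "vnorm u = 1" "mean AW (proj u) = t"
    using battery_vector[where x = z, OF R(1) dims(3) t(1,2)] unfolding R(2) by blast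
  obtain u' where u': "u' \<in> carrier_vec dW" "vnorm u' = 1" "mean AW (proj u') = t + \<delta>"
    using battery_vector[where x = z, OF R(1) dims(3) t(3,4)] unfolding R(2) by blast
  show ?thesis using u u' unfolding \<delta>_def by (intro exI[of _ u] exI[of _ u']) simp
qed

lemma converse_direction:
  fixes c dS dB :: nat and dW :: "nat \<Rightarrow> nat" and AS AB AW :: "nat \<Rightarrow> complex mat" and \<tau> :: "complex mat"
    and \<rho>s \<sigma>s :: "nat \<Rightarrow> nat \<Rightarrow> complex mat"
  defines "A \<equiv> total_charge c dS dB dW AS AB AW"
    and "\<rho>S \<equiv> \<lambda>n. kron_list (map (\<rho>s n) [0..<n])"
    and "\<sigma>SB \<equiv> \<lambda>n. to_block dS dB n (kron_list (map (\<sigma>s n) [0..<n]))"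
  assumes dims: "0 < dS" "0 < dB" "\<And>j. j < c \<Longrightarrow> 0 < dW j"
    and AS: "\<And>j. j < c \<Longrightarrow> hermitian dS (AS j)" and AB: "\<And>j. j < c \<Longrightarrow> hermitian dB (AB j)"
    and AW: "\<And>j. j < c \<Longrightarrow> hermitian (dW j) (AW j)"
    and standing: "\<And>j. j < c \<Longrightarrow> spread (AS j) + spread (AB j) \<le> spread (AW j)"
    and \<tau>: "density dB \<tau>" and \<rho>s: "\<And>n i. density dS (\<rho>s n i)" and \<sigma>s: "\<And>n i. density (dS * dB) (\<sigma>s n i)"
    and r\<rho>: "regular c (\<lambda>j n. ncopy (AS j) n) \<rho>S" and r\<sigma>: "regular c (SB_charge dS dB AS AB) \<sigma>SB"
    and ent: "lim (entropy_rate \<sigma>SB) = lim (entropy_rate \<rho>S) + vn_entropy \<tau>"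
  shows "\<exists>w w'. (\<forall>j<c. \<forall>n i. w j n i \<in> carrier_vec (dW j) \<and> vnorm (w j n i) = 1
                      \<and> w' j n i \<in> carrier_vec (dW j) \<and> vnorm (w' j n i) = 1) \<and>
          (\<forall>j<c. convergent (charge_avg (batt_j w j) (\<lambda>n. ncopy (AW j) n))
                \<and> convergent (charge_avg (batt_j w' j) (\<lambda>n. ncopy (AW j) n))) \<and>
          acu_equiv c A (\<lambda>n. kron (kron (\<rho>S n) (tpow \<tau> n)) (batt c w n))
                        (\<lambda>n. kron (\<sigma>SB n) (batt c w' n)) \<and>
          acu_equiv c A (\<lambda>n. kron (\<sigma>SB n) (batt c w' n))
                        (\<lambda>n. kron (kron (\<rho>S n) (tpow \<tau> n)) (batt c w n))"
proof -
  define K where "K j = kron (AS j) (1\<^sub>m dB) + kron (1\<^sub>m dS) (AB j)" for j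
  have hK: "hermitian (dS * dB) (K j)" if "j < c" for j
    unfolding K_def by (intro hermitian_add hermitian_kron AS[OF that] AB[OF that] hermitian_one)
  have SBK: "SB_charge dS dB AS AB j n = to_block dS dB n (ncopy (K j) n)" if "j < c" for j n
    unfolding K_def by (rule to_block_ncopy[where AS = AS and AB = AB and j = j, symmetric, OF hermitianD(1)[OF AS[OF that]] hermitianD(1)[OF AB[OF that]]])
  note pS = product_state[of dS "\<rho>s n" for n, OF \<rho>s]
  note pK = product_state[of "dS * dB" "\<sigma>s n" for n, OF \<sigma>s]
  have d\<rho>: "density (dS ^ n) (\<rho>S n)" "vn_entropy (\<rho>S n) = (\<Sum>i<n. vn_entropy (\<rho>s n i))"
    "info_var (\<rho>S n) = (\<Sum>i<n. info_var (\<rho>s n i))" for n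
    unfolding \<rho>S_def by (rule pS(1)[OF hermitian_one] pS(2)[OF hermitian_one] pS(3)[OF hermitian_one])+
  have dk: "density ((dS * dB) ^ n) (kron_list (map (\<sigma>s n) [0..<n]))" for n by (rule pK(1)[OF hermitian_one])
  have d\<sigma>: "density (dS ^ n * dB ^ n) (\<sigma>SB n)" "info_var (\<sigma>SB n) = (\<Sum>i<n. info_var (\<sigma>s n i))" for n
    unfolding \<sigma>SB_def using to_block_state(1,3)[OF dk hermitian_one] pK(3)[OF hermitian_one] by simp_all
  have m\<rho>: "mean (ncopy (AS j) n) (\<rho>S n) = (\<Sum>i<n. mean (AS j) (\<rho>s n i))"
    "var (ncopy (AS j) n) (\<rho>S n) = (\<Sum>i<n. var (AS j) (\<rho>s n i))" if "j < c" for j n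
    unfolding \<rho>S_def by (rule pS(4)[OF AS[OF that]] pS(5)[OF AS[OF that]])+
  have m\<sigma>: "mean (SB_charge dS dB AS AB j n) (\<sigma>SB n) = (\<Sum>i<n. mean (K j) (\<sigma>s n i))"
    "var (SB_charge dS dB AS AB j n) (\<sigma>SB n) = (\<Sum>i<n. var (K j) (\<sigma>s n i))" if "j < c" for j n
    unfolding SBK[OF that] \<sigma>SB_def
    using to_block_state(4,5)[OF dk ncopy_hermitian[OF hK[OF that]]] pK(4,5)[OF hK[OF that]] by simp_all
  define a where "a j = lim (\<lambda>n. (\<Sum>i<n. mean (AS j) (\<rho>s n i)) / real n)" for j
  define f where "f j = lim (\<lambda>n. (\<Sum>i<n. mean (K j) (\<sigma>s n i)) / real n)" for j
  have al: "(\<lambda>n. (\<Sum>i<n. mean (AS j) (\<rho>s n i)) / real n) \<longlonglongrightarrow> a j" if "j < c" for j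
    using r\<rho> that unfolding regular_def charge_avg_mean a_def convergent_LIMSEQ_iff[symmetric] by (simp add: m\<rho>)
  have fl: "(\<lambda>n. (\<Sum>i<n. mean (K j) (\<sigma>s n i)) / real n) \<longlonglongrightarrow> f j" if "j < c" for j
    using r\<sigma> that unfolding regular_def charge_avg_mean f_def convergent_LIMSEQ_iff[symmetric] by (simp add: m\<sigma>)
  have "\<exists>u u'. u \<in> carrier_vec (dW j) \<and> vnorm u = 1 \<and> u' \<in> carrier_vec (dW j) \<and> vnorm u' = 1 \<and>
    a j + mean (AB j) \<tau> + mean (AW j) (proj u) = f j + mean (AW j) (proj u')" if "j < c" for j
    by (rule battery_choice[OF AS AB AW dims standing \<tau> \<rho>s \<sigma>s al fl[unfolded K_def]]) (rule that)+
  then obtain u u' where u: "\<And>j. j < c \<Longrightarrow> u j \<in> carrier_vec (dW j) \<and> vnorm (u j) = 1"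
    and u': "\<And>j. j < c \<Longrightarrow> u' j \<in> carrier_vec (dW j) \<and> vnorm (u' j) = 1"
    and bal: "\<And>j. j < c \<Longrightarrow> a j + mean (AB j) \<tau> + mean (AW j) (proj (u j)) = f j + mean (AW j) (proj (u' j))"
    by metis
  \<comment> \<open>The same vector in every copy and for every n, so each battery is a power of one
    pure state with constant charge per copy.\<close>
  define w where "w j n i = u j" for j n i :: nat
  define w' where "w' j n i = u' j" for j n i :: nat
  have wv: "w j n i \<in> carrier_vec (dW j) \<and> vnorm (w j n i) = 1" "w' j n i \<in> carrier_vec (dW j) \<and> vnorm (w' j n i) = 1"
    if "j < c" for j n i using u[OF that] u'[OF that] by (simp_all add: w_def w'_def)
  have b: "density (battW_dim c dW n) (batt c w n)" "vn_entropy (batt c w n) = 0" "info_var (batt c w n) = 0" for n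
    using batt_state[of c dW w n] dims(3) wv by blast+
  have b': "density (battW_dim c dW n) (batt c w' n)" "vn_entropy (batt c w' n) = 0" "info_var (batt c w' n) = 0" for n
    using batt_state[of c dW w' n] dims(3) wv by blast+
  have dP: "density (dW j) (proj (u j))" "density (dW j) (proj (u' j))" if "j < c" for j
    using proj_pure(1) u[OF that] u'[OF that] dims(3)[OF that] by blast+
  have bt: "batt_j w j n = tpow (proj (u j)) n" "batt_j w' j n = tpow (proj (u' j)) n" for j n
    by (simp_all add: batt_j_def tpow_product w_def w'_def)
  note mb = vn_entropy_tpow(4,5)[OF dP(1) AW] and mb' = vn_entropy_tpow(4,5)[OF dP(2) AW]
  note mt = vn_entropy_tpow[OF \<tau>]
  define X where "X n = kron (kron (\<rho>S n) (tpow \<tau> n)) (batt c w n)" for n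
  define Y where "Y n = kron (\<sigma>SB n) (batt c w' n)" for n
  define D where "D n = dS ^ n * dB ^ n * battW_dim c dW n" for n
  have Dp: "0 < D n" for n unfolding D_def battW_dim_def using dims by (auto intro!: prod_pos)
  have dt: "density (dB ^ n) (tpow \<tau> n)" for n by (rule mt(1)[OF hermitian_one])
  have d\<rho>\<tau>: "density (dS ^ n * dB ^ n) (kron (\<rho>S n) (tpow \<tau> n))" for n by (rule density_kron[OF d\<rho>(1) dt])
  have dX: "density (D n) (X n)" for n unfolding X_def D_def by (rule density_kron[OF d\<rho>\<tau>]) (rule b(1))
  have dY: "density (D n) (Y n)" for n unfolding Y_def D_def by (rule density_kron[OF d\<sigma>(1)]) (rule b'(1))
  have hA: "hermitian (D n) (A j n)" if "j < c" for j n
    unfolding A_def D_def by (rule total_charge_hermitian[of dS AS j dB AB, OF AS[OF that] AB[OF that] AW])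
  \<comment> \<open>The common limit of the total charge per copy on both sides, by
    \<open>bal\<close>.\<close>
  define v where "v j = f j + mean (AW j) (proj (u' j))" for j
  have X1: "(\<lambda>n. mean (A j n) (X n) / real n) \<longlonglongrightarrow> v j" and X2: "(\<lambda>n. var (A j n) (X n) / (real n)\<^sup>2) \<longlonglongrightarrow> 0"
    and Y1: "(\<lambda>n. mean (A j n) (Y n) / real n) \<longlonglongrightarrow> v j" and Y2: "(\<lambda>n. var (A j n) (Y n) / (real n)\<^sup>2) \<longlonglongrightarrow> 0"
    if j: "j < c" for j
  proof -
    note ASj = AS[OF j] and ABj = AB[OF j] and AWj = AW[OF j]
    have sb: "mean (SB_charge dS dB AS AB j n) (kron (\<rho>S n) (tpow \<tau> n)) = (\<Sum>i<n. mean (AS j) (\<rho>s n i)) + real n * mean (AB j) \<tau>"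
      "var (SB_charge dS dB AS AB j n) (kron (\<rho>S n) (tpow \<tau> n)) = (\<Sum>i<n. var (AS j) (\<rho>s n i)) + real n * var (AB j) \<tau>" for n
      unfolding SB_charge_def
      using mean_var_kron[OF d\<rho>(1) dt ncopy_hermitian[OF ASj] ncopy_hermitian[OF ABj], of n] by (simp_all add: m\<rho>[OF j] mt(4,5)[OF ABj])
    have Xm: "mean (A j n) (X n) = (\<Sum>i<n. mean (AS j) (\<rho>s n i)) + real n * mean (AB j) \<tau> + real n * mean (AW j) (proj (u j))"
      "var (A j n) (X n) = (\<Sum>i<n. var (AS j) (\<rho>s n i)) + real n * var (AB j) \<tau> + real n * var (AW j) (proj (u j))" for n
      using total_charge_state[of dS AS j dB AB c dW AW w n, OF ASj ABj AW dims(3) wv(1) j d\<rho>\<tau>]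
      unfolding A_def X_def by (simp_all add: sb bt mb[OF j j])
    have Ym: "mean (A j n) (Y n) = (\<Sum>i<n. mean (K j) (\<sigma>s n i)) + real n * mean (AW j) (proj (u' j))"
      "var (A j n) (Y n) = (\<Sum>i<n. var (K j) (\<sigma>s n i)) + real n * var (AW j) (proj (u' j))" for n
      using total_charge_state[of dS AS j dB AB c dW AW w' n, OF ASj ABj AW dims(3) wv(2) j d\<sigma>(1)]
      unfolding A_def Y_def by (simp_all add: m\<sigma>[OF j] bt mb'[OF j j])
    have "(\<lambda>n. (\<Sum>i<n. mean (AS j) (\<rho>s n i)) / real n + real n * mean (AB j) \<tau> / real n + real n * mean (AW j) (proj (u j)) / real n)
       \<longlonglongrightarrow> a j + mean (AB j) \<tau> + mean (AW j) (proj (u j))"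
      by (intro tendsto_add al[OF j] tendsto_cmult_over_n)
    then show "(\<lambda>n. mean (A j n) (X n) / real n) \<longlonglongrightarrow> v j" unfolding Xm bal[OF j] v_def add_divide_distrib .
    have "(\<lambda>n. (\<Sum>i<n. mean (K j) (\<sigma>s n i)) / real n + real n * mean (AW j) (proj (u' j)) / real n) \<longlonglongrightarrow> v j"
      unfolding v_def by (intro tendsto_add fl[OF j] tendsto_cmult_over_n)
    then show "(\<lambda>n. mean (A j n) (Y n) / real n) \<longlonglongrightarrow> v j" unfolding Ym add_divide_distrib .
    obtain e where e: "0 \<le> e" "opb e (AS j)" using opb_exists[OF hermitianD(1)[OF ASj]] by auto
    obtain g where g: "0 \<le> g" "opb g (K j)" using opb_exists[OF hermitianD(1)[OF hK[OF j]]] by auto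
    \<comment> \<open>The factors may differ from copy to copy and change with n; the squared
      operator norm of the one-copy charge bounds all their variances at once.\<close>
    have vS: "(\<Sum>i<n. var (AS j) (\<rho>s n i)) \<le> real n * e\<^sup>2" for n
      using sum_bounded_above[of "{..<n}" "\<lambda>i. var (AS j) (\<rho>s n i)" "e\<^sup>2"] var_le[OF \<rho>s ASj e(2,1)] by simp
    have vK: "(\<Sum>i<n. var (K j) (\<sigma>s n i)) \<le> real n * g\<^sup>2" for n
      using sum_bounded_above[of "{..<n}" "\<lambda>i. var (K j) (\<sigma>s n i)" "g\<^sup>2"] var_le[OF \<sigma>s hK[OF j] g(2,1)] by simp
    show "(\<lambda>n. var (A j n) (X n) / (real n)\<^sup>2) \<longlonglongrightarrow> 0"
    proof (rule bounded_per_copy)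
      show "0 \<le> var (A j n) (X n)" for n by (rule var_nonneg[OF dX hA[OF j]])
      show "var (A j n) (X n) \<le> real n * (e\<^sup>2 + var (AB j) \<tau> + var (AW j) (proj (u j)))" for n
        unfolding Xm using vS[of n] by (simp add: distrib_left)
    qed
    show "(\<lambda>n. var (A j n) (Y n) / (real n)\<^sup>2) \<longlonglongrightarrow> 0"
    proof (rule bounded_per_copy)
      show "0 \<le> var (A j n) (Y n)" for n by (rule var_nonneg[OF dY hA[OF j]])
      show "var (A j n) (Y n) \<le> real n * (g\<^sup>2 + var (AW j) (proj (u' j)))" for n
        unfolding Ym using vK[of n] by (simp add: distrib_left)
    qed
  qed
  define s where "s = lim (entropy_rate \<sigma>SB)"
  have SX: "vn_entropy (X n) = vn_entropy (\<rho>S n) + real n * vn_entropy \<tau>" "info_var (X n) = info_var (\<rho>S n) + real n * info_var \<tau>" for n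
    unfolding X_def using info_kron(1)[OF d\<rho>\<tau> b(1)] info_kron(1)[OF d\<rho>(1) dt] info_var_kron[OF d\<rho>\<tau> b(1)] info_var_kron[OF d\<rho>(1) dt] b(2,3)
      mt(2,3)[OF hermitian_one] by simp_all
  have SY: "vn_entropy (Y n) = vn_entropy (\<sigma>SB n)" "info_var (Y n) = info_var (\<sigma>SB n)" for n
    unfolding Y_def using info_kron(1)[OF d\<sigma>(1) b'(1)] info_var_kron[OF d\<sigma>(1) b'(1)] b'(2,3) by simp_all
  have "entropy_rate \<rho>S \<longlonglongrightarrow> lim (entropy_rate \<rho>S)" using r\<rho> by (simp add: regular_def convergent_LIMSEQ_iff)
  then have "(\<lambda>n. vn_entropy (\<rho>S n) / real n + real n * vn_entropy \<tau> / real n) \<longlonglongrightarrow> lim (entropy_rate \<rho>S) + vn_entropy \<tau>"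
    unfolding entropy_rate_def[abs_def] by (intro tendsto_add tendsto_cmult_over_n)
  then have iX: "(\<lambda>n. vn_entropy (X n) / real n) \<longlonglongrightarrow> s"
    unfolding SX s_def ent add_divide_distrib .
  have iY: "(\<lambda>n. vn_entropy (Y n) / real n) \<longlonglongrightarrow> s"
    using r\<sigma> unfolding SY s_def regular_def convergent_LIMSEQ_iff entropy_rate_def[abs_def] by blast
  have vX: "(\<lambda>n. info_var (X n) / (real n)\<^sup>2) \<longlonglongrightarrow> 0"
  proof (rule bounded_per_copy)
    show "0 \<le> info_var (X n)" for n by (rule info_var_bounds(1)[OF dX])
    have "(\<Sum>i<n. info_var (\<rho>s n i)) \<le> real n * (4 * real dS)" for n
      using sum_bounded_above[of "{..<n}" "\<lambda>i. info_var (\<rho>s n i)" "4 * real dS"] info_var_bounds(2)[OF \<rho>s] by simp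
    then show "info_var (X n) \<le> real n * (4 * real dS + info_var \<tau>)" for n
      unfolding SX d\<rho>(3) by (simp add: distrib_left)
  qed
  have vY: "(\<lambda>n. info_var (Y n) / (real n)\<^sup>2) \<longlonglongrightarrow> 0"
  proof (rule bounded_per_copy)
    show "0 \<le> info_var (Y n)" for n by (rule info_var_bounds(1)[OF dY])
    show "info_var (Y n) \<le> real n * (4 * real (dS * dB))" for n
      unfolding SY d\<sigma>(2)
      using sum_bounded_above[of "{..<n}" "\<lambda>i. info_var (\<sigma>s n i)" "4 * real (dS * dB)"] info_var_bounds(2)[OF \<sigma>s] by simp
  qed
  have "acu_equiv c A X Y"
    by (rule acu_equiv_of_concentration[OF Dp dX dY hA X1 X2 Y1 Y2 iX vX iY vY])
  \<comment> \<open>Concentration treats the two sequences symmetrically, so the reverse conversion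
    needs no inversion of the unitaries found before.\<close>
  moreover have "acu_equiv c A Y X"
    by (rule acu_equiv_of_concentration[OF Dp dY dX hA Y1 Y2 X1 X2 iY vY iX vX])
  moreover have "convergent (charge_avg (batt_j w j) (\<lambda>n. ncopy (AW j) n)) \<and> convergent (charge_avg (batt_j w' j) (\<lambda>n. ncopy (AW j) n))"
    if "j < c" for j
    using tendsto_cmult_over_n[of "mean (AW j) (proj (u j))"] tendsto_cmult_over_n[of "mean (AW j) (proj (u' j))"]
    unfolding charge_avg_mean bt mb[OF that that] mb'[OF that that] convergent_def by blast
  ultimately show ?thesis
    using wv unfolding X_def Y_def by (intro exI[of _ w] exI[of _ w']) blast
qed

theorem theorem8p1:
  fixes c dS dB :: nat and dW :: "nat \<Rightarrow> nat"
    and AS AB AW :: "nat \<Rightarrow> complex mat" and \<beta> :: "nat \<Rightarrow> real"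
  defines "\<tau> \<equiv> gibbs c dB \<beta> AB"
      and "A \<equiv> total_charge c dS dB dW AS AB AW"
  assumes dims: "0 < dS" "0 < dB" "\<forall>j<c. 0 < dW j"
    and herm: "\<forall>j<c. hermitian dS (AS j) \<and> hermitian dB (AB j) \<and> hermitian (dW j) (AW j)"
    and standing: "\<forall>j<c. spread (AS j) + spread (AB j) \<le> spread (AW j)"
  shows
    "(\<forall>(\<rho>S :: nat \<Rightarrow> complex mat) (\<sigma>SB :: nat \<Rightarrow> complex mat)
        (w :: nat \<Rightarrow> nat \<Rightarrow> nat \<Rightarrow> complex vec) (w' :: nat \<Rightarrow> nat \<Rightarrow> nat \<Rightarrow> complex vec).
       (\<forall>n. density (dS ^ n) (\<rho>S n)) \<longrightarrow>
       (\<forall>n. density (dS ^ n * dB ^ n) (\<sigma>SB n)) \<longrightarrow>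
       (\<forall>j<c. \<forall>n i. w j n i \<in> carrier_vec (dW j) \<and> vnorm (w j n i) = 1
                   \<and> w' j n i \<in> carrier_vec (dW j) \<and> vnorm (w' j n i) = 1) \<longrightarrow>
       regular c A (\<lambda>n. kron (kron (\<rho>S n) (tpow \<tau> n)) (batt c w n)) \<longrightarrow>
       regular c A (\<lambda>n. kron (\<sigma>SB n) (batt c w' n)) \<longrightarrow>
       convergent (entropy_rate \<rho>S) \<longrightarrow>
       convergent (entropy_rate \<sigma>SB) \<longrightarrow>
       (\<forall>j<c. convergent (charge_avg \<rho>S (\<lambda>n. ncopy (AS j) n))
             \<and> convergent (charge_avg (\<lambda>n. ptr_right (dS ^ n) (dB ^ n) (\<sigma>SB n)) (\<lambda>n. ncopy (AS j) n))
             \<and> convergent (charge_avg (\<lambda>n. ptr_left (dS ^ n) (dB ^ n) (\<sigma>SB n)) (\<lambda>n. ncopy (AB j) n))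
             \<and> convergent (charge_avg (batt_j w j) (\<lambda>n. ncopy (AW j) n))
             \<and> convergent (charge_avg (batt_j w' j) (\<lambda>n. ncopy (AW j) n))) \<longrightarrow>
       acu_equiv c A (\<lambda>n. kron (kron (\<rho>S n) (tpow \<tau> n)) (batt c w n))
                     (\<lambda>n. kron (\<sigma>SB n) (batt c w' n)) \<longrightarrow>
       lim (entropy_rate \<sigma>SB) = lim (entropy_rate \<rho>S) + vn_entropy \<tau> \<and>
       (\<forall>j<c.
          lim (\<lambda>n. Re (mtrace ((batt_j w' j n - batt_j w j n) * ncopy (AW j) n)) / real n)
          = - lim (\<lambda>n. Re (mtrace ((ptr_right (dS ^ n) (dB ^ n) (\<sigma>SB n) - \<rho>S n) * ncopy (AS j) n)) / real n)
            - lim (\<lambda>n. Re (mtrace ((ptr_left (dS ^ n) (dB ^ n) (\<sigma>SB n) - tpow \<tau> n) * ncopy (AB j) n)) / real n)))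
   \<and>
    (\<forall>(\<rho>s :: nat \<Rightarrow> nat \<Rightarrow> complex mat) (\<sigma>s :: nat \<Rightarrow> nat \<Rightarrow> complex mat).
       let \<rho>S = (\<lambda>n. kron_list (map (\<rho>s n) [0..<n]));
           \<sigma>SB = (\<lambda>n. to_block dS dB n (kron_list (map (\<sigma>s n) [0..<n])))
       in
       (\<forall>n i. density dS (\<rho>s n i) \<and> density (dS * dB) (\<sigma>s n i)) \<longrightarrow>
       regular c (\<lambda>j n. ncopy (AS j) n) \<rho>S \<longrightarrow>
       regular c (SB_charge dS dB AS AB) \<sigma>SB \<longrightarrow>
       lim (entropy_rate \<sigma>SB) = lim (entropy_rate \<rho>S) + vn_entropy \<tau> \<longrightarrow>
       (\<exists>(w :: nat \<Rightarrow> nat \<Rightarrow> nat \<Rightarrow> complex vec) (w' :: nat \<Rightarrow> nat \<Rightarrow> nat \<Rightarrow> complex vec).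
          (\<forall>j<c. \<forall>n i. w j n i \<in> carrier_vec (dW j) \<and> vnorm (w j n i) = 1
                      \<and> w' j n i \<in> carrier_vec (dW j) \<and> vnorm (w' j n i) = 1) \<and>
          (\<forall>j<c. convergent (charge_avg (batt_j w j) (\<lambda>n. ncopy (AW j) n))
                \<and> convergent (charge_avg (batt_j w' j) (\<lambda>n. ncopy (AW j) n))) \<and>
          acu_equiv c A (\<lambda>n. kron (kron (\<rho>S n) (tpow \<tau> n)) (batt c w n))
                        (\<lambda>n. kron (\<sigma>SB n) (batt c w' n)) \<and>
          acu_equiv c A (\<lambda>n. kron (\<sigma>SB n) (batt c w' n))
                        (\<lambda>n. kron (kron (\<rho>S n) (tpow \<tau> n)) (batt c w n))))"
proof -
  have \<tau>: "density dB \<tau>" unfolding \<tau>_def by (rule gibbs_density) (use herm dims in auto)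
  have h: "\<And>j. j < c \<Longrightarrow> 0 < dW j" "\<And>j. j < c \<Longrightarrow> hermitian dS (AS j)" "\<And>j. j < c \<Longrightarrow> hermitian dB (AB j)"
    "\<And>j. j < c \<Longrightarrow> hermitian (dW j) (AW j)" "\<And>j. j < c \<Longrightarrow> spread (AS j) + spread (AB j) \<le> spread (AW j)"
    using dims herm standing by auto
  note fwd = forward_direction[where c = c and dS = dS and dB = dB and AS = AS and AB = AB and AW = AW and dW = dW and \<tau> = \<tau>, folded A_def]
  note conv = converse_direction[where c = c and dS = dS and dB = dB and AS = AS and AB = AB and AW = AW and dW = dW and \<tau> = \<tau>, folded A_def]
  show ?thesis
  proof (rule conjI, goal_cases)
    case 1
    show ?case
    proof (intro allI impI, goal_cases)
      case (1 \<rho>S \<sigma>SB w w')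
      have d: "\<And>n. density (dS ^ n) (\<rho>S n)" "\<And>n. density (dS ^ n * dB ^ n) (\<sigma>SB n)"
        using 1(1,2) by blast+
      have w: "\<And>j n i. j < c \<Longrightarrow> w j n i \<in> carrier_vec (dW j) \<and> vnorm (w j n i) = 1"
        "\<And>j n i. j < c \<Longrightarrow> w' j n i \<in> carrier_vec (dW j) \<and> vnorm (w' j n i) = 1"
        using 1(3) by blast+
      have r: "\<And>j. j < c \<Longrightarrow> convergent (charge_avg (\<lambda>n. ptr_right (dS ^ n) (dB ^ n) (\<sigma>SB n)) (\<lambda>n. ncopy (AS j) n))"
        "\<And>j. j < c \<Longrightarrow> convergent (charge_avg (\<lambda>n. ptr_left (dS ^ n) (dB ^ n) (\<sigma>SB n)) (\<lambda>n. ncopy (AB j) n))"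
        "\<And>j. j < c \<Longrightarrow> convergent (charge_avg (batt_j w j) (\<lambda>n. ncopy (AW j) n))"
        "\<And>j. j < c \<Longrightarrow> convergent (charge_avg (batt_j w' j) (\<lambda>n. ncopy (AW j) n))"
        using 1(8) by simp_all
      show ?case
      proof (intro conjI allI impI)
        show "lim (entropy_rate \<sigma>SB) = lim (entropy_rate \<rho>S) + vn_entropy \<tau>"
          by (rule fwd(1)[where w = w and w' = w']) (fact dims h \<tau> d w r 1)+
        fix j assume j: "j < c"
        show "lim (\<lambda>n. Re (mtrace ((batt_j w' j n - batt_j w j n) * ncopy (AW j) n)) / real n)
          = - lim (\<lambda>n. Re (mtrace ((ptr_right (dS ^ n) (dB ^ n) (\<sigma>SB n) - \<rho>S n) * ncopy (AS j) n)) / real n)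
            - lim (\<lambda>n. Re (mtrace ((ptr_left (dS ^ n) (dB ^ n) (\<sigma>SB n) - tpow \<tau> n) * ncopy (AB j) n)) / real n)"
          by (rule fwd(2)[where w = w and w' = w']) (fact dims h \<tau> d w r 1 j)+
      qed
    qed
  next
    case 2
    show ?case unfolding Let_def
    proof (intro allI impI, goal_cases)
      case (1 \<rho>s \<sigma>s)
      have d: "\<And>n i. density dS (\<rho>s n i)" "\<And>n i. density (dS * dB) (\<sigma>s n i)" using 1(1) by blast+
      show ?case by (rule conv[where \<rho>s = \<rho>s and \<sigma>s = \<sigma>s]) (fact dims h \<tau> d 1)+
    qed
  qed
qed

end
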